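(* Let $1\le p\le\infty$, let $Y$ be a Banach space which is a subspace of a quotient (or a quotient of a subspace) of an $L_p(\mu)$-space, let $s$ be defined by $1/s=1+|1/2-1/p|$, and let $u\in Y^*\widehat\otimes_s Y$. Then the spectrum of the operator $\widetilde u$ is central-symmetric if and only if $\operatorname{trace} u^{2n-1}=0$ for all $n=1,2,\dots$.
   Context: Banach spaces are complex; subspaces are closed; $1/\infty=0$. For a Banach space $X$ with dual $X^*$, $X^*\widehat\otimes X$ is the projective tensor product (completion of $X^*\otimes X$ in the norm $\|w\|_\wedge=\inf\{\sum_{k=1}^N\|x'_k\|\,\|x_k\| : w=\sum_{k=1}^N x'_k\otimes x_k\}$). For $0<s\le1$, $X^*\widehat\otimes_s X$ is the set of those $u\in X^*\widehat\otimes X$ admitting a representation $u=\sum_{k=1}^\infty x'_k\otimes x_k$ with $x'_k\in X^*$, $x_k\in X$ and $\sum_{k}\|x'_k\|^s\|x_k\|^s<\infty$. The functional $\operatorname{trace}$ on $X^*\widehat\otimes X$ is the unique continuous linear extension of $x'\otimes x\mapsto\langle x',x\rangle$. Each $u=\sum_k x'_k\otimes x_k\in X^*\widehat\otimes X$ generates the operator $\widetilde u:X\to X$, $\widetilde u(x)=\sum_k\langle x'_k,x\rangle x_k$. The powers $u^m\in X^*\widehat\otimes X$ are taken with respect to the product on $X^*\widehat\otimes X$ that extends, bilinearly and continuously, $(x'\otimes x)(y'\otimes y)=\langle x',y\rangle\, y'\otimes x$ (composition of finite rank operators). The operator $\widetilde u$ is compact. The spectrum of a compact operator is called central-symmetric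 if for every nonzero eigenvalue $\lambda$ of it, $-\lambda$ is also an eigenvalue, of the same algebraic multiplicity. *)

theory Defs
  imports "HOL-Analysis.Analysis" "HOL-Probability.Essential_Supremum"
begin

section \<open>Complex normed spaces\<close>

class complex_vector = real_vector +
  fixes scaleC :: "complex \<Rightarrow> 'a \<Rightarrow> 'a" (infixr "*\<^sub>C" 75)
  assumes scaleC_add_right: "a *\<^sub>C (x + y) = a *\<^sub>C x + a *\<^sub>C y"
    and scaleC_add_left: "(a + b) *\<^sub>C x = a *\<^sub>C x + b *\<^sub>C x"
    and scaleC_scaleC: "a *\<^sub>C b *\<^sub>C x = (a * b) *\<^sub>C x"
    and scaleC_of_real: "complex_of_real r *\<^sub>C x = r *\<^sub>R x"

class complex_normed_vector = complex_vector + real_normed_vector +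
  assumes norm_scaleC: "norm (a *\<^sub>C x) = cmod a * norm x"

class complex_banach = complex_normed_vector + banach

global_interpretation complex_vector: vector_space "scaleC :: complex \<Rightarrow> 'a \<Rightarrow> 'a::complex_vector"
  defines cdim = complex_vector.dim
  using scaleC_of_real[of 1]
  by unfold_locales (auto simp: scaleC_add_right scaleC_add_left scaleC_scaleC)

instantiation complex :: complex_banach
begin

definition scaleC_complex :: "complex \<Rightarrow> complex \<Rightarrow> complex"
  where "scaleC_complex = (*)"

instance
  by standard (auto simp: scaleC_complex_def algebra_simps norm_mult scaleR_conv_of_real)

end

definition bounded_clinear :: "('a::complex_normed_vector \<Rightarrow> 'b::complex_normed_vector) \<Rightarrow> bool"
  where "bounded_clinear f \<longleftrightarrow> bounded_linear f \<and> (\<forall>c x. f (c *\<^sub>C x) = c *\<^sub>C f x)"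

definition bounded_cbilinear ::
  "('a::complex_normed_vector \<Rightarrow> 'b::complex_normed_vector \<Rightarrow> 'c::complex_normed_vector) \<Rightarrow> bool"
  where "bounded_cbilinear B \<longleftrightarrow> bounded_bilinear B \<and>
    (\<forall>c a b. B (c *\<^sub>C a) b = c *\<^sub>C B a b \<and> B a (c *\<^sub>C b) = c *\<^sub>C B a b)"


section \<open>The dual space\<close>

typedef (overloaded) ('a::complex_normed_vector) cdual =
  "{f :: 'a \<Rightarrow>\<^sub>L complex. \<forall>c x. blinfun_apply f (c *\<^sub>C x) = c * blinfun_apply f x}"
  by (rule exI[of _ 0]) simp

setup_lifting type_definition_cdual

lift_definition cdual_apply :: "'a::complex_normed_vector cdual \<Rightarrow> 'a \<Rightarrow> complex"
  is blinfun_apply .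

instantiation cdual :: (complex_normed_vector) complex_normed_vector
begin

lift_definition zero_cdual :: "'a cdual" is 0 by simp
lift_definition plus_cdual :: "'a cdual \<Rightarrow> 'a cdual \<Rightarrow> 'a cdual" is "(+)"
  by (simp add: blinfun.add_left distrib_left)
lift_definition minus_cdual :: "'a cdual \<Rightarrow> 'a cdual \<Rightarrow> 'a cdual" is "(-)"
  by (simp add: blinfun.diff_left right_diff_distrib)
lift_definition uminus_cdual :: "'a cdual \<Rightarrow> 'a cdual" is uminus
  by (simp add: blinfun.minus_left)
lift_definition scaleR_cdual :: "real \<Rightarrow> 'a cdual \<Rightarrow> 'a cdual" is scaleR
  by (simp add: blinfun.scaleR_left)
lift_definition scaleC_cdual :: "complex \<Rightarrow> 'a cdual \<Rightarrow> 'a cdual"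
  is "\<lambda>c f. Blinfun (\<lambda>x. c * blinfun_apply f x)"
  by (subst (1 2) bounded_linear_Blinfun_apply)
     (auto intro!: bounded_linear_const_mult blinfun.bounded_linear_right)
lift_definition norm_cdual :: "'a cdual \<Rightarrow> real" is norm .

definition dist_cdual :: "'a cdual \<Rightarrow> 'a cdual \<Rightarrow> real"
  where "dist_cdual f g = norm (f - g)"
definition sgn_cdual :: "'a cdual \<Rightarrow> 'a cdual"
  where "sgn_cdual f = scaleR (inverse (norm f)) f"
definition uniformity_cdual :: "('a cdual \<times> 'a cdual) filter"
  where "uniformity_cdual = (INF e\<in>{0 <..}. principal {(x, y). dist x y < e})"
definition open_cdual :: "'a cdual set \<Rightarrow> bool"
  where "open_cdual S = (\<forall>x\<in>S. \<forall>\<^sub>F (x', y) in uniformity. x' = x \<longrightarrow> y \<in> S)"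

instance
proof
  have bl: "bounded_linear (\<lambda>x. c * blinfun_apply f x)" for c and f :: "'a \<Rightarrow>\<^sub>L complex"
    by (intro bounded_linear_const_mult blinfun.bounded_linear_right)
  fix f g h :: "'a cdual" and r s :: real and a b :: complex
  show "f + g + h = f + (g + h)" "f + g = g + f" "0 + f = f" "- f + f = 0" "f - g = f + - g"
    by (transfer; simp)+
  show "r *\<^sub>R (f + g) = r *\<^sub>R f + r *\<^sub>R g" "(r + s) *\<^sub>R f = r *\<^sub>R f + s *\<^sub>R f"
    "r *\<^sub>R s *\<^sub>R f = (r * s) *\<^sub>R f" "1 *\<^sub>R f = f"
    by (transfer; simp add: algebra_simps)+
  show "a *\<^sub>C (f + g) = a *\<^sub>C f + a *\<^sub>C g"
    by (transfer; rule blinfun_eqI;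
        simp add: bounded_linear_Blinfun_apply bl bounded_linear_add blinfun.add_left distrib_left)
  show "(a + b) *\<^sub>C f = a *\<^sub>C f + b *\<^sub>C f"
    by (transfer; rule blinfun_eqI;
        simp add: bounded_linear_Blinfun_apply bl bounded_linear_add blinfun.add_left distrib_right)
  show "a *\<^sub>C b *\<^sub>C f = (a * b) *\<^sub>C f"
    by (transfer; rule blinfun_eqI; simp add: bounded_linear_Blinfun_apply bl bounded_linear_const_mult)
  show "complex_of_real r *\<^sub>C f = r *\<^sub>R f"
    by (transfer; rule blinfun_eqI;
        simp add: bounded_linear_Blinfun_apply[OF bl] blinfun.scaleR_left scaleR_conv_of_real)
  show "dist f g = norm (f - g)" by (rule dist_cdual_def)
  show "sgn f = inverse (norm f) *\<^sub>R f" by (rule sgn_cdual_def)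
  show "(uniformity :: ('a cdual \<times> 'a cdual) filter) =
      (INF e\<in>{0 <..}. principal {(x, y). dist x y < e})"
    by (rule uniformity_cdual_def)
  show "open S = (\<forall>x\<in>S. \<forall>\<^sub>F (x', y) in uniformity. x' = x \<longrightarrow> y \<in> S)" for S :: "'a cdual set"
    by (rule open_cdual_def)
  show "(norm f = 0) = (f = 0)" by (transfer; simp)
  show "norm (f + g) \<le> norm f + norm g" by (transfer; simp add: norm_triangle_ineq)
  show "norm (r *\<^sub>R f) = \<bar>r\<bar> * norm f" by (transfer; simp)
  show "norm (a *\<^sub>C f) = cmod a * norm f"
  proof (transfer)
    fix a :: complex and f :: "'a \<Rightarrow>\<^sub>L complex"
    have le: "norm (Blinfun (\<lambda>x. c * blinfun_apply f x)) \<le> cmod c * norm f" for c and f :: "'a \<Rightarrow>\<^sub>L complex"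
      by (rule norm_blinfun_bound)
         (auto simp: bounded_linear_Blinfun_apply[OF bl] norm_mult mult.assoc
               intro!: mult_left_mono norm_blinfun)
    show "norm (Blinfun (\<lambda>x. a * blinfun_apply f x)) = cmod a * norm f"
    proof (cases "a = 0")
      case True
      then show ?thesis using le[of 0 f] by simp
    next
      case False
      let ?g = "Blinfun (\<lambda>x. a * blinfun_apply f x)"
      have "f = Blinfun (\<lambda>x. inverse a * blinfun_apply ?g x)"
        by (rule blinfun_eqI) (use False in \<open>simp add: bounded_linear_Blinfun_apply bl bounded_linear_const_mult\<close>)
      then have "norm f \<le> cmod (inverse a) * norm ?g" by (metis le)
      then have "cmod a * norm f \<le> norm ?g"
        using False by (simp add: norm_inverse norm_divide field_simps)
      with le[of a f] show ?thesis by simp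
    qed
  qed
qed

end

lemma cdual_apply_simps:
  "cdual_apply (f + g) x = cdual_apply f x + cdual_apply g x"
  "cdual_apply f (x + y) = cdual_apply f x + cdual_apply f y"
  "cdual_apply (c *\<^sub>C f) x = c * cdual_apply f x"
  "cdual_apply f (c *\<^sub>C x) = c * cdual_apply f x"
  "cdual_apply (r *\<^sub>R f) x = r *\<^sub>R cdual_apply f x"
  "cdual_apply f (r *\<^sub>R x) = r *\<^sub>R cdual_apply f x"
  by (transfer; simp add: blinfun.add_left blinfun.add_right blinfun.scaleR_left blinfun.scaleR_right
        bounded_linear_Blinfun_apply bounded_linear_const_mult blinfun.bounded_linear_right)+

lemma norm_cdual_apply: "cmod (cdual_apply f x) \<le> norm f * norm x"
  by (transfer; rule norm_blinfun)

lemma bounded_clinear_cdual_apply: "bounded_clinear (cdual_apply f)"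
  unfolding bounded_clinear_def
  by (auto simp: cdual_apply_simps scaleC_complex_def mult.commute
      intro!: bounded_linear_intro[of _ "norm f"] norm_cdual_apply[THEN order_trans])


section \<open>The algebraic tensor product\<close>

text \<open>
  A list of pairs stands for the formal sum of the elementary tensors of its entries.
  Two lists represent the same tensor iff they are identified by the congruence
  generated by commutativity of the sum and bilinearity of the elementary tensors.
\<close>

inductive tensor_eq ::
  "('a::complex_vector \<times> 'b::complex_vector) list \<Rightarrow> ('a \<times> 'b) list \<Rightarrow> bool"
where
  refl: "tensor_eq l l"
| sym: "tensor_eq l m \<Longrightarrow> tensor_eq m l"
| trans: "tensor_eq l m \<Longrightarrow> tensor_eq m n \<Longrightarrow> tensor_eq l n"
| append: "tensor_eq l l' \<Longrightarrow> tensor_eq m m' \<Longrightarrow> tensor_eq (l @ m) (l' @ m')"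
| commute: "tensor_eq (l @ m) (m @ l)"
| add_left: "tensor_eq [(a + a', b)] [(a, b), (a', b)]"
| add_right: "tensor_eq [(a, b + b')] [(a, b), (a, b')]"
| scale: "tensor_eq [(c *\<^sub>C a, b)] [(a, c *\<^sub>C b)]"
| zero: "tensor_eq [(0, b)] []"

quotient_type (overloaded) ('a, 'b) atensor =
  "('a::complex_vector \<times> 'b::complex_vector) list" / tensor_eq
  by (intro equivpI reflpI sympI transpI) (blast intro: tensor_eq.intros)+

lemma tensor_eq_map_scale:
  assumes "tensor_eq l m"
  shows "tensor_eq (map (\<lambda>(a, b). (c *\<^sub>C a, b)) l) (map (\<lambda>(a, b). (c *\<^sub>C a, b)) m)"
  using assms
proof (induction rule: tensor_eq.induct)
  case (scale d a b)
  have "tensor_eq [((c * d) *\<^sub>C a, b)] [(c *\<^sub>C a, d *\<^sub>C b)]"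
    using tensor_eq.scale[of d "c *\<^sub>C a" b] by (simp add: scaleC_scaleC mult.commute)
  then show ?case by (simp add: scaleC_scaleC)
qed (auto simp: scaleC_add_right intro: tensor_eq.intros)

lemma tensor_eq_scale_zero:
  "tensor_eq (map (\<lambda>(a, b). (0 *\<^sub>C a, b)) l) []"
proof (induction l)
  case (Cons p l)
  then show ?case
    using tensor_eq.append[OF tensor_eq.zero[of "snd p"] Cons.IH]
    by (cases p) simp
qed (simp add: tensor_eq.refl)

lemma tensor_eq_scale_add:
  "tensor_eq (map (\<lambda>(a, b). ((c + d) *\<^sub>C a, b)) l)
     (map (\<lambda>(a, b). (c *\<^sub>C a, b)) l @ map (\<lambda>(a, b). (d *\<^sub>C a, b)) l)"
proof (induction l)
  case (Cons p l)
  obtain a b where p: "p = (a, b)" by (cases p)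
  let ?m = "\<lambda>c. map (\<lambda>(a, b). (c *\<^sub>C a, b)) l"
  have "tensor_eq ([((c + d) *\<^sub>C a, b)] @ ?m (c + d)) ([(c *\<^sub>C a, b), (d *\<^sub>C a, b)] @ (?m c @ ?m d))"
    by (rule tensor_eq.append, simp only: scaleC_add_left tensor_eq.add_left, rule Cons.IH)
  moreover have "tensor_eq ([(c *\<^sub>C a, b)] @ (([(d *\<^sub>C a, b)] @ ?m c) @ ?m d))
      ([(c *\<^sub>C a, b)] @ ((?m c @ [(d *\<^sub>C a, b)]) @ ?m d))"
    by (intro tensor_eq.append tensor_eq.refl tensor_eq.commute)
  ultimately show ?case using p by (auto intro: tensor_eq.trans)
qed (simp add: tensor_eq.refl)

instantiation atensor :: (complex_vector, complex_vector) complex_vector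
begin

lift_definition zero_atensor :: "('a, 'b) atensor" is "[]" .
lift_definition plus_atensor :: "('a, 'b) atensor \<Rightarrow> ('a, 'b) atensor \<Rightarrow> ('a, 'b) atensor"
  is "(@)" by (rule tensor_eq.append)
lift_definition scaleC_atensor :: "complex \<Rightarrow> ('a, 'b) atensor \<Rightarrow> ('a, 'b) atensor"
  is "\<lambda>c. map (\<lambda>(a, b). (c *\<^sub>C a, b))" by (rule tensor_eq_map_scale)

definition scaleR_atensor :: "real \<Rightarrow> ('a, 'b) atensor \<Rightarrow> ('a, 'b) atensor"
  where "scaleR_atensor r x = complex_of_real r *\<^sub>C x"
definition uminus_atensor :: "('a, 'b) atensor \<Rightarrow> ('a, 'b) atensor"
  where "uminus_atensor x = (- 1) *\<^sub>C x"
definition minus_atensor :: "('a, 'b) atensor \<Rightarrow> ('a, 'b) atensor \<Rightarrow> ('a, 'b) atensor"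
  where "minus_atensor x y = x + (- 1) *\<^sub>C y"

instance
proof
  fix x y z :: "('a, 'b) atensor" and r s :: real and a b :: complex
  show add_assoc: "x + y + z = x + (y + z)"
    by transfer (simp add: tensor_eq.refl)
  show "x + y = y + x"
    by transfer (rule tensor_eq.commute)
  show "0 + x = x"
    by transfer (simp add: tensor_eq.refl)
  have one: "1 *\<^sub>C x = x" for x :: "('a, 'b) atensor"
    by transfer (simp add: tensor_eq.refl)
  have zero: "0 *\<^sub>C x = 0" for x :: "('a, 'b) atensor"
    by transfer (rule tensor_eq_scale_zero)
  show add_left: "(a + b) *\<^sub>C x = a *\<^sub>C x + b *\<^sub>C x" for a b and x :: "('a, 'b) atensor"
    by transfer (rule tensor_eq_scale_add)
  show add_right: "a *\<^sub>C (x + y) = a *\<^sub>C x + a *\<^sub>C y" for a and x y :: "('a, 'b) atensor"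
    by transfer (simp add: tensor_eq.refl)
  show scale: "a *\<^sub>C b *\<^sub>C x = (a * b) *\<^sub>C x" for a b and x :: "('a, 'b) atensor"
    by transfer (simp add: tensor_eq.refl scaleC_scaleC case_prod_unfold o_def)
  show "- x + x = 0"
    using add_left[of "- 1" 1 x] by (simp add: uminus_atensor_def one zero)
  show "x - y = x + - y"
    by (simp add: minus_atensor_def uminus_atensor_def)
  show "r *\<^sub>R (x + y) = r *\<^sub>R x + r *\<^sub>R y" "(r + s) *\<^sub>R x = r *\<^sub>R x + s *\<^sub>R x"
    "r *\<^sub>R s *\<^sub>R x = (r * s) *\<^sub>R x" "1 *\<^sub>R x = x" "complex_of_real r *\<^sub>C x = r *\<^sub>R x"
    by (simp_all add: scaleR_atensor_def add_left add_right scale one)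
qed

end

lift_definition atensor_elem :: "'a::complex_vector \<Rightarrow> 'b::complex_vector \<Rightarrow> ('a, 'b) atensor"
  is "\<lambda>a b. [(a, b)]" .


definition atensor_lift ::
  "('a::complex_vector \<Rightarrow> 'b::complex_vector \<Rightarrow> 'c::complex_vector) \<Rightarrow> ('a, 'b) atensor \<Rightarrow> 'c"
  where "atensor_lift B w = (\<Sum>(a, b)\<leftarrow>rep_atensor w. B a b)"

lemma sum_list_tensor_eq:
  fixes B :: "'a::complex_vector \<Rightarrow> 'b::complex_vector \<Rightarrow> 'c::complex_vector"
  assumes "tensor_eq l m"
    and add: "\<And>a a' b. B (a + a') b = B a b + B a' b" "\<And>a b b'. B a (b + b') = B a b + B a b'"
    and scale: "\<And>c a b. B (c *\<^sub>C a) b = c *\<^sub>C B a b" "\<And>c a b. B a (c *\<^sub>C b) = c *\<^sub>C B a b"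
  shows "(\<Sum>(a, b)\<leftarrow>l. B a b) = (\<Sum>(a, b)\<leftarrow>m. B a b)"
  using assms(1)
proof (induction rule: tensor_eq.induct)
  case (zero b)
  then show ?case using add(1)[of 0 0 b] by simp
qed (simp_all add: add scale add.commute)

lemma atensor_sum_eq: "(\<Sum>(a, b)\<leftarrow>l. atensor_elem a b) = abs_atensor l"
proof (induction l)
  case Nil
  show ?case by (simp add: zero_atensor_def)
next
  case (Cons p l)
  then show ?case
    by (cases p) (simp add: atensor_elem.abs_eq plus_atensor.abs_eq)
qed

lemma atensor_lift_abs:
  fixes B :: "'a::complex_vector \<Rightarrow> 'b::complex_vector \<Rightarrow> 'c::complex_vector"
  assumes "\<And>a a' b. B (a + a') b = B a b + B a' b" "\<And>a b b'. B a (b + b') = B a b + B a b'"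
    and "\<And>c a b. B (c *\<^sub>C a) b = c *\<^sub>C B a b" "\<And>c a b. B a (c *\<^sub>C b) = c *\<^sub>C B a b"
  shows "atensor_lift B (abs_atensor l) = (\<Sum>(a, b)\<leftarrow>l. B a b)"
  unfolding atensor_lift_def
proof (rule sum_list_tensor_eq[OF _ assms])
  show "tensor_eq (rep_atensor (abs_atensor l)) l"
    by (metis Quotient_atensor Quotient_rep_abs tensor_eq.refl)
qed


section \<open>The projective norm\<close>

definition proj_weight :: "('a::complex_normed_vector \<times> 'b::complex_normed_vector) list \<Rightarrow> real"
  where "proj_weight l = (\<Sum>(a, b)\<leftarrow>l. norm a * norm b)"

definition proj_norm :: "('a::complex_normed_vector, 'b::complex_normed_vector) atensor \<Rightarrow> real"
  where "proj_norm w = Inf {proj_weight l | l. w = (\<Sum>(a, b)\<leftarrow>l. atensor_elem a b)}"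

lemma proj_weight_nonneg: "0 \<le> proj_weight l"
  unfolding proj_weight_def by (rule sum_list_nonneg) auto

lemma proj_norm_le: "proj_norm (abs_atensor l) \<le> proj_weight l"
  unfolding proj_norm_def atensor_sum_eq
  by (rule cInf_lower) (auto intro!: bdd_belowI[of _ 0] proj_weight_nonneg)

lemma abs_atensor_surj: "\<exists>l. w = abs_atensor l"
  by (metis Quotient_atensor Quotient_abs_rep)

lemma proj_norm_approx:
  assumes "0 < e"
  shows "\<exists>l. w = abs_atensor l \<and> proj_weight l < proj_norm w + e"
proof -
  let ?S = "{proj_weight l | l. w = abs_atensor l}"
  have ne: "?S \<noteq> {}" using abs_atensor_surj by blast
  have "Inf ?S < proj_norm w + e"
    using assms unfolding proj_norm_def atensor_sum_eq by simp
  from cInf_lessD[OF ne this] show ?thesis by auto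
qed

lemma proj_norm_greatest:
  assumes "\<And>l. w = abs_atensor l \<Longrightarrow> x \<le> proj_weight l"
  shows "x \<le> proj_norm w"
proof (rule field_le_epsilon)
  fix e :: real assume "0 < e"
  then show "x \<le> proj_norm w + e"
    using proj_norm_approx[of e w] assms by (meson order_trans less_imp_le)
qed

lemma proj_norm_nonneg: "0 \<le> proj_norm w"
  by (rule proj_norm_greatest) (rule proj_weight_nonneg)

lemma proj_norm_zero: "proj_norm 0 = 0"
proof (rule antisym)
  show "proj_norm 0 \<le> 0"
    using proj_norm_le[of "[]"] by (simp add: proj_weight_def zero_atensor_def)
qed (rule proj_norm_nonneg)

lemma proj_norm_elem: "proj_norm (atensor_elem a b) \<le> norm a * norm b"
  using proj_norm_le[of "[(a, b)]"] by (simp add: proj_weight_def atensor_elem.abs_eq)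

lemma proj_norm_triangle: "proj_norm (v + w) \<le> proj_norm v + proj_norm w"
proof (rule field_le_epsilon)
  fix e :: real assume "0 < e"
  then obtain l m where l: "v = abs_atensor l" "proj_weight l < proj_norm v + e / 2"
    and m: "w = abs_atensor m" "proj_weight m < proj_norm w + e / 2"
    using proj_norm_approx[of "e / 2"] by (metis half_gt_zero)
  have "proj_norm (v + w) \<le> proj_weight (l @ m)"
    using proj_norm_le[of "l @ m"] l(1) m(1) by (simp add: plus_atensor.abs_eq)
  then show "proj_norm (v + w) \<le> proj_norm v + proj_norm w + e"
    using l(2) m(2) by (simp add: proj_weight_def)
qed

lemma proj_norm_scaleC_le: "proj_norm (c *\<^sub>C w) \<le> cmod c * proj_norm w"
proof (cases "c = 0")
  case True
  then show ?thesis by (simp add: proj_norm_zero)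
next
  case False
  have "proj_norm (c *\<^sub>C w) / cmod c \<le> proj_norm w"
  proof (rule proj_norm_greatest)
    fix l assume w: "w = abs_atensor l"
    have "proj_norm (c *\<^sub>C w) \<le> proj_weight (map (\<lambda>(a, b). (c *\<^sub>C a, b)) l)"
      using proj_norm_le w by (metis scaleC_atensor.abs_eq)
    also have "\<dots> = cmod c * proj_weight l"
      by (simp add: proj_weight_def norm_scaleC case_prod_unfold o_def mult.assoc sum_list_const_mult)
    finally show "proj_norm (c *\<^sub>C w) / cmod c \<le> proj_weight l"
      using False by (simp add: field_simps)
  qed
  then show ?thesis using False by (simp add: field_simps)
qed

lemma proj_norm_scaleC: "proj_norm (c *\<^sub>C w) = cmod c * proj_norm w"
proof (cases "c = 0")
  case False
  have "proj_norm w \<le> cmod (inverse c) * proj_norm (c *\<^sub>C w)"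
    using proj_norm_scaleC_le[of "inverse c" "c *\<^sub>C w"] False by simp
  then show ?thesis
    using False proj_norm_scaleC_le[of c w]
    by (intro antisym) (simp_all add: norm_inverse norm_divide field_simps)
qed (simp add: proj_norm_zero)

lemma proj_norm_minus: "proj_norm (- w) = proj_norm w"
  using proj_norm_scaleC[of "- 1" w] by simp

lemma proj_norm_minus_commute: "proj_norm (v - w) = proj_norm (w - v)"
  by (metis minus_diff_eq proj_norm_minus)

lemma proj_norm_triangle_diff: "\<bar>proj_norm v - proj_norm w\<bar> \<le> proj_norm (v - w)"
  using proj_norm_triangle[of "v - w" w] proj_norm_triangle[of "w - v" v]
  by (simp add: proj_norm_minus_commute[of w v])

lemma proj_norm_triangle3: "proj_norm (u - w) \<le> proj_norm (u - v) + proj_norm (v - w)"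
  using proj_norm_triangle[of "u - v" "v - w"] by simp

lemma atensor_lift_elem:
  assumes "bounded_cbilinear B"
  shows "atensor_lift B (atensor_elem a b) = B a b"
    and "atensor_lift B (v + w) = atensor_lift B v + atensor_lift B w"
    and "atensor_lift B (c *\<^sub>C w) = c *\<^sub>C atensor_lift B w"
proof -
  interpret bounded_bilinear B using assms by (simp add: bounded_cbilinear_def)
  have B: "atensor_lift B (abs_atensor l) = (\<Sum>(a, b)\<leftarrow>l. B a b)" for l
    by (rule atensor_lift_abs) (use assms in \<open>auto simp: bounded_cbilinear_def add_left add_right\<close>)
  show "atensor_lift B (atensor_elem a b) = B a b"
    by (simp add: atensor_elem.abs_eq B)
  obtain l m where lm: "v = abs_atensor l" "w = abs_atensor m" using abs_atensor_surj by metis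
  show "atensor_lift B (v + w) = atensor_lift B v + atensor_lift B w"
    by (simp add: lm plus_atensor.abs_eq B)
  have "(\<Sum>(a, b)\<leftarrow>map (\<lambda>(a, b). (c *\<^sub>C a, b)) m. B a b) = c *\<^sub>C (\<Sum>(a, b)\<leftarrow>m. B a b)"
    using assms by (induction m) (auto simp: bounded_cbilinear_def scaleC_add_right)
  then show "atensor_lift B (c *\<^sub>C w) = c *\<^sub>C atensor_lift B w"
    by (simp add: lm scaleC_atensor.abs_eq B)
qed

lemma atensor_lift_bound:
  assumes B: "bounded_cbilinear B" and K: "\<And>a b. norm (B a b) \<le> norm a * norm b * K" and "0 < K"
  shows "norm (atensor_lift B w) \<le> K * proj_norm w"
proof -
  interpret bounded_bilinear B using assms by (simp add: bounded_cbilinear_def)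
  have "norm (atensor_lift B w) / K \<le> proj_norm w"
  proof (rule proj_norm_greatest)
    fix l assume w: "w = abs_atensor l"
    have "norm (\<Sum>(a, b)\<leftarrow>l. B a b) \<le> K * proj_weight l"
    proof (induction l)
      case (Cons p l)
      obtain a b where "p = (a, b)" by (cases p)
      then show ?case
        using Cons norm_triangle_ineq[of "B a b" "\<Sum>(a, b)\<leftarrow>l. B a b"] K[of a b]
        by (simp add: proj_weight_def algebra_simps)
    qed (simp add: proj_weight_def)
    moreover have "atensor_lift B w = (\<Sum>(a, b)\<leftarrow>l. B a b)"
      unfolding w
      by (rule atensor_lift_abs) (use B in \<open>auto simp: bounded_cbilinear_def add_left add_right\<close>)
    ultimately show "norm (atensor_lift B w) / K \<le> proj_weight l"
      using \<open>0 < K\<close> by (simp add: field_simps)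
  qed
  then show ?thesis using \<open>0 < K\<close> by (simp add: field_simps)
qed


section \<open>The projective tensor product\<close>

text \<open>
  The completion is formed from Cauchy sequences modulo null sequences; this construction
  does not need to know beforehand that only the zero tensor has projective norm zero.
\<close>

definition tensor_cauchy :: "(nat \<Rightarrow> ('a::complex_normed_vector, 'b::complex_normed_vector) atensor) \<Rightarrow> bool"
  where "tensor_cauchy X \<longleftrightarrow> (\<forall>e>0. \<exists>N. \<forall>m\<ge>N. \<forall>n\<ge>N. proj_norm (X m - X n) < e)"

definition tensor_rel ::
  "(nat \<Rightarrow> ('a::complex_normed_vector, 'b::complex_normed_vector) atensor) \<Rightarrow> (nat \<Rightarrow> ('a, 'b) atensor) \<Rightarrow> bool"
  where "tensor_rel X Y \<longleftrightarrow> tensor_cauchy X \<and> tensor_cauchy Y \<and> (\<lambda>n. proj_norm (X n - Y n)) \<longlonglongrightarrow> 0"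

lemma tensor_cauchy_const: "tensor_cauchy (\<lambda>n. w)"
  by (simp add: tensor_cauchy_def proj_norm_zero)

lemma tensor_rel_refl: "tensor_cauchy X \<Longrightarrow> tensor_rel X X"
  by (simp add: tensor_rel_def proj_norm_zero)

lemma proj_null_le:
  assumes "(\<lambda>n. proj_norm (Y n)) \<longlonglongrightarrow> 0" "(\<lambda>n. proj_norm (Z n)) \<longlonglongrightarrow> 0"
    and "\<And>n. proj_norm (X n) \<le> proj_norm (Y n) + proj_norm (Z n)"
  shows "(\<lambda>n. proj_norm (X n)) \<longlonglongrightarrow> 0"
proof (rule Lim_null_comparison)
  show "(\<lambda>n. proj_norm (Y n) + proj_norm (Z n)) \<longlonglongrightarrow> 0"
    using tendsto_add[OF assms(1,2)] by simp
  show "\<forall>\<^sub>F n in sequentially. norm (proj_norm (X n)) \<le> proj_norm (Y n) + proj_norm (Z n)"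
    using assms(3) by (simp add: proj_norm_nonneg)
qed

lemma part_equivp_tensor_rel: "part_equivp tensor_rel"
proof (rule part_equivpI)
  show "\<exists>X. tensor_rel X X" using tensor_rel_refl tensor_cauchy_const by blast
  show "symp tensor_rel"
  proof (rule sympI)
    fix X Y
    assume "tensor_rel X Y"
    moreover have "(\<lambda>n. proj_norm (Y n - X n)) = (\<lambda>n. proj_norm (X n - Y n))"
      by (intro ext proj_norm_minus_commute)
    ultimately show "tensor_rel Y X" by (simp add: tensor_rel_def)
  qed
  show "transp tensor_rel"
  proof (rule transpI)
    fix X Y Z
    assume XY: "tensor_rel X Y" and YZ: "tensor_rel Y Z"
    have lim: "(\<lambda>n. proj_norm (X n - Y n)) \<longlonglongrightarrow> 0" "(\<lambda>n. proj_norm (Y n - Z n)) \<longlonglongrightarrow> 0"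
      using XY YZ by (simp_all add: tensor_rel_def)
    have "(\<lambda>n. proj_norm (X n - Z n)) \<longlonglongrightarrow> 0"
      by (rule proj_null_le[OF lim]) (rule proj_norm_triangle3)
    then show "tensor_rel X Z" using XY YZ by (simp add: tensor_rel_def)
  qed
qed

quotient_type (overloaded) ('a, 'b) ptensor =
  "nat \<Rightarrow> ('a::complex_normed_vector, 'b::complex_normed_vector) atensor" / partial: tensor_rel
  by (rule part_equivp_tensor_rel)

lemma tensor_cauchy_add:
  assumes "tensor_cauchy X" "tensor_cauchy Y"
  shows "tensor_cauchy (\<lambda>n. X n + Y n)"
  unfolding tensor_cauchy_def
proof (intro allI impI)
  fix e :: real assume "0 < e"
  then obtain N1 N2 where N1: "\<And>m n. m \<ge> N1 \<Longrightarrow> n \<ge> N1 \<Longrightarrow> proj_norm (X m - X n) < e / 2"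
    and N2: "\<And>m n. m \<ge> N2 \<Longrightarrow> n \<ge> N2 \<Longrightarrow> proj_norm (Y m - Y n) < e / 2"
    using assms unfolding tensor_cauchy_def by (metis half_gt_zero)
  have "proj_norm (X m + Y m - (X n + Y n)) < e" if "m \<ge> max N1 N2" "n \<ge> max N1 N2" for m n
    using N1[of m n] N2[of m n] that proj_norm_triangle[of "X m - X n" "Y m - Y n"]
    by (simp add: algebra_simps)
  then show "\<exists>N. \<forall>m\<ge>N. \<forall>n\<ge>N. proj_norm (X m + Y m - (X n + Y n)) < e" by blast
qed

lemma tensor_cauchy_scaleC:
  assumes "tensor_cauchy X"
  shows "tensor_cauchy (\<lambda>n. c *\<^sub>C X n)"
  unfolding tensor_cauchy_def
proof (intro allI impI)
  fix e :: real assume "0 < e"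
  moreover have c: "0 < cmod c + 1" by (rule add_nonneg_pos) auto
  ultimately have "0 < e / (cmod c + 1)" by (rule divide_pos_pos)
  then obtain N where N: "\<And>m n. m \<ge> N \<Longrightarrow> n \<ge> N \<Longrightarrow> proj_norm (X m - X n) < e / (cmod c + 1)"
    using assms unfolding tensor_cauchy_def by metis
  have "proj_norm (c *\<^sub>C X m - c *\<^sub>C X n) < e" if "m \<ge> N" "n \<ge> N" for m n
  proof -
    have "cmod c * proj_norm (X m - X n) \<le> (cmod c + 1) * proj_norm (X m - X n)"
      by (simp add: distrib_right proj_norm_nonneg)
    also have "\<dots> < e"
      using N[OF that] c by (simp add: pos_less_divide_eq mult.commute)
    finally show ?thesis
      by (metis proj_norm_scaleC complex_vector.scale_right_diff_distrib)
  qed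
  then show "\<exists>N. \<forall>m\<ge>N. \<forall>n\<ge>N. proj_norm (c *\<^sub>C X m - c *\<^sub>C X n) < e" by blast
qed

lemma tensor_cauchy_norm_convergent:
  assumes "tensor_cauchy X"
  shows "convergent (\<lambda>n. proj_norm (X n))"
proof -
  have "Cauchy (\<lambda>n. proj_norm (X n))"
  proof (rule metric_CauchyI)
    fix e :: real assume "0 < e"
    then obtain N where "\<forall>m\<ge>N. \<forall>n\<ge>N. proj_norm (X m - X n) < e"
      using assms unfolding tensor_cauchy_def by blast
    then show "\<exists>N. \<forall>m\<ge>N. \<forall>n\<ge>N. dist (proj_norm (X m)) (proj_norm (X n)) < e"
      unfolding dist_real_def using proj_norm_triangle_diff by (metis le_less_trans)
  qed
  then show ?thesis by (rule Cauchy_convergent)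
qed

lemma tensor_rel_norm:
  assumes "tensor_rel X Y"
  shows "lim (\<lambda>n. proj_norm (X n)) = lim (\<lambda>n. proj_norm (Y n))"
proof -
  have "(\<lambda>n. proj_norm (X n) - proj_norm (Y n)) \<longlonglongrightarrow> 0"
    by (rule Lim_null_comparison[where g = "\<lambda>n. proj_norm (X n - Y n)"])
       (use assms in \<open>auto simp: tensor_rel_def proj_norm_triangle_diff\<close>)
  moreover have "(\<lambda>n. proj_norm (Y n)) \<longlonglongrightarrow> lim (\<lambda>n. proj_norm (Y n))"
    using assms tensor_cauchy_norm_convergent[of Y] by (auto simp: tensor_rel_def convergent_LIMSEQ_iff)
  ultimately have "(\<lambda>n. proj_norm (X n) - proj_norm (Y n) + proj_norm (Y n)) \<longlonglongrightarrow> 0 + lim (\<lambda>n. proj_norm (Y n))"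
    by (rule tendsto_add)
  then show ?thesis by (auto intro: limI)
qed

instantiation ptensor :: (complex_normed_vector, complex_normed_vector) complex_normed_vector
begin

lift_definition zero_ptensor :: "('a, 'b) ptensor" is "\<lambda>n. 0"
  by (intro tensor_rel_refl tensor_cauchy_const)
lift_definition plus_ptensor :: "('a, 'b) ptensor \<Rightarrow> ('a, 'b) ptensor \<Rightarrow> ('a, 'b) ptensor"
  is "\<lambda>X Y n. X n + Y n"
proof -
  fix X X' Y Y' :: "nat \<Rightarrow> ('a, 'b) atensor"
  assume "tensor_rel X X'" "tensor_rel Y Y'"
  then have cauchy: "tensor_cauchy X" "tensor_cauchy Y" "tensor_cauchy X'" "tensor_cauchy Y'"
    and lim: "(\<lambda>n. proj_norm (X n - X' n)) \<longlonglongrightarrow> 0" "(\<lambda>n. proj_norm (Y n - Y' n)) \<longlonglongrightarrow> 0"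
    by (simp_all add: tensor_rel_def)
  have "(\<lambda>n. proj_norm (X n + Y n - (X' n + Y' n))) \<longlonglongrightarrow> 0"
    unfolding add_diff_add by (rule proj_null_le[OF lim]) (rule proj_norm_triangle)
  then show "tensor_rel (\<lambda>n. X n + Y n) (\<lambda>n. X' n + Y' n)"
    unfolding tensor_rel_def using cauchy tensor_cauchy_add by blast
qed
lift_definition scaleC_ptensor :: "complex \<Rightarrow> ('a, 'b) ptensor \<Rightarrow> ('a, 'b) ptensor"
  is "\<lambda>c X n. c *\<^sub>C X n"
  by (simp add: tensor_rel_def tensor_cauchy_scaleC proj_norm_scaleC tendsto_mult_right_zero
      flip: complex_vector.scale_right_diff_distrib)
lift_definition norm_ptensor :: "('a, 'b) ptensor \<Rightarrow> real"
  is "\<lambda>X. lim (\<lambda>n. proj_norm (X n))" by (rule tensor_rel_norm)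

definition scaleR_ptensor :: "real \<Rightarrow> ('a, 'b) ptensor \<Rightarrow> ('a, 'b) ptensor"
  where "scaleR_ptensor r x = complex_of_real r *\<^sub>C x"
definition uminus_ptensor :: "('a, 'b) ptensor \<Rightarrow> ('a, 'b) ptensor"
  where "uminus_ptensor x = (- 1) *\<^sub>C x"
definition minus_ptensor :: "('a, 'b) ptensor \<Rightarrow> ('a, 'b) ptensor \<Rightarrow> ('a, 'b) ptensor"
  where "minus_ptensor x y = x + (- 1) *\<^sub>C y"
definition dist_ptensor :: "('a, 'b) ptensor \<Rightarrow> ('a, 'b) ptensor \<Rightarrow> real"
  where "dist_ptensor f g = norm (f - g)"
definition sgn_ptensor :: "('a, 'b) ptensor \<Rightarrow> ('a, 'b) ptensor"
  where "sgn_ptensor f = scaleR (inverse (norm f)) f"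
definition uniformity_ptensor :: "(('a, 'b) ptensor \<times> ('a, 'b) ptensor) filter"
  where "uniformity_ptensor = (INF e\<in>{0 <..}. principal {(x, y). dist x y < e})"
definition open_ptensor :: "('a, 'b) ptensor set \<Rightarrow> bool"
  where "open_ptensor S = (\<forall>x\<in>S. \<forall>\<^sub>F (x', y) in uniformity. x' = x \<longrightarrow> y \<in> S)"

instance
proof
  have rel: "tensor_rel X Y" if "tensor_cauchy X" "X = Y" for X Y :: "nat \<Rightarrow> ('a, 'b) atensor"
    using that tensor_rel_refl by blast
  note cauchy = tensor_cauchy_const tensor_cauchy_add tensor_cauchy_scaleC
  fix x y z :: "('a, 'b) ptensor" and r s :: real and a b :: complex
  show "x + y + z = x + (y + z)"
    by (transfer, rule rel) (auto intro!: cauchy simp: tensor_rel_def add.assoc)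
  show "x + y = y + x"
    by (transfer, rule rel) (auto intro!: cauchy simp: tensor_rel_def add.commute)
  show "0 + x = x"
    by (transfer, rule rel) (auto intro!: cauchy simp: tensor_rel_def)
  have one: "1 *\<^sub>C x = x" for x :: "('a, 'b) ptensor"
    by (transfer, rule rel) (auto intro!: cauchy simp: tensor_rel_def)
  have zero: "0 *\<^sub>C x = 0" for x :: "('a, 'b) ptensor"
    by (transfer, rule rel) (auto intro!: cauchy simp: tensor_rel_def)
  show add_left: "(a + b) *\<^sub>C x = a *\<^sub>C x + b *\<^sub>C x" for a b and x :: "('a, 'b) ptensor"
    by (transfer, rule rel) (auto intro!: cauchy simp: tensor_rel_def scaleC_add_left)
  show add_right: "a *\<^sub>C (x + y) = a *\<^sub>C x + a *\<^sub>C y" for a and x y :: "('a, 'b) ptensor"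
    by (transfer, rule rel) (auto intro!: cauchy simp: tensor_rel_def scaleC_add_right)
  show scale: "a *\<^sub>C b *\<^sub>C x = (a * b) *\<^sub>C x" for a b and x :: "('a, 'b) ptensor"
    by (transfer, rule rel) (auto intro!: cauchy simp: tensor_rel_def scaleC_scaleC)
  show "- x + x = 0"
    using add_left[of "- 1" 1 x] by (simp add: uminus_ptensor_def one zero)
  show "x - y = x + - y"
    by (simp add: minus_ptensor_def uminus_ptensor_def)
  show "r *\<^sub>R (x + y) = r *\<^sub>R x + r *\<^sub>R y" "(r + s) *\<^sub>R x = r *\<^sub>R x + s *\<^sub>R x"
    "r *\<^sub>R s *\<^sub>R x = (r * s) *\<^sub>R x" "1 *\<^sub>R x = x" "complex_of_real r *\<^sub>C x = r *\<^sub>R x"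
    by (simp_all add: scaleR_ptensor_def add_left add_right scale one)
  show "dist x y = norm (x - y)" by (rule dist_ptensor_def)
  show "sgn x = inverse (norm x) *\<^sub>R x" by (rule sgn_ptensor_def)
  show "(uniformity :: (('a, 'b) ptensor \<times> ('a, 'b) ptensor) filter) =
      (INF e\<in>{0 <..}. principal {(x, y). dist x y < e})"
    by (rule uniformity_ptensor_def)
  show "open S = (\<forall>x\<in>S. \<forall>\<^sub>F (x', y) in uniformity. x' = x \<longrightarrow> y \<in> S)" for S :: "('a, 'b) ptensor set"
    by (rule open_ptensor_def)
  have lim: "(\<lambda>n. proj_norm (X n)) \<longlonglongrightarrow> lim (\<lambda>n. proj_norm (X n))"
    if "tensor_cauchy X" for X :: "nat \<Rightarrow> ('a, 'b) atensor"
    using tensor_cauchy_norm_convergent[OF that] by (simp add: convergent_LIMSEQ_iff)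
  show "(norm x = 0) = (x = 0)"
  proof (transfer)
    fix X :: "nat \<Rightarrow> ('a, 'b) atensor"
    assume "tensor_rel X X"
    then have X: "tensor_cauchy X" by (simp add: tensor_rel_def)
    have "(lim (\<lambda>n. proj_norm (X n)) = 0) = ((\<lambda>n. proj_norm (X n)) \<longlonglongrightarrow> 0)"
      using lim[OF X] limI by metis
    then show "(lim (\<lambda>n. proj_norm (X n)) = 0) = tensor_rel X (\<lambda>n. 0)"
      using X by (simp add: tensor_rel_def tensor_cauchy_const)
  qed
  show "norm (x + y) \<le> norm x + norm y"
  proof (transfer)
    fix X Y :: "nat \<Rightarrow> ('a, 'b) atensor"
    assume "tensor_rel X X" "tensor_rel Y Y"
    then have XY: "tensor_cauchy X" "tensor_cauchy Y" by (auto simp: tensor_rel_def)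
    show "lim (\<lambda>n. proj_norm (X n + Y n)) \<le> lim (\<lambda>n. proj_norm (X n)) + lim (\<lambda>n. proj_norm (Y n))"
      by (rule LIMSEQ_le[OF lim[OF tensor_cauchy_add[OF XY]] tendsto_add[OF lim[OF XY(1)] lim[OF XY(2)]]])
         (use proj_norm_triangle in blast)
  qed
  show normC: "norm (a *\<^sub>C x) = cmod a * norm x" for a
  proof (transfer)
    fix a and X :: "nat \<Rightarrow> ('a, 'b) atensor"
    assume "tensor_rel X X"
    then have X: "tensor_cauchy X" by (auto simp: tensor_rel_def)
    show "lim (\<lambda>n. proj_norm (a *\<^sub>C X n)) = cmod a * lim (\<lambda>n. proj_norm (X n))"
      unfolding proj_norm_scaleC by (intro limI tendsto_mult tendsto_const lim X)
  qed
  show "norm (r *\<^sub>R x) = \<bar>r\<bar> * norm x"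
    by (simp add: scaleR_ptensor_def normC)
qed

end

definition ptensor_of :: "('a::complex_normed_vector, 'b::complex_normed_vector) atensor \<Rightarrow> ('a, 'b) ptensor"
  where "ptensor_of w = abs_ptensor (\<lambda>n. w)"

lemma tensor_cauchy_rep: "tensor_cauchy (rep_ptensor u)"
  using Quotient_rep_reflp[OF Quotient_ptensor, of u] by (simp add: tensor_rel_def)

lemma abs_rep_ptensor: "abs_ptensor (rep_ptensor u) = u"
  by (rule Quotient_abs_rep[OF Quotient_ptensor])

lemma ptensor_of_linear:
  "ptensor_of (v + w) = ptensor_of v + ptensor_of w"
  "ptensor_of (c *\<^sub>C w) = c *\<^sub>C ptensor_of w"
  "ptensor_of (v - w) = ptensor_of v - ptensor_of w"
proof -
  show add: "ptensor_of (v + w) = ptensor_of v + ptensor_of w" for v w :: "('a, 'b) atensor"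
    by (simp add: ptensor_of_def plus_ptensor.abs_eq tensor_rel_refl tensor_cauchy_const)
  show scale: "ptensor_of (c *\<^sub>C w) = c *\<^sub>C ptensor_of w" for c and w :: "('a, 'b) atensor"
    by (simp add: ptensor_of_def scaleC_ptensor.abs_eq tensor_rel_refl tensor_cauchy_const)
  show "ptensor_of (v - w) = ptensor_of v - ptensor_of w"
    unfolding minus_atensor_def minus_ptensor_def add scale ..
qed

lemma norm_ptensor_of: "norm (ptensor_of w) = proj_norm w"
  by (simp add: ptensor_of_def norm_ptensor.abs_eq tensor_rel_refl tensor_cauchy_const)

lemma abs_ptensor_lim:
  assumes X: "tensor_cauchy X"
  shows "(\<lambda>n. ptensor_of (X n)) \<longlonglongrightarrow> abs_ptensor X"
proof (rule LIMSEQ_I)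
  fix e :: real assume "0 < e"
  then obtain N where N: "\<And>m n. m \<ge> N \<Longrightarrow> n \<ge> N \<Longrightarrow> proj_norm (X m - X n) < e / 2"
    using X unfolding tensor_cauchy_def by (metis half_gt_zero)
  have "norm (ptensor_of (X n) - abs_ptensor X) < e" if n: "n \<ge> N" for n
  proof -
    have c: "tensor_cauchy (\<lambda>k. X n + (- 1) *\<^sub>C X k)"
      by (intro tensor_cauchy_add tensor_cauchy_scaleC tensor_cauchy_const X)
    have "ptensor_of (X n) - abs_ptensor X = abs_ptensor (\<lambda>k. X n + (- 1) *\<^sub>C X k)"
      unfolding minus_ptensor_def ptensor_of_def
        scaleC_ptensor.abs_eq[OF tensor_rel_refl[OF X]]
        plus_ptensor.abs_eq[OF tensor_rel_refl[OF tensor_cauchy_const]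
          tensor_rel_refl[OF tensor_cauchy_scaleC[OF X]]] ..
    then have "norm (ptensor_of (X n) - abs_ptensor X) = lim (\<lambda>k. proj_norm (X n - X k))"
      unfolding minus_atensor_def using norm_ptensor.abs_eq[OF tensor_rel_refl[OF c]] by (simp only:)
    also have "\<dots> \<le> e / 2"
    proof (rule LIMSEQ_le_const2)
      show "(\<lambda>k. proj_norm (X n - X k)) \<longlonglongrightarrow> lim (\<lambda>k. proj_norm (X n - X k))"
        using tensor_cauchy_norm_convergent[OF c]
        unfolding minus_atensor_def convergent_LIMSEQ_iff .
      show "\<exists>N. \<forall>k\<ge>N. proj_norm (X n - X k) \<le> e / 2"
        using N[OF n] by (auto intro!: exI[of _ N] less_imp_le)
    qed
    finally show ?thesis using \<open>0 < e\<close> by simp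
  qed
  then show "\<exists>N. \<forall>n\<ge>N. norm (ptensor_of (X n) - abs_ptensor X) < e" by blast
qed

lemma ptensor_of_dense:
  assumes "0 < e"
  shows "\<exists>w. norm (u - ptensor_of w) < e"
proof -
  have "(\<lambda>n. ptensor_of (rep_ptensor u n)) \<longlonglongrightarrow> u"
    using abs_ptensor_lim[OF tensor_cauchy_rep[of u]] by (simp add: abs_rep_ptensor)
  from LIMSEQ_D[OF this assms] show ?thesis
    by (metis norm_minus_commute order_refl)
qed

lemma tensor_cauchy_iff: "tensor_cauchy X \<longleftrightarrow> Cauchy (\<lambda>n. ptensor_of (X n))"
  by (simp add: Cauchy_def tensor_cauchy_def dist_norm norm_ptensor_of flip: ptensor_of_linear)

instance ptensor :: (complex_normed_vector, complex_normed_vector) complex_banach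
proof
  fix U :: "nat \<Rightarrow> ('a, 'b) ptensor"
  assume U: "Cauchy U"
  have "\<exists>w. norm (U n - ptensor_of w) < inverse (real (Suc n))" for n
    by (rule ptensor_of_dense) simp
  then obtain X where X: "\<And>n. norm (U n - ptensor_of (X n)) < inverse (real (Suc n))"
    by metis
  have null: "(\<lambda>n. U n - ptensor_of (X n)) \<longlonglongrightarrow> 0"
    by (rule Lim_null_comparison[OF _ LIMSEQ_inverse_real_of_nat])
       (use X less_imp_le in \<open>auto intro!: always_eventually\<close>)
  have "Cauchy (\<lambda>n. ptensor_of (X n))"
  proof (rule CauchyI)
    fix e :: real assume "0 < e"
    then have "0 < e / 2" by simp
    from CauchyD[OF U this] CauchyD[OF LIMSEQ_imp_Cauchy[OF null] this] obtain M N
      where M: "\<forall>m\<ge>M. \<forall>n\<ge>M. norm (U m - U n) < e / 2"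
        and N: "\<forall>m\<ge>N. \<forall>n\<ge>N. norm ((U m - ptensor_of (X m)) - (U n - ptensor_of (X n))) < e / 2"
      by blast
    have "norm (ptensor_of (X m) - ptensor_of (X n)) < e" if "m \<ge> max M N" "n \<ge> max M N" for m n
    proof -
      have "norm ((U m - U n) - ((U m - ptensor_of (X m)) - (U n - ptensor_of (X n)))) < e / 2 + e / 2"
        using M N that
        by (intro le_less_trans[OF norm_triangle_ineq4[of "U m - U n"] add_strict_mono]) auto
      then show ?thesis by (simp add: algebra_simps)
    qed
    then show "\<exists>M. \<forall>m\<ge>M. \<forall>n\<ge>M. norm (ptensor_of (X m) - ptensor_of (X n)) < e" by blast
  qed
  then have "tensor_cauchy X"
    by (simp add: tensor_cauchy_iff)
  from tendsto_add[OF null abs_ptensor_lim[OF this]] show "convergent U"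
    by (auto simp: convergent_def)
qed

definition ptensor_elem :: "'a::complex_normed_vector \<Rightarrow> 'b::complex_normed_vector \<Rightarrow> ('a, 'b) ptensor"
  where "ptensor_elem a b = ptensor_of (atensor_elem a b)"

definition ptensor_lift ::
  "('a::complex_normed_vector \<Rightarrow> 'b::complex_normed_vector \<Rightarrow> 'c::complex_banach) \<Rightarrow> ('a, 'b) ptensor \<Rightarrow> 'c"
  where "ptensor_lift B = (THE F. bounded_clinear F \<and> (\<forall>a b. F (ptensor_elem a b) = B a b))"

lemma bounded_cbilinear_ptensor_elem: "bounded_cbilinear ptensor_elem"
proof -
  have add: "atensor_elem (a + a') b = atensor_elem a b + atensor_elem a' b"
    "atensor_elem a (b + b') = atensor_elem a b + atensor_elem a b'"
    "atensor_elem (c *\<^sub>C a) b = c *\<^sub>C atensor_elem a b"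
    "atensor_elem a (c *\<^sub>C b) = c *\<^sub>C atensor_elem a b"
    for a a' :: 'a and b b' :: 'b and c
    by (transfer; auto intro: tensor_eq.intros)+
  have scaleC: "ptensor_elem (c *\<^sub>C a) b = c *\<^sub>C ptensor_elem a b"
    "ptensor_elem a (c *\<^sub>C b) = c *\<^sub>C ptensor_elem a b" for a :: 'a and b :: 'b and c
    by (simp_all add: ptensor_elem_def add ptensor_of_linear)
  have "bounded_bilinear (ptensor_elem :: 'a \<Rightarrow> 'b \<Rightarrow> _)"
  proof
    show "\<exists>K. \<forall>(a :: 'a) (b :: 'b). norm (ptensor_elem a b) \<le> norm a * norm b * K"
      by (rule exI[of _ 1]) (simp add: ptensor_elem_def norm_ptensor_of proj_norm_elem)
  qed (simp_all add: scaleC flip: scaleC_of_real, simp_all add: ptensor_elem_def add ptensor_of_linear)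
  with scaleC show ?thesis by (simp add: bounded_cbilinear_def)
qed

lemma ptensor_of_abs: "ptensor_of (abs_atensor l) = (\<Sum>(a, b)\<leftarrow>l. ptensor_elem a b)"
proof (induction l)
  case Nil
  show ?case
    using ptensor_of_linear(2)[of 0 "abs_atensor []"] by (simp flip: zero_atensor_def)
next
  case (Cons p l)
  obtain a b where p: "p = (a, b)" by (cases p)
  have "abs_atensor (p # l) = atensor_elem a b + abs_atensor l"
    by (simp add: p atensor_elem.abs_eq plus_atensor.abs_eq)
  then show ?case
    using Cons p by (simp add: ptensor_of_linear ptensor_elem_def)
qed

lemma ptensor_ext:
  fixes F G :: "('a::complex_normed_vector, 'b::complex_normed_vector) ptensor \<Rightarrow> 'c::complex_normed_vector"
  assumes F: "bounded_clinear F" and G: "bounded_clinear G"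
    and elem: "\<And>a b. F (ptensor_elem a b) = G (ptensor_elem a b)"
  shows "F = G"
proof
  interpret F: bounded_linear F using F by (simp add: bounded_clinear_def)
  interpret G: bounded_linear G using G by (simp add: bounded_clinear_def)
  have eq: "F (ptensor_of w) = G (ptensor_of w)" for w
  proof -
    obtain l where w: "w = abs_atensor l" using abs_atensor_surj by blast
    show ?thesis unfolding w ptensor_of_abs
      by (induction l) (auto simp: F.add G.add F.zero G.zero elem)
  qed
  fix u :: "('a, 'b) ptensor"
  have X: "(\<lambda>n. ptensor_of (rep_ptensor u n)) \<longlonglongrightarrow> u"
    using abs_ptensor_lim[OF tensor_cauchy_rep[of u]] by (simp add: abs_rep_ptensor)
  show "F u = G u"
    using LIMSEQ_unique[OF F.tendsto[OF X]] G.tendsto[OF X] by (simp add: eq)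
qed

theorem ptensor_lift_ex1:
  fixes B :: "'a::complex_normed_vector \<Rightarrow> 'b::complex_normed_vector \<Rightarrow> 'c::complex_banach"
  assumes B: "bounded_cbilinear B"
  shows "\<exists>!F. bounded_clinear F \<and> (\<forall>a b. F (ptensor_elem a b) = B a b)"
proof (rule ex_ex1I)
  interpret B: bounded_bilinear B using B by (simp add: bounded_cbilinear_def)
  obtain K where K: "0 < K" "\<And>a b. norm (B a b) \<le> norm a * norm b * K"
    using B.pos_bounded by blast
  note L = atensor_lift_elem[OF B]
  have Ldiff: "atensor_lift B (v - w) = atensor_lift B v - atensor_lift B w" for v w
    using L(2)[of "v - w" w] by simp
  have bound: "norm (atensor_lift B w) \<le> K * norm (ptensor_of w)" for w
    using atensor_lift_bound[OF B K(2,1)] by (simp add: norm_ptensor_of)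
  have conv: "\<exists>y. \<forall>X. (\<lambda>n. ptensor_of (X n)) \<longlonglongrightarrow> u \<longrightarrow> (\<lambda>n. atensor_lift B (X n)) \<longlonglongrightarrow> y" for u
  proof -
    obtain Y where Y: "(\<lambda>n. ptensor_of (Y n)) \<longlonglongrightarrow> u"
      using abs_ptensor_lim[OF tensor_cauchy_rep[of u]] by (auto simp: abs_rep_ptensor)
    have "Cauchy (\<lambda>n. atensor_lift B (Y n))"
    proof (rule CauchyI)
      fix e :: real assume "0 < e"
      then have "0 < e / K" using K by simp
      from CauchyD[OF LIMSEQ_imp_Cauchy[OF Y] this]
      obtain M where M: "\<forall>m\<ge>M. \<forall>n\<ge>M. norm (ptensor_of (Y m) - ptensor_of (Y n)) < e / K" by blast
      have "norm (atensor_lift B (Y m) - atensor_lift B (Y n)) < e" if "m \<ge> M" "n \<ge> M" for m n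
      proof -
        have "norm (ptensor_of (Y m - Y n)) < e / K"
          using M that by (simp add: ptensor_of_linear)
        then have "K * norm (ptensor_of (Y m - Y n)) < e"
          using K by (simp add: field_simps)
        with bound[of "Y m - Y n"] show ?thesis by (simp add: Ldiff)
      qed
      then show "\<exists>M. \<forall>m\<ge>M. \<forall>n\<ge>M. norm (atensor_lift B (Y m) - atensor_lift B (Y n)) < e" by blast
    qed
    then obtain y where y: "(\<lambda>n. atensor_lift B (Y n)) \<longlonglongrightarrow> y"
      using Cauchy_convergent convergent_def by blast
    have "(\<lambda>n. atensor_lift B (X n)) \<longlonglongrightarrow> y" if X: "(\<lambda>n. ptensor_of (X n)) \<longlonglongrightarrow> u" for X
    proof -
      have "(\<lambda>n. ptensor_of (X n) - ptensor_of (Y n)) \<longlonglongrightarrow> 0"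
        using tendsto_diff[OF X Y] by simp
      from tendsto_mult_right_zero[OF tendsto_norm_zero[OF this], of K]
      have "(\<lambda>n. K * norm (ptensor_of (X n - Y n))) \<longlonglongrightarrow> 0"
        by (simp add: ptensor_of_linear)
      then have "(\<lambda>n. atensor_lift B (X n - Y n)) \<longlonglongrightarrow> 0"
        by (rule Lim_null_comparison[rotated]) (simp add: bound)
      from tendsto_add[OF this y] show ?thesis by (simp add: Ldiff)
    qed
    then show ?thesis by blast
  qed
  then obtain F where F: "\<And>u X. (\<lambda>n. ptensor_of (X n)) \<longlonglongrightarrow> u \<Longrightarrow> (\<lambda>n. atensor_lift B (X n)) \<longlonglongrightarrow> F u"
    by metis
  have approx: "\<exists>X. (\<lambda>n. ptensor_of (X n)) \<longlonglongrightarrow> u" for u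
    using abs_ptensor_lim[OF tensor_cauchy_rep[of u]] by (auto simp: abs_rep_ptensor)
  have add: "F (u + v) = F u + F v" for u v
  proof -
    obtain X Y where XY: "(\<lambda>n. ptensor_of (X n)) \<longlonglongrightarrow> u" "(\<lambda>n. ptensor_of (Y n)) \<longlonglongrightarrow> v"
      using approx by metis
    have "(\<lambda>n. atensor_lift B (X n + Y n)) \<longlonglongrightarrow> F (u + v)"
      by (rule F) (use tendsto_add[OF XY] in \<open>simp add: ptensor_of_linear\<close>)
    moreover have "(\<lambda>n. atensor_lift B (X n + Y n)) \<longlonglongrightarrow> F u + F v"
      unfolding L(2) by (intro tendsto_add F XY)
    ultimately show ?thesis by (rule LIMSEQ_unique)
  qed
  have blC: "bounded_linear (\<lambda>x :: 'd::complex_normed_vector. c *\<^sub>C x)" for c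
    by (rule bounded_linear_intro[of _ "cmod c"])
       (simp_all add: scaleC_add_right norm_scaleC mult.commute scaleC_scaleC flip: scaleC_of_real)
  have scale: "F (c *\<^sub>C u) = c *\<^sub>C F u" for c u
  proof -
    obtain X where X: "(\<lambda>n. ptensor_of (X n)) \<longlonglongrightarrow> u"
      using approx by metis
    have "(\<lambda>n. atensor_lift B (c *\<^sub>C X n)) \<longlonglongrightarrow> F (c *\<^sub>C u)"
      by (rule F) (use bounded_linear.tendsto[OF blC X, of c] in \<open>simp add: ptensor_of_linear\<close>)
    moreover have "(\<lambda>n. atensor_lift B (c *\<^sub>C X n)) \<longlonglongrightarrow> c *\<^sub>C F u"
      unfolding L(3) by (intro bounded_linear.tendsto[OF blC] F X)
    ultimately show ?thesis by (rule LIMSEQ_unique)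
  qed
  have "bounded_linear F"
  proof (rule bounded_linear_intro)
    show "F (r *\<^sub>R u) = r *\<^sub>R F u" for r u
      using scale[of "complex_of_real r" u] by (simp add: scaleC_of_real)
    show "norm (F u) \<le> norm u * K" for u
    proof -
      obtain X where X: "(\<lambda>n. ptensor_of (X n)) \<longlonglongrightarrow> u"
        using approx by metis
      show ?thesis
        by (rule LIMSEQ_le[OF tendsto_norm[OF F[OF X]] tendsto_mult[OF tendsto_norm[OF X] tendsto_const]])
           (use bound in \<open>auto simp: mult.commute\<close>)
    qed
  qed (rule add)
  moreover have "F (ptensor_elem a b) = B a b" for a b
  proof -
    have "(\<lambda>n :: nat. atensor_lift B (atensor_elem a b)) \<longlonglongrightarrow> F (ptensor_elem a b)"
      by (rule F) (simp add: ptensor_elem_def)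
    then show ?thesis by (simp add: L LIMSEQ_const_iff)
  qed
  ultimately show "\<exists>F. bounded_clinear F \<and> (\<forall>a b. F (ptensor_elem a b) = B a b)"
    using scale by (auto simp: bounded_clinear_def)
qed (rule ptensor_ext; simp)

lemma ptensor_lift:
  assumes "bounded_cbilinear B"
  shows "bounded_clinear (ptensor_lift B)" "ptensor_lift B (ptensor_elem a b) = B a b"
  using theI'[OF ptensor_lift_ex1[OF assms]] unfolding ptensor_lift_def by auto


lemma norm_ptensor_lift_le:
  assumes B: "bounded_cbilinear B" and K: "\<And>a b. norm (B a b) \<le> norm a * norm b * K" and "0 \<le> K"
  shows "norm (ptensor_lift B u) \<le> K * norm u"
proof -
  interpret F: bounded_linear "ptensor_lift B"
    using ptensor_lift(1)[OF B] by (simp add: bounded_clinear_def)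
  have "norm (ptensor_lift B (ptensor_of w)) \<le> K * proj_norm w" for w
  proof (rule field_le_epsilon)
    fix e :: real assume "0 < e"
    then have "0 < e / (K + 1)" using \<open>0 \<le> K\<close> by simp
    then obtain l where w: "w = abs_atensor l" and l: "proj_weight l < proj_norm w + e / (K + 1)"
      using proj_norm_approx by blast
    have "norm (ptensor_lift B (ptensor_of w)) \<le> K * proj_weight l"
      unfolding w ptensor_of_abs
    proof (induction l)
      case (Cons p l)
      obtain a b where p: "p = (a, b)" by (cases p)
      let ?t = "ptensor_lift B (\<Sum>(a, b)\<leftarrow>l. ptensor_elem a b)"
      have "norm (B a b + ?t) \<le> norm a * norm b * K + K * proj_weight l"
        using Cons by (intro norm_triangle_le add_mono K)
      then show ?case
        by (simp add: p F.add ptensor_lift(2)[OF B] proj_weight_def distrib_left mult.commute)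
    qed (simp add: F.zero proj_weight_def)
    also have "\<dots> \<le> K * (proj_norm w + e / (K + 1))"
      using l \<open>0 \<le> K\<close> by (intro mult_left_mono) auto
    also have "\<dots> = K * proj_norm w + K * (e / (K + 1))"
      by (rule distrib_left)
    also have "K * (e / (K + 1)) \<le> e"
      using \<open>0 \<le> K\<close> \<open>0 < e\<close> by (simp add: field_simps)
    finally show "norm (ptensor_lift B (ptensor_of w)) \<le> K * proj_norm w + e" by simp
  qed
  then have le: "norm (ptensor_lift B (ptensor_of w)) \<le> K * norm (ptensor_of w)" for w
    by (simp add: norm_ptensor_of)
  have X: "(\<lambda>n. ptensor_of (rep_ptensor u n)) \<longlonglongrightarrow> u"
    using abs_ptensor_lim[OF tensor_cauchy_rep[of u]] by (simp add: abs_rep_ptensor)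
  show ?thesis
    by (rule LIMSEQ_le[OF tendsto_norm[OF F.tendsto[OF X]] tendsto_mult[OF tendsto_const tendsto_norm[OF X]]])
       (use le in blast)
qed


section \<open>Trace, generated operator and product\<close>

definition ptrace :: "('a::complex_banach cdual, 'a) ptensor \<Rightarrow> complex"
  where "ptrace = ptensor_lift cdual_apply"

text \<open>
  For \<open>u = (\<Sum>k. f\<^sub>k \<otimes> y\<^sub>k)\<close> this is \<open>x \<mapsto> (\<Sum>k. \<langle>f\<^sub>k, x\<rangle> y\<^sub>k)\<close>, see \<open>ptensor_op_sums\<close> below.
\<close>

definition ptensor_op :: "('a::complex_banach cdual, 'a) ptensor \<Rightarrow> 'a \<Rightarrow> 'a"
  where "ptensor_op u x = ptensor_lift (\<lambda>f y. cdual_apply f x *\<^sub>C y) u"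

text \<open>
  On elementary tensors this is the composition rule \<open>(f \<otimes> x) (g \<otimes> y) = \<langle>f, y\<rangle> (g \<otimes> x)\<close>; the
  inner lift extends it to all \<open>v\<close>, the outer one to all \<open>u\<close>.
\<close>

definition ptensor_mult ::
  "('a::complex_banach cdual, 'a) ptensor \<Rightarrow> ('a cdual, 'a) ptensor \<Rightarrow> ('a cdual, 'a) ptensor"
  where "ptensor_mult u v =
    ptensor_lift (\<lambda>f x. ptensor_lift (\<lambda>g y. cdual_apply f y *\<^sub>C ptensor_elem g x) v) u"

text \<open>The power is meaningful for positive exponents only, as the algebra has no unit in general.\<close>

definition ptensor_power :: "('a::complex_banach cdual, 'a) ptensor \<Rightarrow> nat \<Rightarrow> ('a cdual, 'a) ptensor"
  where "ptensor_power u m = (ptensor_mult u ^^ (m - 1)) u"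

lemma bounded_cbilinear_cdual_apply: "bounded_cbilinear cdual_apply"
proof -
  have "bounded_bilinear (cdual_apply :: 'a cdual \<Rightarrow> _)"
    by standard (auto simp: cdual_apply_simps intro!: exI[of _ 1] norm_cdual_apply)
  then show ?thesis
    by (simp add: bounded_cbilinear_def cdual_apply_simps scaleC_complex_def)
qed

lemma bounded_clinear_ptrace: "bounded_clinear ptrace"
  and ptrace_elem: "ptrace (ptensor_elem f x) = cdual_apply f x"
  unfolding ptrace_def using ptensor_lift[OF bounded_cbilinear_cdual_apply] by auto

lemma norm_op_kernel_le:
  fixes y :: "'b::complex_normed_vector"
  shows "norm (cdual_apply f x *\<^sub>C y) \<le> norm f * norm y * norm x"
  using mult_right_mono[OF norm_cdual_apply[of f x], of "norm y"]
  by (simp add: norm_scaleC mult_ac)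

lemma bounded_cbilinear_op_kernel:
  "bounded_cbilinear (\<lambda>f (y :: 'b::complex_normed_vector). cdual_apply f x *\<^sub>C y)"
proof -
  have "bounded_bilinear (\<lambda>f (y :: 'b). cdual_apply f x *\<^sub>C y)"
  proof
    show "\<exists>K. \<forall>f (y :: 'b). norm (cdual_apply f x *\<^sub>C y) \<le> norm f * norm y * K"
      using norm_op_kernel_le by blast
  qed (simp_all add: cdual_apply_simps scaleC_add_left scaleC_add_right scaleC_scaleC scaleR_conv_of_real
      mult.commute flip: scaleC_of_real)
  then show ?thesis
    by (simp add: bounded_cbilinear_def cdual_apply_simps scaleC_scaleC mult.commute)
qed

lemma ptensor_op_sums:
  fixes x :: "'a::complex_banach"
  assumes "(\<lambda>k. ptensor_elem (f k) (y k)) sums u"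
  shows "(\<lambda>k. cdual_apply (f k) x *\<^sub>C y k) sums ptensor_op u x"
proof -
  have "bounded_cbilinear (\<lambda>f (y :: 'a). cdual_apply f x *\<^sub>C y)"
    by (rule bounded_cbilinear_op_kernel)
  note L = ptensor_lift[OF this]
  have "bounded_linear (ptensor_lift (\<lambda>f (y :: 'a). cdual_apply f x *\<^sub>C y))"
    using L(1) by (simp add: bounded_clinear_def)
  from bounded_linear.sums[OF this assms] show ?thesis
    by (simp add: ptensor_op_def L(2))
qed

lemma bounded_clinear_add: "bounded_clinear F \<Longrightarrow> bounded_clinear G \<Longrightarrow> bounded_clinear (\<lambda>u. F u + G u)"
  by (simp add: bounded_clinear_def bounded_linear_add scaleC_add_right)

lemma bounded_clinear_scaleC: "bounded_clinear F \<Longrightarrow> bounded_clinear (\<lambda>u. c *\<^sub>C F u)"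
proof -
  have bl: "bounded_linear (\<lambda>x :: 'b. c *\<^sub>C x)"
    by (rule bounded_linear_intro[of _ "cmod c"])
       (simp_all add: scaleC_add_right norm_scaleC mult.commute scaleC_scaleC flip: scaleC_of_real)
  assume "bounded_clinear F"
  then show ?thesis
    using bounded_linear_compose[OF bl, of F]
    by (simp add: bounded_clinear_def scaleC_scaleC mult.commute)
qed

lemma ptensor_elem_linear:
  fixes a a' :: "'a::complex_normed_vector" and b b' :: "'b::complex_normed_vector"
  shows
  "ptensor_elem (a + a') b = ptensor_elem a b + ptensor_elem a' b"
  "ptensor_elem a (b + b') = ptensor_elem a b + ptensor_elem a b'"
  "ptensor_elem (c *\<^sub>C a) b = c *\<^sub>C ptensor_elem a b"
  "ptensor_elem a (c *\<^sub>C b) = c *\<^sub>C ptensor_elem a b"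
proof -
  interpret bounded_bilinear "ptensor_elem :: 'a \<Rightarrow> 'b \<Rightarrow> _"
    using bounded_cbilinear_ptensor_elem[where 'a = 'a and 'b = 'b] by (simp add: bounded_cbilinear_def)
  show "ptensor_elem (a + a') b = ptensor_elem a b + ptensor_elem a' b"
    "ptensor_elem a (b + b') = ptensor_elem a b + ptensor_elem a b'"
    by (rule add_left add_right)+
  show "ptensor_elem (c *\<^sub>C a) b = c *\<^sub>C ptensor_elem a b"
    "ptensor_elem a (c *\<^sub>C b) = c *\<^sub>C ptensor_elem a b"
    using bounded_cbilinear_ptensor_elem[where 'a = 'a and 'b = 'b]
    by (simp_all add: bounded_cbilinear_def)
qed

lemma norm_ptensor_elem_le: "norm (ptensor_elem a b) \<le> norm a * norm b"
  by (simp add: ptensor_elem_def norm_ptensor_of proj_norm_elem)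

definition mult_kernel ::
  "'a::complex_normed_vector cdual \<Rightarrow> 'a \<Rightarrow> 'a cdual \<Rightarrow> 'a \<Rightarrow> ('a cdual, 'a) ptensor"
  where "mult_kernel f x g y = cdual_apply f y *\<^sub>C ptensor_elem g x"

lemma norm_mult_kernel_le: "norm (mult_kernel f x g y) \<le> norm g * norm y * (norm f * norm x)"
  using mult_mono[OF norm_cdual_apply[of f y] norm_ptensor_elem_le[of g x]]
  by (simp add: mult_kernel_def norm_scaleC mult_ac)

lemma mult_kernel_linear:
  "mult_kernel (f + f') x g y = mult_kernel f x g y + mult_kernel f' x g y"
  "mult_kernel f (x + x') g y = mult_kernel f x g y + mult_kernel f x' g y"
  "mult_kernel f x (g + g') y = mult_kernel f x g y + mult_kernel f x g' y"
  "mult_kernel f x g (y + y') = mult_kernel f x g y + mult_kernel f x g y'"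
  "mult_kernel (c *\<^sub>C f) x g y = c *\<^sub>C mult_kernel f x g y"
  "mult_kernel f (c *\<^sub>C x) g y = c *\<^sub>C mult_kernel f x g y"
  "mult_kernel f x (c *\<^sub>C g) y = c *\<^sub>C mult_kernel f x g y"
  "mult_kernel f x g (c *\<^sub>C y) = c *\<^sub>C mult_kernel f x g y"
  by (simp_all add: mult_kernel_def cdual_apply_simps ptensor_elem_linear scaleC_add_left
      scaleC_add_right scaleC_scaleC mult.commute)

lemma bounded_cbilinear_mult_inner: "bounded_cbilinear (mult_kernel f x)"
proof -
  have "bounded_bilinear (mult_kernel f x)"
  proof
    show "\<exists>K. \<forall>g y. norm (mult_kernel f x g y) \<le> norm g * norm y * K"
      using norm_mult_kernel_le by blast
    show "mult_kernel f x (r *\<^sub>R g) y = r *\<^sub>R mult_kernel f x g y"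
      "mult_kernel f x g (r *\<^sub>R y) = r *\<^sub>R mult_kernel f x g y" for r g y
      using mult_kernel_linear(7,8)[where c = "complex_of_real r"] by (simp_all add: scaleC_of_real)
  qed (simp_all add: mult_kernel_linear)
  then show ?thesis by (simp add: bounded_cbilinear_def mult_kernel_linear)
qed

lemma bounded_cbilinear_mult_outer:
  fixes v :: "('a::complex_banach cdual, 'a) ptensor"
  shows "bounded_cbilinear (\<lambda>f x. ptensor_lift (mult_kernel f x) v)"
proof -
  note L = ptensor_lift[OF bounded_cbilinear_mult_inner]
  note cl = L(1) bounded_clinear_add bounded_clinear_scaleC
  have lin: "ptensor_lift (mult_kernel (f + f') x) v = ptensor_lift (mult_kernel f x) v + ptensor_lift (mult_kernel f' x) v"
    "ptensor_lift (mult_kernel f (x + x')) v = ptensor_lift (mult_kernel f x) v + ptensor_lift (mult_kernel f x') v"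
    "ptensor_lift (mult_kernel (c *\<^sub>C f) x) v = c *\<^sub>C ptensor_lift (mult_kernel f x) v"
    "ptensor_lift (mult_kernel f (c *\<^sub>C x)) v = c *\<^sub>C ptensor_lift (mult_kernel f x) v"
    for f f' :: "'a cdual" and x x' c
    by (rule fun_cong[of _ _ v], rule ptensor_ext, rule L(1), intro cl, unfold L(2), rule mult_kernel_linear)+
  have "bounded_bilinear (\<lambda>f x. ptensor_lift (mult_kernel f x) v)"
  proof
    have "norm (ptensor_lift (mult_kernel f x) v) \<le> norm f * norm x * norm v" for f x
      by (rule norm_ptensor_lift_le[OF bounded_cbilinear_mult_inner norm_mult_kernel_le]) simp
    then show "\<exists>K. \<forall>f x. norm (ptensor_lift (mult_kernel f x) v) \<le> norm f * norm x * K" by blast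
    show "ptensor_lift (mult_kernel (r *\<^sub>R f) x) v = r *\<^sub>R ptensor_lift (mult_kernel f x) v"
      "ptensor_lift (mult_kernel f (r *\<^sub>R x)) v = r *\<^sub>R ptensor_lift (mult_kernel f x) v" for r f x
      using lin(3)[of "complex_of_real r" f x] lin(4)[of f "complex_of_real r" x]
      by (simp_all add: scaleC_of_real)
  qed (simp_all add: lin)
  then show ?thesis by (simp add: bounded_cbilinear_def lin)
qed

lemma ptensor_mult_eq: "ptensor_mult u v = ptensor_lift (\<lambda>f x. ptensor_lift (mult_kernel f x) v) u"
  by (simp add: ptensor_mult_def mult_kernel_def[abs_def])

lemma ptensor_mult_elem:
  "ptensor_mult (ptensor_elem f x) (ptensor_elem g y) = cdual_apply f y *\<^sub>C ptensor_elem g x"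
  unfolding ptensor_mult_eq
  by (subst ptensor_lift(2)[OF bounded_cbilinear_mult_outer],
      subst ptensor_lift(2)[OF bounded_cbilinear_mult_inner], rule mult_kernel_def)


section \<open>Tensors with an s-summable representation\<close>

definition s_tensors :: "real \<Rightarrow> ('a::complex_normed_vector, 'b::complex_normed_vector) ptensor set"
  where "s_tensors s = {u. \<exists>f x. (\<lambda>k. ptensor_elem (f k) (x k)) sums u \<and>
    summable (\<lambda>k. norm (f k) powr s * norm (x k) powr s)}"


section \<open>Central-symmetric spectrum\<close>

definition eigenvalue :: "('a::complex_vector \<Rightarrow> 'a) \<Rightarrow> complex \<Rightarrow> bool"
  where "eigenvalue T l \<longleftrightarrow> (\<exists>x. x \<noteq> 0 \<and> T x = l *\<^sub>C x)"

definition generalized_eigenspace :: "('a::complex_vector \<Rightarrow> 'a) \<Rightarrow> complex \<Rightarrow> 'a set"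
  where "generalized_eigenspace T l = {x. \<exists>k. ((\<lambda>y. T y - l *\<^sub>C y) ^^ k) x = 0}"

text \<open>
  The dimension of an infinite-dimensional space is 0 by convention; the generalized eigenspaces
  of a compact operator at its nonzero eigenvalues are finite-dimensional.
\<close>

definition alg_multiplicity :: "('a::complex_vector \<Rightarrow> 'a) \<Rightarrow> complex \<Rightarrow> nat"
  where "alg_multiplicity T l = cdim (generalized_eigenspace T l)"

definition central_symmetric_spectrum :: "('a::complex_vector \<Rightarrow> 'a) \<Rightarrow> bool"
  where "central_symmetric_spectrum T \<longleftrightarrow>
    (\<forall>l. l \<noteq> 0 \<longrightarrow> eigenvalue T l \<longrightarrow>
      eigenvalue T (- l) \<and> alg_multiplicity T (- l) = alg_multiplicity T l)"


section \<open>Subspaces of quotients of \<open>L\<^sub>p\<close>-spaces\<close>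

definition Lp_functional :: "'m measure \<Rightarrow> ennreal \<Rightarrow> ('m \<Rightarrow> complex) \<Rightarrow> ennreal"
  where "Lp_functional M p f =
    (if p = \<infinity> then esssup M (\<lambda>x. ennreal (cmod (f x)))
     else \<integral>\<^sup>+ x. ennreal (cmod (f x) powr enn2real p) \<partial>M)"

definition Lp_functions :: "'m measure \<Rightarrow> ennreal \<Rightarrow> ('m \<Rightarrow> complex) set"
  where "Lp_functions M p = {f \<in> borel_measurable M. Lp_functional M p f < \<infinity>}"

definition Lp_norm :: "'m measure \<Rightarrow> ennreal \<Rightarrow> ('m \<Rightarrow> complex) \<Rightarrow> real"
  where "Lp_norm M p f =
    (if p = \<infinity> then enn2real (Lp_functional M p f)
     else enn2real (Lp_functional M p f) powr (1 / enn2real p))"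

text \<open>
  Functions are not identified almost everywhere. A closed subspace of \<open>L\<^sub>p\<close> is represented by the
  set of all functions whose classes belong to it: being closed for the seminorm, such a set
  contains with a function all functions in its class, and in particular all null functions. So the
  cosets below are exactly the elements of the quotients of closed subspaces of \<open>L\<^sub>p\<close>.
\<close>

definition Lp_closed_subspace :: "'m measure \<Rightarrow> ennreal \<Rightarrow> ('m \<Rightarrow> complex) set \<Rightarrow> bool"
  where "Lp_closed_subspace M p N \<longleftrightarrow>
    N \<subseteq> Lp_functions M p \<and> (\<lambda>x. 0) \<in> N \<and>
    (\<forall>f\<in>N. \<forall>g\<in>N. (\<lambda>x. f x + g x) \<in> N) \<and>
    (\<forall>c. \<forall>f\<in>N. (\<lambda>x. c * f x) \<in> N) \<and>
    (\<forall>F f. (\<forall>n. F n \<in> N) \<longrightarrow> f \<in> Lp_functions M p \<longrightarrow>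
      (\<lambda>n. Lp_norm M p (\<lambda>x. F n x - f x)) \<longlonglongrightarrow> 0 \<longrightarrow> f \<in> N)"

definition Lp_cosets :: "('m \<Rightarrow> complex) set \<Rightarrow> ('m \<Rightarrow> complex) set \<Rightarrow> ('m \<Rightarrow> complex) set set"
  where "Lp_cosets Z N = (\<lambda>f. {\<lambda>x. f x + g x | g. g \<in> N}) ` Z"

definition quotient_norm :: "'m measure \<Rightarrow> ennreal \<Rightarrow> ('m \<Rightarrow> complex) set \<Rightarrow> real"
  where "quotient_norm M p A = (INF f\<in>A. Lp_norm M p f)"

definition linear_isometry_to_cosets ::
  "'m measure \<Rightarrow> ennreal \<Rightarrow> ('y::complex_normed_vector \<Rightarrow> ('m \<Rightarrow> complex) set) \<Rightarrow> bool"
  where "linear_isometry_to_cosets M p J \<longleftrightarrow>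
    (\<forall>y. quotient_norm M p (J y) = norm y) \<and>
    (\<forall>y z. \<forall>f\<in>J y. \<forall>g\<in>J z. (\<lambda>x. f x + g x) \<in> J (y + z)) \<and>
    (\<forall>c y. \<forall>f\<in>J y. (\<lambda>x. c * f x) \<in> J (c *\<^sub>C y))"

text \<open>Being a subspace of a quotient, or a quotient of a subspace, is meant up to isometric isomorphism.\<close>

definition is_subspace_of_quotient_Lp :: "'y::complex_banach itself \<Rightarrow> 'm measure \<Rightarrow> ennreal \<Rightarrow> bool"
  where "is_subspace_of_quotient_Lp Y M p \<longleftrightarrow>
    (\<exists>N (J :: 'y \<Rightarrow> ('m \<Rightarrow> complex) set). Lp_closed_subspace M p N \<and>
      range J \<subseteq> Lp_cosets (Lp_functions M p) N \<and> linear_isometry_to_cosets M p J)"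

definition is_quotient_of_subspace_Lp :: "'y::complex_banach itself \<Rightarrow> 'm measure \<Rightarrow> ennreal \<Rightarrow> bool"
  where "is_quotient_of_subspace_Lp Y M p \<longleftrightarrow>
    (\<exists>Z N (J :: 'y \<Rightarrow> ('m \<Rightarrow> complex) set). Lp_closed_subspace M p Z \<and> Lp_closed_subspace M p N \<and>
      N \<subseteq> Z \<and> range J = Lp_cosets Z N \<and> linear_isometry_to_cosets M p J)"

end

(*
  Write a = |1/2 - 1/p|, so that 1/s = 1 + a. On a subquotient Y of L_p, determinants of the form
  det (f_i(x_j)), i, j < n, are at most n^(a n) prod |f_i| |x_j|: lift the x_j to L_p, approximate
  by simple functions, extend the functionals, and reduce Hadamard's inequality in l_2 to l_p by
  changing the density. For u = sum f_k (x) x_k with sum (|f_k| |x_k|)^s finite, this bound makes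
  the Fredholm determinant D(z) = lim det (1 - z (f_i(x_j))), i, j < N, an entire function of order
  one and minimal type: |D(z)| <= C exp (delta |z|) for every delta > 0. Splitting off invariant
  subspaces of generalized eigenspaces shows that the order of the zero of D at 1/lambda is the
  algebraic multiplicity of lambda, and Newton's identities D' = - D sum trace (u^(m+1)) z^m hold.

  If the odd traces vanish, Newton's identities force D to be even, so its zeros are symmetric.
  Conversely, if the zeros are symmetric, divide D by prod (1 - z/w) over the zeros in a disc of
  radius R. In the disc the quotient is exp h with Re h = O(1) + delta O(R), and the zeros
  contribute nothing to the odd power sums. So the odd trace of u^m is bounded by m times the
  m-th coefficient of h, which the Borel-Caratheodory inequality bounds by (O(1) + delta O(R)) / R^m.
  For m = 1 the result is O(delta), which is where minimal type is needed.
*)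

theory Submission
  imports Defs "Jordan_Normal_Form.Schur_Decomposition" "HOL-Complex_Analysis.Complex_Analysis"
begin

section \<open>Determinants over finite index sets\<close>

text \<open>The exponent 1/s = 1 + a makes two growth rates cancel. The numbers (|f_k| |x_k|)^s have
  a finite sum, so for every eps their elementary symmetric function of degree n is at most a
  polynomial in n times (e eps / n)^n. The power 1 + a of this absorbs the factor n^(a n) of the
  determinant bound and leaves delta^n / n!, hence minimal type. Since Y may fail the approximation
  property, the trace of a general tensor is not determined by its operator. So D is built from a
  representation of u, the traces enter as coefficients of its logarithmic derivative, and the
  operator enters only where zeros of D are compared with eigenvalues. The series of all eigenvalues
  is never summed: only finitely many zeros are divided out at a time. For p = 1 and p = infinity, a
  = 1/2, and the determinant bound is Hadamard's inequality for entries of modulus at most 1, the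
  case s = 2/3 going back to Grothendieck.\<close>

definition sdet :: "nat set \<Rightarrow> (nat \<Rightarrow> nat \<Rightarrow> complex) \<Rightarrow> complex"
  where "sdet S A = (\<Sum>\<pi> | \<pi> permutes S. of_int (sign \<pi>) * (\<Prod>i\<in>S. A i (\<pi> i)))"

abbreviation fmat :: "nat \<Rightarrow> (nat \<Rightarrow> nat \<Rightarrow> complex) \<Rightarrow> complex mat"
  where "fmat n A \<equiv> mat n n (\<lambda>(i, j). A i j)"

lemma sdet_cong:
  assumes "\<And>i j. i \<in> S \<Longrightarrow> j \<in> S \<Longrightarrow> A i j = B i j"
  shows "sdet S A = sdet S B"
  unfolding sdet_def
  by (intro sum.cong HOL.refl arg_cong2[where f = "(*)"] prod.cong) (auto simp: assms permutes_in_image)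

lemma sdet_eq_det: "sdet {..<n} A = Determinant.det (fmat n A)"
proof -
  have "Determinant.det (fmat n A) =
      (\<Sum>p | p permutes {0..<n}. signof p * (\<Prod>i = 0..<n. fmat n A $$ (i, p i)))"
    by (rule det_def') simp
  also have "\<dots> = sdet {..<n} A"
    unfolding sdet_def atLeast0LessThan
  proof (intro sum.cong HOL.refl)
    fix p assume "p \<in> {p. p permutes {..<n}}"
    then have "p permutes {..<n}" by simp
    then have "p i < n" if "i < n" for i using that permutes_in_image[of p "{..<n}" i] by simp
    then show "signof p * (\<Prod>i<n. fmat n A $$ (i, p i)) = of_int (sign p) * (\<Prod>i<n. A i (p i))"
      by (auto intro!: arg_cong2[where f = "(*)"] prod.cong)
  qed
  finally show ?thesis by simp
qed

text \<open>Multiplying out the rows, each choice of the set \<open>T\<close> of rows taken from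
  \<open>B\<close> leaves identity rows on \<open>S - T\<close>, and only permutations fixing
  \<open>S - T\<close> pointwise survive; what remains is a principal minor. Determinants are
  indexed by finite sets so that these minors need no renumbering.\<close>

lemma sdet_one_plus:
  assumes "finite S"
  shows "sdet S (\<lambda>i j. (if i = j then 1 else 0) + B i j) = (\<Sum>T\<in>Pow S. sdet T B)"
proof -
  let ?\<delta> = "\<lambda>i j. (if i = j then 1 else 0 :: complex)"
  have "sdet S (\<lambda>i j. ?\<delta> i j + B i j) =
      (\<Sum>\<pi> | \<pi> permutes S. \<Sum>T\<in>Pow S. of_int (sign \<pi>) * ((\<Prod>i\<in>T. B i (\<pi> i)) * (\<Prod>i\<in>S - T. ?\<delta> i (\<pi> i))))"
    unfolding sdet_def
    by (subst add.commute) (simp add: prod_add[OF assms] sum_distrib_left)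
  also have "\<dots> = (\<Sum>T\<in>Pow S. \<Sum>\<pi> | \<pi> permutes S. of_int (sign \<pi>) * ((\<Prod>i\<in>T. B i (\<pi> i)) * (\<Prod>i\<in>S - T. ?\<delta> i (\<pi> i))))"
    by (rule sum.swap)
  also have "\<dots> = (\<Sum>T\<in>Pow S. sdet T B)"
  proof (rule sum.cong[OF HOL.refl])
    fix T assume "T \<in> Pow S"
    then have T: "T \<subseteq> S" by simp
    have "(\<Sum>\<pi> | \<pi> permutes S. of_int (sign \<pi>) * ((\<Prod>i\<in>T. B i (\<pi> i)) * (\<Prod>i\<in>S - T. ?\<delta> i (\<pi> i))))
      = (\<Sum>\<pi> | \<pi> permutes T. of_int (sign \<pi>) * ((\<Prod>i\<in>T. B i (\<pi> i)) * (\<Prod>i\<in>S - T. ?\<delta> i (\<pi> i))))"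
    proof (rule sum.mono_neutral_right)
      show "finite {\<pi>. \<pi> permutes S}" using assms by (rule finite_permutations)
      show "{\<pi>. \<pi> permutes T} \<subseteq> {\<pi>. \<pi> permutes S}" using permutes_subset T by blast
      show "\<forall>\<pi>\<in>{\<pi>. \<pi> permutes S} - {\<pi>. \<pi> permutes T}.
          of_int (sign \<pi>) * ((\<Prod>i\<in>T. B i (\<pi> i)) * (\<Prod>i\<in>S - T. ?\<delta> i (\<pi> i))) = 0"
      proof
        fix \<pi> assume "\<pi> \<in> {\<pi>. \<pi> permutes S} - {\<pi>. \<pi> permutes T}"
        then have p: "\<pi> permutes S" "\<not> \<pi> permutes T" by auto
        have "\<exists>i\<in>S - T. \<pi> i \<noteq> i"
        proof (rule ccontr)
          assume "\<not> (\<exists>i\<in>S - T. \<pi> i \<noteq> i)"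
          then have "\<pi> permutes T" using permutes_superset[OF p(1)] by blast
          with p(2) show False by simp
        qed
        then have "(\<Prod>i\<in>S - T. ?\<delta> i (\<pi> i)) = 0"
          using assms by (intro prod_zero) (auto, metis DiffI)
        then show "of_int (sign \<pi>) * ((\<Prod>i\<in>T. B i (\<pi> i)) * (\<Prod>i\<in>S - T. ?\<delta> i (\<pi> i))) = 0" by simp
      qed
    qed
    also have "\<dots> = sdet T B"
      unfolding sdet_def
    proof (rule sum.cong[OF HOL.refl])
      fix \<pi> assume "\<pi> \<in> {\<pi>. \<pi> permutes T}"
      then have "(\<Prod>i\<in>S - T. ?\<delta> i (\<pi> i)) = 1"
        by (intro prod.neutral) (auto simp: permutes_not_in)
      then show "of_int (sign \<pi>) * ((\<Prod>i\<in>T. B i (\<pi> i)) * (\<Prod>i\<in>S - T. ?\<delta> i (\<pi> i))) =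
          of_int (sign \<pi>) * (\<Prod>i\<in>T. B i (\<pi> i))" by simp
    qed
    finally show "(\<Sum>\<pi> | \<pi> permutes S. of_int (sign \<pi>) * ((\<Prod>i\<in>T. B i (\<pi> i)) * (\<Prod>i\<in>S - T. ?\<delta> i (\<pi> i)))) = sdet T B" .
  qed
  finally show ?thesis .
qed

text \<open>Conjugation by \<open>h\<close> carries permutations of \<open>S\<close> to permutations
  of \<open>T\<close> and keeps the sign. This transports bounds known for initial segments of the
  naturals to arbitrary minors.\<close>

lemma sdet_reindex:
  assumes h: "bij_betw h S T" and S: "finite S"
  shows "sdet T A = sdet S (\<lambda>i j. A (h i) (h j))"
proof -
  have inj: "inj_on h S" and im: "h ` S = T" using h by (auto simp: bij_betw_def)
  have "sdet S (\<lambda>i j. A (h i) (h j)) =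
      (\<Sum>\<pi> | \<pi> permutes S. of_int (sign (map_permutation S h \<pi>)) * (\<Prod>i\<in>T. A i (map_permutation S h \<pi> i)))"
    unfolding sdet_def
  proof (rule sum.cong[OF HOL.refl])
    fix \<pi> assume "\<pi> \<in> {\<pi>. \<pi> permutes S}"
    then have p: "\<pi> permutes S" by simp
    have "sign (map_permutation S h \<pi>) = sign \<pi>"
      using sign_map_permutation[OF inj p S] .
    moreover have "(\<Prod>i\<in>T. A i (map_permutation S h \<pi> i)) = (\<Prod>i\<in>S. A (h i) (h (\<pi> i)))"
      unfolding im[symmetric]
      by (subst prod.reindex[OF inj]) (auto intro!: prod.cong simp: map_permutation_apply[OF inj])
    ultimately show "of_int (sign \<pi>) * (\<Prod>i\<in>S. A (h i) (h (\<pi> i))) =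
      of_int (sign (map_permutation S h \<pi>)) * (\<Prod>i\<in>T. A i (map_permutation S h \<pi> i))" by simp
  qed
  also have "\<dots> = sdet T A"
    unfolding sdet_def
  proof (rule sum.reindex_bij_witness[where i = "map_permutation T (inv_into S h)" and j = "map_permutation S h"])
    have h': "bij_betw (inv_into S h) T S" using h by (rule bij_betw_inv_into)
    fix \<pi> assume "\<pi> \<in> {\<pi>. \<pi> permutes S}"
    then have p: "\<pi> permutes S" by simp
    show "map_permutation S h \<pi> \<in> {\<pi>. \<pi> permutes T}"
      using map_permutation_permutes[OF h p] by simp
    show "map_permutation T (inv_into S h) (map_permutation S h \<pi>) = \<pi>"
      using map_permutation_compose_inv[OF h p] h by (auto simp: bij_betw_inv_into_left)
  next
    have h': "bij_betw (inv_into S h) T S" using h by (rule bij_betw_inv_into)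
    fix \<pi> assume "\<pi> \<in> {\<pi>. \<pi> permutes T}"
    then have p: "\<pi> permutes T" by simp
    show "map_permutation T (inv_into S h) \<pi> \<in> {\<pi>. \<pi> permutes S}"
      using map_permutation_permutes[OF h' p] by simp
    show "map_permutation S h (map_permutation T (inv_into S h) \<pi>) = \<pi>"
      using map_permutation_compose_inv[OF h' p] h by (auto simp: bij_betw_inv_into_right)
  qed simp
  finally show ?thesis by simp
qed

lemma sdet_mult:
  "sdet {..<n} (\<lambda>i j. \<Sum>k<n. A i k * B k j) = sdet {..<n} A * sdet {..<n} B"
proof -
  have "fmat n (\<lambda>i j. \<Sum>k<n. A i k * B k j) = fmat n A * fmat n B"
    by (rule eq_matI) (auto simp: scalar_prod_def atLeast0LessThan)
  then show ?thesis unfolding sdet_eq_det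
    by (simp add: det_mult[of _ n])
qed

lemma sdet_lower_triangular:
  assumes "\<And>i j. i < j \<Longrightarrow> j < n \<Longrightarrow> A i j = 0"
  shows "sdet {..<n} A = (\<Prod>i<n. A i i)"
proof -
  have "Determinant.det (fmat n A) = prod_list (diag_mat (fmat n A))"
    by (rule det_lower_triangular[of n]) (auto simp: assms)
  also have "\<dots> = (\<Prod>i<n. A i i)"
    by (auto simp: prod_list_diag_prod atLeast0LessThan)
  finally show ?thesis by (simp add: sdet_eq_det)
qed

lemma sdet_transpose: "sdet {..<n} (\<lambda>i j. A j i) = sdet {..<n} A"
proof -
  have "fmat n (\<lambda>i j. A j i) = transpose_mat (fmat n A)" by (rule eq_matI) auto
  then show ?thesis unfolding sdet_eq_det by (simp add: det_transpose[of _ n])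
qed

lemma sdet_cnj: "sdet S (\<lambda>i j. cnj (A i j)) = cnj (sdet S A)"
  unfolding sdet_def by (simp add: cnj_sum cnj_prod)

lemma sdet_nonzero:
  assumes "\<And>c. (\<And>i. i < n \<Longrightarrow> (\<Sum>j<n. A i j * c j) = 0) \<Longrightarrow> \<forall>i<n. c i = 0"
  shows "sdet {..<n} A \<noteq> 0"
proof
  assume "sdet {..<n} A = 0"
  then have "Determinant.det (fmat n A) = 0" by (simp add: sdet_eq_det)
  then obtain v where v: "v \<in> carrier_vec n" "v \<noteq> 0\<^sub>v n" "fmat n A *\<^sub>v v = 0\<^sub>v n"
    using det_0_iff_vec_prod_zero[of "fmat n A" n] by auto
  have "(\<Sum>j<n. A i j * vec_index v j) = 0" if "i < n" for i
  proof -
    have "(\<Sum>j<n. A i j * vec_index v j) = vec_index (fmat n A *\<^sub>v v) i"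
      using that v(1) by (auto simp: scalar_prod_def atLeast0LessThan)
    then show ?thesis using v(3) that by simp
  qed
  then have "\<forall>i<n. vec_index v i = 0" by (rule assms)
  then have "v = 0\<^sub>v n" using v(1) by (intro eq_vecI) auto
  with v(2) show False by simp
qed

section \<open>Powers, traces and eigenvalues of finite corners of a matrix\<close>

fun mpow :: "nat \<Rightarrow> (nat \<Rightarrow> nat \<Rightarrow> complex) \<Rightarrow> nat \<Rightarrow> nat \<Rightarrow> nat \<Rightarrow> complex"
  where "mpow n A 0 i j = (if i = j then 1 else 0)"
  | "mpow n A (Suc m) i j = (\<Sum>k<n. A i k * mpow n A m k j)"

definition mtrace :: "nat \<Rightarrow> (nat \<Rightarrow> nat \<Rightarrow> complex) \<Rightarrow> complex"
  where "mtrace n A = (\<Sum>i<n. A i i)"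

lemma pow_mat_mult_comm:
  fixes A :: "complex mat"
  assumes A: "A \<in> carrier_mat n n"
  shows "A * A ^\<^sub>m m = A ^\<^sub>m Suc m"
proof (induction m)
  case (Suc m)
  have "A * A ^\<^sub>m Suc m = (A * A ^\<^sub>m m) * A"
    using A by (simp add: assoc_mult_mat[of A n n "A ^\<^sub>m m" n A n])
  then show ?case unfolding Suc by simp
qed (use A in simp)

lemma fmat_mpow: "fmat n (mpow n A m) = fmat n A ^\<^sub>m m"
proof (induction m)
  case 0
  show ?case by (rule eq_matI) auto
next
  case (Suc m)
  have "fmat n (mpow n A (Suc m)) = fmat n A * fmat n (mpow n A m)"
    by (rule eq_matI) (auto simp: scalar_prod_def atLeast0LessThan)
  also have "\<dots> = fmat n A ^\<^sub>m Suc m"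
    unfolding Suc by (rule pow_mat_mult_comm[of _ n]) simp
  finally show ?case .
qed

lemma mat_trace_comm:
  fixes A B :: "complex mat"
  assumes "A \<in> carrier_mat n n" "B \<in> carrier_mat n n"
  shows "(\<Sum>i<n. (A * B) $$ (i, i)) = (\<Sum>i<n. (B * A) $$ (i, i))"
proof -
  have "(\<Sum>i<n. (A * B) $$ (i, i)) = (\<Sum>i<n. \<Sum>k<n. A $$ (i, k) * B $$ (k, i))"
    using assms by (auto simp: scalar_prod_def atLeast0LessThan intro!: sum.cong)
  also have "\<dots> = (\<Sum>k<n. \<Sum>i<n. B $$ (k, i) * A $$ (i, k))"
    by (subst sum.swap) (simp add: mult.commute)
  also have "\<dots> = (\<Sum>i<n. (B * A) $$ (i, i))"
    using assms by (auto simp: scalar_prod_def atLeast0LessThan intro!: sum.cong)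
  finally show ?thesis .
qed

lemma prod_list_linear_eq:
  "(\<Prod>e\<leftarrow>es. 1 - z * e) = (\<Prod>i<length es. 1 - z * es ! i :: complex)"
  by (induction es rule: rev_induct) (auto simp: nth_append intro!: prod.cong)

lemma power_upper_triangular:
  fixes B :: "complex mat"
  assumes B: "B \<in> carrier_mat n n" "upper_triangular B"
  shows "upper_triangular (B ^\<^sub>m m) \<and> (\<forall>i<n. (B ^\<^sub>m m) $$ (i, i) = (B $$ (i, i)) ^ m)"
proof (induction m)
  case 0
  then show ?case using B by auto
next
  case (Suc m)
  have C: "B ^\<^sub>m m \<in> carrier_mat n n" using B by auto
  have low: "B $$ (i, j) = 0" "(B ^\<^sub>m m) $$ (i, j) = 0" if "j < i" "i < n" for i j
    using that B C Suc by auto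
  have entry: "(B ^\<^sub>m Suc m) $$ (i, j) = (\<Sum>k<n. (B ^\<^sub>m m) $$ (i, k) * B $$ (k, j))" if "i < n" "j < n" for i j
    using that B C by (auto simp: scalar_prod_def atLeast0LessThan)
  have "(B ^\<^sub>m Suc m) $$ (i, j) = 0" if "j < i" "i < n" for i j
  proof -
    have "(B ^\<^sub>m m) $$ (i, k) * B $$ (k, j) = 0" if "k < n" for k
      using low[of k i] low[of j k] that \<open>j < i\<close> \<open>i < n\<close> by (cases "k < i") auto
    then show ?thesis unfolding entry[OF \<open>i < n\<close> less_trans[OF that]] by (auto intro!: sum.neutral)
  qed
  moreover have "(B ^\<^sub>m Suc m) $$ (i, i) = (B $$ (i, i)) ^ Suc m" if "i < n" for i
  proof -
    have "(B ^\<^sub>m m) $$ (i, k) * B $$ (k, i) = 0" if "k \<in> {..<n} - {i}" for k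
      using low[of k i] low[of i k] that \<open>i < n\<close> by (cases "k < i") auto
    then have "(\<Sum>k<n. (B ^\<^sub>m m) $$ (i, k) * B $$ (k, i)) = (B ^\<^sub>m m) $$ (i, i) * B $$ (i, i)"
      using that by (subst sum.remove[of _ i]) (force intro!: sum.neutral)+
    then show ?thesis unfolding entry[OF that that] using that Suc by simp
  qed
  ultimately show ?case using B by auto
qed

text \<open>Schur triangularization provides one list, with multiplicities, that serves at once for
  the determinant, for all traces of powers and for eigenvectors. The shared list is what links
  traces to determinants.\<close>

lemma eigenvalues_exist:
  fixes A :: "nat \<Rightarrow> nat \<Rightarrow> complex"
  obtains es where "length es = n"
    and "\<And>z. sdet {..<n} (\<lambda>i j. (if i = j then 1 else 0) + - z * A i j) = (\<Prod>e\<leftarrow>es. 1 - z * e)"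
    and "\<And>m. mtrace n (mpow n A m) = (\<Sum>e\<leftarrow>es. e ^ m)"
    and "\<And>e. e \<in> set es \<Longrightarrow> \<exists>c. (\<exists>i<n. c i \<noteq> 0) \<and> (\<forall>i<n. (\<Sum>j<n. A i j * c j) = e * c i)"
proof -
  let ?A = "fmat n A"
  have A: "?A \<in> carrier_mat n n" by simp
  obtain es where es: "char_poly ?A = (\<Prod>a\<leftarrow>es. [:- a, 1:])" "length es = n"
    using char_poly_factorized[OF A] by auto
  obtain B P Q where schur: "schur_decomposition ?A es = (B, P, Q)" by (cases "schur_decomposition ?A es") auto
  from schur_decomposition[OF A es(1) schur] have sim: "similar_mat_wit ?A B P Q"
    and up: "upper_triangular B" and diag: "diag_mat B = es" by auto
  from similar_mat_witD2[OF A sim] have PQ: "P * Q = 1\<^sub>m n" "Q * P = 1\<^sub>m n" "?A = P * B * Q"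
    and car: "B \<in> carrier_mat n n" "P \<in> carrier_mat n n" "Q \<in> carrier_mat n n" by auto
  have B_diag: "B $$ (i, i) = es ! i" if "i < n" for i
    using that car unfolding diag[symmetric] by (simp add: diag_mat_def)
  have "sdet {..<n} (\<lambda>i j. (if i = j then 1 else 0) + - z * A i j) = (\<Prod>e\<leftarrow>es. 1 - z * e)" for z
  proof -
    let ?U = "1\<^sub>m n + (- z) \<cdot>\<^sub>m B"
    have "fmat n (\<lambda>i j. (if i = j then 1 else 0) + - z * A i j) = 1\<^sub>m n + (- z) \<cdot>\<^sub>m ?A"
      by (rule eq_matI) auto
    also have "\<dots> = P * ?U * Q"
    proof -
      have "P * ?U * Q = (P * 1\<^sub>m n + P * ((- z) \<cdot>\<^sub>m B)) * Q"
        using car by (subst mult_add_distrib_mat[of P n n]) auto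
      also have "\<dots> = P * Q + P * ((- z) \<cdot>\<^sub>m B) * Q"
        using car by (subst add_mult_distrib_mat[of _ n n]) auto
      also have "P * ((- z) \<cdot>\<^sub>m B) * Q = (- z) \<cdot>\<^sub>m (P * B * Q)"
        using car by (simp add: mult_smult_distrib[of P n n] mult_smult_assoc_mat[of _ n n] del: assoc_mult_mat)
      finally show ?thesis by (simp add: PQ)
    qed
    finally have eq: "fmat n (\<lambda>i j. (if i = j then 1 else 0) + - z * A i j) = P * ?U * Q" .
    have "sdet {..<n} (\<lambda>i j. (if i = j then 1 else 0) + - z * A i j) =
        Determinant.det P * Determinant.det ?U * Determinant.det Q"
      unfolding sdet_eq_det eq using car by (simp add: det_mult[of _ n])
    also have "\<dots> = Determinant.det ?U * Determinant.det (P * Q)"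
      using car by (subst det_mult[of P n Q]) auto
    also have "\<dots> = Determinant.det ?U" by (simp add: PQ)
    also have "\<dots> = prod_list (diag_mat ?U)"
      by (rule det_upper_triangular[of _ n], rule upper_triangularI)
         (use car upper_triangularD[OF up] in auto)
    also have "\<dots> = (\<Prod>e\<leftarrow>es. 1 - z * e)"
      unfolding prod_list_linear_eq using car
      by (auto simp: prod_list_diag_prod atLeast0LessThan es B_diag intro!: prod.cong)
    finally show ?thesis .
  qed
  moreover have "mtrace n (mpow n A m) = (\<Sum>e\<leftarrow>es. e ^ m)" for m
  proof -
    have "?A ^\<^sub>m m = P * B ^\<^sub>m m * Q"
      using similar_mat_wit_pow[OF sim, of m] unfolding similar_mat_wit_def by (auto simp: Let_def)
    then have "mtrace n (mpow n A m) = (\<Sum>i<n. ((P * B ^\<^sub>m m) * Q) $$ (i, i))"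
      unfolding mtrace_def using fmat_mpow[of n A m] by (metis (no_types, lifting) index_mat(1) lessThan_iff old.prod.case sum.cong)
    also have "\<dots> = (\<Sum>i<n. (Q * (P * B ^\<^sub>m m)) $$ (i, i))"
      by (rule mat_trace_comm) (use car in auto)
    also have "Q * (P * B ^\<^sub>m m) = B ^\<^sub>m m"
      using car PQ by (subst assoc_mult_mat[symmetric, of Q n n P n]) auto
    also have "(\<Sum>i<n. (B ^\<^sub>m m) $$ (i, i)) = (\<Sum>i<n. es ! i ^ m)"
      using power_upper_triangular[OF car(1) up, of m] by (auto simp: B_diag)
    also have "\<dots> = (\<Sum>e\<leftarrow>es. e ^ m)"
      by (simp add: sum_list_sum_nth es atLeast0LessThan)
    finally show ?thesis .
  qed
  moreover have "\<exists>c. (\<exists>i<n. c i \<noteq> 0) \<and> (\<forall>i<n. (\<Sum>j<n. A i j * c j) = e * c i)" if "e \<in> set es" for e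
  proof -
    have "poly (char_poly ?A) e = 0"
      using that unfolding es(1) by (induction es) auto
    then have "Char_Poly.eigenvalue ?A e"
      using eigenvalue_root_char_poly[OF A] by simp
    then obtain v where v: "v \<in> carrier_vec n" "v \<noteq> 0\<^sub>v n" "?A *\<^sub>v v = e \<cdot>\<^sub>v v"
      unfolding Char_Poly.eigenvalue_def eigenvector_def by auto
    have "\<exists>i<n. vec_index v i \<noteq> 0"
    proof (rule ccontr)
      assume "\<not> (\<exists>i<n. vec_index v i \<noteq> 0)"
      then have "v = 0\<^sub>v n" using v(1) by (intro eq_vecI) auto
      with v(2) show False by simp
    qed
    moreover have "(\<Sum>j<n. A i j * vec_index v j) = e * vec_index v i" if "i < n" for i
    proof -
      have "(\<Sum>j<n. A i j * vec_index v j) = vec_index (?A *\<^sub>v v) i"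
        using that v(1) by (auto simp: scalar_prod_def atLeast0LessThan)
      then show ?thesis using v that by simp
    qed
    ultimately show ?thesis by (intro exI[of _ "vec_index v"]) blast
  qed
  ultimately show thesis using that es(2) by blast
qed

section \<open>Hadamard's inequality\<close>

text \<open>Vanishing vectors \<open>e i\<close> are allowed, so that linearly dependent families are covered.\<close>

definition QR_factorization ::
  "nat set \<Rightarrow> nat \<Rightarrow> (nat \<Rightarrow> nat \<Rightarrow> complex) \<Rightarrow> (nat \<Rightarrow> nat \<Rightarrow> complex) \<Rightarrow> (nat \<Rightarrow> nat \<Rightarrow> complex) \<Rightarrow> bool"
  where "QR_factorization K n x e R \<longleftrightarrow>
    (\<forall>i<n. \<forall>j<n. i \<noteq> j \<longrightarrow> (\<Sum>k\<in>K. e i k * cnj (e j k)) = 0) \<and>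
    (\<forall>i<n. (\<Sum>k\<in>K. e i k * cnj (e i k)) \<in> {0, 1}) \<and>
    (\<forall>j<n. \<forall>k\<in>K. x j k = (\<Sum>l<n. R j l * e l k)) \<and>
    (\<forall>j l. j < l \<longrightarrow> R j l = 0) \<and>
    (\<forall>j<n. (cmod (R j j))\<^sup>2 \<le> (\<Sum>k\<in>K. (cmod (x j k))\<^sup>2))"

lemma QR_factorizationD:
  assumes "QR_factorization K n x e R"
  shows "i < n \<Longrightarrow> j < n \<Longrightarrow> i \<noteq> j \<Longrightarrow> (\<Sum>k\<in>K. e i k * cnj (e j k)) = 0"
    and "i < n \<Longrightarrow> (\<Sum>k\<in>K. e i k * cnj (e i k)) \<in> {0, 1}"
    and "j < n \<Longrightarrow> k \<in> K \<Longrightarrow> x j k = (\<Sum>l<n. R j l * e l k)"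
    and "j < l \<Longrightarrow> R j l = 0"
    and "j < n \<Longrightarrow> (cmod (R j j))\<^sup>2 \<le> (\<Sum>k\<in>K. (cmod (x j k))\<^sup>2)"
  using assms unfolding QR_factorization_def by blast+

text \<open>Gram-Schmidt, adding one vector at a time. The new diagonal entry of \<open>R\<close> is
  the length of the component of \<open>x n\<close> orthogonal to the earlier \<open>e l\<close>,
  which by Pythagoras is at most the length of \<open>x n\<close>.\<close>

lemma QR_factorization_exists:
  fixes x :: "nat \<Rightarrow> nat \<Rightarrow> complex"
  assumes K: "finite K"
  shows "\<exists>e R. QR_factorization K n x e R"
proof (induction n)
  case 0
  show ?case by (intro exI[of _ "\<lambda>_ _. 0"]) (auto simp: QR_factorization_def)
next
  case (Suc n)
  define ip where "ip u v = (\<Sum>k\<in>K. u k * cnj (v k))" for u v :: "nat \<Rightarrow> complex"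
  from Suc obtain e R where qr: "QR_factorization K n x e R" by blast
  note orth = QR_factorizationD(1)[OF qr, folded ip_def]
    and unit = QR_factorizationD(2)[OF qr, folded ip_def]
    and x = QR_factorizationD(3)[OF qr]
    and tri = QR_factorizationD(4)[OF qr]
    and nrm = QR_factorizationD(5)[OF qr]
  have ip_self: "ip u u = of_real (\<Sum>k\<in>K. (cmod (u k))\<^sup>2)" for u
    by (simp add: ip_def complex_mult_cnj cmod_def of_real_sum)
  have ip_zero: "u k = 0" if "ip u u = 0" "k \<in> K" for u k
  proof -
    have "(\<Sum>k\<in>K. (cmod (u k))\<^sup>2) = 0" using that(1) unfolding ip_self by (simp only: of_real_eq_0_iff)
    then show ?thesis using K that(2) by (simp add: sum_nonneg_eq_0_iff)
  qed
  have ip_cnj: "ip u v = cnj (ip v u)" for u v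
    by (simp add: ip_def mult.commute)
  define c where "c l = ip (x n) (e l)" for l
  define y where "y k = x n k - (\<Sum>l<n. c l * e l k)" for k
  have ip_sum: "ip (\<lambda>k. \<Sum>l<n. c l * e l k) v = (\<Sum>l<n. c l * ip (e l) v)" for v
    unfolding ip_def sum_distrib_left sum_distrib_right
    by (subst sum.swap) (simp add: mult.assoc)
  have ip_y: "ip y (e j) = 0" if j: "j < n" for j
  proof -
    have "ip y (e j) = ip (x n) (e j) - ip (\<lambda>k. \<Sum>l<n. c l * e l k) (e j)"
      unfolding ip_def y_def by (simp add: left_diff_distrib sum_subtractf)
    also have "ip (\<lambda>k. \<Sum>l<n. c l * e l k) (e j) = c j * ip (e j) (e j)"
      unfolding ip_sum using j orth by (subst sum.remove[of _ j]) auto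
    \<comment> \<open>A vanishing \<open>e j\<close> has \<open>c j = 0\<close>, so the expansion
      coefficient is right in the degenerate case as well.\<close>
    also have "\<dots> = c j"
    proof (cases "ip (e j) (e j) = 0")
      case True
      then have "c j = 0" unfolding c_def ip_def using ip_zero[OF True] by (simp add: sum.neutral)
      then show ?thesis by simp
    next
      case False
      then show ?thesis using unit[OF j] by simp
    qed
    finally show ?thesis by (simp add: c_def)
  qed
  define N where "N = (\<Sum>k\<in>K. (cmod (y k))\<^sup>2)"
  have N: "ip y y = of_real N" by (simp add: ip_self N_def)
  have N0: "N \<ge> 0" by (simp add: N_def sum_nonneg)
  have N_le: "N \<le> (\<Sum>k\<in>K. (cmod (x n k))\<^sup>2)"
  proof -
    let ?w = "\<lambda>k. \<Sum>l<n. c l * e l k"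
    have xy: "x n k = y k + ?w k" for k by (simp add: y_def)
    have wy: "ip ?w y = 0" unfolding ip_sum using ip_y ip_cnj[of _ y] by (auto intro!: sum.neutral)
    have "ip (x n) (x n) = ip y y + ip y ?w + ip ?w y + ip ?w ?w"
      unfolding ip_def xy by (simp add: algebra_simps sum.distrib)
    also have "\<dots> = ip y y + ip ?w ?w" using wy ip_cnj[of y ?w] by simp
    finally have "complex_of_real (\<Sum>k\<in>K. (cmod (x n k))\<^sup>2) = of_real (N + (\<Sum>k\<in>K. (cmod (?w k))\<^sup>2))"
      unfolding ip_self N_def by (simp only: of_real_add)
    then have "(\<Sum>k\<in>K. (cmod (x n k))\<^sup>2) = N + (\<Sum>k\<in>K. (cmod (?w k))\<^sup>2)" by (simp only: of_real_eq_iff)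
    then show ?thesis by (simp add: sum_nonneg)
  qed
  \<comment> \<open>For \<open>N = 0\<close> division by zero makes the new vector 0 and its Gram
    entry 0; the residual \<open>y\<close> then vanishes on \<open>K\<close>, so the factorization
    persists.\<close>
  define e' where "e' = e(n := (\<lambda>k. y k / sqrt N))"
  define R' where "R' = R(n := (\<lambda>l. if l < n then c l else if l = n then of_real (sqrt N) else 0))"
  have sq: "complex_of_real (sqrt N) * of_real (sqrt N) = of_real N"
    using N0 by (metis of_real_mult real_sqrt_mult_self abs_of_nonneg)
  have e'n: "ip (e' n) (e' n) \<in> {0, 1}"
  proof -
    have "ip (e' n) (e' n) = ip y y / of_real N"
      by (simp add: e'_def ip_def sum_divide_distrib sq)
    then show ?thesis unfolding N by (cases "N = 0") auto
  qed
  have ip_ye: "ip (e' n) (e j) = 0" "ip (e j) (e' n) = 0" if "j < n" for j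
  proof -
    have "ip (e' n) (e j) = ip y (e j) / of_real (sqrt N)"
      by (simp add: e'_def ip_def sum_divide_distrib)
    then show "ip (e' n) (e j) = 0" using ip_y[OF that] by simp
    then show "ip (e j) (e' n) = 0" using ip_cnj[of "e j"] by simp
  qed
  have 1: "\<forall>i<Suc n. \<forall>j<Suc n. i \<noteq> j \<longrightarrow> ip (e' i) (e' j) = 0"
    using orth ip_ye by (auto simp: less_Suc_eq) (auto simp: e'_def)
  have 2: "\<forall>i<Suc n. ip (e' i) (e' i) \<in> {0, 1}"
    using unit e'n by (auto simp: less_Suc_eq) (auto simp: e'_def)
  have 3: "\<forall>j<Suc n. \<forall>k\<in>K. x j k = (\<Sum>l<Suc n. R' j l * e' l k)"
  proof (intro allI impI ballI)
    fix j k assume j: "j < Suc n" and k: "k \<in> K"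
    show "x j k = (\<Sum>l<Suc n. R' j l * e' l k)"
    proof (cases "j = n")
      case True
      have "of_real (sqrt N) * (y k / of_real (sqrt N)) = y k"
      proof (cases "N = 0")
        case True
        then show ?thesis using ip_zero[OF _ k, of y] N by simp
      qed simp
      then show ?thesis using True by (simp add: R'_def e'_def y_def)
    next
      case False
      then show ?thesis using j x[of j k] k tri[of j n] by (simp add: R'_def e'_def)
    qed
  qed
  have 4: "\<forall>j l. j < l \<longrightarrow> R' j l = 0" using tri by (auto simp: R'_def)
  have 5: "\<forall>j<Suc n. (cmod (R' j j))\<^sup>2 \<le> (\<Sum>k\<in>K. (cmod (x j k))\<^sup>2)"
    using nrm N_le N0 by (auto simp: less_Suc_eq R'_def)
  show ?case
    using 1 2 3 4 5 unfolding ip_def QR_factorization_def by blast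
qed

text \<open>Factor \<open>B\<close> as \<open>R\<close> times \<open>e\<close>: the determinant of
  \<open>R\<close> is the product of its diagonal, and the squared modulus of the determinant of
  \<open>e\<close> is that of its Gram matrix, a diagonal matrix of zeros and ones.\<close>

lemma Hadamard_square:
  "cmod (sdet {..<n} B) \<le> (\<Prod>i<n. sqrt (\<Sum>k<n. (cmod (B i k))\<^sup>2))"
proof -
  obtain e R where qr: "QR_factorization {..<n} n B e R"
    using QR_factorization_exists[of "{..<n}"] by blast
  note orth = QR_factorizationD(1)[OF qr] and unit = QR_factorizationD(2)[OF qr]
    and nrm = QR_factorizationD(5)[OF qr]
  have x: "B j k = (\<Sum>l<n. R j l * e l k)" if "j < n" "k < n" for j k
    using QR_factorizationD(3)[OF qr] that by simp
  have detR: "sdet {..<n} R = (\<Prod>i<n. R i i)"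
    by (rule sdet_lower_triangular) (rule QR_factorizationD(4)[OF qr])
  have "sdet {..<n} B = sdet {..<n} R * sdet {..<n} e"
    unfolding sdet_mult[symmetric] by (rule sdet_cong) (simp add: x)
  moreover have "cmod (sdet {..<n} R) \<le> (\<Prod>i<n. sqrt (\<Sum>k<n. (cmod (B i k))\<^sup>2))"
    unfolding detR prod_norm[symmetric]
    by (intro prod_mono) (use nrm in \<open>auto intro!: real_le_rsqrt\<close>)
  moreover have "cmod (sdet {..<n} e) \<le> 1"
  proof -
    have "sdet {..<n} e * cnj (sdet {..<n} e) = sdet {..<n} (\<lambda>i j. \<Sum>k<n. e i k * cnj (e j k))"
      unfolding sdet_cnj[symmetric] sdet_transpose[of n "\<lambda>i j. cnj (e i j)", symmetric]
      by (rule sdet_mult[symmetric])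
    also have "\<dots> = (\<Prod>i<n. \<Sum>k<n. e i k * cnj (e i k))"
    proof -
      have "sdet {..<n} (\<lambda>i j. \<Sum>k<n. e i k * cnj (e j k)) =
          sdet {..<n} (\<lambda>i j. if i = j then \<Sum>k<n. e i k * cnj (e i k) else 0)"
        by (rule sdet_cong) (use orth in auto)
      also have "\<dots> = (\<Prod>i<n. \<Sum>k<n. e i k * cnj (e i k))"
        by (subst sdet_lower_triangular) auto
      finally show ?thesis .
    qed
    finally have eq: "sdet {..<n} e * cnj (sdet {..<n} e) = (\<Prod>i<n. \<Sum>k<n. e i k * cnj (e i k))" .
    have "(cmod (sdet {..<n} e))\<^sup>2 = cmod (sdet {..<n} e * cnj (sdet {..<n} e))"
      by (simp add: power2_eq_square norm_mult)
    also have "\<dots> = cmod (\<Prod>i<n. \<Sum>k<n. e i k * cnj (e i k))" unfolding eq ..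
    also have "\<dots> \<le> 1"
      unfolding prod_norm[symmetric] by (intro prod_le_1) (use unit in force)
    finally show ?thesis using abs_square_le_1[of "cmod (sdet {..<n} e)"] by simp
  qed
  ultimately show ?thesis
    using mult_mono[of "cmod (sdet {..<n} R)" _ "cmod (sdet {..<n} e)" 1]
    by (simp add: norm_mult prod_nonneg sum_nonneg)
qed

text \<open>The squared length of \<open>w\<close>, the difference between the conjugate of
  \<open>y\<close> and its projection, is nonnegative. The conjugate appears because
  \<open>c l\<close> pairs \<open>y\<close> with \<open>e l\<close> bilinearly.\<close>

lemma Bessel:
  fixes e :: "nat \<Rightarrow> nat \<Rightarrow> complex"
  assumes K: "finite K"
    and orth: "\<And>i j. i < n \<Longrightarrow> j < n \<Longrightarrow> i \<noteq> j \<Longrightarrow> (\<Sum>k\<in>K. e i k * cnj (e j k)) = 0"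
    and unit: "\<And>i. i < n \<Longrightarrow> (\<Sum>k\<in>K. e i k * cnj (e i k)) \<in> {0, 1}"
  shows "(\<Sum>l<n. (cmod (\<Sum>k\<in>K. y k * e l k))\<^sup>2) \<le> (\<Sum>k\<in>K. (cmod (y k))\<^sup>2)"
proof -
  define c where "c l = (\<Sum>k\<in>K. y k * e l k)" for l
  define w where "w k = cnj (y k) - (\<Sum>l<n. cnj (c l) * e l k)" for k
  have unit': "c l * (\<Sum>k\<in>K. e l k * cnj (e l k)) = c l" if l: "l < n" for l
  proof (cases "(\<Sum>k\<in>K. e l k * cnj (e l k)) = 0")
    case True
    have "(\<Sum>k\<in>K. e l k * cnj (e l k)) = of_real (\<Sum>k\<in>K. (cmod (e l k))\<^sup>2)"
      by (simp add: complex_mult_cnj cmod_def)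
    then have "(\<Sum>k\<in>K. (cmod (e l k))\<^sup>2) = 0" using True by (metis of_real_eq_0_iff)
    then have "e l k = 0" if "k \<in> K" for k using K that by (simp add: sum_nonneg_eq_0_iff)
    then show ?thesis by (simp add: c_def sum.neutral)
  next
    case False
    then show ?thesis using unit[OF l] by simp
  qed
  have cross: "(\<Sum>k\<in>K. (\<Sum>l<n. cnj (c l) * e l k) * cnj (\<Sum>l<n. cnj (c l) * e l k)) = (\<Sum>l<n. cnj (c l) * c l)"
  proof -
    have "(\<Sum>k\<in>K. (\<Sum>l<n. cnj (c l) * e l k) * cnj (\<Sum>l<n. cnj (c l) * e l k)) =
        (\<Sum>k\<in>K. \<Sum>l<n. \<Sum>m<n. cnj (c l) * (c m * (e l k * cnj (e m k))))"
      unfolding cnj_sum sum_product by (intro sum.cong HOL.refl) (simp add: mult_ac)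
    also have "\<dots> = (\<Sum>l<n. \<Sum>m<n. \<Sum>k\<in>K. cnj (c l) * (c m * (e l k * cnj (e m k))))"
      by (subst sum.swap, rule sum.cong[OF HOL.refl], rule sum.swap)
    also have "\<dots> = (\<Sum>l<n. \<Sum>m<n. cnj (c l) * (c m * (\<Sum>k\<in>K. e l k * cnj (e m k))))"
      by (simp add: sum_distrib_left)
    also have "\<dots> = (\<Sum>l<n. cnj (c l) * c l)"
    proof (rule sum.cong[OF HOL.refl])
      fix l assume "l \<in> {..<n}"
      then have l: "l < n" by simp
      have "(\<Sum>m<n. cnj (c l) * (c m * (\<Sum>k\<in>K. e l k * cnj (e m k)))) =
          cnj (c l) * (c l * (\<Sum>k\<in>K. e l k * cnj (e l k)))"
        using l orth[OF l] by (subst sum.remove[of _ l]) (auto intro!: sum.neutral)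
      then show "(\<Sum>m<n. cnj (c l) * (c m * (\<Sum>k\<in>K. e l k * cnj (e m k)))) = cnj (c l) * c l"
        using unit'[OF l] by simp
    qed
    finally show ?thesis .
  qed
  have "of_real (\<Sum>k\<in>K. (cmod (w k))\<^sup>2) = (\<Sum>k\<in>K. w k * cnj (w k))"
    by (simp add: complex_mult_cnj cmod_def)
  also have "\<dots> = (\<Sum>k\<in>K. cnj (y k) * y k) - (\<Sum>k\<in>K. (\<Sum>l<n. cnj (c l) * e l k) * y k)
      - (\<Sum>k\<in>K. cnj (y k) * cnj (\<Sum>l<n. cnj (c l) * e l k))
      + (\<Sum>k\<in>K. (\<Sum>l<n. cnj (c l) * e l k) * cnj (\<Sum>l<n. cnj (c l) * e l k))"
    unfolding w_def complex_cnj_diff complex_cnj_cnj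
    by (simp add: left_diff_distrib right_diff_distrib sum.distrib sum_subtractf del: cnj_sum)
  also have "(\<Sum>k\<in>K. (\<Sum>l<n. cnj (c l) * e l k) * y k) = (\<Sum>l<n. cnj (c l) * c l)"
  proof -
    have "(\<Sum>k\<in>K. (\<Sum>l<n. cnj (c l) * e l k) * y k) = (\<Sum>l<n. \<Sum>k\<in>K. cnj (c l) * (y k * e l k))"
      unfolding sum_distrib_right by (subst sum.swap) (simp only: mult_ac)
    then show ?thesis unfolding sum_distrib_left[symmetric] c_def[symmetric] .
  qed
  also have "(\<Sum>k\<in>K. cnj (y k) * cnj (\<Sum>l<n. cnj (c l) * e l k)) = (\<Sum>l<n. cnj (c l) * c l)"
  proof -
    have cc: "cnj (c l) = (\<Sum>k\<in>K. cnj (y k) * cnj (e l k))" for l by (simp add: c_def)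
    have "(\<Sum>k\<in>K. cnj (y k) * cnj (\<Sum>l<n. cnj (c l) * e l k)) =
        (\<Sum>l<n. \<Sum>k\<in>K. (cnj (y k) * cnj (e l k)) * c l)"
      unfolding cnj_sum sum_distrib_left complex_cnj_mult complex_cnj_cnj
      by (subst sum.swap) (simp only: mult_ac)
    then show ?thesis unfolding sum_distrib_right[symmetric] cc[symmetric] .
  qed
  also note cross
  finally have "of_real (\<Sum>k\<in>K. (cmod (w k))\<^sup>2) = (\<Sum>k\<in>K. cnj (y k) * y k) - (\<Sum>l<n. cnj (c l) * c l)" by simp
  also have "\<dots> = of_real ((\<Sum>k\<in>K. (cmod (y k))\<^sup>2) - (\<Sum>l<n. (cmod (c l))\<^sup>2))"
    by (simp add: complex_mult_cnj cmod_def mult.commute[of "cnj _"])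
  finally have "(\<Sum>k\<in>K. (cmod (w k))\<^sup>2) = (\<Sum>k\<in>K. (cmod (y k))\<^sup>2) - (\<Sum>l<n. (cmod (c l))\<^sup>2)"
    by (simp only: of_real_eq_iff)
  moreover have "(\<Sum>k\<in>K. (cmod (w k))\<^sup>2) \<ge> 0" by (simp add: sum_nonneg)
  ultimately show ?thesis by (simp add: c_def)
qed

text \<open>A form of Cauchy-Binet type, where the size of \<open>K\<close> is unrelated to
  \<open>n\<close>. Orthonormalizing the \<open>x j\<close> turns the matrix into \<open>C\<close>
  times the transpose of \<open>R\<close>, and Bessel's inequality keeps the rows of
  \<open>C\<close> no longer than those of \<open>y\<close>.\<close>

theorem Hadamard_inequality:
  fixes y x :: "nat \<Rightarrow> nat \<Rightarrow> complex"
  assumes K: "finite K"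
  shows "cmod (sdet {..<n} (\<lambda>i j. \<Sum>k\<in>K. y i k * x j k)) \<le>
    (\<Prod>i<n. sqrt (\<Sum>k\<in>K. (cmod (y i k))\<^sup>2)) * (\<Prod>i<n. sqrt (\<Sum>k\<in>K. (cmod (x i k))\<^sup>2))"
proof -
  obtain e R where qr: "QR_factorization K n x e R"
    using QR_factorization_exists[OF K] by blast
  note orth = QR_factorizationD(1)[OF qr] and unit = QR_factorizationD(2)[OF qr]
    and x = QR_factorizationD(3)[OF qr] and nrm = QR_factorizationD(5)[OF qr]
  have detR: "sdet {..<n} R = (\<Prod>i<n. R i i)"
    by (rule sdet_lower_triangular) (rule QR_factorizationD(4)[OF qr])
  define C where "C i l = (\<Sum>k\<in>K. y i k * e l k)" for i l
  have "sdet {..<n} (\<lambda>i j. \<Sum>k\<in>K. y i k * x j k) = sdet {..<n} (\<lambda>i j. \<Sum>l<n. C i l * R j l)"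
  proof (rule sdet_cong)
    fix i j assume "i \<in> {..<n}" "j \<in> {..<n}"
    then have "(\<Sum>k\<in>K. y i k * x j k) = (\<Sum>k\<in>K. \<Sum>l<n. y i k * (R j l * e l k))"
      by (simp add: x sum_distrib_left)
    also have "\<dots> = (\<Sum>l<n. C i l * R j l)"
      unfolding C_def sum_distrib_right by (subst sum.swap) (simp add: mult_ac)
    finally show "(\<Sum>k\<in>K. y i k * x j k) = (\<Sum>l<n. C i l * R j l)" .
  qed
  also have "\<dots> = sdet {..<n} C * sdet {..<n} R"
    unfolding sdet_mult sdet_transpose[of n R] by (rule HOL.refl)
  finally have eq: "sdet {..<n} (\<lambda>i j. \<Sum>k\<in>K. y i k * x j k) = sdet {..<n} C * sdet {..<n} R" .
  have "cmod (sdet {..<n} R) \<le> (\<Prod>i<n. sqrt (\<Sum>k\<in>K. (cmod (x i k))\<^sup>2))"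
    unfolding detR prod_norm[symmetric]
    by (intro prod_mono) (use nrm in \<open>auto intro!: real_le_rsqrt\<close>)
  moreover have "cmod (sdet {..<n} C) \<le> (\<Prod>i<n. sqrt (\<Sum>k\<in>K. (cmod (y i k))\<^sup>2))"
    by (rule order_trans[OF Hadamard_square])
       (auto intro!: prod_mono sum_nonneg Bessel[OF K orth unit] simp: C_def)
  ultimately show ?thesis
    unfolding eq norm_mult by (intro mult_mono) (auto intro!: prod_nonneg sum_nonneg)
qed

section \<open>Inequalities between power sums and the determinant bound in l_p\<close>

lemma powr_add_subadd:
  fixes a b \<alpha> :: real
  assumes "0 < \<alpha>" "\<alpha> \<le> 1" "0 \<le> a" "0 \<le> b"
  shows "(a + b) powr \<alpha> \<le> a powr \<alpha> + b powr \<alpha>"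
proof (cases "a + b = 0")
  case False
  then have ab: "a + b > 0" using assms by simp
  have le: "c / (a + b) \<le> (c / (a + b)) powr \<alpha>" if "0 \<le> c" "c \<le> a + b" for c
  proof (cases "c = 0")
    case False
    then have "(c / (a + b)) powr 1 \<le> (c / (a + b)) powr \<alpha>"
      using that ab assms by (intro powr_mono') auto
    then show ?thesis using that ab False by simp
  qed simp
  have "1 = a / (a + b) + b / (a + b)" using ab by (simp add: add_divide_distrib[symmetric])
  also have "\<dots> \<le> (a / (a + b)) powr \<alpha> + (b / (a + b)) powr \<alpha>"
    using assms by (intro add_mono le) auto
  also have "\<dots> = (a powr \<alpha> + b powr \<alpha>) / (a + b) powr \<alpha>"
    using assms ab by (simp add: powr_divide add_divide_distrib)
  finally show ?thesis using ab by (simp add: field_simps)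
qed (use assms in simp)

lemma powr_sum_subadd:
  fixes t :: "'a \<Rightarrow> real"
  assumes "0 < \<alpha>" "\<alpha> \<le> 1" "finite I" "\<And>i. i \<in> I \<Longrightarrow> 0 \<le> t i"
  shows "(\<Sum>i\<in>I. t i) powr \<alpha> \<le> (\<Sum>i\<in>I. t i powr \<alpha>)"
  using assms(3,4)
proof (induction I rule: finite_induct)
  case (insert i I)
  have "(t i + (\<Sum>i\<in>I. t i)) powr \<alpha> \<le> t i powr \<alpha> + (\<Sum>i\<in>I. t i) powr \<alpha>"
    using insert assms by (intro powr_add_subadd) (auto intro: sum_nonneg)
  then show ?case using insert by simp
qed simp

text \<open>Subadditivity of the power 1/b, applied to the terms \<open>t i powr b\<close>.\<close>

lemma sum_powr_le_powr_sum:
  fixes t :: "'a \<Rightarrow> real"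
  assumes b: "1 \<le> b" and "finite I" "\<And>i. i \<in> I \<Longrightarrow> 0 \<le> t i"
  shows "(\<Sum>i\<in>I. t i powr b) \<le> (\<Sum>i\<in>I. t i) powr b"
proof -
  have "(\<Sum>i\<in>I. t i powr b) powr (1 / b) \<le> (\<Sum>i\<in>I. (t i powr b) powr (1 / b))"
    using assms by (intro powr_sum_subadd) auto
  also have "\<dots> = (\<Sum>i\<in>I. t i)"
    using assms by (intro sum.cong HOL.refl) (auto simp: powr_powr)
  finally have "((\<Sum>i\<in>I. t i powr b) powr (1 / b)) powr b \<le> (\<Sum>i\<in>I. t i) powr b"
    using b by (intro powr_mono2) auto
  then show ?thesis using b by (simp add: powr_powr sum_nonneg)
qed

text \<open>By Hoelder, multiplication by a weight in the unit ball of l_r, 1/r = 1/2 - 1/p, maps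
  the unit ball of l_p into that of l_2. Dividing the \<open>y i\<close> by a weight adapted to
  their common square function gives vectors whose squared lengths sum to at most n^(1 + 2/r), and
  by the arithmetic-geometric mean inequality the product of the lengths is at most n^(n/r).\<close>

lemma det_lp_bound:
  fixes y x :: "nat \<Rightarrow> nat \<Rightarrow> complex"
  assumes K: "finite K" and n: "n \<ge> 1"
    and pq: "1 < q" "q \<le> 2" "2 \<le> p" "1 / p + 1 / q = 1"
    and x: "\<And>i. i < n \<Longrightarrow> (\<Sum>k\<in>K. cmod (x i k) powr p) \<le> 1"
    and y: "\<And>i. i < n \<Longrightarrow> (\<Sum>k\<in>K. cmod (y i k) powr q) \<le> 1"
  shows "cmod (sdet {..<n} (\<lambda>i j. \<Sum>k\<in>K. y i k * x j k)) \<le> real n powr (real n * (1 / 2 - 1 / p))"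
proof (cases "p = 2")
  case True
  then have "q = 2" using pq by (simp add: field_simps)
  have sq: "cmod z powr 2 = (cmod z)\<^sup>2" for z using powr_realpow'[of "cmod z" 2] by simp
  have "cmod (sdet {..<n} (\<lambda>i j. \<Sum>k\<in>K. y i k * x j k)) \<le>
    (\<Prod>i<n. sqrt (\<Sum>k\<in>K. (cmod (y i k))\<^sup>2)) * (\<Prod>i<n. sqrt (\<Sum>k\<in>K. (cmod (x i k))\<^sup>2))"
    by (rule Hadamard_inequality[OF K])
  also have "\<dots> \<le> 1 * 1"
    using x y True \<open>q = 2\<close>
    by (intro mult_mono prod_le_1) (auto simp: sq intro!: prod_nonneg sum_nonneg)
  finally show ?thesis using True n by simp
next
  case False
  then have p2: "p > 2" using pq by simp
  define r where "r = 1 / (1 / 2 - 1 / p)"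
  have ir: "1 / r = 1 / 2 - 1 / p" by (simp add: r_def)
  have r: "r > 2" unfolding r_def using p2 by (simp add: field_simps)
  have ir': "1 / r = 1 / q - 1 / 2" using ir pq by simp
  have qr: "2 / r = 2 / q - 1" using ir' by (simp add: field_simps)
  \<comment> \<open>Change of density: Hadamard's inequality is applied to \<open>y / w\<close> and \<open>w x\<close> for a weight \<open>w\<close> proportional to \<open>\<sigma> powr (q / r)\<close>.\<close>
  define \<sigma> where "\<sigma> k = sqrt (\<Sum>i<n. (cmod (y i k))\<^sup>2)" for k
  have \<sigma>0: "\<sigma> k \<ge> 0" for k by (simp add: \<sigma>_def sum_nonneg)
  have \<sigma>y: "y i k = 0" if "\<sigma> k = 0" "i < n" for i k
  proof -
    have "(\<Sum>i<n. (cmod (y i k))\<^sup>2) = 0" using that(1) by (simp add: \<sigma>_def)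
    then show ?thesis using that(2) by (simp add: sum_nonneg_eq_0_iff)
  qed
  define c where "c = (\<Sum>k\<in>K. \<sigma> k powr q)"
  have c0: "c \<ge> 0" by (simp add: c_def sum_nonneg)
  \<comment> \<open>Since q/2 \<le> 1, the power q/2 of a sum of squares is at most the sum of the
    powers; this is where q \<le> 2 enters.\<close>
  have cn: "c \<le> n"
  proof -
    have "c \<le> (\<Sum>k\<in>K. \<Sum>i<n. cmod (y i k) powr q)"
      unfolding c_def
    proof (rule sum_mono)
      fix k
      have "\<sigma> k powr q = (\<Sum>i<n. (cmod (y i k))\<^sup>2) powr (q / 2)"
        by (simp add: \<sigma>_def powr_half_sqrt[symmetric] powr_powr sum_nonneg)
      also have "\<dots> \<le> (\<Sum>i<n. ((cmod (y i k))\<^sup>2) powr (q / 2))"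
        using pq by (intro powr_sum_subadd) auto
      also have "\<dots> = (\<Sum>i<n. cmod (y i k) powr q)"
        by (intro sum.cong HOL.refl) (simp add: powr_powr flip: powr_numeral)
      finally show "\<sigma> k powr q \<le> (\<Sum>i<n. cmod (y i k) powr q)" .
    qed
    also have "\<dots> = (\<Sum>i<n. \<Sum>k\<in>K. cmod (y i k) powr q)" by (rule sum.swap)
    also have "\<dots> \<le> (\<Sum>i<n. 1)" by (intro sum_mono y) simp
    finally show ?thesis by simp
  qed
  define W where "W k = (\<sigma> k powr q / c) powr (2 / r)" for k
  have W0: "W k \<ge> 0" for k by (simp add: W_def)
  \<comment> \<open>Where the weight vanishes every \<open>y i\<close> vanishes, so the division by
    it in \<open>y'\<close> loses nothing.\<close>
  have yW: "y i k = 0" if "W k = 0" "i < n" "k \<in> K" for i k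
  proof -
    have "\<sigma> k powr q / c = 0" using that(1) by (simp add: W_def)
    then have "\<sigma> k = 0 \<or> c = 0" by auto
    moreover have "\<sigma> k = 0" if "c = 0"
      using that K \<open>k \<in> K\<close> by (simp add: c_def sum_nonneg_eq_0_iff)
    ultimately show ?thesis using \<sigma>y that by blast
  qed
  define y' where "y' i k = y i k / of_real (sqrt (W k))" for i k
  define x' where "x' i k = of_real (sqrt (W k)) * x i k" for i k
  have "sdet {..<n} (\<lambda>i j. \<Sum>k\<in>K. y i k * x j k) = sdet {..<n} (\<lambda>i j. \<Sum>k\<in>K. y' i k * x' j k)"
    by (intro sdet_cong sum.cong HOL.refl) (auto simp: y'_def x'_def yW)
  also have "cmod \<dots> \<le> (\<Prod>i<n. sqrt (\<Sum>k\<in>K. (cmod (y' i k))\<^sup>2)) * (\<Prod>i<n. sqrt (\<Sum>k\<in>K. (cmod (x' i k))\<^sup>2))"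
    by (rule Hadamard_inequality[OF K])
  also have "\<dots> \<le> (\<Prod>i<n. sqrt (\<Sum>k\<in>K. (cmod (y' i k))\<^sup>2)) * 1"
  proof (intro mult_left_mono prod_le_1 conjI)
    fix i assume "i \<in> {..<n}"
    then have i: "i < n" by simp
    have "(\<Sum>k\<in>K. (cmod (x' i k))\<^sup>2) \<le> (\<Sum>k\<in>K. (2 / r) * (\<sigma> k powr q / c) + (2 / p) * cmod (x i k) powr p)"
    proof (rule sum_mono)
      fix k
      have "(cmod (x' i k))\<^sup>2 = W k * (cmod (x i k))\<^sup>2"
        using W0 by (simp add: x'_def norm_mult power_mult_distrib)
      \<comment> \<open>Young's inequality with the conjugate exponents r/2 and p/2, since 2/r + 2/p
        = 1.\<close>
      also have "\<dots> \<le> W k powr (r / 2) / (r / 2) + ((cmod (x i k))\<^sup>2) powr (p / 2) / (p / 2)"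
        using p2 r W0 ir by (intro Youngs_inequality) (auto simp: field_simps)
      also have "W k powr (r / 2) = \<sigma> k powr q / c"
        using c0 r by (simp add: W_def powr_powr)
      also have "((cmod (x i k))\<^sup>2) powr (p / 2) = cmod (x i k) powr p"
        by (simp add: powr_powr flip: powr_numeral)
      finally show "(cmod (x' i k))\<^sup>2 \<le> (2 / r) * (\<sigma> k powr q / c) + (2 / p) * cmod (x i k) powr p"
        by (simp add: field_simps)
    qed
    also have "\<dots> = (2 / r) * (c / c) + (2 / p) * (\<Sum>k\<in>K. cmod (x i k) powr p)"
      by (simp add: sum.distrib sum_distrib_left[symmetric] sum_divide_distrib[symmetric] c_def)
    also have "\<dots> \<le> (2 / r) * 1 + (2 / p) * 1"
      using r p2 x[OF i] by (intro add_mono mult_left_mono) auto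
    also have "\<dots> = 1" using ir by (simp add: field_simps)
    finally show "sqrt (\<Sum>k\<in>K. (cmod (x' i k))\<^sup>2) \<le> 1" by simp
  qed (auto intro!: prod_nonneg sum_nonneg)
  also have "\<dots> = sqrt (\<Prod>i<n. \<Sum>k\<in>K. (cmod (y' i k))\<^sup>2)"
  proof -
    have "(\<Prod>i<n. sqrt (f i)) = sqrt (\<Prod>i<n. f i)" for f :: "nat \<Rightarrow> real"
      by (induction n) (auto simp: real_sqrt_mult)
    then show ?thesis by simp
  qed
  also have "\<dots> \<le> sqrt (real n powr (2 * real n / r))"
  proof (rule real_sqrt_le_mono)
    let ?S = "\<lambda>i. \<Sum>k\<in>K. (cmod (y' i k))\<^sup>2"
    have tot: "(\<Sum>i<n. ?S i) \<le> real n powr (1 + 2 / r)"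
    proof (cases "c = 0")
      case True
      then have "W k = 0" for k by (simp add: W_def)
      then show ?thesis by (simp add: y'_def)
    next
      case False
      then have c: "c > 0" using c0 by simp
      have "(\<Sum>i<n. ?S i) = (\<Sum>k\<in>K. \<Sum>i<n. (cmod (y i k))\<^sup>2 / W k)"
        by (subst sum.swap) (simp add: y'_def norm_divide power_divide W0)
      also have "\<dots> = (\<Sum>k\<in>K. (\<sigma> k)\<^sup>2 / W k)"
        by (simp add: \<sigma>_def sum_divide_distrib sum_nonneg)
      \<comment> \<open>The exponent of the weight is made for this identity: q (2/r) = 2 - q, so
        the quotient is again a multiple of \<open>\<sigma> k powr q\<close>, whose sum is
        \<open>c\<close>.\<close>
      also have "\<dots> = (\<Sum>k\<in>K. c powr (2 / r) * \<sigma> k powr q)"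
      proof (rule sum.cong[OF HOL.refl])
        fix k
        show "(\<sigma> k)\<^sup>2 / W k = c powr (2 / r) * \<sigma> k powr q"
        proof (cases "\<sigma> k = 0")
          case False
          then have s: "\<sigma> k > 0" using \<sigma>0[of k] by simp
          have "W k = \<sigma> k powr (q * (2 / r)) / c powr (2 / r)"
            using s c by (simp add: W_def powr_divide powr_powr)
          moreover have "q * (2 / r) = 2 - q" unfolding qr using pq by (simp add: field_simps)
          moreover have "(\<sigma> k)\<^sup>2 = \<sigma> k powr (2 - q) * \<sigma> k powr q"
            using s by (simp add: powr_add[symmetric])
          ultimately show ?thesis using s by simp
        qed simp
      qed
      also have "\<dots> = c powr (1 + 2 / r)"
        using c by (simp add: sum_distrib_left[symmetric] c_def[symmetric] powr_add)
      also have "\<dots> \<le> real n powr (1 + 2 / r)"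
        using cn c r by (intro powr_mono2) auto
      finally show ?thesis .
    qed
    have am: "(\<Prod>i<n. ?S i) powr (1 / n) \<le> (\<Sum>i<n. ?S i / n)"
    proof -
      have "{..<n} \<noteq> {}" using n by (auto simp: lessThan_empty_iff)
      from arith_geom_mean[OF finite_lessThan this, of ?S] show ?thesis by (simp add: sum_nonneg)
    qed
    also have "\<dots> = (\<Sum>i<n. ?S i) / n" by (simp add: sum_divide_distrib)
    also have "\<dots> \<le> real n powr (1 + 2 / r) / n" using tot by (intro divide_right_mono) auto
    also have "\<dots> = real n powr (2 / r)" using n by (simp add: powr_add)
    finally have "((\<Prod>i<n. ?S i) powr (1 / n)) powr n \<le> (real n powr (2 / r)) powr n"
      by (intro powr_mono2) auto
    then show "(\<Prod>i<n. ?S i) \<le> real n powr (2 * real n / r)"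
      using n by (simp add: powr_powr prod_nonneg sum_nonneg)
  qed
  also have "\<dots> = real n powr (real n * (1 / 2 - 1 / p))"
    unfolding ir[symmetric] by (simp add: powr_half_sqrt[symmetric] powr_powr)
  finally show ?thesis .
qed

section \<open>Fredholm determinants of minimal type\<close>

text \<open>The maximum only matters for \<open>n = 0\<close>, where \<open>0 powr 0 = 0\<close> would give the wrong value.\<close>

definition hadamard_const :: "real \<Rightarrow> nat \<Rightarrow> real"
  where "hadamard_const a n = max 1 (real n) powr (a * real n)"

text \<open>Rows with entries of modulus at most 1 have length at most sqrt n; this is the exponent
  a = 1/2 of the endpoints p = 1 and p = infinity.\<close>

lemma det_entries_bound:
  assumes "\<And>i j. i < n \<Longrightarrow> j < n \<Longrightarrow> cmod (A i j) \<le> 1"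
  shows "cmod (sdet {..<n} A) \<le> hadamard_const (1 / 2) n"
proof -
  have "cmod (sdet {..<n} A) \<le> (\<Prod>i<n. sqrt (\<Sum>k<n. (cmod (A i k))\<^sup>2))"
    by (rule Hadamard_square)
  also have "\<dots> \<le> (\<Prod>i<n. sqrt (\<Sum>k<n. 1))"
    using assms by (intro prod_mono conjI real_sqrt_le_mono sum_mono power_le_one) (auto intro!: sum_nonneg)
  also have "\<dots> = sqrt (real n) ^ n" by simp
  also have "\<dots> \<le> hadamard_const (1 / 2) n"
  proof (cases "n = 0")
    case False
    then have "sqrt (real n) ^ n = (real n powr (1 / 2)) powr real n"
      by (simp add: powr_half_sqrt powr_realpow)
    then show ?thesis using False by (simp add: hadamard_const_def powr_powr max_def)
  qed (simp add: hadamard_const_def)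
  finally show ?thesis .
qed

text \<open>From 1 + x \<le> exp x with x = n \<beta> / K. As \<open>K\<close> is at least
  \<open>M * \<beta>\<close>, the exponential rate after taking the power \<open>M\<close> is at
  most 1.\<close>

lemma poly_exp_bound:
  fixes \<beta> M :: real
  assumes "0 \<le> \<beta>" "0 \<le> M"
  shows "\<exists>C\<ge>1. \<forall>n::nat. (1 + real n * \<beta>) powr M \<le> C * exp (real n)"
proof -
  define K where "K = max 1 (M * \<beta>)"
  have K: "K \<ge> 1" "M * \<beta> \<le> K" by (auto simp: K_def)
  have "(1 + real n * \<beta>) powr M \<le> K powr M * exp (real n)" for n
  proof -
    have "1 + real n * \<beta> \<le> K * (1 + real n * \<beta> / K)"
      using K by (simp add: field_simps)
    also have "\<dots> \<le> K * exp (real n * \<beta> / K)"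
      using K by (intro mult_left_mono exp_ge_add_one_self) auto
    finally have "(1 + real n * \<beta>) powr M \<le> (K * exp (real n * \<beta> / K)) powr M"
      using assms by (intro powr_mono2) auto
    also have "\<dots> = K powr M * exp (real n * \<beta> / K * M)"
      using K by (simp add: powr_mult exp_powr_real)
    also have "\<dots> \<le> K powr M * exp (real n)"
    proof (intro mult_left_mono exp_le_cancel_iff[THEN iffD2])
      have "real n * (M * \<beta>) \<le> real n * K" using K by (intro mult_left_mono) auto
      then show "real n * \<beta> / K * M \<le> real n" using K by (simp add: field_simps)
    qed auto
    finally show ?thesis .
  qed
  moreover have "K powr M \<ge> 1" using K assms by (simp add: ge_one_powr_ge_zero)
  ultimately show ?thesis by blast
qed

text \<open>Put b = l^(1/(1+a)). The elementary symmetric sum of \<open>l\<close> of degree n is at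
  most the power 1 + a of that of b, called \<open>F\<close> below. Since b is summable, the terms
  after the first \<open>m\<close> sum to less than \<open>\<epsilon>\<close>, and evaluating the
  generating product at n / \<epsilon> bounds \<open>F\<close> by a polynomial in n times (e
  \<epsilon> / n)^n. The power 1 + a of this cancels the factor n^(a n) and leaves 1 / n^n, which is
  at most 1 / n!.\<close>

lemma minimal_type_bound:
  fixes l :: "nat \<Rightarrow> real"
  assumes a: "0 \<le> a" and l: "\<And>k. 0 \<le> l k"
    and summ: "summable (\<lambda>k. l k powr (1 / (1 + a)))" and \<delta>: "0 < \<delta>"
  shows "\<exists>C\<ge>0. \<forall>N r. 0 \<le> r \<longrightarrow>
    (\<Sum>S\<in>Pow {..<N}. r ^ card S * hadamard_const a (card S) * (\<Prod>i\<in>S. l i)) \<le> C * exp (\<delta> * r)"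
proof -
  define b where "b k = l k powr (1 / (1 + a))" for k
  have b0: "b k \<ge> 0" for k by (simp add: b_def)
  have lb: "l k = b k powr (1 + a)" for k using a l[of k] by (simp add: b_def powr_powr)
  \<comment> \<open>The solution of (\<epsilon> e)^(1+a) e = \<delta>. The inner factor e comes from
    the tail of the generating product, the outer one pays for the polynomial factor through
    \<open>poly_exp_bound\<close>.\<close>
  define \<epsilon> where "\<epsilon> = (\<delta> / exp 1) powr (1 / (1 + a)) / exp 1"
  have \<epsilon>: "\<epsilon> > 0" using \<delta> by (simp add: \<epsilon>_def)
  have \<epsilon>\<delta>: "(\<epsilon> * exp 1) powr (1 + a) * exp 1 = \<delta>"
    using a \<delta> by (simp add: \<epsilon>_def powr_powr)
  have sb: "summable b" using summ by (simp add: b_def[abs_def])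
  define B where "B = suminf b"
  have B: "sum b I \<le> B" if "finite I" for I
    unfolding B_def using sb b0 that by (intro sum_le_suminf) auto
  have B0: "B \<ge> 0" using B[of "{}"] by simp
  obtain m where m: "\<And>N. (\<Sum>k\<in>{m..<N}. b k) < \<epsilon>"
  proof -
    from summable_Cauchy[THEN iffD1, OF sb] \<epsilon> obtain m where
      "\<forall>j\<ge>m. \<forall>N. norm (sum b {j..<N}) < \<epsilon>" by blast
    then have "\<And>N. (\<Sum>k\<in>{m..<N}. b k) < \<epsilon>" by (metis order_refl abs_le_D1 le_less_trans real_norm_def)
    then show thesis by (rule that)
  qed
  obtain C where C: "C \<ge> 1" "\<And>n::nat. (1 + real n * (B / \<epsilon>)) powr (real m * (1 + a)) \<le> C * exp (real n)"
    using poly_exp_bound[of "B / \<epsilon>" "real m * (1 + a)"] a B0 \<epsilon> by auto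
  have key: "hadamard_const a n * (\<Sum>S | S \<subseteq> {..<N} \<and> card S = n. \<Prod>i\<in>S. l i) \<le> C * \<delta> ^ n / fact n" for n N
  proof (cases "n = 0")
    case True
    have "{S. S \<subseteq> {..<N} \<and> card S = 0} = {{}}" by (auto dest: finite_subset)
    then show ?thesis using True C(1) by (simp add: hadamard_const_def)
  next
    case False
    let ?P = "{S. S \<subseteq> {..<N} \<and> card S = n}"
    have finP: "finite ?P" by simp
    \<comment> \<open>The elementary symmetric function \<open>F\<close> of degree \<open>n\<close> is at most \<open>(\<Prod>i. 1 + \<rho> * b i) / \<rho> ^ n\<close> for every \<open>\<rho> > 0\<close>.\<close>
    define \<rho> where "\<rho> = real n / \<epsilon>"
    have \<rho>: "\<rho> > 0" using False \<epsilon> by (simp add: \<rho>_def)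
    define F where "F = (\<Sum>S\<in>?P. \<Prod>i\<in>S. b i)"
    have F0: "F \<ge> 0" unfolding F_def by (intro sum_nonneg prod_nonneg b0)
    have "(\<Sum>S\<in>?P. \<Prod>i\<in>S. l i) = (\<Sum>S\<in>?P. (\<Prod>i\<in>S. b i) powr (1 + a))"
      unfolding lb by (intro sum.cong HOL.refl) (simp add: prod_powr_distrib b0)
    also have "\<dots> \<le> F powr (1 + a)"
      unfolding F_def using a by (intro sum_powr_le_powr_sum finP) (auto intro!: prod_nonneg b0)
    finally have E: "(\<Sum>S\<in>?P. \<Prod>i\<in>S. l i) \<le> F powr (1 + a)" .
    have "\<rho> ^ n * F = (\<Sum>S\<in>?P. \<Prod>i\<in>S. \<rho> * b i)"
      unfolding F_def sum_distrib_left by (intro sum.cong HOL.refl) (auto simp: prod.distrib)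
    also have "\<dots> \<le> (\<Sum>S\<in>Pow {..<N}. \<Prod>i\<in>S. \<rho> * b i)"
      using \<rho> by (intro sum_mono2) (auto intro!: mult_nonneg_nonneg prod_nonneg b0)
    also have "\<dots> = (\<Prod>i<N. \<rho> * b i + 1)"
      by (subst prod_add) auto
    \<comment> \<open>The added factors are at least 1; they matter only when N < m, a case treated
      together with the others in this way.\<close>
    also have "\<dots> \<le> (\<Prod>i\<in>{..<m} \<union> {m..<N}. \<rho> * b i + 1)"
      using \<rho> b0 by (intro prod_mono2) auto
    also have "\<dots> = (\<Prod>i<m. \<rho> * b i + 1) * (\<Prod>i\<in>{m..<N}. \<rho> * b i + 1)"
      by (intro prod.union_disjoint) auto
    also have "\<dots> \<le> (\<Prod>i<m. 1 + real n * (B / \<epsilon>)) * (\<Prod>i\<in>{m..<N}. exp (\<rho> * b i))"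
    proof (intro mult_mono prod_mono conjI prod_nonneg)
      fix i
      have "b i \<le> B" using B[of "{i}"] by simp
      then have "\<rho> * b i \<le> \<rho> * B" using \<rho> by simp
      then show "\<rho> * b i + 1 \<le> 1 + real n * (B / \<epsilon>)" by (simp add: \<rho>_def)
      show "\<rho> * b i + 1 \<le> exp (\<rho> * b i)" using exp_ge_add_one_self[of "\<rho> * b i"] by (simp add: add.commute)
    qed (use \<rho> b0 B0 \<epsilon> in auto)
    also have "(\<Prod>i\<in>{m..<N}. exp (\<rho> * b i)) = exp (\<rho> * (\<Sum>i\<in>{m..<N}. b i))"
      by (simp add: exp_sum sum_distrib_left)
    also have "(\<Prod>i<m. 1 + real n * (B / \<epsilon>)) * exp (\<rho> * (\<Sum>i\<in>{m..<N}. b i)) \<le>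
        (1 + real n * (B / \<epsilon>)) ^ m * exp (real n)"
    proof (intro mult_mono)
      have "\<rho> * (\<Sum>i\<in>{m..<N}. b i) \<le> \<rho> * \<epsilon>" using m[of N] \<rho> by (intro mult_left_mono) auto
      then show "exp (\<rho> * (\<Sum>i\<in>{m..<N}. b i)) \<le> exp (real n)" using \<epsilon> by (simp add: \<rho>_def)
    qed (use B0 \<epsilon> in auto)
    finally have "\<rho> ^ n * F \<le> (1 + real n * (B / \<epsilon>)) ^ m * exp (real n)" .
    then have "F \<le> (1 + real n * (B / \<epsilon>)) ^ m * exp (real n) / \<rho> ^ n"
      using \<rho> by (simp add: field_simps)
    then have "F powr (1 + a) \<le> ((1 + real n * (B / \<epsilon>)) ^ m * exp (real n) / \<rho> ^ n) powr (1 + a)"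
      using F0 a by (intro powr_mono2) auto
    also have "\<dots> = (1 + real n * (B / \<epsilon>)) powr (real m * (1 + a)) * exp (real n * (1 + a)) / \<rho> powr (real n * (1 + a))"
      using \<rho> B0 \<epsilon> by (simp add: powr_mult powr_divide exp_powr_real powr_realpow[symmetric] powr_powr add_nonneg_pos add_pos_nonneg)
    also have "\<dots> \<le> C * exp (real n) * exp (real n * (1 + a)) / \<rho> powr (real n * (1 + a))"
      using C(2)[of n] by (intro divide_right_mono mult_right_mono) auto
    finally have F: "F powr (1 + a) \<le> C * exp (real n) * exp (real n * (1 + a)) / \<rho> powr (real n * (1 + a))" .
    have h: "hadamard_const a n = real n powr (a * real n)" using False by (simp add: hadamard_const_def max_def)
    have "hadamard_const a n * (\<Sum>S\<in>?P. \<Prod>i\<in>S. l i) \<le>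
        real n powr (a * real n) * (C * exp (real n) * exp (real n * (1 + a)) / \<rho> powr (real n * (1 + a)))"
      unfolding h using order_trans[OF E F] by (intro mult_left_mono) auto
    also have "\<dots> = C * \<delta> ^ n / real n ^ n"
    proof -
      have "\<delta> ^ n = ((\<epsilon> * exp 1) powr (1 + a) * exp 1) powr real n"
        using \<delta> by (simp add: \<epsilon>\<delta> powr_realpow)
      also have "\<dots> = \<epsilon> powr (real n * (1 + a)) * exp (real n * (1 + a)) * exp (real n)"
        using \<epsilon> by (simp add: powr_mult powr_powr exp_powr_real mult_ac)
      finally have d: "\<delta> ^ n = \<epsilon> powr (real n * (1 + a)) * exp (real n * (1 + a)) * exp (real n)" .
      have "\<rho> powr (real n * (1 + a)) = real n powr (a * real n) * real n ^ n / \<epsilon> powr (real n * (1 + a))"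
        using False \<epsilon> by (simp add: \<rho>_def powr_divide powr_realpow[symmetric] powr_add[symmetric] algebra_simps)
      moreover have "A * (C * x * y / (A * D / E)) = C * (E * y * x) / D"
        if "A \<noteq> 0" "D \<noteq> 0" "E \<noteq> 0" for A D E x y :: real
        using that by (simp add: field_simps)
      ultimately show ?thesis using False \<epsilon> unfolding d by simp
    qed
    also have "\<dots> \<le> C * \<delta> ^ n / fact n"
    proof (rule divide_left_mono)
      show "(fact n :: real) \<le> real n ^ n" using fact_le_power[of n, where 'a = real] by simp
    qed (use False C \<delta> in auto)
    finally show ?thesis .
  qed
  have "(\<Sum>S\<in>Pow {..<N}. r ^ card S * hadamard_const a (card S) * (\<Prod>i\<in>S. l i)) \<le> C * exp (\<delta> * r)"
    if r: "0 \<le> r" for N r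
  proof -
    have "(\<Sum>S\<in>Pow {..<N}. r ^ card S * hadamard_const a (card S) * (\<Prod>i\<in>S. l i)) =
        (\<Sum>n\<in>{..N}. \<Sum>S | S \<in> Pow {..<N} \<and> card S = n. r ^ card S * hadamard_const a (card S) * (\<Prod>i\<in>S. l i))"
      by (rule sum.group[symmetric]) (auto dest: card_mono[rotated])
    also have "\<dots> = (\<Sum>n\<le>N. r ^ n * (hadamard_const a n * (\<Sum>S | S \<subseteq> {..<N} \<and> card S = n. \<Prod>i\<in>S. l i)))"
      by (intro sum.cong HOL.refl) (simp add: sum_distrib_left mult.assoc)
    also have "\<dots> \<le> (\<Sum>n\<le>N. r ^ n * (C * \<delta> ^ n / fact n))"
      using r key by (intro sum_mono mult_left_mono) auto
    also have "\<dots> = C * (\<Sum>n\<le>N. (\<delta> * r) ^ n /\<^sub>R fact n)"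
      by (simp add: sum_distrib_left power_mult_distrib field_simps)
    also have "\<dots> \<le> C * exp (\<delta> * r)"
    proof (rule mult_left_mono)
      show "(\<Sum>n\<le>N. (\<delta> * r) ^ n /\<^sub>R fact n) \<le> exp (\<delta> * r)"
        unfolding exp_def using r \<delta>
        by (intro sum_le_suminf summable_exp_generic) auto
    qed (use C in simp)
    finally show ?thesis .
  qed
  then show ?thesis using C(1) by (intro exI[of _ C]) auto
qed

section \<open>Fredholm determinants as limits over finite corners\<close>

lemma sdet_cmult:
  assumes "finite S"
  shows "sdet S (\<lambda>i j. c * A i j) = c ^ card S * sdet S A"
  unfolding sdet_def by (simp add: prod.distrib sum_distrib_left mult_ac)

definition fredholm_trunc :: "(nat \<Rightarrow> nat \<Rightarrow> complex) \<Rightarrow> nat \<Rightarrow> complex \<Rightarrow> complex"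
  where "fredholm_trunc A N z = sdet {..<N} (\<lambda>i j. (if i = j then 1 else 0) + - z * A i j)"

text \<open>The limit exists under the assumptions of \<open>minimal_type_matrix\<close>. The
  function is attached to the matrix of a chosen representation, not a priori to an
  operator.\<close>

definition fredholm_det :: "(nat \<Rightarrow> nat \<Rightarrow> complex) \<Rightarrow> complex \<Rightarrow> complex"
  where "fredholm_det A z = lim (\<lambda>N. fredholm_trunc A N z)"

text \<open>Principal minors are the right quantities to bound because they are the coefficients of
  the truncated determinants, see \<open>fredholm_trunc_eq\<close>.\<close>

definition det_dominated :: "real \<Rightarrow> (nat \<Rightarrow> real) \<Rightarrow> (nat \<Rightarrow> nat \<Rightarrow> complex) \<Rightarrow> bool"
  where "det_dominated a l A \<longleftrightarrow>
    (\<forall>S. finite S \<longrightarrow> cmod (sdet S A) \<le> hadamard_const a (card S) * (\<Prod>i\<in>S. l i))"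

lemma fredholm_trunc_eq:
  "fredholm_trunc A N z = (\<Sum>S\<in>Pow {..<N}. (- z) ^ card S * sdet S A)"
  unfolding fredholm_trunc_def
  by (subst sdet_one_plus, simp, rule sum.cong[OF HOL.refl], rule sdet_cmult) (auto intro: finite_subset)

definition l_sum :: "real \<Rightarrow> (nat \<Rightarrow> real) \<Rightarrow> nat \<Rightarrow> real \<Rightarrow> real"
  where "l_sum a l N r = (\<Sum>S\<in>Pow {..<N}. r ^ card S * hadamard_const a (card S) * (\<Prod>i\<in>S. l i))"

locale minimal_type_matrix =
  fixes a :: real and l :: "nat \<Rightarrow> real" and A :: "nat \<Rightarrow> nat \<Rightarrow> complex"
  assumes a: "0 \<le> a" and l: "\<And>k. 0 \<le> l k"
    and summ: "summable (\<lambda>k. l k powr (1 / (1 + a)))"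
    and dom: "det_dominated a l A"
begin

lemma term_le:
  assumes "finite S" "cmod z \<le> r"
  shows "cmod ((- z) ^ card S * sdet S A) \<le> r ^ card S * hadamard_const a (card S) * (\<Prod>i\<in>S. l i)"
proof -
  have "cmod ((- z) ^ card S * sdet S A) \<le> r ^ card S * (hadamard_const a (card S) * (\<Prod>i\<in>S. l i))"
    unfolding norm_mult norm_power norm_minus_cancel
    using assms dom order_trans[OF norm_ge_zero assms(2)] unfolding det_dominated_def
    by (intro mult_mono power_mono) auto
  then show ?thesis by (simp add: mult.assoc)
qed

text \<open>Passing from \<open>M\<close> to \<open>N\<close> adds the minors of the index sets not
  contained in the smaller segment, and the same index sets account for the increase of the
  majorant.\<close>

lemma l_sum_diff:
  assumes "M \<le> N" "cmod z \<le> r"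
  shows "cmod (fredholm_trunc A N z - fredholm_trunc A M z) \<le> l_sum a l N r - l_sum a l M r"
proof -
  have sub: "Pow {..<M} \<subseteq> Pow {..<N}" using assms by auto
  have "fredholm_trunc A N z - fredholm_trunc A M z = (\<Sum>S\<in>Pow {..<N} - Pow {..<M}. (- z) ^ card S * sdet S A)"
    unfolding fredholm_trunc_eq using sub by (subst sum_diff) auto
  also have "cmod \<dots> \<le> (\<Sum>S\<in>Pow {..<N} - Pow {..<M}. r ^ card S * hadamard_const a (card S) * (\<Prod>i\<in>S. l i))"
    by (rule sum_norm_le) (use assms in \<open>auto intro!: term_le finite_subset[of _ "{..<N}"]\<close>)
  also have "\<dots> = l_sum a l N r - l_sum a l M r"
    unfolding l_sum_def using sub by (subst sum_diff) auto
  finally show ?thesis .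
qed

lemma trunc_le: "cmod z \<le> r \<Longrightarrow> cmod (fredholm_trunc A N z) \<le> l_sum a l N r"
  unfolding fredholm_trunc_eq l_sum_def
  by (rule sum_norm_le) (auto intro!: term_le finite_subset[of _ "{..<N}"])

lemma l_sum_bound:
  assumes "0 < \<delta>"
  obtains C where "0 \<le> C" "\<And>N r. 0 \<le> r \<Longrightarrow> l_sum a l N r \<le> C * exp (\<delta> * r)"
  using minimal_type_bound[OF a l summ assms] unfolding l_sum_def by blast

lemma l_sum_mono:
  assumes "0 \<le> r" "M \<le> N"
  shows "l_sum a l M r \<le> l_sum a l N r"
  unfolding l_sum_def
  by (rule sum_mono2)
     (use assms in \<open>auto intro!: mult_nonneg_nonneg prod_nonneg l simp: hadamard_const_def\<close>)

lemma l_sum_convergent: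
  assumes "0 \<le> r"
  shows "convergent (\<lambda>N. l_sum a l N r)"
proof -
  obtain C where "0 \<le> C" and C: "\<And>N r. 0 \<le> r \<Longrightarrow> l_sum a l N r \<le> C * exp (1 * r)"
    by (rule l_sum_bound[of 1], simp) blast
  have "incseq (\<lambda>N. l_sum a l N r)" using l_sum_mono[OF assms] by (simp add: incseq_def)
  then show ?thesis using C[OF assms] by (metis incseq_convergent convergentI)
qed

text \<open>The majorants increase with \<open>N\<close> and stay bounded, hence are Cauchy; by
  \<open>l_sum_diff\<close> so are the truncated determinants, uniformly on the disc.\<close>

lemma uniform_limit_fredholm:
  "uniform_limit (cball 0 r) (fredholm_trunc A) (fredholm_det A) sequentially"
proof (cases "0 \<le> r")
  case True
  have "uniformly_Cauchy_on (cball 0 r) (fredholm_trunc A)"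
  proof (rule uniformly_Cauchy_onI)
    fix e :: real assume "e > 0"
    from l_sum_convergent[OF True, THEN convergent_Cauchy] this
    obtain M where M: "\<And>m n. m \<ge> M \<Longrightarrow> n \<ge> M \<Longrightarrow> \<bar>l_sum a l m r - l_sum a l n r\<bar> < e"
      unfolding Cauchy_def dist_real_def by blast
    have *: "dist (fredholm_trunc A m z) (fredholm_trunc A n z) < e"
      if "z \<in> cball 0 r" "m \<ge> n" "n \<ge> M" for z m n
      using l_sum_diff[of n m z r] M[of m n] that by (simp add: dist_norm)
    show "\<exists>M. \<forall>z\<in>cball 0 r. \<forall>m\<ge>M. \<forall>n\<ge>M. dist (fredholm_trunc A m z) (fredholm_trunc A n z) < e"
    proof (intro exI ballI allI impI)
      fix z m n assume "z \<in> cball (0 :: complex) r" "m \<ge> M" "n \<ge> M"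
      then show "dist (fredholm_trunc A m z) (fredholm_trunc A n z) < e"
        using *[of z m n] *[of z n m] by (cases "m \<ge> n") (auto simp: dist_commute)
    qed
  qed
  then have "uniformly_convergent_on (cball 0 r) (fredholm_trunc A)"
    by (rule Cauchy_uniformly_convergent)
  then show ?thesis
    unfolding uniformly_convergent_uniform_limit_iff fredholm_det_def .
qed simp

lemma fredholm_trunc_tendsto: "(\<lambda>N. fredholm_trunc A N z) \<longlonglongrightarrow> fredholm_det A z"
  by (rule tendsto_uniform_limitI[OF uniform_limit_fredholm[of "cmod z"]]) simp

lemma holomorphic_trunc: "fredholm_trunc A N holomorphic_on S"
  unfolding fredholm_trunc_eq[abs_def] by (intro holomorphic_intros)

lemma holomorphic_fredholm: "fredholm_det A holomorphic_on S"
proof -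
  have "fredholm_det A holomorphic_on ball 0 r" for r
    by (rule holomorphic_uniform_limit[THEN conjunct2, OF _ uniform_limit_fredholm])
       (auto intro!: always_eventually holomorphic_trunc holomorphic_on_imp_continuous_on)
  then have "fredholm_det A field_differentiable at z" for z
    using holomorphic_on_imp_differentiable_at[of "fredholm_det A" "ball 0 (cmod z + 1)" z] by simp
  then show ?thesis
    by (meson field_differentiable_at_within holomorphic_on_def)
qed

lemma fredholm_bound:
  assumes "0 < \<delta>"
  obtains C where "0 \<le> C" "\<And>z. cmod (fredholm_det A z) \<le> C * exp (\<delta> * cmod z)"
    "\<And>N z. cmod (fredholm_trunc A N z) \<le> C * exp (\<delta> * cmod z)"
proof -
  obtain C where C: "0 \<le> C" "\<And>N r. 0 \<le> r \<Longrightarrow> l_sum a l N r \<le> C * exp (\<delta> * r)"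
    using l_sum_bound[OF assms] by blast
  have *: "cmod (fredholm_trunc A N z) \<le> C * exp (\<delta> * cmod z)" for N z
    using trunc_le[OF order_refl] C(2)[OF norm_ge_zero] by (rule order_trans)
  have "cmod (fredholm_det A z) \<le> C * exp (\<delta> * cmod z)" for z
    by (rule LIMSEQ_le_const2[OF tendsto_norm[OF fredholm_trunc_tendsto]]) (use * in blast)
  then show thesis using that C(1) * by blast
qed

lemma fredholm_trunc_0: "fredholm_trunc A N 0 = 1"
proof -
  have "fredholm_trunc A N 0 = (\<Sum>S\<in>Pow {..<N}. if S = {} then 1 else 0)"
    unfolding fredholm_trunc_eq
  proof (rule sum.cong[OF HOL.refl])
    fix S assume "S \<in> Pow {..<N}"
    then have "finite S" by (auto intro: finite_subset)
    then show "(- 0) ^ card S * sdet S A = (if S = {} then 1 else 0)"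
      by (auto simp: sdet_def power_0_left)
  qed
  then show ?thesis by simp
qed

lemma fredholm_0: "fredholm_det A 0 = 1"
  using fredholm_trunc_tendsto[of 0] by (simp add: fredholm_trunc_0 LIMSEQ_const_iff)

end

text \<open>Logarithmic differentiation: each factor 1 - e X contributes -e / (1 - e X), which up to
  sign is the generating series of the powers of e.\<close>

lemma prod_linear_fps:
  fixes es :: "complex list"
  defines "G \<equiv> (\<Prod>e\<leftarrow>es. 1 - fps_const e * fps_X)"
  shows "(\<lambda>z. \<Prod>e\<leftarrow>es. 1 - z * e) has_fps_expansion G"
    and "fps_deriv G = - G * Abs_fps (\<lambda>m. \<Sum>e\<leftarrow>es. e ^ Suc m)"
proof -
  show "(\<lambda>z. \<Prod>e\<leftarrow>es. 1 - z * e) has_fps_expansion G"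
    unfolding G_def
  proof (induction es)
    case (Cons e es)
    have "(\<lambda>z. 1 - z * e) has_fps_expansion (1 - fps_const e * fps_X)"
      by (subst mult.commute) (intro fps_expansion_intros)
    from has_fps_expansion_mult[OF this Cons] show ?case by simp
  qed (simp add: has_fps_expansion_1)
  show "fps_deriv G = - G * Abs_fps (\<lambda>m. \<Sum>e\<leftarrow>es. e ^ Suc m)"
    unfolding G_def
  proof (induction es)
    case Nil
    show ?case by (simp add: fps_eq_iff fps_mult_nth)
  next
    case (Cons e es)
    define g where "g = (\<Prod>e\<leftarrow>es. 1 - fps_const e * fps_X)"
    define T where "T = Abs_fps (\<lambda>m. \<Sum>e\<leftarrow>es. e ^ Suc m)"
    define E where "E = Abs_fps (\<lambda>m. e ^ Suc m)"
    define L where "L = 1 - fps_const e * fps_X"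
    have "L * E = fps_const e"
    proof (rule fps_ext)
      fix n show "(L * E) $ n = fps_const e $ n"
        unfolding L_def E_def by (cases n) (simp_all add: left_diff_distrib mult.assoc)
    qed
    then have E: "L * g * E = fps_const e * g" by (metis mult.assoc mult.commute)
    have ET: "Abs_fps (\<lambda>m. \<Sum>e\<leftarrow>e # es. e ^ Suc m) = E + T" by (simp add: fps_eq_iff E_def T_def)
    have "fps_deriv (L * g) = L * fps_deriv g + fps_deriv L * g" by (rule fps_deriv_mult)
    also have "fps_deriv g = - g * T" using Cons by (simp add: g_def T_def)
    also have "fps_deriv L = - fps_const e" by (simp add: L_def)
    also have "L * (- g * T) + - fps_const e * g = L * (- g * T) - L * g * E"
      unfolding E by (simp only: diff_conv_add_uminus minus_mult_left)
    also have "\<dots> = - (L * g) * (E + T)"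
      by (simp add: algebra_simps)
    finally show ?case unfolding ET by (simp add: g_def L_def)
  qed
qed

text \<open>The coefficient of index m + 1 is determined by \<open>T\<close> and the earlier
  coefficients. This allows two determinants to be identified by comparing traces.\<close>

lemma fps_log_deriv_unique:
  fixes F G T :: "complex fps"
  assumes "fps_deriv F = - F * T" "fps_deriv G = - G * T" "fps_nth F 0 = fps_nth G 0"
  shows "F = G"
proof (rule fps_ext)
  fix n show "fps_nth F n = fps_nth G n"
  proof (induction n rule: less_induct)
    case (less n)
    show ?case
    proof (cases n)
      case (Suc m)
      have "(- F * T) $ m = (- G * T) $ m"
        unfolding fps_mult_nth using less Suc by (intro sum.cong HOL.refl) auto
      then have "fps_deriv F $ m = fps_deriv G $ m" using assms by metis
      then show ?thesis using Suc by (simp del: of_nat_Suc)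
    qed (use assms in simp)
  qed
qed

context minimal_type_matrix
begin

text \<open>Exact for every truncation by the list of eigenvalues, then passed to the limit
  coefficient by coefficient: uniform convergence near 0 takes care of the derivatives, the
  assumption on \<open>t\<close> of the traces.\<close>

lemma newton_identities:
  assumes t: "\<And>m. (\<lambda>N. mtrace N (mpow N A (Suc m))) \<longlonglongrightarrow> t (Suc m)"
  defines "F \<equiv> fps_expansion (fredholm_det A) 0"
  shows "fps_deriv F = - F * Abs_fps (\<lambda>m. t (Suc m))"
proof -
  define G where "G N = fps_expansion (fredholm_trunc A N) 0" for N
  have G: "fps_deriv (G N) = - G N * Abs_fps (\<lambda>m. mtrace N (mpow N A (Suc m)))" for N
  proof -
    obtain es where "length es = N" and es: "\<And>z. sdet {..<N} (\<lambda>i j. (if i = j then 1 else 0) + - z * A i j) = (\<Prod>e\<leftarrow>es. 1 - z * e)"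
      "\<And>m. mtrace N (mpow N A m) = (\<Sum>e\<leftarrow>es. e ^ m)"
      by (rule eigenvalues_exist[of N A]) blast
    have "fredholm_trunc A N = (\<lambda>z. \<Prod>e\<leftarrow>es. 1 - z * e)"
      by (rule ext) (simp only: fredholm_trunc_def es)
    then have "G N = (\<Prod>e\<leftarrow>es. 1 - fps_const e * fps_X)"
      using fps_nth_fps_expansion[OF prod_linear_fps(1)[of es]]
      by (simp add: G_def fps_expansion_def fps_eq_iff)
    then show ?thesis using prod_linear_fps(2)[of es] by (simp only: es(2))
  qed
  have lim: "(\<lambda>N. fps_nth (G N) n) \<longlonglongrightarrow> fps_nth F n" for n
  proof -
    have "(\<lambda>N. (deriv ^^ n) (fredholm_trunc A N) 0) \<longlonglongrightarrow> (deriv ^^ n) (fredholm_det A) 0"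
      by (rule higher_deriv_complex_uniform_limit[where A = "ball 0 1"])
         (auto intro!: always_eventually holomorphic_trunc uniform_limit_on_subset[OF uniform_limit_fredholm[of 1]])
    from tendsto_divide[OF this tendsto_const, of "fact n"] show ?thesis
      by (simp add: G_def F_def fps_expansion_def)
  qed
  show ?thesis
  proof (rule fps_ext)
    fix n
    have "(\<lambda>N. fps_nth (fps_deriv (G N)) n) \<longlonglongrightarrow> fps_nth (fps_deriv F) n"
      by (simp del: of_nat_Suc) (intro tendsto_intros lim)
    moreover have "(\<lambda>N. fps_nth (- G N * Abs_fps (\<lambda>m. mtrace N (mpow N A (Suc m)))) n)
        \<longlonglongrightarrow> fps_nth (- F * Abs_fps (\<lambda>m. t (Suc m))) n"
      unfolding fps_mult_nth fps_neg_nth fps_nth_Abs_fps by (intro tendsto_intros lim t)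
    ultimately show "fps_nth (fps_deriv F) n = fps_nth (- F * Abs_fps (\<lambda>m. t (Suc m))) n"
      unfolding G by (rule LIMSEQ_unique)
  qed
qed

end

section \<open>Symmetry of zeros and odd power sums\<close>

text \<open>The order 0 is allowed and means that \<open>w\<close> is not a zero. The cofactor is
  entire, so that factors at several points can be split off one after the other.\<close>

definition has_root_order :: "(complex \<Rightarrow> complex) \<Rightarrow> complex \<Rightarrow> nat \<Rightarrow> bool"
  where "has_root_order D w d \<longleftrightarrow>
    (\<exists>E. E holomorphic_on UNIV \<and> E w \<noteq> 0 \<and> (\<forall>z. D z = (z - w) ^ d * E z))"

lemma has_root_order_unique:
  assumes "has_root_order D w d" "has_root_order D w d'"
  shows "d = d'"
proof -
  have *: "False" if "d < d'" "E holomorphic_on UNIV" "E w \<noteq> 0" "\<And>z. D z = (z - w) ^ d * E z"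
    "E' holomorphic_on UNIV" "\<And>z. D z = (z - w) ^ d' * E' z" for d d' E E'
  proof -
    have eq: "E z = (z - w) ^ (d' - d) * E' z" if "z \<noteq> w" for z
    proof -
      have "(z - w) ^ d * E z = (z - w) ^ (d + (d' - d)) * E' z"
        using \<open>d < d'\<close> \<open>\<And>z. D z = (z - w) ^ d * E z\<close> \<open>\<And>z. D z = (z - w) ^ d' * E' z\<close> by (metis add_diff_inverse_nat less_asym)
      then show ?thesis using that by (simp add: power_add)
    qed
    have cont: "continuous (at w) E" "continuous (at w) E'"
      using that(2,5) by (meson UNIV_I holomorphic_on_imp_continuous_on continuous_on_eq_continuous_at open_UNIV)+
    have "((\<lambda>z. (z - w) ^ (d' - d) * E' z) \<longlongrightarrow> (w - w) ^ (d' - d) * E' w) (at w)"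
      using cont(2) unfolding continuous_at by (intro tendsto_intros)
    moreover have "(E \<longlongrightarrow> E w) (at w)" using cont(1) by (simp add: continuous_at)
    then have "((\<lambda>z. (z - w) ^ (d' - d) * E' z) \<longlongrightarrow> E w) (at w)"
      by (rule Lim_transform_eventually) (auto simp: eventually_at_filter eq intro!: always_eventually)
    ultimately have "E w = (w - w) ^ (d' - d) * E' w"
      using tendsto_unique[OF at_neq_bot] by blast
    then show False using that(1,3) by simp
  qed
  show ?thesis
    using assms *[of d d'] *[of d' d] unfolding has_root_order_def by (metis linorder_neqE_nat)
qed

text \<open>The local factorization at \<open>w\<close> and the quotient away from \<open>w\<close>
  agree on the overlap, so the cofactor is entire. The value at \<open>z0\<close> excludes the zero
  function.\<close>

lemma has_root_order_exists:
  assumes D: "D holomorphic_on UNIV" and nz: "D z0 \<noteq> 0"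
  shows "\<exists>d. has_root_order D w d"
proof -
  define g where "g = zor_poly D w"
  define n where "n = nat (zorder D w)"
  from zorder_exist_zero[OF D open_UNIV connected_UNIV UNIV_I[of w]] nz
  obtain r where r: "r > 0" "g holomorphic_on cball w r"
    "\<And>z. z \<in> cball w r \<Longrightarrow> D z = g z * (z - w) ^ n \<and> g z \<noteq> 0"
    unfolding g_def n_def by blast
  define E where "E z = (if z = w then g w else D z / (z - w) ^ n)" for z
  have Eg: "E z = g z" if "z \<in> ball w r" for z
    using r(3)[of z] that by (auto simp: E_def)
  have "E holomorphic_on ball w r"
    using r(2) by (rule holomorphic_transform[OF holomorphic_on_subset]) (auto simp: Eg)
  moreover have "E holomorphic_on - {w}"
    by (rule holomorphic_transform[of "\<lambda>z. D z / (z - w) ^ n"])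
       (auto intro!: holomorphic_intros holomorphic_on_subset[OF D] simp: E_def)
  ultimately have "E holomorphic_on ball w r \<union> - {w}"
    by (intro holomorphic_on_Un) auto
  moreover have "ball w r \<union> - {w} = UNIV" using r(1) by auto
  ultimately have "E holomorphic_on UNIV" by simp
  moreover have "E w \<noteq> 0" using r(1) r(3)[of w] by (simp add: E_def)
  moreover have "D z = (z - w) ^ n * E z" for z
    using r(1) r(3)[of w] by (auto simp: E_def)
  ultimately show ?thesis unfolding has_root_order_def by blast
qed

text \<open>Zeros are recorded by their reciprocals: the factors then equal 1 at the origin, and the
  entries of the list play the role of eigenvalues.\<close>

lemma factor_zeros:
  assumes Z: "finite Z" "0 \<notin> Z" and D: "D holomorphic_on UNIV" "D 0 = 1"
  shows "\<exists>es E. E holomorphic_on UNIV \<and> (\<forall>z. D z = (\<Prod>e\<leftarrow>es. 1 - z * e) * E z) \<and>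
    (\<forall>w\<in>Z. E w \<noteq> 0) \<and> set es \<subseteq> inverse ` Z"
  using Z
proof (induction Z rule: finite_induct)
  case empty
  show ?case using D by (intro exI[of _ "[]"] exI[of _ D]) auto
next
  case (insert w Z)
  then obtain es E where E: "E holomorphic_on UNIV" "\<And>z. D z = (\<Prod>e\<leftarrow>es. 1 - z * e) * E z"
    "\<And>w. w \<in> Z \<Longrightarrow> E w \<noteq> 0" "set es \<subseteq> inverse ` Z" by auto
  have w: "w \<noteq> 0" using insert by auto
  have E0: "E 0 \<noteq> 0" using E(2)[of 0] D(2) by auto
  obtain d E' where E': "E' holomorphic_on UNIV" "E' w \<noteq> 0" "\<And>z. E z = (z - w) ^ d * E' z"
    using has_root_order_exists[OF E(1) E0, of w] unfolding has_root_order_def by blast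
  have "(z - w) ^ d = (1 - z * inverse w) ^ d * (- w) ^ d" for z
    using w by (simp add: power_mult_distrib[symmetric] field_simps)
  then have "D z = (\<Prod>e\<leftarrow>replicate d (inverse w) @ es. 1 - z * e) * ((- w) ^ d * E' z)" for z
    by (simp add: E(2) E'(3))
  moreover have "(\<lambda>z. (- w) ^ d * E' z) holomorphic_on UNIV"
    by (intro holomorphic_intros E')
  moreover have "(- w) ^ d * E' v \<noteq> 0" if "v \<in> insert w Z" for v
  proof (cases "v = w")
    case False
    then show ?thesis using that E(3)[of v] E'(3)[of v] w by auto
  qed (use w E' in simp)
  moreover have "set (replicate d (inverse w) @ es) \<subseteq> inverse ` insert w Z"
    using E(4) by auto
  ultimately show ?case
    by (intro exI[of _ "replicate d (inverse w) @ es"] exI[of _ "\<lambda>z. (- w) ^ d * E' z"]) blast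
qed

text \<open>Factors whose entry differs from 1/w do not vanish at \<open>w\<close>, so the exponent
  of z - w is exactly the multiplicity of 1/w in the list.\<close>

lemma has_root_order_count:
  assumes E: "E holomorphic_on UNIV" "\<And>z. D z = (\<Prod>e\<leftarrow>es. 1 - z * e) * E z" "E w \<noteq> 0" and w: "w \<noteq> 0"
  shows "has_root_order D w (count (mset es) (inverse w))"
proof -
  define G where "G z = (\<Prod>e\<leftarrow>filter (\<lambda>e. e \<noteq> inverse w) es. 1 - z * e) * (- inverse w) ^ count (mset es) (inverse w) * E z" for z
  have prod_split: "(\<Prod>e\<leftarrow>es. 1 - z * e) = (1 - z * inverse w) ^ count (mset es) (inverse w) *
      (\<Prod>e\<leftarrow>filter (\<lambda>e. e \<noteq> inverse w) es. 1 - z * e)" for z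
    by (induction es) auto
  have "1 - z * inverse w = (z - w) * (- inverse w)" for z using w by (simp add: field_simps)
  then have "D z = (z - w) ^ count (mset es) (inverse w) * G z" for z
    unfolding E(2) prod_split G_def by (simp only: power_mult_distrib mult_ac)
  moreover have "(\<lambda>z. \<Prod>e\<leftarrow>l. 1 - z * e) holomorphic_on UNIV" for l :: "complex list"
    by (induction l) (auto intro!: holomorphic_intros)
  then have "G holomorphic_on UNIV"
    unfolding G_def by (intro holomorphic_intros E(1))
  moreover have "(\<Prod>e\<leftarrow>filter (\<lambda>e. e \<noteq> inverse w) es. 1 - w * e) \<noteq> 0"
    using w by (auto simp: prod_list_zero_iff) (metis inverse_unique)
  then have "G w \<noteq> 0" using E(3) w by (simp add: G_def)
  ultimately show ?thesis unfolding has_root_order_def by blast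
qed

text \<open>Negation permutes the multiset of entries, so an odd power sum equals its own
  negative.\<close>

lemma sum_odd_powers_symmetric:
  fixes es :: "complex list"
  assumes "\<And>e. count (mset es) (- e) = count (mset es) e" and "odd m"
  shows "(\<Sum>e\<leftarrow>es. e ^ m) = 0"
proof -
  have sym: "mset es = image_mset uminus (mset es)"
  proof (rule multiset_eqI)
    fix x
    have "count (image_mset uminus A) x = count A (- x)" for A :: "complex multiset"
      by (induction A) (auto simp: equation_minus_iff)
    then show "count (mset es) x = count (image_mset uminus (mset es)) x" using assms(1) by simp
  qed
  have "(\<Sum>e\<leftarrow>es. e ^ m) = (\<Sum>e\<in>#mset es. e ^ m)" by (simp flip: sum_mset_sum_list)
  also have "\<dots> = (\<Sum>e\<in>#mset es. (- e) ^ m)"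
    by (subst sym) (simp add: image_mset.compositionality o_def)
  also have "(\<Sum>e\<in>#A. (- e) ^ m) = - (\<Sum>e\<in>#A. e ^ m)" for A :: "complex multiset"
    using \<open>odd m\<close> by (induction A) auto
  finally have "(\<Sum>e\<leftarrow>es. e ^ m) = - (\<Sum>e\<leftarrow>es. e ^ m)" by (simp flip: sum_mset_sum_list)
  then show ?thesis by simp
qed

text \<open>The Moebius map w / (2M - w) sends the half-plane Re w \<le> M into the closed unit disc
  and fixes 0. Schwarz's lemma bounds its value by 1/2 on the disc of half the radius, and solving
  for \<open>f\<close> gives 2M.\<close>

lemma Borel_Caratheodory_half:
  assumes f: "f holomorphic_on ball 0 R" and f0: "f 0 = 0" and R: "0 < R" and M: "0 < M"
    and re: "\<And>z. z \<in> ball 0 R \<Longrightarrow> Re (f z) \<le> M" and z: "cmod z \<le> R / 2"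
  shows "cmod (f z) \<le> 2 * M"
proof -
  define \<phi> where "\<phi> z = f (of_real R * z) / (2 * of_real M - f (of_real R * z))" for z
  have inb: "of_real R * z \<in> ball 0 R" if "cmod z < 1" for z :: complex
    using that R by (simp add: norm_mult)
  have nz: "2 * of_real M - f v \<noteq> 0" if "v \<in> ball 0 R" for v
  proof
    assume "2 * of_real M - f v = 0"
    then have "f v = of_real (2 * M)" by simp
    then have "Re (f v) = 2 * M" by simp
    with re[OF that] M show False by simp
  qed
  have le: "cmod (f v) \<le> cmod (2 * of_real M - f v)" if "v \<in> ball 0 R" for v
  proof -
    have "(2 * M - Re (f v))\<^sup>2 - (Re (f v))\<^sup>2 = 4 * M * (M - Re (f v))"
      by (simp add: power2_eq_square algebra_simps)
    also have "\<dots> \<ge> 0" using re[OF that] M by simp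
    finally show ?thesis unfolding cmod_def by simp
  qed
  have hol: "\<phi> holomorphic_on ball 0 1"
  proof -
    have "(\<lambda>z. f (of_real R * z)) holomorphic_on ball 0 1"
      by (rule holomorphic_on_compose_gen[OF _ f, unfolded o_def]) (auto intro!: holomorphic_intros inb)
    then show ?thesis unfolding \<phi>_def using nz inb by (intro holomorphic_intros) auto
  qed
  have le1: "cmod (\<phi> z) \<le> 1" if "cmod z < 1" for z
    using le[OF inb[OF that]] nz[OF inb[OF that]] by (simp add: \<phi>_def norm_divide divide_le_eq_1)
  \<comment> \<open>Schwarz's lemma wants a strict bound; modulus 1 at an interior point would make
    \<open>\<phi>\<close> constant, contradicting its value 0 at the origin.\<close>
  have lt1: "cmod (\<phi> z) < 1" if zb: "cmod z < 1" for z
  proof (rule ccontr)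
    assume "\<not> cmod (\<phi> z) < 1"
    then have "cmod (\<phi> z) = 1" using le1[OF zb] by simp
    then have "\<phi> constant_on ball 0 1"
      using le1 zb by (intro maximum_modulus_principle[OF hol, where U = "ball 0 1" and \<xi> = z]) auto
    then have "\<phi> z = \<phi> 0" using zb by (auto simp: constant_on_def)
    moreover have "\<phi> 0 = 0" by (simp add: \<phi>_def f0)
    ultimately show False using \<open>cmod (\<phi> z) = 1\<close> by simp
  qed
  define v where "v = z / of_real R"
  have v: "cmod v \<le> 1 / 2" using z R by (simp add: v_def norm_divide field_simps)
  have "cmod (\<phi> v) \<le> cmod v"
    using v by (intro Schwarz_Lemma(1)[OF hol _ lt1]) (auto simp: \<phi>_def f0)
  then have \<phi>v: "cmod (\<phi> v) \<le> 1 / 2" using v by simp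
  have fz: "f z = f (of_real R * v)" using R by (simp add: v_def)
  have "z \<in> ball 0 R" using z R by simp
  from nz[OF this] have eq: "f z = \<phi> v * (2 * of_real M - f z)"
    using R by (simp add: \<phi>_def v_def)
  have "cmod (f z) = cmod (\<phi> v) * cmod (2 * of_real M - f z)"
    by (subst eq) (simp add: norm_mult)
  also have "\<dots> \<le> 1 / 2 * (2 * M + cmod (f z))"
    using \<phi>v M norm_triangle_ineq4[of "2 * complex_of_real M" "f z"] by (intro mult_mono) auto
  finally show ?thesis by simp
qed

text \<open>The analytic side in isolation: \<open>D\<close> and the numbers \<open>t\<close> are
  linked only by Newton's identities.\<close>

locale minimal_type_entire =
  fixes D :: "complex \<Rightarrow> complex" and t :: "nat \<Rightarrow> complex"
  assumes hol: "D holomorphic_on UNIV" and D0: "D 0 = 1"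
    and growth: "\<And>\<delta>. 0 < \<delta> \<Longrightarrow> \<exists>C. \<forall>z. cmod (D z) \<le> C * exp (\<delta> * cmod z)"
    and newton: "fps_deriv (fps_expansion D 0) = - fps_expansion D 0 * Abs_fps (\<lambda>m. t (Suc m))"
begin

lemma expansion: "D has_fps_expansion fps_expansion D 0"
  by (rule has_fps_expansion_fps_expansion[of UNIV]) (auto intro: hol)

lemma eval_expansion: "eval_fps (fps_expansion D 0) z = D z"
  by (rule has_fps_expansion_imp_eval_fps_eq[OF expansion, of _ "cmod z + 1"])
     (auto intro: holomorphic_on_subset[OF hol])

text \<open>In the recursion for an odd coefficient, the index of the earlier coefficient and that
  of the trace add up to an odd number. One of them is odd, so every term vanishes by
  induction.\<close>

lemma even_if_odd_traces_vanish:
  assumes "\<And>m. odd m \<Longrightarrow> t m = 0"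
  shows "D (- z) = D z"
proof -
  define F where "F = fps_expansion D 0"
  have odd0: "fps_nth F n = 0" if "odd n" for n
    using that
  proof (induction n rule: less_induct)
    case (less n)
    then obtain m where m: "n = Suc m" by (cases n) auto
    have "of_nat (Suc m) * fps_nth F (Suc m) = fps_nth (fps_deriv F) m" by simp
    also have "\<dots> = (\<Sum>i=0..m. - fps_nth F i * t (Suc (m - i)))"
      unfolding F_def newton by (simp add: fps_mult_nth sum_negf)
    also have "\<dots> = 0"
    proof (rule sum.neutral, rule ballI)
      fix i assume i: "i \<in> {0..m}"
      show "- fps_nth F i * t (Suc (m - i)) = 0"
      proof (cases "odd i")
        case True
        then show ?thesis using less.IH[of i] i m by simp
      next
        case False
        then have "odd (Suc (m - i))" using i m less.prems by auto
        then show ?thesis using assms by simp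
      qed
    qed
    finally show ?case using m by (simp del: of_nat_Suc)
  qed
  have "(\<lambda>n. fps_nth F n * (- z) ^ n) = (\<lambda>n. fps_nth F n * z ^ n)"
  proof
    fix n show "fps_nth F n * (- z) ^ n = fps_nth F n * z ^ n"
      using odd0[of n] by (cases "odd n") (auto simp: uminus_power_if)
  qed
  then show ?thesis
    using eval_expansion[of z] eval_expansion[of "- z"] by (simp add: eval_fps_def F_def)
qed

text \<open>Three radii are at work: zeros are removed up to \<open>R\<close>, the quotient is
  estimated on the circle of radius 2R, and its logarithm is controlled on radius R/2, where
  Cauchy's estimate is applied.\<close>

lemma traces_approx:
  assumes sym: "\<And>w d. w \<noteq> 0 \<Longrightarrow> has_root_order D w d \<Longrightarrow> has_root_order D (- w) d"
    and \<delta>: "0 < \<delta>" and C: "1 \<le> C" "\<And>z. cmod (D z) \<le> C * exp (\<delta> * cmod z)"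
    and R: "0 < R" and m: "odd (Suc m)"
  shows "cmod (t (Suc m)) \<le> real (Suc m) * (2 * (ln C + \<delta> * (2 * R))) / (R / 2) ^ Suc m"
proof -
  define Z where "Z = {w \<in> cball 0 R. D w = 0}"
  have "\<not> D constant_on UNIV \<or> Z = {}"
    using D0 by (auto simp: constant_on_def Z_def)
  then have finZ: "finite Z"
  proof
    assume "\<not> D constant_on UNIV"
    then show ?thesis unfolding Z_def
      by (rule holomorphic_compact_finite_zeros[OF hol open_UNIV connected_UNIV compact_cball subset_UNIV])
  qed simp
  have Z0: "0 \<notin> Z" using D0 by (simp add: Z_def)
  obtain es E where E: "E holomorphic_on UNIV" "\<And>z. D z = (\<Prod>e\<leftarrow>es. 1 - z * e) * E z"
    "\<And>w. w \<in> Z \<Longrightarrow> E w \<noteq> 0" "set es \<subseteq> inverse ` Z"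
    using factor_zeros[OF finZ Z0 hol D0] by blast
  have E_nz: "E w \<noteq> 0" if "w \<in> cball 0 R" for w
    using E(3)[of w] E(2)[of w] that by (cases "w \<in> Z") (auto simp: Z_def)
  have E0: "E 0 = 1" using E(2)[of 0] D0 by (simp add: map_replicate_const)
  have ord: "has_root_order D w (count (mset es) (inverse w))" if "w \<in> cball 0 R" "w \<noteq> 0" for w
    by (rule has_root_order_count[OF E(1,2) E_nz]) (use that in auto)
  \<comment> \<open>The closed disc is symmetric. Either the reciprocals of both \<open>e\<close>
    and \<open>- e\<close> lie in it, where counts are root orders, or neither entry occurs in
    \<open>es\<close>.\<close>
  have "count (mset es) (- e) = count (mset es) e" for e
  proof (cases "e \<noteq> 0 \<and> inverse e \<in> cball 0 R")
    case True
    then have "has_root_order D (inverse e) (count (mset es) e)"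
      "has_root_order D (- inverse e) (count (mset es) (- e))"
      using ord[of "inverse e"] ord[of "- inverse e"] by auto
    moreover from this(1) have "has_root_order D (- inverse e) (count (mset es) e)"
      using sym True by simp
    ultimately show ?thesis using has_root_order_unique by blast
  next
    case False
    have notin: "x \<notin> set es" if "\<not> (x \<noteq> 0 \<and> inverse x \<in> cball 0 R)" for x
      using that E(4) Z0 by (auto simp: Z_def)
    have "e \<notin> set es" "- e \<notin> set es" using notin[of e] notin[of "- e"] False by auto
    then show ?thesis by (simp add: count_eq_zero_iff[THEN iffD2])
  qed
  then have pow0: "(\<Sum>e\<leftarrow>es. e ^ Suc m) = 0"
    by (rule sum_odd_powers_symmetric) (rule m)
  define M where "M = ln C + \<delta> * (2 * R)"
  have M: "0 < M" using C(1) \<delta> R by (simp add: M_def add_nonneg_pos)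
  \<comment> \<open>On the circle of radius 2R every quotient z/w has modulus at least 2, so each
    factor has modulus at least 1 and dividing by the product does not increase the modulus of
    \<open>D\<close>.\<close>
  have prod_ge: "1 \<le> cmod (\<Prod>e\<leftarrow>es. 1 - z * e)" if z: "cmod z = 2 * R" for z
    using E(4)
  proof (induction es)
    case (Cons e es)
    have "e \<in> inverse ` Z" using Cons by simp
    then obtain w where w: "w \<in> Z" "e = inverse w" by blast
    then have w0: "w \<noteq> 0" "cmod w \<le> R" using Z0 by (metis, simp add: Z_def)
    have "cmod (z * e) = 2 * R / cmod w" by (simp add: w norm_mult norm_inverse z divide_inverse)
    also have "\<dots> \<ge> 2" using w0 by (simp add: le_divide_eq)
    finally have "2 \<le> cmod (z * e)" .
    then have "1 \<le> cmod (1 - z * e)"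
      using norm_triangle_ineq2[of "z * e" 1] by (simp add: norm_minus_commute)
    then show ?case using Cons mult_mono[of 1 "cmod (1 - z * e)" 1] by (simp add: norm_mult)
  qed simp
  have bdry: "cmod (E z) \<le> exp M" if z: "cmod z = 2 * R" for z
  proof -
    have "1 * cmod (E z) \<le> cmod (\<Prod>e\<leftarrow>es. 1 - z * e) * cmod (E z)"
      using prod_ge[OF z] by (intro mult_right_mono) auto
    also have "\<dots> = cmod (D z)" by (simp add: E(2) norm_mult)
    also have "\<dots> \<le> C * exp (\<delta> * (2 * R))" using C(2)[of z] z by simp
    also have "\<dots> = exp M" using C(1) by (simp add: M_def exp_add)
    finally show ?thesis by simp
  qed
  have E_le: "cmod (E z) \<le> exp M" if "z \<in> ball 0 R" for z
    by (rule maximum_modulus_frontier[of E "cball 0 (2 * R)"])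
       (use that R bdry in \<open>auto intro: holomorphic_on_subset[OF E(1)]
          intro!: holomorphic_on_imp_continuous_on holomorphic_on_subset[OF E(1)] simp: frontier_cball\<close>)
  have "simply_connected (ball (0::complex) R)" by (simp add: convex_imp_simply_connected)
  then obtain g where g: "g holomorphic_on ball 0 R" "\<And>z. z \<in> ball 0 R \<Longrightarrow> E z = exp (g z)"
    unfolding simply_connected_eq_holomorphic_log[OF open_ball]
    using E_nz holomorphic_on_subset[OF E(1)] by (metis ball_subset_cball subsetD subset_UNIV)
  define f where "f z = g z - g 0" for z
  have f: "f holomorphic_on ball 0 R" unfolding f_def by (intro holomorphic_intros g)
  have f0: "f 0 = 0" by (simp add: f_def)
  have Ef: "E z = exp (f z)" if "z \<in> ball 0 R" for z
    using g(2)[OF that] g(2)[of 0] R E0 by (simp add: f_def exp_diff)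
  have re: "Re (f z) \<le> M" if "z \<in> ball 0 R" for z
    using E_le[OF that] Ef[OF that] by simp
  have f_le: "cmod (f z) \<le> 2 * M" if "cmod z \<le> R / 2" for z
    by (rule Borel_Caratheodory_half[OF f f0 R M re that])
  define \<Phi> where "\<Phi> = fps_expansion f 0"
  have \<Phi>: "f has_fps_expansion \<Phi>"
    unfolding \<Phi>_def by (rule has_fps_expansion_fps_expansion[of "ball 0 R"]) (use f R in auto)
  define G where "G = (\<Prod>e\<leftarrow>es. 1 - fps_const e * fps_X)"
  define S where "S = Abs_fps (\<lambda>m. \<Sum>e\<leftarrow>es. e ^ Suc m)"
  define T where "T = Abs_fps (\<lambda>m. t (Suc m))"
  define H where "H = fps_expansion E 0"
  have H: "E has_fps_expansion H"
    unfolding H_def by (rule has_fps_expansion_fps_expansion[of UNIV]) (use E in auto)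
  have dH: "fps_deriv H = fps_deriv \<Phi> * H"
  proof -
    have "deriv E has_fps_expansion fps_deriv H" by (intro fps_expansion_intros H)
    moreover have "(\<lambda>z. deriv f z * E z) has_fps_expansion fps_deriv \<Phi> * H"
      by (intro fps_expansion_intros H \<Phi>)
    moreover have ev: "eventually (\<lambda>z. deriv E z = deriv f z * E z) (nhds 0)"
    proof -
      have "deriv E z = deriv f z * E z" if z: "z \<in> ball 0 R" for z
      proof -
        have "((\<lambda>z. exp (f z)) has_field_derivative exp (f z) * deriv f z) (at z)"
          using holomorphic_derivI[OF f open_ball z] by (auto intro!: derivative_eq_intros)
        then have "(E has_field_derivative exp (f z) * deriv f z) (at z)"
          by (rule has_field_derivative_transform_within_open[OF _ open_ball z]) (simp add: Ef)
        then show ?thesis using Ef[OF z] by (simp add: DERIV_imp_deriv mult.commute)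
      qed
      then show ?thesis using R by (intro eventually_nhds_in_open[THEN eventually_mono, of "ball 0 R"]) auto
    qed
    moreover from ev have "deriv E has_fps_expansion fps_deriv \<Phi> * H \<longleftrightarrow> (\<lambda>z. deriv f z * E z) has_fps_expansion fps_deriv \<Phi> * H"
      by (rule has_fps_expansion_cong) simp
    ultimately show ?thesis
      using fps_expansion_unique_complex[of "deriv E"] by simp
  qed
  have F: "fps_expansion D 0 = G * H"
  proof -
    have "(\<lambda>z. (\<Prod>e\<leftarrow>es. 1 - z * e) * E z) has_fps_expansion G * H"
      unfolding G_def by (intro has_fps_expansion_mult prod_linear_fps(1) H)
    moreover have "(\<lambda>z. (\<Prod>e\<leftarrow>es. 1 - z * e) * E z) = D" using E(2) by (intro ext) simp
    ultimately have "D has_fps_expansion G * H" by simp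
    then show ?thesis using expansion fps_expansion_unique_complex by blast
  qed
  have dG: "fps_deriv G = - G * S" unfolding G_def S_def by (rule prod_linear_fps(2))
  \<comment> \<open>Logarithmic derivative of D = G H: the removed zeros give \<open>S\<close>, the
    logarithm \<open>f\<close> of \<open>E\<close> gives \<open>fps_deriv \<Phi>\<close>. Comparison
    with Newton's identities yields \<open>T = S - fps_deriv \<Phi>\<close>.\<close>
  have "fps_deriv (G * H) = - (G * H) * (S - fps_deriv \<Phi>)"
    unfolding fps_deriv_mult dG dH by (simp add: algebra_simps)
  then have "(G * H) * (S - fps_deriv \<Phi>) = (G * H) * T"
    using newton unfolding F T_def[symmetric] by (metis minus_mult_left neg_equal_iff_equal)
  moreover have "fps_nth (G * H) 0 = 1"
    using F D0 by (simp add: fps_expansion_def flip: F)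
  then have "G * H \<noteq> 0" by auto
  ultimately have "S - fps_deriv \<Phi> = T" by (metis mult_left_cancel)
  then have "fps_nth (S - fps_deriv \<Phi>) m = fps_nth T m" by simp
  then have "t (Suc m) = - of_nat (Suc m) * fps_nth \<Phi> (Suc m)"
    using pow0 by (simp add: S_def T_def del: of_nat_Suc power_Suc)
  then have tm: "cmod (t (Suc m)) = real (Suc m) * cmod (fps_nth \<Phi> (Suc m))"
    by (simp add: norm_mult del: of_nat_Suc)
  have "cmod ((deriv ^^ Suc m) f 0) \<le> fact (Suc m) * (2 * M) / (R / 2) ^ Suc m"
  proof (rule Cauchy_inequality)
    show "f holomorphic_on ball 0 (R / 2)" by (rule holomorphic_on_subset[OF f]) (use R in auto)
    show "continuous_on (cball 0 (R / 2)) f"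
      by (rule holomorphic_on_imp_continuous_on, rule holomorphic_on_subset[OF f]) (use R in auto)
  qed (use R f_le in auto)
  then have "cmod (fps_nth \<Phi> (Suc m)) \<le> 2 * M / (R / 2) ^ Suc m"
    by (simp add: \<Phi>_def fps_expansion_def norm_divide field_simps del: fact_Suc power_Suc)
  then show ?thesis unfolding tm M_def[symmetric] using mult_left_mono[of _ _ "real (Suc m)"]
    by (metis of_nat_0_le_iff times_divide_eq_right)
qed

lemma odd_traces_vanish:
  assumes sym: "\<And>w d. w \<noteq> 0 \<Longrightarrow> has_root_order D w d \<Longrightarrow> has_root_order D (- w) d" and m: "odd m"
  shows "t m = 0"
proof -
  obtain k where k: "m = Suc k" using m by (cases m) auto
  have "cmod (t (Suc k)) \<le> e" if e: "e > 0" for e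
  proof -
    \<comment> \<open>Fixed before \<open>R\<close>: for R \<ge> 2 the bound of
      \<open>traces_approx\<close> is at most a quantity tending to 8 \<delta> (k + 1) as R grows,
      and this choice keeps that limit at most e/2.\<close>
    define \<delta> where "\<delta> = e / (16 * 2 ^ k * real (Suc k))"
    have \<delta>: "\<delta> > 0" using e by (simp add: \<delta>_def)
    obtain C0 where C0: "\<And>z. cmod (D z) \<le> C0 * exp (\<delta> * cmod z)" using growth[OF \<delta>] by blast
    define C where "C = max 1 C0"
    have C: "1 \<le> C" "\<And>z. cmod (D z) \<le> C * exp (\<delta> * cmod z)"
    proof -
      fix z show "cmod (D z) \<le> C * exp (\<delta> * cmod z)"
        by (rule order_trans[OF C0]) (simp add: C_def)
    qed (simp add: C_def)
    define b where "b R = real (Suc k) * (2 * (ln C + \<delta> * (2 * R))) / (R / 2) ^ Suc k" for R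
    have "((\<lambda>R. (2 * real (Suc k) * ln C) * (2 / R) + 8 * \<delta> * real (Suc k)) \<longlongrightarrow> (2 * real (Suc k) * ln C) * 0 + 8 * \<delta> * real (Suc k)) at_top"
      by (intro tendsto_intros) real_asymp
    then have "eventually (\<lambda>R. (2 * real (Suc k) * ln C) * (2 / R) + 8 * \<delta> * real (Suc k) < e) at_top"
    proof (rule order_tendstoD(2))
      have "1 \<le> (2::real) ^ k" by simp
      have "8 * \<delta> * real (Suc k) = e / (2 * 2 ^ k)" by (simp add: \<delta>_def field_simps del: of_nat_Suc)
      also have "\<dots> \<le> e / 2" using e \<open>1 \<le> 2 ^ k\<close> by (intro divide_left_mono) auto
      finally show "2 * real (Suc k) * ln C * 0 + 8 * \<delta> * real (Suc k) < e" using e by simp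
    qed
    then have "eventually (\<lambda>R. R \<ge> 2 \<and> (2 * real (Suc k) * ln C) * (2 / R) + 8 * \<delta> * real (Suc k) < e) at_top"
      using eventually_ge_at_top[of 2] by eventually_elim auto
    then have "\<exists>R. R \<ge> 2 \<and> (2 * real (Suc k) * ln C) * (2 / R) + 8 * \<delta> * real (Suc k) < e"
      by (rule eventually_happens'[OF trivial_limit_at_top_linorder])
    then obtain R where R: "R \<ge> 2" "(2 * real (Suc k) * ln C) * (2 / R) + 8 * \<delta> * real (Suc k) < e" by blast
    have "cmod (t (Suc k)) \<le> real (Suc k) * (2 * (ln C + \<delta> * (2 * R))) / (R / 2) ^ Suc k"
      by (rule traces_approx[OF sym \<delta> C]) (use R m k in auto)
    also have "\<dots> \<le> real (Suc k) * (2 * (ln C + \<delta> * (2 * R))) / (R / 2)"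
    proof (rule divide_left_mono)
      show "R / 2 \<le> (R / 2) ^ Suc k" using R by (simp add: self_le_power)
      show "0 \<le> real (Suc k) * (2 * (ln C + \<delta> * (2 * R)))" using C \<delta> R by simp
    qed (use R in auto)
    also have "\<dots> = (2 * real (Suc k) * ln C) * (2 / R) + 8 * \<delta> * real (Suc k)"
      using R by (simp add: field_simps)
    finally show ?thesis using R by simp
  qed
  then have "cmod (t (Suc k)) \<le> 0" by (metis field_le_epsilon add_0)
  then show ?thesis using k by simp
qed

end

section \<open>The algebra of nuclear tensors\<close>

type_synonym 'a otensor = "('a cdual, 'a) ptensor"

lemma bounded_clinear_mult_left: "bounded_clinear (\<lambda>u. ptensor_mult u v)"
  unfolding ptensor_mult_eq by (rule ptensor_lift(1)[OF bounded_cbilinear_mult_outer])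

lemma ptensor_mult_elem_left:
  "ptensor_mult (ptensor_elem f x) v = ptensor_lift (mult_kernel f x) v"
  unfolding ptensor_mult_eq by (rule ptensor_lift(2)[OF bounded_cbilinear_mult_outer])

lemma norm_ptensor_mult_le:
  fixes u v :: "'a::complex_banach otensor"
  shows "norm (ptensor_mult u v) \<le> norm u * norm v"
proof -
  have "norm (ptensor_mult u v) \<le> norm v * norm u"
    unfolding ptensor_mult_eq
  proof (rule norm_ptensor_lift_le[OF bounded_cbilinear_mult_outer])
    show "norm (ptensor_lift (mult_kernel f x) v) \<le> norm f * norm x * norm v" for f and x :: 'a
      by (rule norm_ptensor_lift_le[OF bounded_cbilinear_mult_inner norm_mult_kernel_le]) simp
  qed simp
  then show ?thesis by (simp add: mult.commute)
qed

lemma bounded_clinear_mult_elem_left: "bounded_clinear (\<lambda>v. ptensor_mult (ptensor_elem f x) v)"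
  unfolding ptensor_mult_elem_left by (rule ptensor_lift(1)[OF bounded_cbilinear_mult_inner])

lemma bounded_clinearD:
  assumes "bounded_clinear F"
  shows "bounded_linear F" "F (x + y) = F x + F y" "F (c *\<^sub>C x) = c *\<^sub>C F x" "F (x - y) = F x - F y" "F 0 = 0"
    "F (sum g I) = (\<Sum>i\<in>I. F (g i))"
proof -
  show bl: "bounded_linear F" using assms by (simp add: bounded_clinear_def)
  interpret bounded_linear F by (rule bl)
  show "F (x + y) = F x + F y" "F (x - y) = F x - F y" "F 0 = 0" "F (sum g I) = (\<Sum>i\<in>I. F (g i))"
    by (rule add diff zero sum)+
  show "F (c *\<^sub>C x) = c *\<^sub>C F x" using assms by (simp add: bounded_clinear_def)
qed

lemma bounded_clinear_ident: "bounded_clinear (\<lambda>x. x)"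
  by (simp add: bounded_clinear_def bounded_linear_ident)

lemma bounded_clinear_compose:
  "bounded_clinear F \<Longrightarrow> bounded_clinear G \<Longrightarrow> bounded_clinear (\<lambda>x. F (G x))"
  by (simp add: bounded_clinear_def bounded_linear_compose)

text \<open>The definition makes linearity visible only in the outer argument \<open>u\<close>. Both
  sides are bounded and linear in \<open>u\<close>, so comparing them on elementary tensors is
  enough; associativity and the trace identity are proved by the same extension argument.\<close>

lemma ptensor_mult_linear_right:
  fixes u v w :: "'a::complex_banach otensor"
  shows "ptensor_mult u (v + w) = ptensor_mult u v + ptensor_mult u w"
    and "ptensor_mult u (c *\<^sub>C v) = c *\<^sub>C ptensor_mult u v"
proof -
  have "(\<lambda>u. ptensor_mult u (v + w)) = (\<lambda>u. ptensor_mult u v + ptensor_mult u w)"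
    by (rule ptensor_ext)
       (auto intro!: bounded_clinear_add bounded_clinear_mult_left
          simp: bounded_clinearD(2)[OF bounded_clinear_mult_elem_left])
  then show "ptensor_mult u (v + w) = ptensor_mult u v + ptensor_mult u w" by (rule fun_cong)
  have "(\<lambda>u. ptensor_mult u (c *\<^sub>C v)) = (\<lambda>u. c *\<^sub>C ptensor_mult u v)"
    by (rule ptensor_ext)
       (auto intro!: bounded_clinear_scaleC bounded_clinear_mult_left
          simp: bounded_clinearD(3)[OF bounded_clinear_mult_elem_left])
  then show "ptensor_mult u (c *\<^sub>C v) = c *\<^sub>C ptensor_mult u v" by (rule fun_cong)
qed

lemma bounded_clinear_mult_right:
  fixes u :: "'a::complex_banach otensor"
  shows "bounded_clinear (\<lambda>v. ptensor_mult u v)"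
proof -
  have "bounded_linear (\<lambda>v. ptensor_mult u v)"
  proof (rule bounded_linear_intro)
    show "ptensor_mult u (r *\<^sub>R v) = r *\<^sub>R ptensor_mult u v" for r v
      using ptensor_mult_linear_right(2)[of u "complex_of_real r" v] by (simp add: scaleC_of_real)
    show "norm (ptensor_mult u v) \<le> norm v * norm u" for v
      using norm_ptensor_mult_le[of u v] by (simp add: mult.commute)
  qed (rule ptensor_mult_linear_right)
  then show ?thesis by (simp add: bounded_clinear_def ptensor_mult_linear_right)
qed

lemmas ptensor_mult_simps =
  bounded_clinearD(2-6)[OF bounded_clinear_mult_left]
  bounded_clinearD(2-6)[OF bounded_clinear_mult_right]

lemma tendsto_ptensor_mult:
  fixes X Y :: "nat \<Rightarrow> 'a::complex_banach otensor"
  assumes "X \<longlonglongrightarrow> u" "Y \<longlonglongrightarrow> v"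
  shows "(\<lambda>n. ptensor_mult (X n) (Y n)) \<longlonglongrightarrow> ptensor_mult u v"
proof -
  have "bounded_bilinear (ptensor_mult :: 'a otensor \<Rightarrow> _)"
  proof
    show "ptensor_mult (r *\<^sub>R u) v = r *\<^sub>R ptensor_mult u v"
      "ptensor_mult u (r *\<^sub>R v) = r *\<^sub>R ptensor_mult u v" for r and u v :: "'a otensor"
      using ptensor_mult_simps(2)[of "complex_of_real r" u v] ptensor_mult_simps(7)[of u "complex_of_real r" v]
      by (simp_all add: scaleC_of_real)
    show "\<exists>K. \<forall>u v :: 'a otensor. norm (ptensor_mult u v) \<le> norm u * norm v * K"
      by (intro exI[of _ 1] allI) (simp add: norm_ptensor_mult_le)
  qed (simp_all add: ptensor_mult_simps)
  then show ?thesis using assms by (rule bounded_bilinear.tendsto)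
qed

lemma ptensor_mult_assoc:
  fixes u v w :: "'a::complex_banach otensor"
  shows "ptensor_mult (ptensor_mult u v) w = ptensor_mult u (ptensor_mult v w)"
proof -
  note cl = bounded_clinear_mult_left bounded_clinear_mult_right
  have cl1: "bounded_clinear (\<lambda>u. ptensor_mult (ptensor_mult u v) w)" "bounded_clinear (\<lambda>v. ptensor_mult (ptensor_mult u v) w)"
    "bounded_clinear (\<lambda>u. ptensor_mult u (ptensor_mult v w))" "bounded_clinear (\<lambda>v. ptensor_mult u (ptensor_mult v w))"
    "bounded_clinear (\<lambda>w. ptensor_mult u (ptensor_mult v w))" for u v w :: "'a otensor"
    using bounded_clinear_compose[OF cl(1) cl(1)] bounded_clinear_compose[OF cl(1) cl(2)]
      bounded_clinear_compose[OF cl(2) cl(1)] bounded_clinear_compose[OF cl(2) cl(2)] cl(1) by blast+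
  have "(\<lambda>u. ptensor_mult (ptensor_mult u v) w) = (\<lambda>u. ptensor_mult u (ptensor_mult v w))"
  proof (rule ptensor_ext[OF cl1(1) cl1(3)])
    fix f :: "'a cdual" and x
    have "(\<lambda>v. ptensor_mult (ptensor_mult (ptensor_elem f x) v) w) = (\<lambda>v. ptensor_mult (ptensor_elem f x) (ptensor_mult v w))"
    proof (rule ptensor_ext[OF cl1(2) cl1(4)])
      fix g :: "'a cdual" and y
      have "(\<lambda>w. ptensor_mult (ptensor_mult (ptensor_elem f x) (ptensor_elem g y)) w) =
        (\<lambda>w. ptensor_mult (ptensor_elem f x) (ptensor_mult (ptensor_elem g y) w))"
        by (rule ptensor_ext[OF cl(2) cl1(5)])
           (simp add: ptensor_mult_elem ptensor_mult_simps scaleC_scaleC mult.commute)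
      then show "ptensor_mult (ptensor_mult (ptensor_elem f x) (ptensor_elem g y)) w =
        ptensor_mult (ptensor_elem f x) (ptensor_mult (ptensor_elem g y) w)" by (rule fun_cong)
    qed
    then show "ptensor_mult (ptensor_mult (ptensor_elem f x) v) w = ptensor_mult (ptensor_elem f x) (ptensor_mult v w)"
      by (rule fun_cong)
  qed
  then show ?thesis by (rule fun_cong)
qed

lemma ptrace_mult_commute:
  fixes u v :: "'a::complex_banach otensor"
  shows "ptrace (ptensor_mult u v) = ptrace (ptensor_mult v u)"
proof -
  note cl = bounded_clinear_compose[OF bounded_clinear_ptrace bounded_clinear_mult_left]
    bounded_clinear_compose[OF bounded_clinear_ptrace bounded_clinear_mult_right]
  have "(\<lambda>u. ptrace (ptensor_mult u v)) = (\<lambda>u. ptrace (ptensor_mult v u))"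
  proof (rule ptensor_ext[OF cl])
    fix f :: "'a cdual" and x
    have "(\<lambda>v. ptrace (ptensor_mult (ptensor_elem f x) v)) = (\<lambda>v. ptrace (ptensor_mult v (ptensor_elem f x)))"
      by (rule ptensor_ext[OF cl(2) cl(1)])
         (simp add: ptensor_mult_elem bounded_clinearD(3)[OF bounded_clinear_ptrace] ptrace_elem scaleC_complex_def)
    then show "ptrace (ptensor_mult (ptensor_elem f x) v) = ptrace (ptensor_mult v (ptensor_elem f x))"
      by (rule fun_cong)
  qed
  then show ?thesis by (rule fun_cong)
qed

lemma ptrace_simps:
  "ptrace (u + v) = ptrace u + ptrace v" "ptrace (c *\<^sub>C u) = c * ptrace u"
  "ptrace (sum g I) = (\<Sum>i\<in>I. ptrace (g i))"
  using bounded_clinearD[OF bounded_clinear_ptrace] by (simp_all add: scaleC_complex_def)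

text \<open>The exponent is shifted: \<open>tpow u n\<close> is the power of exponent n + 1, since
  the algebra need not have a unit to start from.\<close>

definition tpow :: "'a::complex_banach otensor \<Rightarrow> nat \<Rightarrow> 'a otensor"
  where "tpow u n = (ptensor_mult u ^^ n) u"

lemma ptensor_power_eq_tpow: "ptensor_power u (Suc n) = tpow u n"
  by (simp add: ptensor_power_def tpow_def)

lemma tpow_simps: "tpow u 0 = u" "tpow u (Suc n) = ptensor_mult u (tpow u n)"
  by (simp_all add: tpow_def)

lemma tpow_Suc_right: "tpow u (Suc n) = ptensor_mult (tpow u n) u"
proof (induction n)
  case (Suc n)
  have "tpow u (Suc (Suc n)) = ptensor_mult u (ptensor_mult (tpow u n) u)"
    unfolding Suc[symmetric] by (rule tpow_simps(2))
  then show ?case by (simp add: ptensor_mult_assoc[symmetric] tpow_simps)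
qed (simp add: tpow_simps)

section \<open>Limits and traces of powers of tensors\<close>

lemma tendsto_tpow: "X \<longlonglongrightarrow> u \<Longrightarrow> (\<lambda>N. tpow (X N) n) \<longlonglongrightarrow> tpow u n"
  by (induction n) (auto simp: tpow_simps intro: tendsto_ptensor_mult)

lemma tendsto_ptrace: "X \<longlonglongrightarrow> u \<Longrightarrow> (\<lambda>N. ptrace (X N)) \<longlonglongrightarrow> ptrace u"
  using bounded_clinear_ptrace by (intro bounded_linear.tendsto[of ptrace]) (auto simp: bounded_clinear_def)

lemma tpow_mult_swap: "ptensor_mult x (tpow (ptensor_mult y x) n) = ptensor_mult (tpow (ptensor_mult x y) n) x"
  by (induction n) (simp_all add: tpow_simps ptensor_mult_assoc)

text \<open>The trace version of the fact that x y and y x share their nonzero spectrum. It will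
  replace the product of a projection tensor with \<open>u\<close> by the product in the other
  order, which is an explicit finite sum.\<close>

lemma ptrace_tpow_swap: "ptrace (tpow (ptensor_mult x y) n) = ptrace (tpow (ptensor_mult y x) n)"
proof (cases n)
  case 0
  then show ?thesis by (simp add: tpow_simps ptrace_mult_commute)
next
  case (Suc m)
  have "ptrace (tpow (ptensor_mult x y) (Suc m)) = ptrace (ptensor_mult (ptensor_mult (tpow (ptensor_mult x y) m) x) y)"
    by (simp add: tpow_Suc_right ptensor_mult_assoc)
  also have "\<dots> = ptrace (ptensor_mult (ptensor_mult x (tpow (ptensor_mult y x) m)) y)"
    by (simp only: tpow_mult_swap)
  also have "\<dots> = ptrace (ptensor_mult y (ptensor_mult x (tpow (ptensor_mult y x) m)))"
    by (rule ptrace_mult_commute)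
  also have "\<dots> = ptrace (tpow (ptensor_mult y x) (Suc m))"
    by (simp add: tpow_simps ptensor_mult_assoc)
  finally show ?thesis using Suc by simp
qed

text \<open>Every word in which \<open>v\<close> stands directly before \<open>a\<close> vanishes,
  as for block triangular matrices. So \<open>v\<close> on the left of a power of the sum leaves
  only the pure power of \<open>v\<close>, and \<open>a\<close> on the right only that of
  \<open>a\<close>; mixed words disappear after a cyclic shift under the trace.\<close>

lemma ptrace_tpow_add:
  assumes va: "ptensor_mult v a = 0"
  shows "ptrace (tpow (a + v) n) = ptrace (tpow a n) + ptrace (tpow v n)"
proof (cases n)
  case 0
  then show ?thesis by (simp add: tpow_simps ptrace_simps)
next
  case (Suc m)
  have L: "ptensor_mult v (tpow (a + v) k) = tpow v (Suc k)" for k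
  proof (induction k)
    case (Suc k)
    have "ptensor_mult v (tpow (a + v) (Suc k)) = ptensor_mult (ptensor_mult v (a + v)) (tpow (a + v) k)"
      by (simp add: tpow_simps ptensor_mult_assoc)
    also have "ptensor_mult v (a + v) = ptensor_mult v v" using va by (simp add: ptensor_mult_simps)
    finally show ?case using Suc by (simp add: ptensor_mult_assoc tpow_simps)
  qed (simp add: tpow_simps ptensor_mult_simps va)
  have R: "ptensor_mult (tpow (a + v) k) a = tpow a (Suc k)" for k
  proof (induction k)
    case (Suc k)
    have "ptensor_mult (tpow (a + v) (Suc k)) a = ptensor_mult (tpow (a + v) k) (ptensor_mult (a + v) a)"
      by (simp add: tpow_Suc_right ptensor_mult_assoc)
    also have "ptensor_mult (a + v) a = ptensor_mult a a" using va by (simp add: ptensor_mult_simps)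
    finally have "ptensor_mult (tpow (a + v) (Suc k)) a = ptensor_mult (ptensor_mult (tpow (a + v) k) a) a"
      by (simp add: ptensor_mult_assoc)
    then show ?case using Suc by (simp add: tpow_Suc_right)
  qed (simp add: tpow_simps ptensor_mult_simps va)
  have "tpow (a + v) (Suc m) = ptensor_mult a (tpow (a + v) m) + ptensor_mult v (tpow (a + v) m)"
    by (simp add: tpow_simps ptensor_mult_simps)
  then have "ptrace (tpow (a + v) (Suc m)) = ptrace (ptensor_mult (tpow (a + v) m) a) + ptrace (ptensor_mult v (tpow (a + v) m))"
    by (simp add: ptrace_simps ptrace_mult_commute[of a])
  then show ?thesis using Suc L R by simp
qed

text \<open>The product keeps the functional of the right factor and the vector of the left one.
  This is why the coefficient in row \<open>i\<close> and column \<open>j\<close> belongs to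
  \<open>f j\<close> and \<open>x i\<close>.\<close>

lemma tpow_finite_rank:
  fixes f :: "nat \<Rightarrow> 'a::complex_banach cdual" and x :: "nat \<Rightarrow> 'a"
  defines "A \<equiv> \<lambda>i j. cdual_apply (f i) (x j)"
  shows "tpow (\<Sum>k<N. ptensor_elem (f k) (x k)) n = (\<Sum>i<N. \<Sum>j<N. mpow N A n i j *\<^sub>C ptensor_elem (f j) (x i))"
proof (induction n)
  case 0
  have "(\<Sum>i<N. \<Sum>j<N. mpow N A 0 i j *\<^sub>C ptensor_elem (f j) (x i)) = (\<Sum>i<N. \<Sum>j<N. if i = j then ptensor_elem (f j) (x i) else 0)"
    by (intro sum.cong HOL.refl) auto
  then show ?case by (simp add: tpow_simps)
next
  case (Suc n)
  have "tpow (\<Sum>k<N. ptensor_elem (f k) (x k)) (Suc n) =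
      (\<Sum>i<N. \<Sum>j<N. \<Sum>k<N. (mpow N A n i j * A k i) *\<^sub>C ptensor_elem (f j) (x k))"
    by (simp add: tpow_simps Suc ptensor_mult_simps ptensor_mult_elem scaleC_scaleC A_def complex_vector.scale_sum_right)
  also have "\<dots> = (\<Sum>i<N. \<Sum>k<N. \<Sum>j<N. (mpow N A n i j * A k i) *\<^sub>C ptensor_elem (f j) (x k))"
    by (rule sum.cong[OF HOL.refl]) (rule sum.swap)
  also have "\<dots> = (\<Sum>k<N. \<Sum>i<N. \<Sum>j<N. (mpow N A n i j * A k i) *\<^sub>C ptensor_elem (f j) (x k))"
    by (rule sum.swap)
  also have "\<dots> = (\<Sum>k<N. \<Sum>j<N. \<Sum>i<N. (A k i * mpow N A n i j) *\<^sub>C ptensor_elem (f j) (x k))"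
    by (rule sum.cong[OF HOL.refl], subst sum.swap) (simp add: mult.commute)
  also have "\<dots> = (\<Sum>k<N. \<Sum>j<N. mpow N A (Suc n) k j *\<^sub>C ptensor_elem (f j) (x k))"
    by (simp add: complex_vector.scale_sum_left)
  finally show ?case .
qed

lemma ptrace_tpow_finite_rank:
  fixes f :: "nat \<Rightarrow> 'a::complex_banach cdual"
  shows "ptrace (tpow (\<Sum>k<N. ptensor_elem (f k) (x k)) n) = mtrace N (mpow N (\<lambda>i j. cdual_apply (f i) (x j)) (Suc n))"
  unfolding tpow_finite_rank mtrace_def
  by (simp add: ptrace_simps ptrace_elem, subst sum.swap) (simp add: mult.commute)

lemma ptensor_op_elem: "ptensor_op (ptensor_elem f x) y = cdual_apply f y *\<^sub>C x"
  unfolding ptensor_op_def by (rule ptensor_lift(2)[OF bounded_cbilinear_op_kernel])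

lemma bounded_clinear_op: "bounded_clinear (\<lambda>u. ptensor_op u y)"
  unfolding ptensor_op_def by (rule ptensor_lift(1)[OF bounded_cbilinear_op_kernel])

lemma bounded_clinear_elem_right:
  fixes f :: "'b::complex_normed_vector"
  shows "bounded_clinear (\<lambda>x :: 'a::complex_normed_vector. ptensor_elem f x)"
proof -
  have "bounded_bilinear (ptensor_elem :: 'b \<Rightarrow> 'a \<Rightarrow> _)"
    using bounded_cbilinear_ptensor_elem by (auto simp: bounded_cbilinear_def)
  from bounded_bilinear.bounded_linear_right[OF this] show ?thesis
    by (simp add: bounded_clinear_def ptensor_elem_linear)
qed

text \<open>The bridge between the algebra and the operator: multiplication from the left acts on
  the vector of an elementary tensor through the generated operator.\<close>

lemma ptensor_mult_elem_right:
  fixes u :: "'a::complex_banach otensor"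
  shows "ptensor_mult u (ptensor_elem g e) = ptensor_elem g (ptensor_op u e)"
proof -
  have "(\<lambda>u. ptensor_mult u (ptensor_elem g e)) = (\<lambda>u. ptensor_elem g (ptensor_op u e))"
    by (rule ptensor_ext[OF bounded_clinear_mult_left bounded_clinear_compose[OF bounded_clinear_elem_right bounded_clinear_op]])
       (simp add: ptensor_mult_elem ptensor_op_elem ptensor_elem_linear)
  then show ?thesis by (rule fun_cong)
qed

section \<open>Zeros of the determinant and eigenvalues\<close>

text \<open>Convergence forces the terms below 1 eventually, and there l \<le> l^s.\<close>

lemma summable_of_summable_powr:
  fixes l :: "nat \<Rightarrow> real"
  assumes s: "0 < s" "s \<le> 1" and l: "\<And>k. 0 \<le> l k" and summ: "summable (\<lambda>k. l k powr s)"
  shows "summable l"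
proof (rule summable_comparison_test_ev[OF _ summ])
  have "eventually (\<lambda>k. l k powr s < 1) sequentially"
    using summable_LIMSEQ_zero[OF summ] by (rule order_tendstoD) simp
  then show "eventually (\<lambda>k. norm (l k) \<le> l k powr s) sequentially"
  proof eventually_elim
    case (elim k)
    have "l k \<le> 1"
    proof (rule ccontr)
      assume "\<not> l k \<le> 1"
      then have "1 \<le> l k powr s" using s by (intro ge_one_powr_ge_zero) auto
      then show False using elim by simp
    qed
    then have "l k powr 1 \<le> l k powr s" if "l k \<noteq> 0"
      using that l[of k] s by (intro powr_mono') auto
    then show ?case using l[of k] by (cases "l k = 0") auto
  qed
qed

section \<open>Biorthogonal systems and spaces with a determinant bound\<close>

lemma cdual_apply_sum:
  "cdual_apply (\<Sum>i\<in>I. g i) y = (\<Sum>i\<in>I. cdual_apply (g i) y)"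
  "cdual_apply h (\<Sum>i\<in>I. e i) = (\<Sum>i\<in>I. cdual_apply h (e i))"
  "cdual_apply h (y - z) = cdual_apply h y - cdual_apply h z"
  "cdual_apply (h - h') y = cdual_apply h y - cdual_apply h' y"
  "cdual_apply h 0 = 0"
  "cdual_apply h (- y) = - cdual_apply h y"
proof -
  interpret bounded_bilinear cdual_apply
    using bounded_cbilinear_cdual_apply by (auto simp: bounded_cbilinear_def)
  show "cdual_apply (\<Sum>i\<in>I. g i) y = (\<Sum>i\<in>I. cdual_apply (g i) y)"
    "cdual_apply h (\<Sum>i\<in>I. e i) = (\<Sum>i\<in>I. cdual_apply h (e i))"
    "cdual_apply h (y - z) = cdual_apply h y - cdual_apply h z"
    "cdual_apply (h - h') y = cdual_apply h y - cdual_apply h' y"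
    "cdual_apply h 0 = 0" "cdual_apply h (- y) = - cdual_apply h y"
    by (rule sum_left sum_right diff_right diff_left zero_right minus_right)+
qed

text \<open>The functionals \<open>g i\<close> are linear combinations of the \<open>f k\<close>, so that no extension theorem on \<open>'y\<close> is needed.\<close>

lemma biorthogonal_system:
  fixes f :: "nat \<Rightarrow> 'y::complex_banach cdual"
  assumes "finite B" "complex_vector.independent B"
    and "\<And>y. y \<in> complex_vector.span B \<Longrightarrow> (\<And>k. cdual_apply (f k) y = 0) \<Longrightarrow> y = 0"
  shows "\<exists>e g. bij_betw e {..<card B} B \<and>
    (\<forall>i<card B. \<forall>j<card B. cdual_apply (g i) (e j) = (if i = j then 1 else 0))"
  using assms
proof (induction B rule: finite_induct)
  case empty
  show ?case by (simp add: bij_betw_def)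
next
  case (insert b B)
  have ind: "complex_vector.independent B" and b: "b \<notin> complex_vector.span B"
    using insert.prems(1) insert.hyps(2) by (auto simp: complex_vector.independent_insert)
  have "\<exists>e g. bij_betw e {..<card B} B \<and>
    (\<forall>i<card B. \<forall>j<card B. cdual_apply (g i) (e j) = (if i = j then 1 else 0))"
    using complex_vector.span_mono[of B "insert b B"]
    by (intro insert.IH[OF ind] insert.prems(2)) auto
  then obtain e g where e: "bij_betw e {..<card B} B"
    and g: "\<And>i j. i < card B \<Longrightarrow> j < card B \<Longrightarrow> cdual_apply (g i) (e j) = (if i = j then 1 else 0)" by blast
  define n where "n = card B"
  have eB: "e i \<in> B" if "i < n" for i using e that by (auto simp: bij_betw_def n_def)
  \<comment> \<open>The part of \<open>b\<close> not seen by the \<open>g i\<close>. It is nonzero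
    by independence, so some \<open>f k\<close> does not vanish on it; correcting that
    \<open>f k\<close> on the old vectors yields the new functional.\<close>
  define b' where "b' = b - (\<Sum>i<n. cdual_apply (g i) b *\<^sub>C e i)"
  have inB: "(\<Sum>i<n. cdual_apply (g i) b *\<^sub>C e i) \<in> complex_vector.span B"
    by (intro complex_vector.span_sum complex_vector.span_scale complex_vector.span_base eB) auto
  have "b' \<noteq> 0" using b inB by (auto simp: b'_def)
  moreover have "b' \<in> complex_vector.span (insert b B)"
    unfolding b'_def using subsetD[OF complex_vector.span_mono inB, of "insert b B"]
    by (intro complex_vector.span_diff[OF complex_vector.span_base]) auto
  ultimately obtain k where k: "cdual_apply (f k) b' \<noteq> 0" using insert.prems(2) by blast
  define h where "h = f k - (\<Sum>i<n. cdual_apply (f k) (e i) *\<^sub>C g i)"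
  have he: "cdual_apply h (e j) = 0" if "j < n" for j
  proof -
    have "(\<Sum>i<n. cdual_apply (f k) (e i) * cdual_apply (g i) (e j)) = (\<Sum>i<n. if i = j then cdual_apply (f k) (e i) else 0)"
      using that g by (intro sum.cong HOL.refl) (auto simp: n_def)
    then show ?thesis using that by (simp add: h_def cdual_apply_sum cdual_apply_simps)
  qed
  have hb: "cdual_apply h b = cdual_apply (f k) b'"
    by (simp add: h_def b'_def cdual_apply_sum cdual_apply_simps mult.commute)
  define gn where "gn = (1 / cdual_apply h b) *\<^sub>C h"
  define g' where "g' i = (if i < n then g i - cdual_apply (g i) b *\<^sub>C gn else gn)" for i
  define e' where "e' = e(n := b)"
  have gn: "cdual_apply gn (e j) = 0" if "j < n" for j
    using he[OF that] by (simp add: gn_def cdual_apply_simps)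
  have gnb: "cdual_apply gn b = 1" using k hb by (simp add: gn_def cdual_apply_simps)
  have card: "card (insert b B) = Suc n" using insert.hyps by (simp add: n_def)
  have "cdual_apply (g' i) (e' j) = (if i = j then 1 else 0)" if "i < Suc n" "j < Suc n" for i j
    using that g[of i j] gn[of j] gnb
    by (auto simp: g'_def e'_def less_Suc_eq cdual_apply_sum cdual_apply_simps n_def)
  moreover have "bij_betw e' {..<Suc n} (insert b B)"
  proof -
    have "bij_betw e' {..<n} B" using e by (subst bij_betw_cong[of _ _ e]) (auto simp: e'_def n_def)
    then have "bij_betw e' ({..<n} \<union> {n}) (B \<union> {e' n})"
      using insert.hyps by (subst notIn_Un_bij_betw3[symmetric]) (auto simp: e'_def)
    then show ?thesis by (simp add: e'_def lessThan_Suc)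
  qed
  ultimately show ?case unfolding card by blast
qed

text \<open>The form in which the geometry of the space enters the determinant theory. The exponent
  a = 0 corresponds to Hadamard's inequality in Hilbert space.\<close>

definition det_bounded_space :: "real \<Rightarrow> 'y::complex_banach itself \<Rightarrow> bool"
  where "det_bounded_space a Y \<longleftrightarrow> (\<forall>n (f :: nat \<Rightarrow> 'y cdual) x.
    cmod (sdet {..<n} (\<lambda>i j. cdual_apply (f i) (x j))) \<le>
      hadamard_const a n * ((\<Prod>i<n. norm (f i)) * (\<Prod>i<n. norm (x i))))"

lemma det_bounded_space_finite:
  fixes f :: "nat \<Rightarrow> 'y::complex_banach cdual"
  assumes "det_bounded_space a TYPE('y)" "finite S"
  shows "cmod (sdet S (\<lambda>i j. cdual_apply (f i) (x j))) \<le>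
    hadamard_const a (card S) * (\<Prod>i\<in>S. norm (f i) * norm (x i))"
proof -
  obtain h where h: "bij_betw h {..<card S} S"
    using ex_bij_betw_nat_finite[OF assms(2)] by (auto simp: atLeast0LessThan)
  have "cmod (sdet {..<card S} (\<lambda>i j. cdual_apply (f (h i)) (x (h j)))) \<le>
      hadamard_const a (card S) * ((\<Prod>i<card S. norm (f (h i))) * (\<Prod>i<card S. norm (x (h i))))"
    using assms(1)[unfolded det_bounded_space_def, rule_format, of "card S" "\<lambda>i. f (h i)" "\<lambda>i. x (h i)"] .
  also have "\<dots> = hadamard_const a (card S) * (\<Prod>i<card S. norm (f (h i)) * norm (x (h i)))"
    by (simp add: prod.distrib)
  also have "(\<Prod>i<card S. norm (f (h i)) * norm (x (h i))) = (\<Prod>i\<in>S. norm (f i) * norm (x i))"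
    by (rule prod.reindex_bij_betw[OF h])
  finally show ?thesis by (simp add: sdet_reindex[OF h])
qed

text \<open>Bolzano-Weierstrass, one coordinate after another. It supplies the compactness of finite
  rank operators used below.\<close>

lemma simultaneous_convergent_subsequence:
  fixes c :: "nat \<Rightarrow> nat \<Rightarrow> complex"
  assumes "\<And>j n. cmod (c n j) \<le> K j"
  shows "\<exists>r :: nat \<Rightarrow> nat. strict_mono r \<and> (\<forall>j<M. convergent (\<lambda>n. c (r n) j))"
proof (induction M)
  case 0
  show ?case by (intro exI[of _ id]) (simp add: strict_mono_def)
next
  case (Suc M)
  then obtain r :: "nat \<Rightarrow> nat" where r: "strict_mono r" "\<And>j. j < M \<Longrightarrow> convergent (\<lambda>n. c (r n) j)" by blast
  have "bounded (range (\<lambda>n. c (r n) M))" using assms by (auto simp: bounded_iff)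
  then obtain l r' where r': "strict_mono r'" "((\<lambda>n. c (r n) M) \<circ> r') \<longlonglongrightarrow> l"
    using bounded_imp_convergent_subsequence by blast
  have "convergent (\<lambda>n. c ((r \<circ> r') n) j)" if "j < Suc M" for j
  proof (cases "j = M")
    case True
    then show ?thesis using r'(2) by (auto simp: convergent_def o_def)
  next
    case False
    then have "j < M" using that by simp
    then obtain l where "(\<lambda>n. c (r n) j) \<longlonglongrightarrow> l" using r(2)[of j] by (auto simp: convergent_def)
    from LIMSEQ_subseq_LIMSEQ[OF this r'(1)] show ?thesis by (auto simp: convergent_def o_def)
  qed
  then show ?case using strict_mono_o[OF r(1) r'(1)] by blast
qed

text \<open>A representation is carried along with the tensor because the determinant is formed from
  it. When an invariant subspace is split off, the functionals stay the same and only the vectors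
  and the tensor change.\<close>

locale nuclear_rep =
  fixes a :: real and f :: "nat \<Rightarrow> 'y::complex_banach cdual" and x :: "nat \<Rightarrow> 'y" and u :: "'y otensor"
  assumes a: "0 \<le> a" and DB: "det_bounded_space a TYPE('y)"
    and sums: "(\<lambda>k. ptensor_elem (f k) (x k)) sums u"
    and summ: "summable (\<lambda>k. (norm (f k) * norm (x k)) powr (1 / (1 + a)))"
begin

abbreviation l :: "nat \<Rightarrow> real" where "l k \<equiv> norm (f k) * norm (x k)"
abbreviation A :: "nat \<Rightarrow> nat \<Rightarrow> complex" where "A i j \<equiv> cdual_apply (f i) (x j)"
abbreviation T :: "'y \<Rightarrow> 'y" where "T \<equiv> ptensor_op u"
abbreviation D :: "complex \<Rightarrow> complex" where "D \<equiv> fredholm_det A"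

lemma summable_l: "summable l"
  by (rule summable_of_summable_powr[OF _ _ _ summ]) (use a in auto)

sublocale mt: minimal_type_matrix a l A
  by unfold_locales (use a summ det_bounded_space_finite[OF DB] in \<open>auto simp: det_dominated_def\<close>)

lemma partial_sums: "(\<lambda>N. \<Sum>k<N. ptensor_elem (f k) (x k)) \<longlonglongrightarrow> u"
  using sums by (simp add: sums_def)

lemma trace_limit: "(\<lambda>N. mtrace N (mpow N A (Suc m))) \<longlonglongrightarrow> ptrace (ptensor_power u (Suc m))"
  using tendsto_ptrace[OF tendsto_tpow[OF partial_sums, of m]]
  by (simp add: ptrace_tpow_finite_rank ptensor_power_eq_tpow)

sublocale me: minimal_type_entire D "\<lambda>m. ptrace (ptensor_power u m)"
proof
  show "\<exists>C. \<forall>z. cmod (D z) \<le> C * exp (\<delta> * cmod z)" if "0 < \<delta>" for \<delta>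
    using mt.fredholm_bound[OF that] by metis
qed (rule mt.holomorphic_fredholm mt.fredholm_0 mt.newton_identities trace_limit)+

lemma T_sums: "(\<lambda>k. cdual_apply (f k) y *\<^sub>C x k) sums T y"
  by (rule ptensor_op_sums[OF sums])

lemma term_norm: "norm (cdual_apply (f k) y *\<^sub>C x k) \<le> l k * norm y"
  by (rule norm_op_kernel_le)

lemma T_linear:
  "T (y + z) = T y + T z" "T (c *\<^sub>C y) = c *\<^sub>C T y" "T (y - z) = T y - T z" "T 0 = 0"
  "T (sum h I) = (\<Sum>i\<in>I. T (h i))"
proof -
  show add: "T (y + z) = T y + T z" for y z
    using sums_add[OF T_sums[of y] T_sums[of z]] T_sums[of "y + z"]
    by (simp add: cdual_apply_simps scaleC_add_left sums_unique2)
  have bl: "bounded_linear (\<lambda>y::'y. c *\<^sub>C y)" for c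
    using bounded_clinear_scaleC[OF bounded_clinear_ident] by (auto simp: bounded_clinear_def)
  show sc: "T (c *\<^sub>C y) = c *\<^sub>C T y" for c y
    using bounded_linear.sums[OF bl T_sums[of y], of c] T_sums[of "c *\<^sub>C y"]
    by (simp add: cdual_apply_simps scaleC_scaleC sums_unique2)
  show "T (y - z) = T y - T z"
    using add[of "y - z" z] by simp
  show 0: "T 0 = 0" using add[of 0 0] by simp
  show "T (sum h I) = (\<Sum>i\<in>I. T (h i))"
    by (induction I rule: infinite_finite_induct) (auto simp: 0 add)
qed

definition trunc_op :: "nat \<Rightarrow> 'y \<Rightarrow> 'y"
  where "trunc_op N y = (\<Sum>k<N. cdual_apply (f k) y *\<^sub>C x k)"

lemma trunc_op_approx: "norm (T y - trunc_op N y) \<le> (\<Sum>k. l (k + N)) * norm y"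
proof -
  have s1: "summable (\<lambda>k. l (k + N) * norm y)"
    by (intro summable_mult2 summable_ignore_initial_segment summable_l)
  have s2: "summable (\<lambda>k. norm (cdual_apply (f (k + N)) y *\<^sub>C x (k + N)))"
    by (rule summable_comparison_test[OF _ s1]) (use term_norm in auto)
  have "T y - trunc_op N y = (\<Sum>k. cdual_apply (f (k + N)) y *\<^sub>C x (k + N))"
    using suminf_minus_initial_segment[OF sums_summable[OF T_sums[of y]], of N] sums_unique[OF T_sums[of y]]
    by (simp add: trunc_op_def)
  also have "norm \<dots> \<le> (\<Sum>k. norm (cdual_apply (f (k + N)) y *\<^sub>C x (k + N)))"
    by (rule summable_norm[OF s2])
  also have "\<dots> \<le> (\<Sum>k. l (k + N) * norm y)"
    by (rule suminf_le[OF _ s2 s1]) (rule term_norm)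
  also have "\<dots> = (\<Sum>k. l (k + N)) * norm y"
    by (rule suminf_mult2[symmetric, OF summable_ignore_initial_segment[OF summable_l]])
  finally show ?thesis .
qed

lemma tail_small:
  assumes "0 < e"
  obtains N0 where "\<And>N. N \<ge> N0 \<Longrightarrow> (\<Sum>k. l (k + N)) < e"
proof -
  have "(\<lambda>N. \<Sum>k. l (k + N)) \<longlonglongrightarrow> 0" by (rule suminf_exist_split2[OF summable_l])
  then have "eventually (\<lambda>N. (\<Sum>k. l (k + N)) < e) sequentially"
    using assms by (rule order_tendstoD(2))
  then show thesis using that by (auto simp: eventually_sequentially)
qed

lemma T_bounded: "norm (T y) \<le> (\<Sum>k. l k) * norm y"
  using trunc_op_approx[of y 0] by (simp add: trunc_op_def)

lemma T_tendsto: "Y \<longlonglongrightarrow> y \<Longrightarrow> (\<lambda>n. T (Y n)) \<longlonglongrightarrow> T y"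
proof -
  have "bounded_linear T"
  proof (rule bounded_linear_intro)
    show "T (r *\<^sub>R y) = r *\<^sub>R T y" for r y using T_linear(2)[of "complex_of_real r" y] by (simp add: scaleC_of_real)
    show "norm (T y) \<le> norm y * (\<Sum>k. l k)" for y using T_bounded[of y] by (simp add: mult.commute)
  qed (rule T_linear)
  then show "Y \<longlonglongrightarrow> y \<Longrightarrow> (\<lambda>n. T (Y n)) \<longlonglongrightarrow> T y" by (rule bounded_linear.tendsto)
qed

lemma tendsto_scaleC: "Y \<longlonglongrightarrow> y \<Longrightarrow> (\<lambda>n. c *\<^sub>C Y n) \<longlonglongrightarrow> (c *\<^sub>C y :: 'y)"
  using bounded_clinear_scaleC[OF bounded_clinear_ident, of c]
  by (intro bounded_linear.tendsto[of "\<lambda>y. c *\<^sub>C y"]) (auto simp: bounded_clinear_def)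

text \<open>The Riesz argument for a norm limit of finite rank operators. Along unit vectors that
  are almost annihilated, the finite rank part converges on a subsequence and the remainder is a
  contraction, so the subsequence itself converges, to a unit vector in the kernel.\<close>

lemma bounded_below:
  assumes inj: "\<And>y. y = z0 *\<^sub>C T y \<Longrightarrow> y = 0"
  shows "\<exists>c>0. \<forall>y. c * norm y \<le> norm (y - z0 *\<^sub>C T y)"
proof (rule ccontr)
  assume "\<not> ?thesis"
  then have neg: "\<And>c. c > 0 \<Longrightarrow> \<exists>y. norm (y - z0 *\<^sub>C T y) < c * norm y" by (force simp: not_le)
  have "\<exists>y. norm y = 1 \<and> norm (y - z0 *\<^sub>C T y) < inverse (real (Suc n))" for n
  proof -
    obtain y where y: "norm (y - z0 *\<^sub>C T y) < inverse (real (Suc n)) * norm y"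
      using neg[of "inverse (real (Suc n))"] by auto
    then have y0: "norm y > 0" by (metis mult_zero_right norm_ge_zero not_le zero_less_norm_iff norm_zero)
    let ?c = "complex_of_real (1 / norm y)"
    have "?c *\<^sub>C y - z0 *\<^sub>C T (?c *\<^sub>C y) = ?c *\<^sub>C (y - z0 *\<^sub>C T y)"
      by (simp add: T_linear scaleC_scaleC mult.commute complex_vector.scale_right_diff_distrib)
    then have "norm (?c *\<^sub>C y - z0 *\<^sub>C T (?c *\<^sub>C y)) = norm (y - z0 *\<^sub>C T y) / norm y"
      by (simp add: norm_scaleC norm_divide)
    also have "\<dots> < inverse (real (Suc n))" using y y0 by (simp add: pos_divide_less_eq)
    finally show ?thesis using y0 by (intro exI[of _ "?c *\<^sub>C y"]) (simp add: norm_scaleC norm_divide)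
  qed
  then obtain Y where Y: "\<And>n. norm (Y n) = 1" "\<And>n. norm (Y n - z0 *\<^sub>C T (Y n)) < inverse (real (Suc n))" by metis
  have "0 < 1 / (2 * (cmod z0 + 1))" by (simp add: add_nonneg_pos)
  then obtain M where M: "\<And>N. N \<ge> M \<Longrightarrow> (\<Sum>k. l (k + N)) < 1 / (2 * (cmod z0 + 1))" using tail_small by blast
  \<comment> \<open>The remainder after \<open>M\<close> terms, scaled by \<open>z0\<close>; the
    choice of \<open>M\<close> makes its norm at most 1/2.\<close>
  define P where "P y = z0 *\<^sub>C (T y - trunc_op M y)" for y
  have trunc_diff: "trunc_op M (y - z) = trunc_op M y - trunc_op M z" for y z
    by (simp add: trunc_op_def cdual_apply_sum complex_vector.scale_left_diff_distrib sum_subtractf)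
  have P_diff: "P (y - z) = P y - P z" for y z
    by (simp add: P_def trunc_diff T_linear complex_vector.scale_right_diff_distrib)
  have P_le: "norm (P y) \<le> norm y / 2" for y
  proof -
    have "norm (P y) \<le> cmod z0 * ((\<Sum>k. l (k + M)) * norm y)"
      unfolding P_def norm_scaleC by (intro mult_left_mono trunc_op_approx) auto
    also have "\<dots> \<le> (cmod z0 + 1) * ((1 / (2 * (cmod z0 + 1))) * norm y)"
      using M[of M] by (intro mult_mono mult_right_mono) (auto intro!: mult_nonneg_nonneg suminf_nonneg summable_ignore_initial_segment summable_l)
    also have "\<dots> = norm y / 2"
    proof -
      have "cmod z0 + 1 \<noteq> 0" using norm_ge_zero[of z0] by linarith
      then show ?thesis by (simp add: field_simps)
    qed
    finally show ?thesis .
  qed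
  have "\<exists>r :: nat \<Rightarrow> nat. strict_mono r \<and> (\<forall>j<M. convergent (\<lambda>n. cdual_apply (f j) (Y (r n))))"
    by (rule simultaneous_convergent_subsequence[of "\<lambda>n j. cdual_apply (f j) (Y n)" "\<lambda>j. norm (f j)"])
       (use norm_cdual_apply[of _ "Y _"] Y(1) in \<open>metis mult_1_right\<close>)
  then obtain r :: "nat \<Rightarrow> nat" where r: "strict_mono r" "\<And>j. j < M \<Longrightarrow> convergent (\<lambda>n. cdual_apply (f j) (Y (r n)))" by blast
  define V where "V n = Y (r n)" for n
  have W0: "(\<lambda>n. V n - z0 *\<^sub>C T (V n)) \<longlonglongrightarrow> 0"
  proof (rule Lim_null_comparison[OF _ LIMSEQ_inverse_real_of_nat])
    show "eventually (\<lambda>n. norm (V n - z0 *\<^sub>C T (V n)) \<le> inverse (real (Suc n))) sequentially"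
    proof (rule always_eventually, rule allI)
      fix n
      have "norm (V n - z0 *\<^sub>C T (V n)) \<le> inverse (real (Suc (r n)))" using Y(2)[of "r n"] by (simp add: V_def)
      also have "\<dots> \<le> inverse (real (Suc n))" using seq_suble[OF r(1), of n] by (simp add: le_imp_inverse_le)
      finally show "norm (V n - z0 *\<^sub>C T (V n)) \<le> inverse (real (Suc n))" .
    qed
  qed
  obtain L where L: "\<And>j. j < M \<Longrightarrow> (\<lambda>n. cdual_apply (f j) (V n)) \<longlonglongrightarrow> L j"
    using r(2) unfolding V_def convergent_def by metis
  have sc_l: "(\<lambda>n. c n *\<^sub>C v) \<longlonglongrightarrow> c0 *\<^sub>C v" if "c \<longlonglongrightarrow> c0" for c c0 and v :: 'y
  proof -
    have "bounded_linear (\<lambda>c. c *\<^sub>C v)"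
      by (rule bounded_linear_intro[of _ "norm v"])
         (simp_all add: scaleC_add_left norm_scaleC scaleR_conv_of_real scaleC_scaleC flip: scaleC_of_real)
    then show ?thesis using that by (rule bounded_linear.tendsto)
  qed
  define q where "q n = (V n - z0 *\<^sub>C T (V n)) + z0 *\<^sub>C trunc_op M (V n)" for n
  have "q \<longlonglongrightarrow> 0 + z0 *\<^sub>C (\<Sum>k<M. L k *\<^sub>C x k)"
    unfolding q_def trunc_op_def
    by (intro tendsto_add W0 tendsto_scaleC tendsto_sum sc_l L) simp
  then have q: "Cauchy q" by (rule LIMSEQ_imp_Cauchy)
  have Vq: "V n = q n + P (V n)" for n
    by (simp add: q_def P_def complex_vector.scale_right_diff_distrib)
  \<comment> \<open>The contraction is absorbed: \<open>V n = q n + P (V n)\<close> with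
    \<open>P\<close> of norm at most 1/2, so differences of \<open>V\<close> are at most twice those
    of \<open>q\<close>.\<close>
  have half: "norm (V m - V n) \<le> 2 * norm (q m - q n)" for m n
  proof -
    have "V m - V n = (q m - q n) + P (V m - V n)"
      unfolding P_diff using Vq[of m] Vq[of n] by (metis add_diff_add)
    then have "norm (V m - V n) \<le> norm (q m - q n) + norm (P (V m - V n))" by (metis norm_triangle_ineq)
    then show ?thesis using P_le[of "V m - V n"] by simp
  qed
  have "Cauchy V"
  proof (rule CauchyI)
    fix e :: real assume "e > 0"
    then have "e / 2 > 0" by simp
    from CauchyD[OF q this] obtain N where N: "\<forall>m\<ge>N. \<forall>n\<ge>N. norm (q m - q n) < e / 2" by blast
    have "norm (V m - V n) < e" if "m \<ge> N" "n \<ge> N" for m n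
      using half[of m n] N that by fastforce
    then show "\<exists>N. \<forall>m\<ge>N. \<forall>n\<ge>N. norm (V m - V n) < e" by blast
  qed
  then obtain y where y: "V \<longlonglongrightarrow> y" using Cauchy_convergent convergent_def by blast
  have "(\<lambda>n. V n - z0 *\<^sub>C T (V n)) \<longlonglongrightarrow> y - z0 *\<^sub>C T y"
    by (intro tendsto_diff tendsto_scaleC T_tendsto y)
  then have "y - z0 *\<^sub>C T y = 0" using W0 LIMSEQ_unique by blast
  then have "y = 0" using inj by simp
  moreover have "norm y = 1"
    using tendsto_norm[OF y] by (simp add: V_def Y(1) LIMSEQ_const_iff)
  ultimately show False by simp
qed

end

section \<open>Nonvanishing of the determinant away from the eigenvalues\<close>

lemma right_inverse_exists:
  assumes "sdet {..<n} M \<noteq> 0"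
  shows "\<exists>B. \<forall>i<n. \<forall>j<n. (\<Sum>k<n. M i k * B k j) = (if i = j then 1 else 0)"
proof -
  have "Determinant.det (fmat n M) \<noteq> 0" using assms by (simp add: sdet_eq_det)
  then have "fmat n M \<in> Units (ring_mat TYPE(complex) n ())"
    by (intro det_non_zero_imp_unit) auto
  then obtain B where B: "B \<in> carrier_mat n n" "fmat n M * B = 1\<^sub>m n"
    unfolding Units_def by (auto simp: ring_mat_simps)
  have "(\<Sum>k<n. M i k * B $$ (k, j)) = (if i = j then 1 else 0)" if "i < n" "j < n" for i j
  proof -
    have "(\<Sum>k<n. M i k * B $$ (k, j)) = (fmat n M * B) $$ (i, j)"
      using that B(1) by (auto simp: scalar_prod_def atLeast0LessThan)
    then show ?thesis using B that by simp
  qed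
  then show ?thesis by (intro exI[of _ "\<lambda>k j. B $$ (k, j)"]) blast
qed

context nuclear_rep
begin

text \<open>Nonzero truncations could still tend to 0, so a lower bound uniform in \<open>N\<close>
  is required. It comes from an upper bound for the determinant of the inverse matrix, which has the
  same kind of expansion into minors.\<close>

lemma fredholm_nonzero:
  assumes inj: "\<And>y. y = z0 *\<^sub>C T y \<Longrightarrow> y = 0"
  shows "D z0 \<noteq> 0"
proof -
  obtain c where c: "c > 0" "\<And>y. c * norm y \<le> norm (y - z0 *\<^sub>C T y)"
    using bounded_below[OF inj] by blast
  \<comment> \<open>The tail is made so small that the truncated operators keep half of the lower
    bound \<open>c\<close>, for all large \<open>N\<close> at once.\<close>
  have "0 < c / (2 * (cmod z0 + 1))" using c by (simp add: add_nonneg_pos)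
  then obtain N0 where N0: "\<And>N. N \<ge> N0 \<Longrightarrow> (\<Sum>k. l (k + N)) < c / (2 * (cmod z0 + 1))" using tail_small by blast
  have below: "c / 2 * norm y \<le> norm (y - z0 *\<^sub>C trunc_op N y)" if N: "N \<ge> N0" for N y
  proof -
    have z1: "cmod z0 + 1 > 0" by (simp add: add_nonneg_pos)
    have "norm (z0 *\<^sub>C (T y - trunc_op N y)) \<le> cmod z0 * ((\<Sum>k. l (k + N)) * norm y)"
      unfolding norm_scaleC by (intro mult_left_mono trunc_op_approx) auto
    also have "\<dots> \<le> (cmod z0 + 1) * ((c / (2 * (cmod z0 + 1))) * norm y)"
      using N0[OF N] c by (intro mult_mono mult_right_mono) (auto intro!: mult_nonneg_nonneg suminf_nonneg summable_ignore_initial_segment summable_l)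
    also have "\<dots> = c / 2 * norm y" using z1 by (simp add: field_simps)
    finally have "norm (z0 *\<^sub>C (T y - trunc_op N y)) \<le> c / 2 * norm y" .
    moreover have "y - z0 *\<^sub>C T y = (y - z0 *\<^sub>C trunc_op N y) - z0 *\<^sub>C (T y - trunc_op N y)"
      by (simp add: complex_vector.scale_right_diff_distrib)
    then have "norm (y - z0 *\<^sub>C T y) \<le> norm (y - z0 *\<^sub>C trunc_op N y) + norm (z0 *\<^sub>C (T y - trunc_op N y))"
      by (metis norm_triangle_ineq4)
    ultimately show ?thesis using c(2)[of y] by simp
  qed
  define K where "K = 2 * cmod z0 / c"
  have K: "K \<ge> 0" using c by (simp add: K_def)
  obtain C where C: "0 \<le> C" "\<And>N r. 0 \<le> r \<Longrightarrow> l_sum a l N r \<le> C * exp (1 * r)"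
    by (rule mt.l_sum_bound[of 1], simp) blast
  define H where "H = C * exp (1 * K)"
  have bound: "1 \<le> H * cmod (fredholm_trunc A N z0)" if N: "N \<ge> N0" for N
  proof -
    \<comment> \<open>The inverse \<open>B\<close> of \<open>M\<close> is \<open>I - (f i (y j))\<close> with \<open>norm (y j) \<le> K * norm (x j)\<close>, so \<open>sdet B\<close> is bounded uniformly in \<open>N\<close>.\<close>
    define M where "M i j = (if i = j then 1 else 0) + - z0 * A i j" for i j
    have Mdet: "fredholm_trunc A N z0 = sdet {..<N} M"
      by (simp add: fredholm_trunc_def M_def[abs_def])
    \<comment> \<open>A kernel vector \<open>v\<close> of the matrix gives y = sum v_j x_j, fixed by
      z0 times the truncated operator. The lower bound forces y = 0, and v_i = z0 f_i(y) then
      vanishes.\<close>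
    have "sdet {..<N} M \<noteq> 0"
    proof (rule sdet_nonzero)
      fix v assume v: "\<And>i. i < N \<Longrightarrow> (\<Sum>j<N. M i j * v j) = 0"
      have vA: "v i = z0 * (\<Sum>j<N. A i j * v j)" if "i < N" for i
      proof -
        have "(\<Sum>j<N. M i j * v j) = (\<Sum>j<N. (if i = j then v j else 0) + - (z0 * (A i j * v j)))"
          by (intro sum.cong HOL.refl) (simp add: M_def algebra_simps)
        also have "\<dots> = v i - z0 * (\<Sum>j<N. A i j * v j)"
          using that by (simp add: sum_subtractf sum_negf sum_distrib_left)
        finally show ?thesis using v[OF that] by simp
      qed
      define y where "y = (\<Sum>j<N. v j *\<^sub>C x j)"
      have fy: "cdual_apply (f i) y = (\<Sum>j<N. A i j * v j)" for i
        by (simp add: y_def cdual_apply_sum cdual_apply_simps mult.commute)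
      have "z0 *\<^sub>C trunc_op N y = (\<Sum>i<N. (z0 * (\<Sum>j<N. A i j * v j)) *\<^sub>C x i)"
        by (simp add: trunc_op_def fy complex_vector.scale_sum_right scaleC_scaleC)
      also have "\<dots> = y" unfolding y_def by (intro sum.cong HOL.refl) (simp add: vA[symmetric])
      finally have zy: "z0 *\<^sub>C trunc_op N y = y" .
      have "c / 2 * norm y \<le> norm (y - z0 *\<^sub>C trunc_op N y)" by (rule below[OF N])
      also have "\<dots> = 0" unfolding zy by simp
      finally have "c / 2 * norm y \<le> 0" .
      then have y0: "y = 0" using c(1) by (simp add: mult_le_0_iff)
      have zero: "(\<Sum>j<N. A i j * v j) = 0" for i
        unfolding fy[of i, symmetric] y0 by (rule cdual_apply_sum(5))
      show "\<forall>i<N. v i = 0"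
        using vA unfolding zero by simp
    qed
    then obtain B where B: "\<And>i j. i < N \<Longrightarrow> j < N \<Longrightarrow> (\<Sum>k<N. M i k * B k j) = (if i = j then 1 else 0)"
      using right_inverse_exists by blast
    have MB: "sdet {..<N} M * sdet {..<N} B = 1"
    proof -
      have "sdet {..<N} M * sdet {..<N} B = sdet {..<N} (\<lambda>i j. if i = j then 1 else 0)"
        unfolding sdet_mult[symmetric] by (rule sdet_cong) (simp add: B)
      also have "\<dots> = 1" by (subst sdet_lower_triangular) auto
      finally show ?thesis .
    qed
    define y where "y j = (- z0) *\<^sub>C (\<Sum>k<N. B k j *\<^sub>C x k)" for j
    have fy: "cdual_apply (f i) (y j) = (if i = j then 1 else 0) - B i j" if "i < N" "j < N" for i j
    proof -
      have "(\<Sum>k<N. M i k * B k j) = (\<Sum>k<N. (if i = k then B k j else 0) + - z0 * (B k j * A i k))"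
        by (intro sum.cong HOL.refl) (simp add: M_def algebra_simps)
      also have "\<dots> = B i j + - z0 * (\<Sum>k<N. B k j * A i k)"
        using that by (simp add: sum_subtractf sum_negf sum_distrib_left)
      finally have "(if i = j then 1 else 0) = B i j + - z0 * (\<Sum>k<N. B k j * A i k)" using B[OF that] by simp
      then show ?thesis by (simp add: y_def cdual_apply_sum cdual_apply_simps)
    qed
    have ynorm: "norm (y j) \<le> K * norm (x j)" if j: "j < N" for j
    proof -
      have t: "trunc_op N (y j) = (\<Sum>k<N. ((if k = j then 1 else 0) - B k j) *\<^sub>C x k)"
        unfolding trunc_op_def by (intro sum.cong HOL.refl) (simp add: fy j)
      \<comment> \<open>The difference collapses to -z0 x_j, so the lower bound for the truncated
        operator controls \<open>y j\<close> by \<open>x j\<close>.\<close>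
      have "y j - z0 *\<^sub>C trunc_op N (y j) = (- z0) *\<^sub>C (\<Sum>k<N. B k j *\<^sub>C x k) - z0 *\<^sub>C (\<Sum>k<N. ((if k = j then 1 else 0) - B k j) *\<^sub>C x k)"
        unfolding t by (simp only: y_def)
      also have "(\<Sum>k<N. ((if k = j then 1 else 0) - B k j) *\<^sub>C x k) = x j - (\<Sum>k<N. B k j *\<^sub>C x k)"
      proof -
        have "(\<Sum>k<N. ((if k = j then 1 else 0) - B k j) *\<^sub>C x k) = (\<Sum>k<N. (if k = j then x k else 0) - B k j *\<^sub>C x k)"
          by (intro sum.cong HOL.refl) (simp add: complex_vector.scale_left_diff_distrib)
        then show ?thesis using j by (simp add: sum_subtractf)
      qed
      also have "(- z0) *\<^sub>C (\<Sum>k<N. B k j *\<^sub>C x k) - z0 *\<^sub>C (x j - (\<Sum>k<N. B k j *\<^sub>C x k)) = - (z0 *\<^sub>C x j)"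
        by (simp add: complex_vector.scale_right_diff_distrib)
      finally have "c / 2 * norm (y j) \<le> cmod z0 * norm (x j)" using below[OF N, of "y j"] by (simp add: norm_scaleC)
      then show ?thesis using c(1) by (simp add: K_def field_simps)
    qed
    have "cmod (sdet {..<N} B) \<le> H"
    proof -
      have "sdet {..<N} B = sdet {..<N} (\<lambda>i j. (if i = j then 1 else 0) + (- 1) * cdual_apply (f i) (y j))"
        by (rule sdet_cong) (simp add: fy)
      also have "\<dots> = (\<Sum>S\<in>Pow {..<N}. sdet S (\<lambda>i j. (- 1) * cdual_apply (f i) (y j)))"
        by (rule sdet_one_plus) simp
      also have "cmod \<dots> \<le> (\<Sum>S\<in>Pow {..<N}. K ^ card S * hadamard_const a (card S) * (\<Prod>i\<in>S. l i))"
      proof (rule sum_norm_le)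
        fix S assume "S \<in> Pow {..<N}"
        then have S: "finite S" "\<And>i. i \<in> S \<Longrightarrow> i < N" by (auto intro: finite_subset)
        have "cmod (sdet S (\<lambda>i j. (- 1) * cdual_apply (f i) (y j))) = cmod (sdet S (\<lambda>i j. cdual_apply (f i) (y j)))"
          by (subst sdet_cmult[OF S(1)]) (simp add: norm_mult norm_power)
        also have "\<dots> \<le> hadamard_const a (card S) * (\<Prod>i\<in>S. norm (f i) * norm (y i))"
          by (rule det_bounded_space_finite[OF DB S(1)])
        also have "\<dots> \<le> hadamard_const a (card S) * (\<Prod>i\<in>S. K * l i)"
        proof (intro mult_left_mono prod_mono conjI)
          fix i assume "i \<in> S"
          then show "norm (f i) * norm (y i) \<le> K * l i"
            using mult_left_mono[OF ynorm[OF S(2)], of i "norm (f i)"] by (simp add: mult_ac)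
        qed (auto simp: hadamard_const_def)
        also have "\<dots> = K ^ card S * hadamard_const a (card S) * (\<Prod>i\<in>S. l i)"
          by (simp add: prod.distrib)
        finally show "cmod (sdet S (\<lambda>i j. (- 1) * cdual_apply (f i) (y j))) \<le> K ^ card S * hadamard_const a (card S) * (\<Prod>i\<in>S. l i)" .
      qed
      also have "\<dots> = l_sum a l N K" by (simp add: l_sum_def)
      also have "\<dots> \<le> H" unfolding H_def by (rule C(2)[OF K])
      finally show ?thesis .
    qed
    then have "cmod (sdet {..<N} M) * cmod (sdet {..<N} B) \<le> cmod (sdet {..<N} M) * H"
      by (intro mult_left_mono) auto
    moreover have "cmod (sdet {..<N} M) * cmod (sdet {..<N} B) = 1" using MB by (metis norm_mult norm_one)
    ultimately show ?thesis by (simp add: Mdet mult.commute)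
  qed
  have "1 \<le> H * cmod (D z0)"
    by (rule LIMSEQ_le_const[OF tendsto_mult[OF tendsto_const tendsto_norm[OF mt.fredholm_trunc_tendsto]]])
       (use bound in blast)
  then show ?thesis by auto
qed

section \<open>Generalized eigenspaces and the orders of zeros\<close>

abbreviation E :: "complex \<Rightarrow> 'y set" where "E \<equiv> generalized_eigenspace T"

lemma shift_linear:
  "((\<lambda>y. T y - lam *\<^sub>C y) ^^ k) (y + z) = ((\<lambda>y. T y - lam *\<^sub>C y) ^^ k) y + ((\<lambda>y. T y - lam *\<^sub>C y) ^^ k) z"
  "((\<lambda>y. T y - lam *\<^sub>C y) ^^ k) (c *\<^sub>C y) = c *\<^sub>C ((\<lambda>y. T y - lam *\<^sub>C y) ^^ k) y"
  "((\<lambda>y. T y - lam *\<^sub>C y) ^^ k) 0 = 0"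
  by (induction k)
     (simp_all add: T_linear scaleC_add_right complex_vector.scale_right_diff_distrib scaleC_scaleC mult.commute)

lemma shift_zero_mono:
  assumes "((\<lambda>y. T y - lam *\<^sub>C y) ^^ k) y = 0" "k \<le> m"
  shows "((\<lambda>y. T y - lam *\<^sub>C y) ^^ m) y = 0"
proof -
  obtain j where "m = j + k" using assms(2) by (metis le_add_diff_inverse2)
  then show ?thesis using assms(1) by (simp add: funpow_add shift_linear)
qed

lemma subspace_E: "complex_vector.subspace (E lam)"
proof (rule complex_vector.subspaceI)
  show "0 \<in> E lam" by (auto simp: generalized_eigenspace_def shift_linear)
next
  fix y z assume "y \<in> E lam" "z \<in> E lam"
  then obtain k m where km: "((\<lambda>y. T y - lam *\<^sub>C y) ^^ k) y = 0" "((\<lambda>y. T y - lam *\<^sub>C y) ^^ m) z = 0"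
    by (auto simp: generalized_eigenspace_def)
  have "((\<lambda>y. T y - lam *\<^sub>C y) ^^ (max k m)) (y + z) = 0"
    using shift_zero_mono[OF km(1) max.cobounded1[of k m]] shift_zero_mono[OF km(2) max.cobounded2[of m k]]
    by (simp add: shift_linear)
  then show "y + z \<in> E lam" by (auto simp: generalized_eigenspace_def)
next
  fix c y assume "y \<in> E lam"
  then show "c *\<^sub>C y \<in> E lam" by (auto simp: generalized_eigenspace_def shift_linear)
qed

text \<open>Only the exponent changes, by one. The direction from right to left later shows that
  nothing of the generalized eigenspace is left over once it has been split off.\<close>

lemma E_shift: "y \<in> E lam \<longleftrightarrow> T y - lam *\<^sub>C y \<in> E lam"
proof
  assume "y \<in> E lam"
  then obtain k where k: "((\<lambda>y. T y - lam *\<^sub>C y) ^^ k) y = 0" by (auto simp: generalized_eigenspace_def)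
  have "((\<lambda>y. T y - lam *\<^sub>C y) ^^ k) (T y - lam *\<^sub>C y) = ((\<lambda>y. T y - lam *\<^sub>C y) ^^ Suc k) y"
    by (simp only: funpow_Suc_right o_apply)
  also have "\<dots> = 0" using k by (simp add: T_linear)
  finally show "T y - lam *\<^sub>C y \<in> E lam" by (auto simp: generalized_eigenspace_def)
next
  assume "T y - lam *\<^sub>C y \<in> E lam"
  then obtain k where "((\<lambda>y. T y - lam *\<^sub>C y) ^^ k) (T y - lam *\<^sub>C y) = 0" by (auto simp: generalized_eigenspace_def)
  then have "((\<lambda>y. T y - lam *\<^sub>C y) ^^ Suc k) y = 0" by (simp only: funpow_Suc_right o_apply)
  then show "y \<in> E lam" unfolding generalized_eigenspace_def by blast
qed

lemma T_E: "y \<in> E lam \<Longrightarrow> T y \<in> E lam"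
proof -
  assume y: "y \<in> E lam"
  then have "(T y - lam *\<^sub>C y) + lam *\<^sub>C y \<in> E lam"
    using E_shift[of y lam] subspace_E[of lam]
    by (intro complex_vector.subspace_add complex_vector.subspace_scale) auto
  then show ?thesis by simp
qed

text \<open>On an eigenvector for \<open>e\<close> the k-th power of T - lam multiplies by (e -
  lam)^k, which is 0 for some k only if e = lam.\<close>

lemma E_eigenvector:
  assumes "y \<in> E lam" "T y = e *\<^sub>C y" "y \<noteq> 0"
  shows "e = lam"
proof -
  have "((\<lambda>y. T y - lam *\<^sub>C y) ^^ k) y = (e - lam) ^ k *\<^sub>C y" for k
  proof (induction k)
    case (Suc k)
    then show ?case
      using assms(2) by (simp add: T_linear scaleC_scaleC complex_vector.scale_left_diff_distrib algebra_simps)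
  qed simp
  then have "\<exists>k. (e - lam) ^ k *\<^sub>C y = 0" using assms(1) by (auto simp: generalized_eigenspace_def)
  then show ?thesis using assms(3) by auto
qed

lemma E_kernel:
  assumes "lam \<noteq> 0" "y \<in> E lam" "T y = 0"
  shows "y = 0"
  using E_eigenvector[of y lam 0] assms by auto

text \<open>Passage to the quotient by a finite dimensional invariant subspace, realized on the same
  space by a projection \<open>Q\<close> that kills it. The tensor splits as u = \<pi> u + v with v
  (\<pi> u) = 0, so the traces of powers add; those of \<pi> u are the traces of a matrix whose only
  eigenvalue is \<open>lam\<close>. Newton's identities turn this sum of traces into a product of
  determinants.\<close>

lemma subsystem:
  assumes lam: "lam \<noteq> 0" and B: "finite B" "complex_vector.independent B" "B \<subseteq> E lam"
    and inv: "\<And>y. y \<in> complex_vector.span B \<Longrightarrow> T y \<in> complex_vector.span B"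
  obtains v Q where "nuclear_rep a f (\<lambda>k. Q (x k)) v"
    "\<And>z. D z = (1 - z * lam) ^ card B * fredholm_det (\<lambda>i j. cdual_apply (f i) (Q (x j))) z"
    "\<And>y. y - Q y \<in> complex_vector.span B" "\<And>y. y \<in> complex_vector.span B \<Longrightarrow> Q y = 0"
    "\<And>y. ptensor_op v y = Q (T y)"
proof -
  have span_E: "complex_vector.span B \<subseteq> E lam"
    by (rule complex_vector.span_minimal[OF B(3) subspace_E])
  \<comment> \<open>If all \<open>f k\<close> vanish at \<open>y\<close> then T y = 0, while T is
    injective on \<open>E lam\<close> for nonzero \<open>lam\<close>. So the \<open>f k\<close>
    separate points of the span and can be combined into coordinates.\<close>
  have sep: "y = 0" if "y \<in> complex_vector.span B" "\<And>k. cdual_apply (f k) y = 0" for y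
  proof -
    have s: "(\<lambda>k. 0 :: 'y) sums T y" using T_sums[of y] unfolding that(2) complex_vector.scale_zero_left .
    have "T y = 0" by (rule sums_unique2[OF s sums_zero])
    then show ?thesis using E_kernel[OF lam] that(1) span_E by blast
  qed
  define d where "d = card B"
  have "\<exists>e g. bij_betw e {..<d} B \<and> (\<forall>i<d. \<forall>j<d. cdual_apply (g i) (e j) = (if i = j then 1 else 0))"
    unfolding d_def by (rule biorthogonal_system[OF B(1,2) sep])
  then obtain e g where e: "bij_betw e {..<d} B"
    and g: "\<And>i j. i < d \<Longrightarrow> j < d \<Longrightarrow> cdual_apply (g i) (e j) = (if i = j then 1 else 0)"
    by blast
  have eB: "e i \<in> complex_vector.span B" if "i < d" for i
    using e that by (auto simp: bij_betw_def intro: complex_vector.span_base)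
  define P where "P y = (\<Sum>i<d. cdual_apply (g i) y *\<^sub>C e i)" for y
  define Q where "Q y = y - P y" for y
  have P_span: "P y \<in> complex_vector.span B" for y
    unfolding P_def by (intro complex_vector.span_sum complex_vector.span_scale eB) simp
  have P_add: "P (y + z) = P y + P z" and P_scale: "P (c *\<^sub>C y) = c *\<^sub>C P y" for y z c
    by (simp_all add: P_def cdual_apply_simps scaleC_add_left sum.distrib complex_vector.scale_sum_right scaleC_scaleC)
  have Pe: "P (e j) = e j" if "j < d" for j
  proof -
    have "P (e j) = (\<Sum>i<d. if i = j then e i else 0)"
      unfolding P_def using that g by (intro sum.cong HOL.refl) auto
    then show ?thesis using that by simp
  qed
  have P_id: "P y = y" if "y \<in> complex_vector.span B" for y
    using that
  proof (induction rule: complex_vector.span_induct_alt)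
    case base
    show ?case by (simp add: P_def cdual_apply_sum)
  next
    case (step c b y)
    then obtain j where "j < d" "b = e j" using e by (auto simp: bij_betw_def)
    then show ?case using step Pe by (simp add: P_add P_scale)
  qed
  have Q_bl: "bounded_clinear Q"
  proof -
    have "bounded_linear Q"
      unfolding Q_def P_def
    proof (intro bounded_linear_sub bounded_linear_ident bounded_linear_sum)
      fix i
      have bl: "bounded_linear (cdual_apply (g i))" using bounded_clinear_cdual_apply by (auto simp: bounded_clinear_def)
      have "bounded_linear (\<lambda>c. c *\<^sub>C e i)"
        by (rule bounded_linear_intro[of _ "norm (e i)"])
           (simp_all add: scaleC_add_left norm_scaleC scaleR_conv_of_real scaleC_scaleC flip: scaleC_of_real)
      from bounded_linear_compose[OF this bl] show "bounded_linear (\<lambda>y. cdual_apply (g i) y *\<^sub>C e i)" .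
    qed
    then show ?thesis by (simp add: bounded_clinear_def Q_def P_scale complex_vector.scale_right_diff_distrib)
  qed
  obtain c where c: "\<And>y. norm (Q y) \<le> norm y * c" "c > 0"
    using bounded_linear.pos_bounded[OF bounded_clinearD(1)[OF Q_bl]] by blast
  define \<pi> where "\<pi> = (\<Sum>i<d. ptensor_elem (g i) (e i))"
  define v where "v = u - ptensor_mult \<pi> u"
  have \<pi>_elem: "ptensor_mult \<pi> (ptensor_elem h y) = ptensor_elem h (P y)" for h y
  proof -
    have "ptensor_op \<pi> y = P y"
      by (simp add: \<pi>_def P_def bounded_clinearD(6)[OF bounded_clinear_op] ptensor_op_elem)
    then show ?thesis by (simp add: ptensor_mult_elem_right)
  qed
  have elem_diff: "ptensor_elem h (y - z) = ptensor_elem h y - ptensor_elem h z" for h :: "'y cdual" and y z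
    by (rule bounded_clinearD(4)[OF bounded_clinear_elem_right])
  have v_sums: "(\<lambda>k. ptensor_elem (f k) (Q (x k))) sums v"
  proof -
    have "(\<lambda>k. ptensor_mult \<pi> (ptensor_elem (f k) (x k))) sums ptensor_mult \<pi> u"
      by (rule bounded_linear.sums[OF bounded_clinearD(1)[OF bounded_clinear_mult_right] sums])
    from sums_diff[OF sums this] show ?thesis
      by (simp add: v_def Q_def elem_diff \<pi>_elem)
  qed
  have rep: "nuclear_rep a f (\<lambda>k. Q (x k)) v"
  proof
    show "summable (\<lambda>k. (norm (f k) * norm (Q (x k))) powr (1 / (1 + a)))"
    proof (rule summable_comparison_test'[where N = 0])
      show "summable (\<lambda>k. c powr (1 / (1 + a)) * (norm (f k) * norm (x k)) powr (1 / (1 + a)))"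
        by (rule summable_mult[OF summ])
      fix n
      have "norm (f n) * norm (Q (x n)) \<le> c * (norm (f n) * norm (x n))"
        using mult_left_mono[OF c(1)[of "x n"], of "norm (f n)"] by (simp add: mult_ac)
      then have "(norm (f n) * norm (Q (x n))) powr (1 / (1 + a)) \<le> (c * (norm (f n) * norm (x n))) powr (1 / (1 + a))"
        using a by (intro powr_mono2) auto
      then show "norm ((norm (f n) * norm (Q (x n))) powr (1 / (1 + a))) \<le>
          c powr (1 / (1 + a)) * (norm (f n) * norm (x n)) powr (1 / (1 + a))"
        using c(2) by (simp add: powr_mult)
    qed
  qed (rule a DB v_sums)+
  interpret v: nuclear_rep a f "\<lambda>k. Q (x k)" v by (rule rep)
  have vop: "ptensor_op v y = Q (T y)" for y
  proof -
    have "(\<lambda>k. Q (cdual_apply (f k) y *\<^sub>C x k)) sums Q (T y)"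
      by (rule bounded_linear.sums[OF bounded_clinearD(1)[OF Q_bl] T_sums])
    then have "(\<lambda>k. cdual_apply (f k) y *\<^sub>C Q (x k)) sums Q (T y)"
      by (simp add: bounded_clinearD(3)[OF Q_bl])
    then show ?thesis using v.T_sums[of y] sums_unique2 by blast
  qed
  have u\<pi>: "ptensor_mult u \<pi> = (\<Sum>i<d. ptensor_elem (g i) (T (e i)))"
    by (simp add: \<pi>_def ptensor_mult_simps ptensor_mult_elem_right)
  \<comment> \<open>Invariance of the span: T maps each \<open>e i\<close> into it, and
    \<open>P\<close> is the identity there.\<close>
  have \<pi>u\<pi>: "ptensor_mult \<pi> (ptensor_mult u \<pi>) = ptensor_mult u \<pi>"
    unfolding u\<pi> ptensor_mult_simps \<pi>_elem using inv[OF eB] P_id by simp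
  have "ptensor_mult v (ptensor_mult \<pi> u) = 0"
  proof -
    have "ptensor_mult v (ptensor_mult \<pi> u) =
      ptensor_mult (ptensor_mult u \<pi>) u - ptensor_mult (ptensor_mult \<pi> (ptensor_mult u \<pi>)) u"
      by (simp add: v_def ptensor_mult_simps ptensor_mult_assoc)
    then show ?thesis by (simp add: \<pi>u\<pi>)
  qed
  from ptrace_tpow_add[OF this]
  have tr1: "ptrace (tpow u n) = ptrace (tpow (ptensor_mult u \<pi>) n) + ptrace (tpow v n)" for n
    by (simp add: v_def ptrace_tpow_swap[of \<pi> u])
  \<comment> \<open>The matrix of T on the span in the basis \<open>e\<close>. Its eigenvectors are
    coordinate vectors of eigenvectors of T inside \<open>E lam\<close>, so all its eigenvalues
    equal \<open>lam\<close>.\<close>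
  define Bm where "Bm i j = cdual_apply (g i) (T (e j))" for i j
  have tr2: "ptrace (tpow (ptensor_mult u \<pi>) n) = of_nat d * lam ^ Suc n" for n
  proof -
    obtain es where es: "length es = d" "\<And>z. sdet {..<d} (\<lambda>i j. (if i = j then 1 else 0) + - z * Bm i j) = (\<Prod>e\<leftarrow>es. 1 - z * e)"
      "\<And>m. mtrace d (mpow d Bm m) = (\<Sum>e\<leftarrow>es. e ^ m)"
      and ev: "\<And>\<mu>. \<mu> \<in> set es \<Longrightarrow> \<exists>c. (\<exists>i<d. c i \<noteq> 0) \<and> (\<forall>i<d. (\<Sum>j<d. Bm i j * c j) = \<mu> * c i)"
      by (rule eigenvalues_exist[of d Bm]) blast
    have "\<mu> = lam" if \<mu>: "\<mu> \<in> set es" for \<mu>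
    proof -
      obtain c where c: "\<exists>i<d. c i \<noteq> 0" "\<And>i. i < d \<Longrightarrow> (\<Sum>j<d. Bm i j * c j) = \<mu> * c i" using ev[OF \<mu>] by blast
      define y where "y = (\<Sum>j<d. c j *\<^sub>C e j)"
      have y: "y \<in> complex_vector.span B"
        unfolding y_def by (intro complex_vector.span_sum complex_vector.span_scale eB) simp
      have gy: "cdual_apply (g i) y = c i" if "i < d" for i
      proof -
        have "cdual_apply (g i) y = (\<Sum>j<d. if i = j then c j else 0)"
          unfolding y_def cdual_apply_sum cdual_apply_simps using that g by (intro sum.cong HOL.refl) auto
        then show ?thesis using that by simp
      qed
      have "y \<noteq> 0" using c(1) gy by (auto simp: cdual_apply_sum)
      moreover have "T y = \<mu> *\<^sub>C y"
      proof -
        have "cdual_apply (g i) (T y) = \<mu> * c i" if "i < d" for i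
          using c(2)[OF that] by (simp add: y_def T_linear cdual_apply_sum cdual_apply_simps Bm_def mult.commute)
        then have "P (T y) = \<mu> *\<^sub>C y" by (simp add: P_def y_def complex_vector.scale_sum_right scaleC_scaleC)
        then show ?thesis using P_id[OF inv[OF y]] by simp
      qed
      ultimately show ?thesis using E_eigenvector y span_E by blast
    qed
    then have "es = replicate d lam" by (intro replicate_eqI es(1))
    then have "mtrace d (mpow d Bm (Suc n)) = of_nat d * lam ^ Suc n"
      using es(3)[of "Suc n"] by (simp add: sum_list_replicate)
    moreover have "ptrace (tpow (ptensor_mult u \<pi>) n) = mtrace d (mpow d Bm (Suc n))"
      unfolding u\<pi> ptrace_tpow_finite_rank Bm_def[abs_def] ..
    ultimately show ?thesis by simp
  qed
  define G where "G = (\<Prod>e\<leftarrow>replicate d lam. 1 - fps_const e * fps_X)"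
  define S where "S = Abs_fps (\<lambda>m. \<Sum>e\<leftarrow>replicate d lam. e ^ Suc m)"
  define Fu where "Fu = fps_expansion D 0"
  define Fv where "Fv = fps_expansion v.D 0"
  define Tu where "Tu = Abs_fps (\<lambda>m. ptrace (ptensor_power u (Suc m)))"
  define Tv where "Tv = Abs_fps (\<lambda>m. ptrace (ptensor_power v (Suc m)))"
  have Tuv: "Tu = S + Tv"
    using tr1 tr2 by (simp add: Tu_def S_def Tv_def fps_eq_iff ptensor_power_eq_tpow sum_list_replicate)
  have "Fu = G * Fv"
  proof (rule fps_log_deriv_unique)
    show "fps_deriv Fu = - Fu * Tu" unfolding Fu_def Tu_def by (rule me.newton)
    have dG: "fps_deriv G = - G * S" unfolding G_def S_def by (rule prod_linear_fps(2))
    have dF: "fps_deriv Fv = - Fv * Tv" unfolding Fv_def Tv_def by (rule v.me.newton)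
    show "fps_deriv (G * Fv) = - (G * Fv) * Tu"
      unfolding fps_deriv_mult dG dF Tuv by (simp add: algebra_simps)
    have "fps_nth G 0 = 1" unfolding G_def by (induction d) auto
    then show "fps_nth Fu 0 = fps_nth (G * Fv) 0"
      using me.D0 v.me.D0 by (simp add: Fu_def Fv_def fps_expansion_def)
  qed
  moreover have exp: "(\<lambda>z. (\<Prod>e\<leftarrow>replicate d lam. 1 - z * e) * v.D z) has_fps_expansion G * Fv"
    unfolding G_def Fv_def by (intro has_fps_expansion_mult prod_linear_fps(1) v.me.expansion)
  have "eval_fps (G * Fv) z = (\<Prod>e\<leftarrow>replicate d lam. 1 - z * e) * v.D z" for z
    by (rule has_fps_expansion_imp_eval_fps_eq[OF exp, of _ "cmod z + 1"])
       (auto intro!: holomorphic_intros v.mt.holomorphic_fredholm)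
  ultimately have "D z = (1 - z * lam) ^ card B * v.D z" for z
    using me.eval_expansion[of z] by (simp add: Fu_def d_def)
  moreover have "y - Q y \<in> complex_vector.span B" for y using P_span by (simp add: Q_def)
  moreover have "Q y = 0" if "y \<in> complex_vector.span B" for y using P_id[OF that] by (simp add: Q_def)
  ultimately show thesis using that rep vop by blast
qed

text \<open>The iterates of T - lam enlarge the set to one spanning a finite dimensional invariant
  subspace, whose dimension is a lower bound for the root order by \<open>subsystem\<close>. So
  \<open>E lam\<close> is finite dimensional because zeros of a nonzero entire function have finite
  order.\<close>

lemma card_independent_le:
  assumes lam: "lam \<noteq> 0" and q: "has_root_order D (inverse lam) q"
    and B: "finite B" "complex_vector.independent B" "B \<subseteq> E lam"
  shows "card B \<le> q"
proof -
  let ?N = "\<lambda>y. T y - lam *\<^sub>C y"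
  have "\<forall>b\<in>B. \<exists>k. (?N ^^ k) b = 0" using B(3) by (auto simp: generalized_eigenspace_def)
  then obtain kb where kb: "\<And>b. b \<in> B \<Longrightarrow> (?N ^^ kb b) b = 0" by metis
  \<comment> \<open>A sum instead of a maximum, so that the empty set is covered too.\<close>
  define K where "K = sum kb B"
  have K: "(?N ^^ K) b = 0" if "b \<in> B" for b
    by (rule shift_zero_mono[OF kb[OF that]]) (use that B(1) in \<open>simp add: K_def member_le_sum\<close>)
  define G where "G = (\<lambda>(j, b). (?N ^^ j) b) ` ({..K} \<times> B)"
  have finG: "finite G" unfolding G_def using B(1) by simp
  have powE: "(?N ^^ j) b \<in> E lam" if "b \<in> E lam" for j b
    using that by (induction j) (auto simp: E_shift[symmetric])
  have GE: "G \<subseteq> E lam" using powE B(3) by (auto simp: G_def)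
  have BG: "B \<subseteq> G" unfolding G_def by (force intro!: image_eqI[of _ _ "(0, _)"])
  have NG: "?N b \<in> complex_vector.span G" if bG: "b \<in> G" for b
  proof -
    obtain j c where jc: "j \<le> K" "c \<in> B" "b = (?N ^^ j) c" using bG by (auto simp: G_def)
    have Nb: "?N b = (?N ^^ Suc j) c" using jc by simp
    show ?thesis
    proof (cases "j = K")
      case True
      then have "?N b = 0" using K[OF jc(2)] jc(3) by (simp add: T_linear)
      then show ?thesis by (simp only: complex_vector.span_zero)
    next
      case False
      then have "Suc j \<le> K" using jc(1) by simp
      then have "(?N ^^ Suc j) c \<in> G" unfolding G_def using jc(2) by (intro image_eqI[of _ _ "(Suc j, c)"]) auto
      then show ?thesis unfolding Nb by (rule complex_vector.span_base)
    qed
  qed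
  have TG: "T b \<in> complex_vector.span G" if "b \<in> G" for b
  proof -
    have "?N b + lam *\<^sub>C b \<in> complex_vector.span G"
      by (intro complex_vector.span_add NG complex_vector.span_scale complex_vector.span_base that)
    then show ?thesis by simp
  qed
  obtain C where C: "C \<subseteq> G" "complex_vector.independent C" "G \<subseteq> complex_vector.span C"
    using complex_vector.maximal_independent_subset by blast
  have finC: "finite C" using C(1) finG finite_subset by blast
  have spanCG: "complex_vector.span C = complex_vector.span G"
    using C by (metis complex_vector.span_mono complex_vector.span_span subset_antisym)
  have inv: "T y \<in> complex_vector.span C" if "y \<in> complex_vector.span C" for y
    using that unfolding spanCG
  proof (induction rule: complex_vector.span_induct_alt)
    case base
    show ?case by (simp add: T_linear complex_vector.span_zero)
  next
    case (step c b y)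
    then show ?case
      unfolding T_linear by (intro complex_vector.span_add[OF complex_vector.span_scale[OF TG]])
  qed
  have "B \<subseteq> complex_vector.span C" using BG C(3) by blast
  then have "card B \<le> card C"
    using complex_vector.independent_span_bound[OF finC B(2)] by blast
  also have "card C \<le> q"
  proof -
    have CE: "C \<subseteq> E lam" using C(1) GE by blast
    obtain v Q where v: "nuclear_rep a f (\<lambda>k. Q (x k)) v"
      "\<And>z. D z = (1 - z * lam) ^ card C * fredholm_det (\<lambda>i j. cdual_apply (f i) (Q (x j))) z"
      by (rule subsystem[OF lam finC C(2) CE inv]) blast+
    interpret v: nuclear_rep a f "\<lambda>k. Q (x k)" v by (rule v(1))
    obtain r H where H: "H holomorphic_on UNIV" "H (inverse lam) \<noteq> 0" "\<And>z. v.D z = (z - inverse lam) ^ r * H z"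
      using has_root_order_exists[OF v.me.hol, of 0 "inverse lam"] v.me.D0 unfolding has_root_order_def by auto
    have eq: "1 - z * lam = (z - inverse lam) * (- lam)" for z using lam by (simp add: field_simps)
    have "D z = (z - inverse lam) ^ (card C + r) * ((- lam) ^ card C * H z)" for z
      unfolding v(2) H(3) eq by (simp only: power_add power_mult_distrib mult_ac)
    moreover have "(\<lambda>z. (- lam) ^ card C * H z) holomorphic_on UNIV" by (intro holomorphic_intros H)
    ultimately have "has_root_order D (inverse lam) (card C + r)"
      unfolding has_root_order_def using H(2) lam by (intro exI[of _ "\<lambda>z. (- lam) ^ card C * H z"]) auto
    then show ?thesis using has_root_order_unique q by fastforce
  qed
  finally show ?thesis .
qed

text \<open>All of \<open>E lam\<close> is split off. A vector fixed by 1/lam times the remaining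
  operator satisfies T y - lam y \<in> E lam, hence lies in \<open>E lam\<close> itself, where the
  remaining operator is 0. So the remaining determinant does not vanish at 1/lam.\<close>

theorem root_order_eq_alg_multiplicity:
  assumes lam: "lam \<noteq> 0"
  shows "has_root_order D (inverse lam) (alg_multiplicity T lam)"
    and "alg_multiplicity T lam \<noteq> 0 \<longleftrightarrow> Defs.eigenvalue T lam"
proof -
  obtain q where q: "has_root_order D (inverse lam) q"
    using has_root_order_exists[OF me.hol, of 0 "inverse lam"] me.D0 by auto
  obtain B where B: "B \<subseteq> E lam" "complex_vector.independent B" "E lam \<subseteq> complex_vector.span B"
    using complex_vector.maximal_independent_subset by blast
  have finB: "finite B"
  proof (rule ccontr)
    assume "infinite B"
    then obtain B' where B': "B' \<subseteq> B" "finite B'" "card B' = Suc q" by (rule infinite_arbitrarily_large[THEN exE]) auto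
    have "card B' \<le> q"
      using complex_vector.independent_mono[OF B(2) B'(1)] B(1) B' by (intro card_independent_le[OF lam q]) auto
    then show False using B'(3) by simp
  qed
  have span: "complex_vector.span B = E lam"
    using B complex_vector.span_minimal[OF B(1) subspace_E] by blast
  \<comment> \<open>The basis is finite, so a dimension 0 really means the zero space and not the
    default value.\<close>
  have dim: "alg_multiplicity T lam = card B"
    unfolding alg_multiplicity_def using complex_vector.basis_card_eq_dim[OF B(1,3,2)] by simp
  have inv: "T y \<in> complex_vector.span B" if "y \<in> complex_vector.span B" for y
    using that T_E unfolding span by blast
  obtain v Q where v: "nuclear_rep a f (\<lambda>k. Q (x k)) v"
    "\<And>z. D z = (1 - z * lam) ^ card B * fredholm_det (\<lambda>i j. cdual_apply (f i) (Q (x j))) z"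
    "\<And>y. y - Q y \<in> complex_vector.span B" "\<And>y. y \<in> complex_vector.span B \<Longrightarrow> Q y = 0"
    "\<And>y. ptensor_op v y = Q (T y)"
    by (rule subsystem[OF lam finB B(2,1) inv]) blast+
  interpret v: nuclear_rep a f "\<lambda>k. Q (x k)" v by (rule v(1))
  have "v.D (inverse lam) \<noteq> 0"
  proof (rule v.fredholm_nonzero)
    fix y assume y: "y = inverse lam *\<^sub>C ptensor_op v y"
    then have ly: "lam *\<^sub>C y = Q (T y)" using lam v(5) by (metis complex_vector.scale_one right_inverse scaleC_scaleC)
    have "T y - lam *\<^sub>C y \<in> E lam" unfolding ly using v(3) span by blast
    then have "y \<in> E lam" using E_shift by blast
    then have "Q (T y) = 0" using v(4) T_E span by blast
    then have "lam *\<^sub>C y = 0" using ly by simp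
    then show "y = 0" using lam by simp
  qed
  moreover have eq: "1 - z * lam = (z - inverse lam) * (- lam)" for z using lam by (simp add: field_simps)
  have "D z = (z - inverse lam) ^ card B * ((- lam) ^ card B * v.D z)" for z
    unfolding v(2) eq by (simp only: power_mult_distrib mult_ac)
  moreover have "(\<lambda>z. (- lam) ^ card B * v.D z) holomorphic_on UNIV"
    by (intro holomorphic_intros v.me.hol)
  ultimately show "has_root_order D (inverse lam) (alg_multiplicity T lam)"
    unfolding has_root_order_def dim using lam by (intro exI[of _ "\<lambda>z. (- lam) ^ card B * v.D z"]) auto
  show "alg_multiplicity T lam \<noteq> 0 \<longleftrightarrow> Defs.eigenvalue T lam"
  proof
    assume "Defs.eigenvalue T lam"
    then obtain y where y: "y \<noteq> 0" "T y = lam *\<^sub>C y" by (auto simp: Defs.eigenvalue_def)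
    then have "((\<lambda>y. T y - lam *\<^sub>C y) ^^ 1) y = 0" by simp
    then have "y \<in> complex_vector.span B" unfolding span generalized_eigenspace_def by blast
    then have "B \<noteq> {}" using y(1) by auto
    then show "alg_multiplicity T lam \<noteq> 0" using finB by (simp add: dim)
  next
    assume "alg_multiplicity T lam \<noteq> 0"
    then have "B \<noteq> {}" by (auto simp: dim)
    then obtain b where b: "b \<in> B" by blast
    then have "b \<noteq> 0" using B(2) complex_vector.dependent_zero by blast
    obtain k where k: "((\<lambda>y. T y - lam *\<^sub>C y) ^^ k) b = 0" using b B(1) by (auto simp: generalized_eigenspace_def)
    \<comment> \<open>The last nonzero iterate of T - lam at a generalized eigenvector is an
      eigenvector.\<close>
    define Z where "Z k \<longleftrightarrow> ((\<lambda>y. T y - lam *\<^sub>C y) ^^ k) b = 0" for k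
    define m where "m = (LEAST k. Z k)"
    have "Z k" using k by (simp add: Z_def)
    then have "Z m" unfolding m_def by (rule LeastI)
    then have m: "((\<lambda>y. T y - lam *\<^sub>C y) ^^ m) b = 0" by (simp add: Z_def)
    then obtain j where j: "m = Suc j" using \<open>b \<noteq> 0\<close> by (cases m) auto
    have "((\<lambda>y. T y - lam *\<^sub>C y) ^^ j) b \<noteq> 0" using not_less_Least[of j Z] j unfolding m_def Z_def by simp
    moreover have "T (((\<lambda>y. T y - lam *\<^sub>C y) ^^ j) b) = lam *\<^sub>C (((\<lambda>y. T y - lam *\<^sub>C y) ^^ j) b)"
      using m unfolding j by simp
    ultimately show "Defs.eigenvalue T lam" unfolding Defs.eigenvalue_def by blast
  qed
qed

theorem central_symmetric_iff:
  "central_symmetric_spectrum T \<longleftrightarrow> (\<forall>n\<ge>1. ptrace (ptensor_power u (2 * n - 1)) = 0)"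
proof
  assume sym: "central_symmetric_spectrum T"
  have root_sym: "has_root_order D (- w) d" if w: "w \<noteq> 0" and d: "has_root_order D w d" for w d
  proof -
    define lam where "lam = inverse w"
    have lam: "lam \<noteq> 0" "- lam \<noteq> 0" and wl: "w = inverse lam" "- w = inverse (- lam)" using w by (auto simp: lam_def)
    have d_eq: "d = alg_multiplicity T lam"
      using has_root_order_unique d root_order_eq_alg_multiplicity(1)[OF lam(1)] wl(1) by simp
    have "alg_multiplicity T (- lam) = alg_multiplicity T lam"
    proof (cases "Defs.eigenvalue T lam")
      case True
      then show ?thesis using sym lam(1) by (auto simp: central_symmetric_spectrum_def)
    next
      \<comment> \<open>Central symmetry speaks of eigenvalues only. Applied at \<open>- lam\<close>
        it shows that neither number is an eigenvalue, and both multiplicities are 0.\<close>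
      case False
      then have "\<not> Defs.eigenvalue T (- lam)"
        using sym lam(2) unfolding central_symmetric_spectrum_def by (metis minus_minus)
      then show ?thesis
        using False root_order_eq_alg_multiplicity(2)[OF lam(1)] root_order_eq_alg_multiplicity(2)[OF lam(2)] by simp
    qed
    then show ?thesis
      using root_order_eq_alg_multiplicity(1)[OF lam(2)] wl(2) d_eq by simp
  qed
  show "\<forall>n\<ge>1. ptrace (ptensor_power u (2 * n - 1)) = 0"
  proof (intro allI impI)
    fix n :: nat assume "n \<ge> 1"
    then have "odd (2 * n - 1)" by simp
    then show "ptrace (ptensor_power u (2 * n - 1)) = 0" using me.odd_traces_vanish[OF root_sym] by blast
  qed
next
  assume tr: "\<forall>n\<ge>1. ptrace (ptensor_power u (2 * n - 1)) = 0"
  have "ptrace (ptensor_power u m) = 0" if "odd m" for m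
  proof -
    from that obtain k where "m = 2 * k + 1" by (rule oddE)
    then have "m = 2 * Suc k - 1" by simp
    then show ?thesis using tr by (metis le_add1 plus_1_eq_Suc)
  qed
  then have even: "D (- z) = D z" for z by (rule me.even_if_odd_traces_vanish)
  have mult: "alg_multiplicity T (- lam) = alg_multiplicity T lam" if "lam \<noteq> 0" for lam
  proof -
    from root_order_eq_alg_multiplicity(1)[OF that] obtain H
      where H: "H holomorphic_on UNIV" "H (inverse lam) \<noteq> 0" "\<And>z. D z = (z - inverse lam) ^ alg_multiplicity T lam * H z"
      unfolding has_root_order_def by blast
    \<comment> \<open>The cofactor after substituting -z; the sign collects the factors -1 of the
      power.\<close>
    define H' where "H' z = (- 1) ^ alg_multiplicity T lam * H (- z)" for z
    have "D z = (z - inverse (- lam)) ^ alg_multiplicity T lam * H' z" for z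
    proof -
      have "D z = (- z - inverse lam) ^ alg_multiplicity T lam * H (- z)"
        using even[of z] H(3)[of "- z"] by simp
      also have "- z - inverse lam = (- 1) * (z - inverse (- lam))" by simp
      finally show ?thesis by (simp only: H'_def power_mult_distrib mult_ac)
    qed
    moreover have "(\<lambda>z. H (- z)) holomorphic_on UNIV"
      by (rule holomorphic_on_compose_gen[OF _ H(1), unfolded o_def]) (auto intro!: holomorphic_intros)
    then have "H' holomorphic_on UNIV"
      unfolding H'_def by (intro holomorphic_intros)
    moreover have "H' (inverse (- lam)) \<noteq> 0" using H(2) by (simp add: H'_def)
    ultimately have ord: "has_root_order D (inverse (- lam)) (alg_multiplicity T lam)"
      unfolding has_root_order_def by (intro exI[of _ H'] conjI allI)
    have "- lam \<noteq> 0" using that by simp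
    from has_root_order_unique[OF root_order_eq_alg_multiplicity(1)[OF this] ord] show ?thesis .
  qed
  show "central_symmetric_spectrum T"
    unfolding central_symmetric_spectrum_def
  proof (intro allI impI conjI)
    fix lam assume lam: "lam \<noteq> 0" and ev: "Defs.eigenvalue T lam"
    show eq: "alg_multiplicity T (- lam) = alg_multiplicity T lam" by (rule mult[OF lam])
    have ml: "- lam \<noteq> 0" using lam by simp
    have "alg_multiplicity T lam \<noteq> 0"
      by (rule root_order_eq_alg_multiplicity(2)[OF lam, THEN iffD2, OF ev])
    then have "alg_multiplicity T (- lam) \<noteq> 0" unfolding eq .
    then show "Defs.eigenvalue T (- lam)"
      by (rule root_order_eq_alg_multiplicity(2)[OF ml, THEN iffD1])
  qed
qed

end

section \<open>Extension of functionals in finitely many steps\<close>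

text \<open>A functional on a subspace dominated by the seminorm is given by its graph. Domination makes the
  graph single-valued and forces equal values at functions at distance zero, so functions need not be
  identified almost everywhere.\<close>

locale function_seminorm =
  fixes L :: "('m \<Rightarrow> complex) set" and q :: "('m \<Rightarrow> complex) \<Rightarrow> real"
  assumes L_add: "\<And>g h. g \<in> L \<Longrightarrow> h \<in> L \<Longrightarrow> (\<lambda>x. g x + h x) \<in> L"
    and L_scale: "\<And>c g. g \<in> L \<Longrightarrow> (\<lambda>x. c * g x) \<in> L"
    and q_add: "\<And>g h. g \<in> L \<Longrightarrow> h \<in> L \<Longrightarrow> q (\<lambda>x. g x + h x) \<le> q g + q h"
    and q_scale: "\<And>c g. g \<in> L \<Longrightarrow> q (\<lambda>x. c * g x) = cmod c * q g"
begin

definition real_graph :: "(('m \<Rightarrow> complex) \<times> real) set \<Rightarrow> bool"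
  where "real_graph G \<longleftrightarrow> G \<noteq> {} \<and>
    (\<forall>(g, r)\<in>G. \<forall>(h, s)\<in>G. (\<lambda>x. g x + h x, r + s) \<in> G) \<and>
    (\<forall>c. \<forall>(g, r)\<in>G. (\<lambda>x. complex_of_real c * g x, c * r) \<in> G) \<and>
    (\<forall>(g, r)\<in>G. g \<in> L \<and> r \<le> q g)"

definition extend_real :: "('m \<Rightarrow> complex) \<Rightarrow> real \<Rightarrow> (('m \<Rightarrow> complex) \<times> real) set \<Rightarrow> (('m \<Rightarrow> complex) \<times> real) set"
  where "extend_real v b G = {(\<lambda>x. g x + complex_of_real t * v x, r + b * t) | g r t. (g, r) \<in> G}"

lemma extend_realI:
  "(g, r) \<in> G \<Longrightarrow> h = (\<lambda>x. g x + complex_of_real t * v x) \<Longrightarrow> s = r + b * t \<Longrightarrow> (h, s) \<in> extend_real v b G"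
  unfolding extend_real_def by blast

text \<open>The classical one-dimensional step. Admissible values at \<open>v\<close> lie between
  all r - q(g - v) and all q(h + v) - s, and subadditivity makes every lower bound at most every
  upper bound. Homogeneity reduces the multiples of \<open>v\<close> to v and -v.\<close>

lemma real_extension:
  assumes G: "real_graph G" and v: "v \<in> L"
  shows "\<exists>b. real_graph (extend_real v b G)"
proof -
  have add: "(\<lambda>x. g x + h x, r + s) \<in> G" if "(g, r) \<in> G" "(h, s) \<in> G" for g r h s
    using G that unfolding real_graph_def by blast
  have scale: "(\<lambda>x. complex_of_real c * g x, c * r) \<in> G" if "(g, r) \<in> G" for c g r
    using G that unfolding real_graph_def by blast
  have L: "g \<in> L" and le: "r \<le> q g" if "(g, r) \<in> G" for g r
    using G that unfolding real_graph_def by blast+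
  obtain g0 r0 where g0: "(g0, r0) \<in> G" using G unfolding real_graph_def by auto
  have mv: "(\<lambda>x. - 1 * v x) \<in> L" by (rule L_scale[OF v])
  have gm: "(\<lambda>x. g x - v x) \<in> L" if "(g, r) \<in> G" for g r
    using L_add[OF L[OF that] mv] by simp
  have gp: "(\<lambda>x. g x + v x) \<in> L" if "(g, r) \<in> G" for g r
    by (rule L_add[OF L[OF that] v])
  define S where "S = {r - q (\<lambda>x. g x - v x) | g r. (g, r) \<in> G}"
  have key: "r - q (\<lambda>x. g x - v x) \<le> q (\<lambda>x. h x + v x) - s" if "(g, r) \<in> G" "(h, s) \<in> G" for g r h s
  proof -
    have "r + s \<le> q (\<lambda>x. g x + h x)" by (rule le[OF add[OF that]])
    also have "(\<lambda>x. g x + h x) = (\<lambda>x. (g x - v x) + (h x + v x))" by (simp add: fun_eq_iff)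
    also have "q \<dots> \<le> q (\<lambda>x. g x - v x) + q (\<lambda>x. h x + v x)"
      by (rule q_add[OF gm[OF that(1)] gp[OF that(2)]])
    finally show ?thesis by simp
  qed
  have S: "S \<noteq> {}" "bdd_above S"
    using g0 key[OF _ g0] unfolding S_def by (auto intro!: bdd_aboveI)
  define b where "b = Sup S"
  have lower: "r - q (\<lambda>x. g x - v x) \<le> b" if "(g, r) \<in> G" for g r
    unfolding b_def using that S by (intro cSup_upper) (auto simp: S_def)
  have upper: "b \<le> q (\<lambda>x. g x + v x) - r" if "(g, r) \<in> G" for g r
    unfolding b_def using S key[OF _ that] by (intro cSup_least) (auto simp: S_def)
  have bound: "r + b * t \<le> q (\<lambda>x. g x + complex_of_real t * v x)" if gr: "(g, r) \<in> G" for g r t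
  proof -
    consider "t = 0" | "t > 0" | "t < 0" by linarith
    then show ?thesis
    proof cases
      case 1
      then show ?thesis using le[OF gr] by simp
    next
      case 2
      let ?g = "\<lambda>x. complex_of_real (1 / t) * g x"
      have "b \<le> q (\<lambda>x. ?g x + v x) - 1 / t * r" by (rule upper[OF scale[OF gr]])
      then have "r + b * t \<le> t * q (\<lambda>x. ?g x + v x)" using 2 by (simp add: field_simps)
      also have "\<dots> = q (\<lambda>x. complex_of_real t * (?g x + v x))"
        using 2 by (subst q_scale[OF gp[OF scale[OF gr]]]) simp
      also have "(\<lambda>x. complex_of_real t * (?g x + v x)) = (\<lambda>x. g x + complex_of_real t * v x)"
        using 2 by (simp add: fun_eq_iff field_simps)
      finally show ?thesis .
    next
      case 3
      let ?g = "\<lambda>x. complex_of_real (1 / (- t)) * g x"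
      have "1 / (- t) * r - q (\<lambda>x. ?g x - v x) \<le> b" by (rule lower[OF scale[OF gr]])
      then have "r + b * t \<le> (- t) * q (\<lambda>x. ?g x - v x)" using 3 by (simp add: field_simps)
      also have "\<dots> = q (\<lambda>x. complex_of_real (- t) * (?g x - v x))"
        using 3 by (subst q_scale[OF gm[OF scale[OF gr]]]) simp
      also have "(\<lambda>x. complex_of_real (- t) * (?g x - v x)) = (\<lambda>x. g x + complex_of_real t * v x)"
        using 3 by (simp add: fun_eq_iff field_simps)
      finally show ?thesis .
    qed
  qed
  have "real_graph (extend_real v b G)" (is "real_graph ?G'")
    unfolding real_graph_def
  proof (intro conjI ballI allI, goal_cases)
    case 1
    show ?case using extend_realI[OF g0 HOL.refl HOL.refl] by blast
  next
    case (2 p)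
    then obtain g r t where p: "p = (\<lambda>x. g x + complex_of_real t * v x, r + b * t)" "(g, r) \<in> G"
      unfolding extend_real_def by blast
    show ?case unfolding p(1) case_prod_conv
    proof (rule ballI)
      fix p' assume "p' \<in> ?G'"
      then obtain h s t' where p': "p' = (\<lambda>x. h x + complex_of_real t' * v x, s + b * t')" "(h, s) \<in> G"
        unfolding extend_real_def by blast
      show "case p' of (h, s) \<Rightarrow> (\<lambda>x. g x + complex_of_real t * v x + h x, r + b * t + s) \<in> ?G'"
        unfolding p'(1) case_prod_conv
        by (rule extend_realI[OF add[OF p(2) p'(2)], where t = "t + t'"]) (simp_all add: fun_eq_iff algebra_simps)
    qed
  next
    case (3 c p)
    then obtain g r t where p: "p = (\<lambda>x. g x + complex_of_real t * v x, r + b * t)" "(g, r) \<in> G"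
      unfolding extend_real_def by blast
    show ?case unfolding p(1) case_prod_conv
      by (rule extend_realI[OF scale[OF p(2), of c], where t = "c * t"]) (simp_all add: fun_eq_iff algebra_simps)
  next
    case (4 p)
    then obtain g r t where p: "p = (\<lambda>x. g x + complex_of_real t * v x, r + b * t)" "(g, r) \<in> G"
      unfolding extend_real_def by blast
    show ?case unfolding p(1) case_prod_conv
      using L_add[OF L[OF p(2)] L_scale[OF v]] bound[OF p(2)] by blast
  qed
  then show ?thesis by blast
qed

definition extend_complex :: "('m \<Rightarrow> complex) \<Rightarrow> complex \<Rightarrow> (('m \<Rightarrow> complex) \<times> complex) set \<Rightarrow> (('m \<Rightarrow> complex) \<times> complex) set"
  where "extend_complex v b G = {(\<lambda>x. g x + \<tau> * v x, z + \<tau> * b) | g z \<tau>. (g, z) \<in> G}"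

lemma extend_complexI:
  "(g, z) \<in> G \<Longrightarrow> h = (\<lambda>x. g x + \<tau> * v x) \<Longrightarrow> s = z + \<tau> * b \<Longrightarrow> (h, s) \<in> extend_complex v b G"
  unfolding extend_complex_def by blast

definition complex_graph :: "(('m \<Rightarrow> complex) \<times> complex) set \<Rightarrow> bool"
  where "complex_graph G \<longleftrightarrow> G \<noteq> {} \<and>
    (\<forall>(g, z)\<in>G. \<forall>(h, w)\<in>G. (\<lambda>x. g x + h x, z + w) \<in> G) \<and>
    (\<forall>c. \<forall>(g, z)\<in>G. (\<lambda>x. c * g x, c * z) \<in> G) \<and>
    (\<forall>(g, z)\<in>G. g \<in> L \<and> cmod z \<le> q g)"

lemma complex_graphD:
  assumes "complex_graph G"
  shows "(g, z) \<in> G \<Longrightarrow> (h, w) \<in> G \<Longrightarrow> (\<lambda>x. g x + h x, z + w) \<in> G"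
    and "(g, z) \<in> G \<Longrightarrow> (\<lambda>x. c * g x, c * z) \<in> G"
    and "(g, z) \<in> G \<Longrightarrow> g \<in> L" "(g, z) \<in> G \<Longrightarrow> cmod z \<le> q g"
    and "(\<lambda>x. 0, 0) \<in> G"
proof -
  show 2: "(\<lambda>x. c * g x, c * z) \<in> G" if "(g, z) \<in> G" for c g z
    using assms that unfolding complex_graph_def by blast
  obtain g0 z0 where "(g0, z0) \<in> G" using assms unfolding complex_graph_def by auto
  from 2[OF this, of 0] show "(\<lambda>x. 0, 0) \<in> G" by simp
qed (use assms in \<open>unfold complex_graph_def, blast\<close>)+

lemma complex_graph_sum:
  assumes G: "complex_graph G" and "finite I" "\<And>i. i \<in> I \<Longrightarrow> (g i, z i) \<in> G"
  shows "(\<lambda>x. \<Sum>i\<in>I. c i * g i x, \<Sum>i\<in>I. c i * z i) \<in> G"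
  using assms(2,3)
proof (induction I rule: finite_induct)
  case empty
  then show ?case using complex_graphD(5)[OF G] by simp
next
  case (insert i I)
  then show ?case
    using complex_graphD(1)[OF G complex_graphD(2)[OF G, of "g i" "z i" "c i"], of "\<lambda>x. \<Sum>i\<in>I. c i * g i x"] by simp
qed

text \<open>The real part is extended to v and to \<i> v by two real steps, from which the complex
  value is assembled. Rotating a value onto the positive axis turns the bound for real parts into
  one for moduli.\<close>

lemma complex_extension:
  assumes G: "complex_graph G" and v: "v \<in> L"
  shows "\<exists>G' b. complex_graph G' \<and> G \<subseteq> G' \<and> (v, b) \<in> G'"
proof -
  note D = complex_graphD[OF G]
  define R0 where "R0 = {(g, Re z) | g z. (g, z) \<in> G}"
  have "real_graph R0"
    unfolding real_graph_def
  proof (intro conjI ballI allI, goal_cases)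
    case 1
    then show ?case using D(5) unfolding R0_def by blast
  next
    case (2 p)
    then obtain g z where p: "p = (g, Re z)" "(g, z) \<in> G" unfolding R0_def by blast
    show ?case unfolding p(1) case_prod_conv
    proof (rule ballI)
      fix p' assume "p' \<in> R0"
      then obtain h w where p': "p' = (h, Re w)" "(h, w) \<in> G" unfolding R0_def by blast
      show "case p' of (h, s) \<Rightarrow> (\<lambda>x. g x + h x, Re z + s) \<in> R0"
        unfolding p'(1) case_prod_conv R0_def using D(1)[OF p(2) p'(2)] by (force simp flip: plus_complex.sel(1))
    qed
  next
    case (3 c p)
    then obtain g z where p: "p = (g, Re z)" "(g, z) \<in> G" unfolding R0_def by blast
    have "c * Re z = Re (complex_of_real c * z)" by simp
    then show ?case unfolding p(1) case_prod_conv R0_def using D(2)[OF p(2), of "complex_of_real c"] by blast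
  next
    case (4 p)
    then obtain g z where p: "p = (g, Re z)" "(g, z) \<in> G" unfolding R0_def by blast
    show ?case unfolding p(1) case_prod_conv
      using D(3,4)[OF p(2)] complex_Re_le_cmod[of z] by auto
  qed
  from real_extension[OF this v] obtain b1 where
    R1: "real_graph (extend_real v b1 R0)" by blast
  have iv: "(\<lambda>x. \<i> * v x) \<in> L" by (rule L_scale[OF v])
  from real_extension[OF R1 iv] obtain b2 where
    R2: "real_graph (extend_real (\<lambda>x. \<i> * v x) b2 (extend_real v b1 R0))" by blast
  \<comment> \<open>A complex linear functional with real part \<open>\<rho>\<close> sends \<open>v\<close> to \<open>\<rho> v - \<i> * \<rho> (\<i> v)\<close>.\<close>
  define b where "b = Complex b1 (- b2)"
  have re: "Re (z + \<tau> * b) \<le> q (\<lambda>x. g x + \<tau> * v x)" if gz: "(g, z) \<in> G" for g z \<tau>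
  proof -
    have "(g, Re z) \<in> R0" using gz unfolding R0_def by blast
    then have R1_mem: "(\<lambda>x. g x + complex_of_real (Re \<tau>) * v x, Re z + b1 * Re \<tau>) \<in> extend_real v b1 R0"
      by (rule extend_realI[where t = "Re \<tau>"]) simp_all
    have "(\<lambda>x. g x + complex_of_real (Re \<tau>) * v x + complex_of_real (Im \<tau>) * (\<i> * v x), Re z + b1 * Re \<tau> + b2 * Im \<tau>)
        \<in> extend_real (\<lambda>x. \<i> * v x) b2 (extend_real v b1 R0)"
      by (rule extend_realI[OF R1_mem, where t = "Im \<tau>"]) simp_all
    then have "Re z + b1 * Re \<tau> + b2 * Im \<tau> \<le> q (\<lambda>x. g x + complex_of_real (Re \<tau>) * v x + complex_of_real (Im \<tau>) * (\<i> * v x))"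
      using R2 unfolding real_graph_def by fast
    also have "(\<lambda>x. g x + complex_of_real (Re \<tau>) * v x + complex_of_real (Im \<tau>) * (\<i> * v x)) = (\<lambda>x. g x + \<tau> * v x)"
    proof
      fix x
      have "\<tau> = complex_of_real (Re \<tau>) + \<i> * complex_of_real (Im \<tau>)" by (rule complex_eq)
      then have "\<tau> * v x = (complex_of_real (Re \<tau>) + \<i> * complex_of_real (Im \<tau>)) * v x" by simp
      then show "g x + complex_of_real (Re \<tau>) * v x + complex_of_real (Im \<tau>) * (\<i> * v x) = g x + \<tau> * v x"
        by (simp add: algebra_simps)
    qed
    also have "Re z + b1 * Re \<tau> + b2 * Im \<tau> = Re (z + \<tau> * b)" by (simp add: b_def algebra_simps)
    finally show ?thesis .
  qed
  have bound: "cmod (z + \<tau> * b) \<le> q (\<lambda>x. g x + \<tau> * v x)" if gz: "(g, z) \<in> G" for g z \<tau>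
  proof -
    define w where "w = z + \<tau> * b"
    define c where "c = (if w = 0 then 1 else cnj w / of_real (cmod w))"
    have c1: "cmod c = 1" by (simp add: c_def norm_divide)
    have "w * cnj w = of_real (cmod w) * of_real (cmod w)"
      by (simp add: complex_norm_square[symmetric] power2_eq_square)
    then have cw: "c * w = of_real (cmod w)" by (simp add: c_def field_simps)
    have "cmod w = Re (c * w)" by (simp add: cw)
    also have "c * w = c * z + (c * \<tau>) * b" by (simp add: w_def algebra_simps)
    also have "Re \<dots> \<le> q (\<lambda>x. c * g x + (c * \<tau>) * v x)" by (rule re[OF D(2)[OF gz]])
    also have "(\<lambda>x. c * g x + (c * \<tau>) * v x) = (\<lambda>x. c * (g x + \<tau> * v x))" by (simp add: algebra_simps)
    also have "q \<dots> = q (\<lambda>x. g x + \<tau> * v x)"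
      by (subst q_scale[OF L_add[OF D(3)[OF gz] L_scale[OF v]]]) (simp add: c1)
    finally show ?thesis by (simp add: w_def)
  qed
  let ?G' = "extend_complex v b G"
  have "complex_graph ?G'"
    unfolding complex_graph_def
  proof (intro conjI ballI allI, goal_cases)
    case 1
    show ?case using extend_complexI[OF D(5) HOL.refl HOL.refl] by blast
  next
    case (2 p)
    then obtain g z t where p: "p = (\<lambda>x. g x + t * v x, z + t * b)" "(g, z) \<in> G"
      unfolding extend_complex_def by blast
    show ?case unfolding p(1) case_prod_conv
    proof (rule ballI)
      fix p' assume "p' \<in> ?G'"
      then obtain h w t' where p': "p' = (\<lambda>x. h x + t' * v x, w + t' * b)" "(h, w) \<in> G"
        unfolding extend_complex_def by blast
      show "case p' of (h, s) \<Rightarrow> (\<lambda>x. g x + t * v x + h x, z + t * b + s) \<in> ?G'"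
        unfolding p'(1) case_prod_conv
        by (rule extend_complexI[OF D(1)[OF p(2) p'(2)], where \<tau> = "t + t'"]) (simp_all add: fun_eq_iff algebra_simps)
    qed
  next
    case (3 c p)
    then obtain g z t where p: "p = (\<lambda>x. g x + t * v x, z + t * b)" "(g, z) \<in> G"
      unfolding extend_complex_def by blast
    show ?case unfolding p(1) case_prod_conv
      by (rule extend_complexI[OF D(2)[OF p(2), of c], where \<tau> = "c * t"]) (simp_all add: fun_eq_iff algebra_simps)
  next
    case (4 p)
    then obtain g z t where p: "p = (\<lambda>x. g x + t * v x, z + t * b)" "(g, z) \<in> G"
      unfolding extend_complex_def by blast
    show ?case unfolding p(1) case_prod_conv
      using L_add[OF D(3)[OF p(2)] L_scale[OF v]] bound[OF p(2)] by blast
  qed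
  moreover have "G \<subseteq> ?G'"
  proof
    fix p assume "p \<in> G"
    then obtain g z where p: "p = (g, z)" "(g, z) \<in> G" by (cases p) auto
    show "p \<in> ?G'" unfolding p(1) by (rule extend_complexI[OF p(2), where \<tau> = 0]) simp_all
  qed
  moreover have "(v, b) \<in> ?G'"
    by (rule extend_complexI[OF D(5), where \<tau> = 1]) simp_all
  ultimately show ?thesis by blast
qed

text \<open>Finitely many steps suffice because functionals will be evaluated only at the indicators
  of a finite partition.\<close>

lemma Hahn_Banach_finite:
  assumes G: "complex_graph G" and v: "\<And>k. k < m \<Longrightarrow> v k \<in> L"
  shows "\<exists>G' b. complex_graph G' \<and> G \<subseteq> G' \<and> (\<forall>k<(m::nat). (v k, b k) \<in> G')"
  using v
proof (induction m)
  case 0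
  then show ?case using G by auto
next
  case (Suc m)
  then obtain G' b where G': "complex_graph G'" "G \<subseteq> G'" "\<And>k. k < m \<Longrightarrow> (v k, b k) \<in> G'" by auto
  obtain G'' c where G'': "complex_graph G''" "G' \<subseteq> G''" "(v m, c) \<in> G''"
    using complex_extension[OF G'(1), of "v m"] Suc.prems by auto
  have "(v k, (b(m := c)) k) \<in> G''" if "k < Suc m" for k
    using that G'(3)[of k] G'' by (cases "k = m") auto
  then show ?case using G'' G'(2) by blast
qed

end

section \<open>Determinants on subquotients of \<open>L\<^sub>p\<close>\<close>

lemma sdet_scale:
  "sdet {..<n} (\<lambda>i j. \<alpha> i * \<gamma> j * B i j) = (\<Prod>i<n. \<alpha> i) * (\<Prod>i<n. \<gamma> i) * sdet {..<n} B"
proof -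
  have "of_int (sign \<pi>) * (\<Prod>i<n. \<alpha> i * \<gamma> (\<pi> i) * B i (\<pi> i)) =
      (\<Prod>i<n. \<alpha> i) * (\<Prod>i<n. \<gamma> i) * (of_int (sign \<pi>) * (\<Prod>i<n. B i (\<pi> i)))" if "\<pi> permutes {..<n}" for \<pi>
    using prod.permute[OF that, of \<gamma>] by (simp add: prod.distrib o_def mult_ac)
  then show ?thesis unfolding sdet_def sum_distrib_left by (intro sum.cong) auto
qed

lemma tendsto_sdet:
  assumes "\<And>i j. i < n \<Longrightarrow> j < n \<Longrightarrow> (\<lambda>m. B m i j) \<longlonglongrightarrow> B' i j"
  shows "(\<lambda>m. sdet {..<n} (B m)) \<longlonglongrightarrow> sdet {..<n} B'"
  unfolding sdet_def
proof (intro tendsto_sum tendsto_mult tendsto_const tendsto_prod)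
  fix \<pi> i assume "\<pi> \<in> {\<pi>. \<pi> permutes {..<n}}" "i \<in> {..<n}"
  then have "\<pi> i < n" using permutes_in_image[of \<pi> "{..<n}" i] by simp
  then show "(\<lambda>m. B m i (\<pi> i)) \<longlonglongrightarrow> B' i (\<pi> i)" using assms \<open>i \<in> {..<n}\<close> by simp
qed

text \<open>Scaling reduces to unit balls; the bounds are positive so that they can be divided by.
  For p < 2 transposition exchanges the roles of \<open>x\<close> and \<open>y\<close>, and |1/2 -
  1/p| = 1/2 - 1/q.\<close>

lemma det_lp_bound_general:
  fixes y x :: "nat \<Rightarrow> nat \<Rightarrow> complex"
  assumes K: "finite K" and pq: "1 < p" "1 < q" "1 / p + 1 / q = 1"
    and \<alpha>: "\<And>i. i < n \<Longrightarrow> 0 < \<alpha> i" and \<gamma>: "\<And>i. i < n \<Longrightarrow> 0 < \<gamma> i"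
    and x: "\<And>i. i < n \<Longrightarrow> (\<Sum>k\<in>K. cmod (x i k) powr p) \<le> \<gamma> i powr p"
    and y: "\<And>i. i < n \<Longrightarrow> (\<Sum>k\<in>K. cmod (y i k) powr q) \<le> \<alpha> i powr q"
  shows "cmod (sdet {..<n} (\<lambda>i j. \<Sum>k\<in>K. y i k * x j k)) \<le>
    hadamard_const \<bar>1 / 2 - 1 / p\<bar> n * ((\<Prod>i<n. \<alpha> i) * (\<Prod>i<n. \<gamma> i))"
proof (cases "n = 0")
  case True
  then show ?thesis by (simp add: sdet_def hadamard_const_def)
next
  case False
  then have n: "n \<ge> 1" by simp
  define x' where "x' i k = x i k / of_real (\<gamma> i)" for i k
  define y' where "y' i k = y i k / of_real (\<alpha> i)" for i k
  have x': "(\<Sum>k\<in>K. cmod (x' i k) powr p) \<le> 1" if "i < n" for i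
  proof -
    have "(\<Sum>k\<in>K. cmod (x' i k) powr p) = (\<Sum>k\<in>K. cmod (x i k) powr p) / \<gamma> i powr p"
      using \<gamma>[OF that] by (simp add: x'_def norm_divide powr_divide sum_divide_distrib)
    then show ?thesis using x[OF that] \<gamma>[OF that] by (simp add: divide_le_eq_1)
  qed
  have y': "(\<Sum>k\<in>K. cmod (y' i k) powr q) \<le> 1" if "i < n" for i
  proof -
    have "(\<Sum>k\<in>K. cmod (y' i k) powr q) = (\<Sum>k\<in>K. cmod (y i k) powr q) / \<alpha> i powr q"
      using \<alpha>[OF that] by (simp add: y'_def norm_divide powr_divide sum_divide_distrib)
    then show ?thesis using y[OF that] \<alpha>[OF that] by (simp add: divide_le_eq_1)
  qed
  have main: "cmod (sdet {..<n} (\<lambda>i j. \<Sum>k\<in>K. y' i k * x' j k)) \<le> real n powr (real n * \<bar>1 / 2 - 1 / p\<bar>)"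
  proof (cases "2 \<le> p")
    case True
    have "1 / p \<le> 1 / 2" using True by (simp add: field_simps)
    then have "1 / q \<ge> 1 / 2" using pq(3) by linarith
    then have "q \<le> 2" using pq by (simp add: field_simps)
    have "\<bar>1 / 2 - 1 / p\<bar> = 1 / 2 - 1 / p" using \<open>1 / p \<le> 1 / 2\<close> by simp
    then show ?thesis
      using det_lp_bound[OF K n pq(2) \<open>q \<le> 2\<close> True pq(3), of x' y'] x' y' by simp
  next
    case False
    then have "1 / p \<ge> 1 / 2" using pq by (simp add: field_simps)
    then have "1 / q \<le> 1 / 2" using pq(3) by linarith
    then have q2: "2 \<le> q" using pq by (simp add: field_simps)
    have "1 / q + 1 / p = 1" using pq(3) by simp
    from det_lp_bound[OF K n pq(1) _ q2 this, of y' x'] False x' y'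
    have "cmod (sdet {..<n} (\<lambda>i j. \<Sum>k\<in>K. x' i k * y' j k)) \<le> real n powr (real n * (1 / 2 - 1 / q))" by simp
    moreover have "1 / 2 - 1 / q = \<bar>1 / 2 - 1 / p\<bar>" using pq(3) \<open>1 / p \<ge> 1 / 2\<close> by simp
    moreover have "sdet {..<n} (\<lambda>i j. \<Sum>k\<in>K. y' i k * x' j k) = sdet {..<n} (\<lambda>i j. \<Sum>k\<in>K. x' i k * y' j k)"
      by (subst sdet_transpose[symmetric]) (simp add: mult.commute)
    ultimately show ?thesis by simp
  qed
  have "sdet {..<n} (\<lambda>i j. \<Sum>k\<in>K. y i k * x j k) =
      sdet {..<n} (\<lambda>i j. of_real (\<alpha> i) * of_real (\<gamma> j) * (\<Sum>k\<in>K. y' i k * x' j k))"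
  proof (rule sdet_cong)
    fix i j assume "i \<in> {..<n}" "j \<in> {..<n}"
    then have nz: "\<alpha> i \<noteq> 0" "\<gamma> j \<noteq> 0" using \<alpha>[of i] \<gamma>[of j] by auto
    have "of_real (\<alpha> i) * of_real (\<gamma> j) * (y' i k * x' j k) = y i k * x j k" for k
      using nz by (simp add: y'_def x'_def)
    then show "(\<Sum>k\<in>K. y i k * x j k) = of_real (\<alpha> i) * of_real (\<gamma> j) * (\<Sum>k\<in>K. y' i k * x' j k)"
      by (simp only: sum_distrib_left)
  qed
  also have "cmod \<dots> = ((\<Prod>i<n. \<alpha> i) * (\<Prod>i<n. \<gamma> i)) * cmod (sdet {..<n} (\<lambda>i j. \<Sum>k\<in>K. y' i k * x' j k))"
    unfolding sdet_scale norm_mult prod_norm[symmetric]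
    using \<alpha> \<gamma> by (intro arg_cong2[where f = "(*)"] prod.cong HOL.refl) (auto simp: abs_of_pos)
  also have "\<dots> \<le> ((\<Prod>i<n. \<alpha> i) * (\<Prod>i<n. \<gamma> i)) * (real n powr (real n * \<bar>1 / 2 - 1 / p\<bar>))"
    using \<alpha> \<gamma> by (intro mult_left_mono main mult_nonneg_nonneg prod_nonneg) (auto intro: less_imp_le)
  finally show ?thesis using n by (simp add: hadamard_const_def mult_ac max_def)
qed

text \<open>Convexity of the power \<open>P\<close> with weights \<alpha> / (\<alpha> + \<beta>) and
  \<beta> / (\<alpha> + \<beta>). Integrated with \<alpha> and \<beta> above the two norms, it gives
  Minkowski's inequality.\<close>

lemma powr_convex_weighted:
  fixes s t \<alpha> \<beta> P :: real
  assumes P: "1 < P" and s: "0 \<le> s" and t: "0 \<le> t" and \<alpha>: "0 < \<alpha>" and \<beta>: "0 < \<beta>"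
  shows "(s + t) powr P \<le> (\<alpha> + \<beta>) powr P * (\<alpha> / (\<alpha> + \<beta>) * (s / \<alpha>) powr P + \<beta> / (\<alpha> + \<beta>) * (t / \<beta>) powr P)"
proof -
  define w where "w = \<alpha> + \<beta>"
  have w: "w > 0" using \<alpha> \<beta> by (simp add: w_def)
  \<comment> \<open>Convexity is used on the open half-line; when \<open>s\<close> or
    \<open>t\<close> is 0, monotonicity in the exponent takes its place, as \<gamma> / w \<le>
    1.\<close>
  have zero: "(r / w) powr P \<le> \<gamma> / w * (r / \<gamma>) powr P" if "0 < \<gamma>" "\<gamma> \<le> w" "0 \<le> r" for r \<gamma>
  proof -
    have "(r / w) powr P = (\<gamma> / w) powr P * (r / \<gamma>) powr P"
      using that w by (simp add: powr_mult[symmetric])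
    also have "\<dots> \<le> (\<gamma> / w) powr 1 * (r / \<gamma>) powr P"
      using that w P by (intro mult_right_mono powr_mono') auto
    finally show ?thesis using that w by simp
  qed
  have "((s + t) / w) powr P \<le> \<alpha> / w * (s / \<alpha>) powr P + \<beta> / w * (t / \<beta>) powr P"
  proof (cases "s = 0 \<or> t = 0")
    case True
    then show ?thesis using zero[of \<alpha> s] zero[of \<beta> t] \<alpha> \<beta> s t P by (auto simp: w_def)
  next
    case False
    then have "s > 0" "t > 0" using s t by auto
    have c: "convex_on {0<..} (\<lambda>x. x powr P)" using P by (intro powr_convex) simp
    have "((1 - \<beta> / w) *\<^sub>R (s / \<alpha>) + (\<beta> / w) *\<^sub>R (t / \<beta>)) powr P \<le> (1 - \<beta> / w) * (s / \<alpha>) powr P + (\<beta> / w) * (t / \<beta>) powr P"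
      using \<open>s > 0\<close> \<open>t > 0\<close> \<alpha> \<beta> w by (intro convex_onD[OF c]) (auto simp: w_def)
    moreover have "1 - \<beta> / w = \<alpha> / w" using w by (simp add: w_def field_simps)
    moreover have "(\<alpha> / w) *\<^sub>R (s / \<alpha>) + (\<beta> / w) *\<^sub>R (t / \<beta>) = (s + t) / w"
      using \<alpha> \<beta> by (simp add: add_divide_distrib)
    ultimately show ?thesis by simp
  qed
  then have "w powr P * ((s + t) / w) powr P \<le> w powr P * (\<alpha> / w * (s / \<alpha>) powr P + \<beta> / w * (t / \<beta>) powr P)"
    by (intro mult_left_mono) auto
  moreover have "w powr P * ((s + t) / w) powr P = (s + t) powr P"
    using w s t by (simp add: powr_mult[symmetric])
  ultimately show ?thesis by (simp add: w_def)
qed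

section \<open>The seminorm of L_p, step functions and duality for 1 < p < infinity\<close>

locale Lp_space =
  fixes M :: "'m measure" and p :: ennreal and P :: real
  assumes p_fin: "p \<noteq> \<infinity>" and P_def: "P = enn2real p" and P: "1 < P"
begin

lemma functional_eq: "Lp_functional M p g = (\<integral>\<^sup>+ x. ennreal (cmod (g x) powr P) \<partial>M)"
  using p_fin by (simp add: Lp_functional_def P_def)

lemma norm_eq: "Lp_norm M p g = enn2real (Lp_functional M p g) powr (1 / P)"
  using p_fin by (simp add: Lp_norm_def P_def)

lemma norm_nonneg: "0 \<le> Lp_norm M p g"
  by (simp add: norm_eq)

lemma functional_norm:
  assumes "g \<in> Lp_functions M p"
  shows "Lp_functional M p g = ennreal (Lp_norm M p g powr P)"
  using assms P by (simp add: norm_eq powr_powr Lp_functions_def ennreal_enn2real_if less_top)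

lemma norm_leI:
  assumes "Lp_functional M p g \<le> ennreal (\<alpha> powr P)" "0 \<le> \<alpha>"
  shows "Lp_norm M p g \<le> \<alpha>"
proof -
  have "enn2real (Lp_functional M p g) \<le> \<alpha> powr P"
    using assms(1) by (simp add: enn2real_leI)
  then have "Lp_norm M p g \<le> (\<alpha> powr P) powr (1 / P)"
    unfolding norm_eq using P by (intro powr_mono2) auto
  then show ?thesis using assms(2) P by (simp add: powr_powr)
qed

text \<open>The strict upper bounds \<alpha> and \<beta> stand in for the norms: they are positive
  even for null functions, so the convexity weights make sense.\<close>

lemma Lp_functional_add_le:
  assumes g: "g \<in> Lp_functions M p" and h: "h \<in> Lp_functions M p"
    and \<alpha>: "Lp_norm M p g < \<alpha>" and \<beta>: "Lp_norm M p h < \<beta>"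
  shows "Lp_functional M p (\<lambda>x. g x + h x) \<le> ennreal ((\<alpha> + \<beta>) powr P)"
proof -
  have [measurable]: "g \<in> borel_measurable M" "h \<in> borel_measurable M" using g h by (auto simp: Lp_functions_def)
  have \<alpha>0: "\<alpha> > 0" and \<beta>0: "\<beta> > 0" using \<alpha> \<beta> norm_nonneg[of g] norm_nonneg[of h] by linarith+
  define c1 where "c1 = (\<alpha> + \<beta>) powr P * (\<alpha> / (\<alpha> + \<beta>)) / \<alpha> powr P"
  define c2 where "c2 = (\<alpha> + \<beta>) powr P * (\<beta> / (\<alpha> + \<beta>)) / \<beta> powr P"
  have c: "c1 \<ge> 0" "c2 \<ge> 0" using \<alpha>0 \<beta>0 by (auto simp: c1_def c2_def)
  have "Lp_functional M p (\<lambda>x. g x + h x) \<le>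
      (\<integral>\<^sup>+ x. ennreal c1 * ennreal (cmod (g x) powr P) + ennreal c2 * ennreal (cmod (h x) powr P) \<partial>M)"
    unfolding functional_eq
  proof (rule nn_integral_mono)
    fix x
    have "cmod (g x + h x) powr P \<le> (cmod (g x) + cmod (h x)) powr P"
      using P by (intro powr_mono2 norm_triangle_ineq) auto
    also have "\<dots> \<le> (\<alpha> + \<beta>) powr P * (\<alpha> / (\<alpha> + \<beta>) * (cmod (g x) / \<alpha>) powr P + \<beta> / (\<alpha> + \<beta>) * (cmod (h x) / \<beta>) powr P)"
      using \<alpha>0 \<beta>0 by (intro powr_convex_weighted P) auto
    also have "\<dots> = c1 * cmod (g x) powr P + c2 * cmod (h x) powr P"
      using \<alpha>0 \<beta>0 by (simp add: c1_def c2_def powr_divide distrib_left)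
    finally show "ennreal (cmod (g x + h x) powr P) \<le> ennreal c1 * ennreal (cmod (g x) powr P) + ennreal c2 * ennreal (cmod (h x) powr P)"
      using c by (simp add: ennreal_mult[symmetric] ennreal_plus[symmetric] ennreal_leI del: ennreal_plus)
  qed
  also have "\<dots> = ennreal c1 * Lp_functional M p g + ennreal c2 * Lp_functional M p h"
    unfolding functional_eq by (subst nn_integral_add) (auto simp: nn_integral_cmult)
  also have "\<dots> \<le> ennreal c1 * ennreal (\<alpha> powr P) + ennreal c2 * ennreal (\<beta> powr P)"
    unfolding functional_norm[OF g] functional_norm[OF h]
    using \<alpha> \<beta> P by (intro add_mono mult_left_mono ennreal_leI powr_mono2 norm_nonneg) auto
  also have "\<dots> = ennreal (c1 * \<alpha> powr P + c2 * \<beta> powr P)"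
    using c by (simp add: ennreal_mult[symmetric] ennreal_plus[symmetric] del: ennreal_plus)
  also have "c1 * \<alpha> powr P + c2 * \<beta> powr P = (\<alpha> + \<beta>) powr P * (\<alpha> / (\<alpha> + \<beta>) + \<beta> / (\<alpha> + \<beta>))"
    using \<alpha>0 \<beta>0 by (simp add: c1_def c2_def distrib_left)
  also have "\<alpha> / (\<alpha> + \<beta>) + \<beta> / (\<alpha> + \<beta>) = 1" using \<alpha>0 \<beta>0 by (simp add: add_divide_distrib[symmetric])
  finally show ?thesis by simp
qed

lemma Lp_add:
  assumes g: "g \<in> Lp_functions M p" and h: "h \<in> Lp_functions M p"
  shows "(\<lambda>x. g x + h x) \<in> Lp_functions M p"
    and "Lp_norm M p (\<lambda>x. g x + h x) \<le> Lp_norm M p g + Lp_norm M p h"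
proof -
  have "Lp_functional M p (\<lambda>x. g x + h x) < \<infinity>"
    using Lp_functional_add_le[OF g h, of "Lp_norm M p g + 1" "Lp_norm M p h + 1"]
    by (auto simp: ennreal_less_top intro: le_less_trans)
  then show "(\<lambda>x. g x + h x) \<in> Lp_functions M p"
    using g h by (auto simp: Lp_functions_def)
  show "Lp_norm M p (\<lambda>x. g x + h x) \<le> Lp_norm M p g + Lp_norm M p h"
  proof (rule field_le_epsilon)
    fix e :: real assume "e > 0"
    then have "Lp_norm M p (\<lambda>x. g x + h x) \<le> (Lp_norm M p g + e / 2) + (Lp_norm M p h + e / 2)"
      using norm_nonneg[of g] norm_nonneg[of h] by (intro norm_leI Lp_functional_add_le[OF g h]) auto
    then show "Lp_norm M p (\<lambda>x. g x + h x) \<le> Lp_norm M p g + Lp_norm M p h + e" by simp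
  qed
qed

lemma functional_scale:
  assumes "g \<in> borel_measurable M"
  shows "Lp_functional M p (\<lambda>x. c * g x) = ennreal (cmod c powr P) * Lp_functional M p g"
  unfolding functional_eq norm_mult using assms
  by (subst nn_integral_cmult[symmetric]) (auto simp: powr_mult ennreal_mult)

lemma Lp_scale:
  assumes g: "g \<in> Lp_functions M p"
  shows "(\<lambda>x. c * g x) \<in> Lp_functions M p"
    and "Lp_norm M p (\<lambda>x. c * g x) = cmod c * Lp_norm M p g"
proof -
  have m: "g \<in> borel_measurable M" and fin: "Lp_functional M p g < \<infinity>" using g by (auto simp: Lp_functions_def)
  show "(\<lambda>x. c * g x) \<in> Lp_functions M p"
    using m fin by (auto simp: Lp_functions_def functional_scale ennreal_mult_less_top)
  show "Lp_norm M p (\<lambda>x. c * g x) = cmod c * Lp_norm M p g"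
    unfolding norm_eq functional_scale[OF m] using P
    by (simp add: enn2real_mult powr_mult powr_powr)
qed

lemma Lp_cong:
  assumes "\<And>x. x \<in> space M \<Longrightarrow> g x = h x"
  shows "Lp_norm M p g = Lp_norm M p h"
proof -
  have "Lp_functional M p g = Lp_functional M p h"
    unfolding functional_eq by (rule nn_integral_cong) (simp add: assms)
  then show ?thesis by (simp add: norm_eq)
qed

text \<open>Dominated convergence: the approximants are at most 2 |g|, so their differences from g
  are dominated by 3 |g|.\<close>

lemma simple_approximation:
  assumes g: "g \<in> Lp_functions M p" and e: "0 < e"
  shows "\<exists>s. simple_function M s \<and> s \<in> Lp_functions M p \<and> Lp_norm M p (\<lambda>x. g x - s x) < e"
proof -
  have gm[measurable]: "g \<in> borel_measurable M" and gfin: "Lp_functional M p g < \<infinity>" using g by (auto simp: Lp_functions_def)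
  from borel_measurable_implies_sequence_metric[OF gm, of 0] obtain F where
    F0: "\<forall>i. simple_function M (F i)" "\<forall>x\<in>space M. (\<lambda>i. F i x) \<longlonglongrightarrow> g x"
    "\<forall>i. \<forall>x\<in>space M. dist (F i x) 0 \<le> 2 * dist (g x) 0" by blast
  have F: "\<And>i. simple_function M (F i)" "\<And>x. x \<in> space M \<Longrightarrow> (\<lambda>i. F i x) \<longlonglongrightarrow> g x"
    "\<And>i x. x \<in> space M \<Longrightarrow> norm (F i x) \<le> 2 * norm (g x)"
    using F0 by simp_all
  have Fm[measurable]: "F i \<in> borel_measurable M" for i by (rule borel_measurable_simple_function[OF F(1)])
  have dom3: "Lp_functional M p (\<lambda>x. 3 * g x) < \<infinity>"
    using Lp_scale(1)[OF g, of 3] by (simp add: Lp_functions_def)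
  have FL: "F i \<in> Lp_functions M p" for i
  proof -
    have "Lp_functional M p (F i) \<le> Lp_functional M p (\<lambda>x. 3 * g x)"
      unfolding functional_eq
    proof (rule nn_integral_mono)
      fix x assume "x \<in> space M"
      then have "norm (F i x) \<le> 2 * norm (g x)" by (rule F(3))
      also have "\<dots> \<le> norm (3 * g x)" by (simp add: norm_mult)
      finally show "ennreal (cmod (F i x) powr P) \<le> ennreal (cmod (3 * g x) powr P)"
        using P by (intro ennreal_leI powr_mono2) auto
    qed
    then show ?thesis using dom3 by (auto simp: Lp_functions_def)
  qed
  have "(\<lambda>i. \<integral>\<^sup>+ x. ennreal (cmod (g x - F i x) powr P) \<partial>M) \<longlonglongrightarrow> (\<integral>\<^sup>+ x. 0 \<partial>M)"
  proof (rule nn_integral_dominated_convergence[where w = "\<lambda>x. ennreal (cmod (3 * g x) powr P)"])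
    show "(\<integral>\<^sup>+ x. ennreal (cmod (3 * g x) powr P) \<partial>M) < \<infinity>" using dom3 by (simp add: functional_eq)
    show "AE x in M. ennreal (cmod (g x - F j x) powr P) \<le> ennreal (cmod (3 * g x) powr P)" for j
    proof (rule AE_I2)
      fix x assume "x \<in> space M"
      then have "cmod (g x - F j x) \<le> cmod (3 * g x)"
        using F(3)[of x j] norm_triangle_ineq4[of "g x" "F j x"] by (simp add: norm_mult)
      then show "ennreal (cmod (g x - F j x) powr P) \<le> ennreal (cmod (3 * g x) powr P)"
        using P by (intro ennreal_leI powr_mono2) auto
    qed
    show "AE x in M. (\<lambda>i. ennreal (cmod (g x - F i x) powr P)) \<longlonglongrightarrow> 0"
    proof (rule AE_I2)
      fix x assume "x \<in> space M"
      then have "(\<lambda>i. cmod (g x - F i x)) \<longlonglongrightarrow> cmod (g x - g x)" by (intro tendsto_intros F(2))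
      then have "(\<lambda>i. cmod (g x - F i x) powr P) \<longlonglongrightarrow> 0 powr P"
        using P by (intro tendsto_powr2 tendsto_const) (auto intro!: always_eventually)
      then have "(\<lambda>i. ennreal (cmod (g x - F i x) powr P)) \<longlonglongrightarrow> ennreal 0"
        by (intro tendsto_ennrealI) simp
      then show "(\<lambda>i. ennreal (cmod (g x - F i x) powr P)) \<longlonglongrightarrow> 0" by simp
    qed
  qed measurable
  then have "(\<lambda>i. Lp_functional M p (\<lambda>x. g x - F i x)) \<longlonglongrightarrow> 0" by (simp add: functional_eq)
  moreover have "0 < ennreal ((e / 2) powr P)" using e by simp
  ultimately have "eventually (\<lambda>i. Lp_functional M p (\<lambda>x. g x - F i x) < ennreal ((e / 2) powr P)) sequentially"
    by (rule order_tendstoD(2))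
  then obtain i where "Lp_functional M p (\<lambda>x. g x - F i x) < ennreal ((e / 2) powr P)"
    by (auto simp: eventually_sequentially)
  then have "Lp_norm M p (\<lambda>x. g x - F i x) \<le> e / 2" using e by (intro norm_leI) auto
  then show ?thesis using F(1) FL e by (intro exI[of _ "F i"]) auto
qed

lemma step_function:
  fixes m :: nat and c :: "nat \<Rightarrow> complex"
  assumes E: "\<And>k. k < m \<Longrightarrow> E k \<in> sets M" "\<And>k. k < m \<Longrightarrow> emeasure M (E k) < \<infinity>"
    and disj: "disjoint_family_on E {..<m}"
  defines "s \<equiv> \<lambda>x. \<Sum>k<m. c k * indicator (E k) x"
  shows "s \<in> Lp_functions M p" and "Lp_norm M p s powr P = (\<Sum>k<m. cmod (c k) powr P * measure M (E k))"
proof -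
  have pw: "ennreal (cmod (s x) powr P) = (\<Sum>k<m. ennreal (cmod (c k) powr P) * indicator (E k) x)" for x
  proof (cases "\<exists>k<m. x \<in> E k")
    case True
    then obtain k0 where k0: "k0 < m" "x \<in> E k0" by blast
    have other: "x \<notin> E k" if "k < m" "k \<noteq> k0" for k
      using disj k0 that unfolding disjoint_family_on_def by blast
    have "s x = (\<Sum>k<m. if k = k0 then c k else 0)"
      unfolding s_def using other k0 by (intro sum.cong HOL.refl) (auto simp: indicator_def)
    moreover have "(\<Sum>k<m. ennreal (cmod (c k) powr P) * indicator (E k) x) = (\<Sum>k<m. if k = k0 then ennreal (cmod (c k) powr P) else 0)"
      using other k0 by (intro sum.cong HOL.refl) (auto simp: indicator_def)
    ultimately show ?thesis using k0 by simp
  next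
    case False
    then have "s x = 0" "(\<Sum>k<m. ennreal (cmod (c k) powr P) * indicator (E k) x) = 0"
      unfolding s_def by (auto intro!: sum.neutral simp: indicator_def)
    then show ?thesis by simp
  qed
  have eq: "Lp_functional M p s = ennreal (\<Sum>k<m. cmod (c k) powr P * measure M (E k))"
  proof -
    have "Lp_functional M p s = (\<Sum>k<m. \<integral>\<^sup>+ x. ennreal (cmod (c k) powr P) * indicator (E k) x \<partial>M)"
      unfolding functional_eq pw using E(1) by (intro nn_integral_sum) auto
    also have "\<dots> = (\<Sum>k<m. ennreal (cmod (c k) powr P * measure M (E k)))"
    proof (rule sum.cong[OF HOL.refl])
      fix k assume "k \<in> {..<m}"
      then have "E k \<in> sets M" "emeasure M (E k) \<noteq> \<infinity>" using E by fastforce+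
      then show "(\<integral>\<^sup>+ x. ennreal (cmod (c k) powr P) * indicator (E k) x \<partial>M) = ennreal (cmod (c k) powr P * measure M (E k))"
        by (simp add: nn_integral_cmult_indicator emeasure_eq_ennreal_measure ennreal_mult)
    qed
    also have "\<dots> = ennreal (\<Sum>k<m. cmod (c k) powr P * measure M (E k))"
      by (rule sum_ennreal) simp
    finally show ?thesis .
  qed
  have "s \<in> borel_measurable M" unfolding s_def using E(1) by (intro borel_measurable_sum borel_measurable_times) auto
  then show sL: "s \<in> Lp_functions M p" by (simp add: Lp_functions_def eq)
  from functional_norm[OF this] show "Lp_norm M p s powr P = (\<Sum>k<m. cmod (c k) powr P * measure M (E k))"
    unfolding eq by (simp add: sum_nonneg)
qed

text \<open>The sets are the level sets of the tuple of all \<open>s j\<close>. Leaving out the zero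
  tuple makes their measures finite, since on each of them some \<open>s j\<close> is a nonzero
  constant.\<close>

lemma common_partition:
  assumes s: "\<And>j. j < n \<Longrightarrow> simple_function M (s j)" "\<And>j. j < n \<Longrightarrow> s j \<in> Lp_functions M p"
  shows "\<exists>(m::nat) E c. (\<forall>k<m. E k \<in> sets M \<and> emeasure M (E k) < \<infinity>) \<and> disjoint_family_on E {..<m} \<and>
    (\<forall>j<(n::nat). \<forall>x\<in>space M. s j x = (\<Sum>k<m. c j k * indicator (E k) x))"
proof -
  define H where "H x = map (\<lambda>j. s j x) [0..<n]" for x
  define V where "V = H ` space M - {replicate n 0}"
  have sub: "H ` space M \<subseteq> {xs. set xs \<subseteq> (\<Union>j<n. s j ` space M) \<and> length xs = n}"
    by (fastforce simp: H_def)
  have "finite (\<Union>j<n. s j ` space M)" using s(1) by (auto simp: simple_function_def)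
  from finite_subset[OF sub finite_lists_length_eq[OF this]] have "finite V" by (simp add: V_def)
  then obtain b where b: "bij_betw b {..<card V} V"
    using ex_bij_betw_nat_finite by (auto simp: atLeast0LessThan)
  define m where "m = card V"
  define E where "E k = {x \<in> space M. H x = b k}" for k
  define c where "c j k = b k ! j" for j k
  have bV: "b k \<in> V" if "k < m" for k using b that by (auto simp: bij_betw_def m_def)
  have len: "length (b k) = n" if "k < m" for k using bV[OF that] by (auto simp: V_def H_def)
  have E_sets: "E k \<in> sets M" if "k < m" for k
  proof -
    have "E k = {x \<in> space M. \<forall>j\<in>{..<n}. s j x = b k ! j}"
      using len[OF that] by (auto simp: E_def H_def list_eq_iff_nth_eq)
    also have "\<dots> \<in> sets M"
    proof (rule sets.sets_Collect_finite_All)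
      fix j assume "j \<in> {..<n}"
      then have "s j -` {b k ! j} \<inter> space M \<in> sets M" using s(1) by (intro simple_functionD(2)) auto
      moreover have "{x \<in> space M. s j x = b k ! j} = s j -` {b k ! j} \<inter> space M" by auto
      ultimately show "{x \<in> space M. s j x = b k ! j} \<in> sets M" by simp
    qed simp
    finally show ?thesis .
  qed
  have E_fin: "emeasure M (E k) < \<infinity>" if k: "k < m" for k
  proof -
    have "b k \<noteq> replicate n 0" using bV[OF k] by (auto simp: V_def)
    then obtain j where j: "j < n" "b k ! j \<noteq> 0" using len[OF k] by (auto simp: list_eq_iff_nth_eq)
    have "ennreal (cmod (b k ! j) powr P) * emeasure M (E k) = (\<integral>\<^sup>+ x. ennreal (cmod (b k ! j) powr P) * indicator (E k) x \<partial>M)"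
      using E_sets[OF k] by (simp add: nn_integral_cmult_indicator)
    also have "\<dots> \<le> Lp_functional M p (s j)"
    proof -
      have "b k ! j = s j x" if "x \<in> E k" for x
      proof -
        have "b k = H x" using that by (simp add: E_def)
        then show ?thesis using j(1) by (simp add: H_def)
      qed
      then show ?thesis unfolding functional_eq by (intro nn_integral_mono) (auto simp: indicator_def)
    qed
    also have "\<dots> < \<infinity>" using s(2)[OF j(1)] by (simp add: Lp_functions_def)
    finally show ?thesis using j(2) by (auto simp: ennreal_mult_less_top)
  qed
  have disj: "disjoint_family_on E {..<m}"
    using b by (auto simp: disjoint_family_on_def E_def bij_betw_def inj_on_def m_def)
  have eq: "s j x = (\<Sum>k<m. c j k * indicator (E k) x)" if j: "j < n" and x: "x \<in> space M" for j x
  proof (cases "H x = replicate n 0")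
    case True
    then have "s j x = 0" using j by (auto simp: H_def list_eq_iff_nth_eq)
    moreover have "x \<notin> E k" if "k < m" for k using True bV[OF that] by (auto simp: E_def V_def)
    ultimately show ?thesis by (simp add: sum.neutral)
  next
    case False
    then have "H x \<in> V" using x by (simp add: V_def)
    then obtain k0 where k0: "k0 < m" "H x = b k0" using b by (auto simp: bij_betw_def m_def)
    then have iff: "x \<in> E k \<longleftrightarrow> k = k0" if "k < m" for k
      using b that x by (auto simp: E_def bij_betw_def inj_on_def m_def)
    have "(\<Sum>k<m. c j k * indicator (E k) x) = (\<Sum>k<m. if k = k0 then c j k else 0)"
      using iff by (intro sum.cong HOL.refl) (auto simp: indicator_def)
    also have "\<dots> = b k0 ! j" using k0 by (simp add: c_def)
    also have "\<dots> = s j x" using k0(2) j by (metis H_def add_0 diff_zero length_upt nth_map nth_upt)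
    finally show ?thesis by simp
  qed
  show ?thesis using E_sets E_fin disj eq by blast
qed

text \<open>Duality for a finite weighted l_P, tested at the extremal vector of Hoelder's
  inequality. Dividing by \<mu>^(1/P) passes to counting measure; the second claim makes this
  harmless at points of weight 0.\<close>

lemma dual_lq_bound:
  fixes \<beta> \<mu> :: "nat \<Rightarrow> _" and Q :: real
  assumes Q: "1 / P + 1 / Q = 1" and \<mu>: "\<And>k. k < m \<Longrightarrow> 0 \<le> \<mu> k" and K: "0 \<le> K"
    and bound: "\<And>t. cmod (\<Sum>k<m. t k * \<beta> k) \<le> K * (\<Sum>k<m. cmod (t k) powr P * \<mu> k) powr (1 / P)"
  shows "(\<Sum>k<m. cmod (\<beta> k / of_real (\<mu> k powr (1 / P))) powr Q) \<le> K powr Q"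
    and "\<And>k. k < m \<Longrightarrow> \<mu> k = 0 \<Longrightarrow> \<beta> k = 0"
proof -
  have "1 / P < 1" using P by simp
  then have "1 / Q > 0" using Q by linarith
  then have Q0: "Q > 0" by simp
  have "1 / P > 0" using P by simp
  then have "1 / Q < 1" using Q by linarith
  then have Q1: "Q > 1" using Q0 by simp
  have QP: "(Q - 1) * P = Q" using Q Q0 P by (simp add: field_simps)
  show zero: "\<beta> k = 0" if k: "k < m" "\<mu> k = 0" for k
  proof -
    have "(\<Sum>k'<m. (if k' = k then 1 else 0) * \<beta> k') = (\<Sum>k'<m. if k' = k then \<beta> k' else 0)"
      by (intro sum.cong HOL.refl) auto
    also have "\<dots> = \<beta> k" using k by simp
    finally have "(\<Sum>k'<m. (if k' = k then 1 else 0) * \<beta> k') = \<beta> k" .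
    moreover have "(\<Sum>k'<m. cmod (if k' = k then 1 else 0) powr P * \<mu> k') = 0"
      using k by (intro sum.neutral) auto
    ultimately show ?thesis using bound[of "\<lambda>k'. if k' = k then 1 else 0"] by simp
  qed
  define y where "y k = \<beta> k / of_real (\<mu> k powr (1 / P))" for k
  define S where "S = (\<Sum>k<m. cmod (y k) powr Q)"
  have S0: "S \<ge> 0" by (simp add: S_def sum_nonneg)
  \<comment> \<open>The Hoelder extremal: t_k \<beta>_k and |t_k|^P \<mu>_k both equal |y_k|^Q,
    because (Q - 1) P = Q.\<close>
  define t where "t k = (if y k = 0 then 0 else cnj (y k) / of_real (cmod (y k)) * of_real (cmod (y k) powr (Q - 1)) / of_real (\<mu> k powr (1 / P)))" for k
  have tb: "t k * \<beta> k = of_real (cmod (y k) powr Q)" if "k < m" for k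
  proof (cases "y k = 0")
    case True
    then show ?thesis by (simp add: t_def)
  next
    case False
    then have mu: "\<mu> k \<noteq> 0" using zero[OF that] by (auto simp: y_def)
    then have "\<beta> k = y k * of_real (\<mu> k powr (1 / P))" by (simp add: y_def)
    then have "t k * \<beta> k = (cnj (y k) * y k) / of_real (cmod (y k)) * of_real (cmod (y k) powr (Q - 1))"
      using False mu by (simp add: t_def)
    also have "cnj (y k) * y k = of_real (cmod (y k)) * of_real (cmod (y k))"
      by (simp add: mult.commute[of "cnj _"] complex_norm_square[symmetric] power2_eq_square)
    also have "of_real (cmod (y k)) * of_real (cmod (y k)) / of_real (cmod (y k)) * of_real (cmod (y k) powr (Q - 1)) =
        complex_of_real (cmod (y k) powr 1 * cmod (y k) powr (Q - 1))"
      using False by simp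
    also have "cmod (y k) powr 1 * cmod (y k) powr (Q - 1) = cmod (y k) powr Q"
      by (subst powr_add[symmetric]) simp
    finally show ?thesis .
  qed
  have tp: "cmod (t k) powr P * \<mu> k = cmod (y k) powr Q" if "k < m" for k
  proof (cases "y k = 0")
    case True
    then show ?thesis by (simp add: t_def)
  next
    case False
    then have mu: "\<mu> k > 0" using zero[OF that] \<mu>[OF that] by (force simp: y_def)
    have "cmod (t k) = cmod (y k) powr (Q - 1) / \<mu> k powr (1 / P)"
      using False by (simp add: t_def norm_mult norm_divide)
    then have "cmod (t k) powr P = cmod (y k) powr Q / \<mu> k"
      using mu P by (simp add: powr_divide powr_powr QP)
    then show ?thesis using mu by simp
  qed
  have "(\<Sum>k<m. t k * \<beta> k) = of_real S" using tb by (simp add: S_def)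
  moreover have "(\<Sum>k<m. cmod (t k) powr P * \<mu> k) = S" using tp by (simp add: S_def)
  ultimately have SK: "S \<le> K * S powr (1 / P)" using bound[of t] S0 by simp
  show "(\<Sum>k<m. cmod (\<beta> k / of_real (\<mu> k powr (1 / P))) powr Q) \<le> K powr Q"
  proof (cases "S = 0")
    case True
    then show ?thesis by (simp add: S_def y_def)
  next
    case False
    then have Spos: "S > 0" using S0 by simp
    have "S = S powr (1 / Q) * S powr (1 / P)"
      using Spos Q by (simp add: powr_add[symmetric] add.commute)
    then have "S powr (1 / Q) * S powr (1 / P) \<le> K * S powr (1 / P)" using SK by simp
    then have "S powr (1 / Q) \<le> K" using Spos by simp
    then have "(S powr (1 / Q)) powr Q \<le> K powr Q" using Q0 by (intro powr_mono2) auto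
    then show ?thesis using Q0 Spos by (simp add: powr_powr S_def y_def)
  qed
qed

text \<open>A functional on the space is pulled back to representatives in L_p and extended to the
  indicators of a partition adapted to step approximations of the vectors. The determinant then
  becomes one for finite l_p and l_q, up to errors that vanish with \<open>e\<close>; the bound
  survives the limit because determinants depend continuously on entries.\<close>

theorem det_bounded_subquotient:
  fixes J :: "'y::complex_banach \<Rightarrow> ('m \<Rightarrow> complex) set"
  assumes iso: "linear_isometry_to_cosets M p J"
    and J: "\<And>y. J y \<noteq> {}" "\<And>y. J y \<subseteq> Lp_functions M p"
  shows "det_bounded_space \<bar>1 / 2 - 1 / P\<bar> TYPE('y)"
proof -
  define N where "N = Lp_norm M p"
  have J_norm: "quotient_norm M p (J y) = norm y"
    and J_add: "g \<in> J y \<Longrightarrow> h \<in> J z \<Longrightarrow> (\<lambda>x. g x + h x) \<in> J (y + z)"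
    and J_scale: "g \<in> J y \<Longrightarrow> (\<lambda>x. c * g x) \<in> J (c *\<^sub>C y)" for y z g h c
    using iso unfolding linear_isometry_to_cosets_def by blast+
  have bdd: "bdd_below (Lp_norm M p ` X)" for X by (rule bdd_belowI[of _ 0]) (auto simp: norm_nonneg)
  have J_le: "norm y \<le> N g" if "g \<in> J y" for g y
    unfolding J_norm[symmetric] quotient_norm_def N_def using that bdd by (rule cINF_lower[rotated])
  have J_approx: "\<exists>g\<in>J y. N g < norm y + e" if "e > 0" for y e
  proof -
    have "(INF g\<in>J y. Lp_norm M p g) < norm y + e" using that J_norm[of y] by (simp add: quotient_norm_def)
    then show ?thesis using cINF_less_iff[OF J(1) bdd] by (auto simp: N_def)
  qed
  define Q where "Q = P / (P - 1)"
  have Q: "1 / P + 1 / Q = 1" "1 < Q" using P by (auto simp: Q_def field_simps)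
  have main: "\<exists>B. (\<forall>i<n. \<forall>j<n. cmod (B i j - cdual_apply (f i) (x j)) \<le> norm (f i) * e) \<and>
      cmod (sdet {..<n} B) \<le> hadamard_const \<bar>1 / 2 - 1 / P\<bar> n * ((\<Prod>i<n. norm (f i) + e) * (\<Prod>i<n. norm (x i) + 2 * e))"
    if e: "0 < e" for n and f :: "nat \<Rightarrow> 'y cdual" and x :: "nat \<Rightarrow> 'y" and e :: real
  proof -
    have "\<exists>g. \<forall>j. g j \<in> J (x j) \<and> N (g j) < norm (x j) + e"
      by (rule choice) (use J_approx[OF e] in blast)
    then obtain g where g: "\<And>j. g j \<in> J (x j)" "\<And>j. N (g j) < norm (x j) + e" by blast
    have gL: "g j \<in> Lp_functions M p" for j using g(1) J(2) by blast
    have "\<exists>s. \<forall>j. simple_function M (s j) \<and> s j \<in> Lp_functions M p \<and> N (\<lambda>x. g j x - s j x) < e"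
      unfolding N_def by (rule choice) (use simple_approximation[OF gL e] in blast)
    then obtain s where s: "\<And>j. simple_function M (s j)" "\<And>j. s j \<in> Lp_functions M p" "\<And>j. N (\<lambda>x. g j x - s j x) < e"
      by blast
    from common_partition[of n s, OF s(1,2)] obtain m :: nat and E c where
      part: "\<forall>k<m. E k \<in> sets M \<and> emeasure M (E k) < \<infinity>" "disjoint_family_on E {..<m}"
        "\<forall>j<n. \<forall>x\<in>space M. s j x = (\<Sum>k<m. c j k * indicator (E k) x)"
      by (elim exE conjE)
    have E: "\<And>k. k < m \<Longrightarrow> E k \<in> sets M" "\<And>k. k < m \<Longrightarrow> emeasure M (E k) < \<infinity>" "disjoint_family_on E {..<m}"
      using part(1,2) by blast+
    have sc: "s j x = (\<Sum>k<m. c j k * indicator (E k) x)" if "j < n" "x \<in> space M" for j x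
      using part(3) that by blast
    define h where "h j x = (\<Sum>k<m. c j k * indicator (E k) x)" for j x
    note step = step_function[OF E]
    have gh: "N (\<lambda>x. g j x - h j x) < e" if "j < n" for j
    proof -
      have "N (\<lambda>x. g j x - h j x) = N (\<lambda>x. g j x - s j x)"
        unfolding N_def by (rule Lp_cong) (simp add: h_def sc[OF that])
      then show ?thesis using s(3)[of j] by simp
    qed
    define \<mu> where "\<mu> k = measure M (E k)" for k
    have \<mu>: "\<mu> k \<ge> 0" for k by (simp add: \<mu>_def)
    have ext: "\<exists>\<beta>. (\<forall>t. cmod (\<Sum>k<m. t k * \<beta> k) \<le> norm (f i) * (\<Sum>k<m. cmod (t k) powr P * \<mu> k) powr (1 / P)) \<and>
        (\<forall>j<n. cmod ((\<Sum>k<m. c j k * \<beta> k) - cdual_apply (f i) (x j)) \<le> norm (f i) * e)" for i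
    proof -
      interpret S: function_seminorm "Lp_functions M p" "\<lambda>g. norm (f i) * N g"
      proof
        fix g h :: "'m \<Rightarrow> complex" and c :: complex
        assume g: "g \<in> Lp_functions M p"
        show "(\<lambda>x. c * g x) \<in> Lp_functions M p" "norm (f i) * N (\<lambda>x. c * g x) = cmod c * (norm (f i) * N g)"
          using Lp_scale[OF g] by (auto simp: N_def)
        assume h: "h \<in> Lp_functions M p"
        show "(\<lambda>x. g x + h x) \<in> Lp_functions M p" by (rule Lp_add(1)[OF g h])
        show "norm (f i) * N (\<lambda>x. g x + h x) \<le> norm (f i) * N g + norm (f i) * N h"
          using mult_left_mono[OF Lp_add(2)[OF g h], of "norm (f i)"] by (simp add: N_def distrib_left)
      qed
      \<comment> \<open>The graph of the functional on representatives. It is dominated because the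
        quotient norm is an infimum: \<open>norm y\<close> is at most the norm of every member of
        \<open>J y\<close>.\<close>
      define G where "G = {(g, cdual_apply (f i) y) | g y. g \<in> J y}"
      have GI: "(g, z) \<in> G" if "g \<in> J y" "z = cdual_apply (f i) y" for g y z
        unfolding G_def using that by blast
      have "S.complex_graph G"
        unfolding S.complex_graph_def
      proof (intro conjI ballI allI, goal_cases)
        case 1
        obtain g where "g \<in> J 0" using J(1)[of 0] by blast
        from GI[OF this HOL.refl] show ?case by blast
      next
        case (2 p)
        then obtain g y where p: "p = (g, cdual_apply (f i) y)" "g \<in> J y" unfolding G_def by blast
        show ?case unfolding p(1) case_prod_conv
        proof (rule ballI)
          fix p' assume "p' \<in> G"
          then obtain h z where p': "p' = (h, cdual_apply (f i) z)" "h \<in> J z" unfolding G_def by blast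
          show "case p' of (h, w) \<Rightarrow> (\<lambda>x. g x + h x, cdual_apply (f i) y + w) \<in> G"
            unfolding p'(1) case_prod_conv by (rule GI[OF J_add[OF p(2) p'(2)]]) (simp add: cdual_apply_simps)
        qed
      next
        case (3 c p)
        then obtain g y where p: "p = (g, cdual_apply (f i) y)" "g \<in> J y" unfolding G_def by blast
        show ?case unfolding p(1) case_prod_conv by (rule GI[OF J_scale[OF p(2)]]) (simp add: cdual_apply_simps)
      next
        case (4 p)
        then obtain g y where p: "p = (g, cdual_apply (f i) y)" "g \<in> J y" unfolding G_def by blast
        have "cmod (cdual_apply (f i) y) \<le> norm (f i) * N g"
          by (rule order_trans[OF norm_cdual_apply mult_left_mono[OF J_le[OF p(2)]]]) simp
        then show ?case unfolding p(1) case_prod_conv using J(2) p(2) by blast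
      qed
      moreover have indL: "(\<lambda>x. indicator (E k) x) \<in> Lp_functions M p" if "k < m" for k
      proof -
        have "(\<lambda>x. \<Sum>k'<m. (if k' = k then 1 else 0) * indicator (E k') x :: complex) = (\<lambda>x. indicator (E k) x)"
          using that by (simp add: fun_eq_iff if_distrib[of "\<lambda>u. u * _"] cong: if_cong)
        then show ?thesis using step(1)[of "\<lambda>k'. if k' = k then 1 else 0"] by simp
      qed
      ultimately obtain G' \<beta> where G': "S.complex_graph G'" "G \<subseteq> G'" "\<And>k. k < m \<Longrightarrow> (\<lambda>x. indicator (E k) x, \<beta> k) \<in> G'"
        using S.Hahn_Banach_finite[of G m "\<lambda>k x. indicator (E k) x"] by blast
      note D = S.complex_graphD[OF G'(1)]
      have lin: "(\<lambda>x. \<Sum>k<m. t k * indicator (E k) x, \<Sum>k<m. t k * \<beta> k) \<in> G'" for t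
        by (rule S.complex_graph_sum[OF G'(1)]) (use G'(3) in auto)
      have "cmod (\<Sum>k<m. t k * \<beta> k) \<le> norm (f i) * (\<Sum>k<m. cmod (t k) powr P * \<mu> k) powr (1 / P)" for t
      proof -
        let ?s = "\<lambda>x. \<Sum>k<m. t k * indicator (E k) x"
        have "cmod (\<Sum>k<m. t k * \<beta> k) \<le> norm (f i) * N ?s" by (rule D(4)[OF lin])
        also have "N ?s = (N ?s powr P) powr (1 / P)" using P norm_nonneg by (simp add: powr_powr N_def)
        also have "N ?s powr P = (\<Sum>k<m. cmod (t k) powr P * \<mu> k)"
          unfolding N_def \<mu>_def by (rule step(2))
        finally show ?thesis .
      qed
      moreover have "cmod ((\<Sum>k<m. c j k * \<beta> k) - cdual_apply (f i) (x j)) \<le> norm (f i) * e" if j: "j < n" for j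
      proof -
        have "(g j, cdual_apply (f i) (x j)) \<in> G'" using GI[OF g(1) HOL.refl] G'(2) by blast
        from D(1)[OF this D(2)[OF lin[of "c j"], of "- 1"]]
        have "(\<lambda>x. g j x + - 1 * (\<Sum>k<m. c j k * indicator (E k) x), cdual_apply (f i) (x j) + - 1 * (\<Sum>k<m. c j k * \<beta> k)) \<in> G'" .
        from D(4)[OF this] have "cmod (cdual_apply (f i) (x j) - (\<Sum>k<m. c j k * \<beta> k)) \<le> norm (f i) * N (\<lambda>x. g j x - h j x)"
          by (simp add: h_def)
        also have "\<dots> \<le> norm (f i) * e" using gh[OF j] by (intro mult_left_mono) auto
        finally show ?thesis by (simp add: norm_minus_commute)
      qed
      ultimately show ?thesis by blast
    qed
    have "\<exists>\<beta>. \<forall>i. (\<forall>t. cmod (\<Sum>k<m. t k * \<beta> i k) \<le> norm (f i) * (\<Sum>k<m. cmod (t k) powr P * \<mu> k) powr (1 / P)) \<and>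
        (\<forall>j<n. cmod ((\<Sum>k<m. c j k * \<beta> i k) - cdual_apply (f i) (x j)) \<le> norm (f i) * e)"
      by (rule choice) (rule allI, rule ext)
    then obtain \<beta> where \<beta>: "\<And>i t. cmod (\<Sum>k<m. t k * \<beta> i k) \<le> norm (f i) * (\<Sum>k<m. cmod (t k) powr P * \<mu> k) powr (1 / P)"
      "\<And>i j. j < n \<Longrightarrow> cmod ((\<Sum>k<m. c j k * \<beta> i k) - cdual_apply (f i) (x j)) \<le> norm (f i) * e" by blast
    note dual = dual_lq_bound[OF Q(1) \<mu> norm_ge_zero \<beta>(1)]
    define B where "B i j = (\<Sum>k<m. c j k * \<beta> i k)" for i j
    \<comment> \<open>The weights \<mu>^(1/P) are moved from one factor to the other, which turns
      weighted sums into plain l_P and l_Q norms. Where \<mu> is 0 both products vanish, since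
      \<beta> does.\<close>
    define y where "y i k = \<beta> i k / of_real (\<mu> k powr (1 / P))" for i k
    define X where "X j k = c j k * of_real (\<mu> k powr (1 / P))" for j k
    have "sdet {..<n} B = sdet {..<n} (\<lambda>i j. \<Sum>k<m. y i k * X j k)"
    proof (rule sdet_cong)
      fix i j
      show "B i j = (\<Sum>k<m. y i k * X j k)"
        unfolding B_def
      proof (rule sum.cong[OF HOL.refl])
        fix k assume "k \<in> {..<m}"
        then show "c j k * \<beta> i k = y i k * X j k"
          using dual(2)[of k] by (cases "\<mu> k = 0") (auto simp: y_def X_def)
      qed
    qed
    also have "cmod \<dots> \<le> hadamard_const \<bar>1 / 2 - 1 / P\<bar> n * ((\<Prod>i<n. norm (f i) + e) * (\<Prod>i<n. norm (x i) + 2 * e))"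
    proof (rule det_lp_bound_general[OF _ P Q(2,1)])
      fix i assume i: "i < n"
      \<comment> \<open>In the bound for the vectors one \<open>e\<close> comes from the choice of a
        representative and one from its step approximation; in that for the functionals
        \<open>e\<close> serves to keep the bound positive.\<close>
      show "0 < norm (f i) + e" "0 < norm (x i) + 2 * e" using e by (auto intro: add_nonneg_pos)
      have "(\<Sum>k<m. cmod (y i k) powr Q) \<le> norm (f i) powr Q" unfolding y_def by (rule dual(1))
      also have "\<dots> \<le> (norm (f i) + e) powr Q" using Q(2) e by (intro powr_mono2) auto
      finally show "(\<Sum>k<m. cmod (y i k) powr Q) \<le> (norm (f i) + e) powr Q" .
      have "(\<Sum>k<m. cmod (X i k) powr P) = (\<Sum>k<m. cmod (c i k) powr P * \<mu> k)"
        using P \<mu> by (intro sum.cong HOL.refl) (simp add: X_def norm_mult powr_mult powr_powr)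
      also have "\<dots> = N (h i) powr P" unfolding N_def \<mu>_def h_def[abs_def] by (rule step(2)[symmetric])
      also have "\<dots> \<le> (norm (x i) + 2 * e) powr P"
      proof (rule powr_mono2)
        have hL: "h i \<in> Lp_functions M p" unfolding h_def[abs_def] by (rule step(1))
        have mL: "(\<lambda>x. - 1 * (g i x - h i x)) \<in> Lp_functions M p" "Lp_norm M p (\<lambda>x. - 1 * (g i x - h i x)) = Lp_norm M p (\<lambda>x. g i x - h i x)"
          using Lp_scale[of "\<lambda>x. g i x - h i x" "- 1"] Lp_add(1)[OF gL Lp_scale(1)[OF hL, of "- 1"]] by simp_all
        have hi: "(\<lambda>x. g i x + - 1 * (g i x - h i x)) = h i" by (simp add: fun_eq_iff)
        have "N (h i) \<le> N (g i) + N (\<lambda>x. - 1 * (g i x - h i x))"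
          using Lp_add(2)[OF gL[of i] mL(1)] unfolding hi N_def .
        then show "N (h i) \<le> norm (x i) + 2 * e" using mL(2) g(2)[of i] gh[OF i] by (simp add: N_def)
      qed (use P norm_nonneg in \<open>auto simp: N_def\<close>)
      finally show "(\<Sum>k<m. cmod (X i k) powr P) \<le> (norm (x i) + 2 * e) powr P" .
    qed simp
    finally show ?thesis using \<beta>(2) by (intro exI[of _ B]) (auto simp: B_def)
  qed
  show ?thesis
    unfolding det_bounded_space_def
  proof (intro allI)
    fix n and f :: "nat \<Rightarrow> 'y cdual" and x :: "nat \<Rightarrow> 'y"
    define e where "e r = inverse (real (Suc r))" for r
    have e0: "e r > 0" for r by (simp add: e_def)
    have elim: "e \<longlonglongrightarrow> 0" unfolding e_def by (rule LIMSEQ_inverse_real_of_nat)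
    define good where "good r C \<longleftrightarrow> (\<forall>i<n. \<forall>j<n. cmod (C i j - cdual_apply (f i) (x j)) \<le> norm (f i) * e r) \<and>
      cmod (sdet {..<n} C) \<le> hadamard_const \<bar>1 / 2 - 1 / P\<bar> n * ((\<Prod>i<n. norm (f i) + e r) * (\<Prod>i<n. norm (x i) + 2 * e r))"
      for r C
    have "\<exists>C. good r C" for r unfolding good_def by (rule main[OF e0])
    then have good: "good r (SOME C. good r C)" for r by (rule someI_ex)
    define B where "B r = (SOME C. good r C)" for r
    have gB: "good r (B r)" for r unfolding B_def by (rule good)
    have B1: "cmod (B r i j - cdual_apply (f i) (x j)) \<le> norm (f i) * e r" if "i < n" "j < n" for r i j
      using conjunct1[OF gB[of r, unfolded good_def], rule_format, OF that] .
    have B2: "cmod (sdet {..<n} (B r)) \<le> hadamard_const \<bar>1 / 2 - 1 / P\<bar> n * ((\<Prod>i<n. norm (f i) + e r) * (\<Prod>i<n. norm (x i) + 2 * e r))" for r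
      using conjunct2[OF gB[of r, unfolded good_def]] .
    have "(\<lambda>r. B r i j) \<longlonglongrightarrow> cdual_apply (f i) (x j)" if "i < n" "j < n" for i j
    proof -
      have "(\<lambda>r. norm (f i) * e r) \<longlonglongrightarrow> norm (f i) * 0" by (intro tendsto_intros elim)
      then have "(\<lambda>r. B r i j - cdual_apply (f i) (x j)) \<longlonglongrightarrow> 0"
        using Lim_null_comparison[OF always_eventually[OF allI[OF B1[OF that]]], of "\<lambda>r. r" sequentially] by simp
      then show ?thesis by (simp add: LIM_zero_iff)
    qed
    then have lim: "(\<lambda>r. cmod (sdet {..<n} (B r))) \<longlonglongrightarrow> cmod (sdet {..<n} (\<lambda>i j. cdual_apply (f i) (x j)))"
      by (intro tendsto_norm tendsto_sdet)
    have "(\<lambda>r. hadamard_const \<bar>1 / 2 - 1 / P\<bar> n * ((\<Prod>i<n. norm (f i) + e r) * (\<Prod>i<n. norm (x i) + 2 * e r)))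
      \<longlonglongrightarrow> hadamard_const \<bar>1 / 2 - 1 / P\<bar> n * ((\<Prod>i<n. norm (f i) + 0) * (\<Prod>i<n. norm (x i) + 2 * 0))"
      by (intro tendsto_intros elim)
    from LIMSEQ_le[OF lim this] B2
    show "cmod (sdet {..<n} (\<lambda>i j. cdual_apply (f i) (x j))) \<le>
        hadamard_const \<bar>1 / 2 - 1 / P\<bar> n * ((\<Prod>i<n. norm (f i)) * (\<Prod>i<n. norm (x i)))" by auto
  qed
qed

end

text \<open>Dividing rows and columns by the norms leaves entries of modulus at most 1; where a norm
  vanishes, so does the original entry.\<close>

lemma det_bounded_space_half: "det_bounded_space (1 / 2) TYPE('y::complex_banach)"
  unfolding det_bounded_space_def
proof (intro allI)
  fix n and f :: "nat \<Rightarrow> 'y cdual" and x :: "nat \<Rightarrow> 'y"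
  define b where "b i j = cdual_apply (f i) (x j) / of_real (norm (f i) * norm (x j))" for i j
  have "sdet {..<n} (\<lambda>i j. cdual_apply (f i) (x j)) = sdet {..<n} (\<lambda>i j. of_real (norm (f i)) * of_real (norm (x j)) * b i j)"
  proof (rule sdet_cong)
    fix i j
    have "cdual_apply (f i) (x j) = 0" if "norm (f i) * norm (x j) = 0"
      using norm_cdual_apply[of "f i" "x j"] that by simp
    then show "cdual_apply (f i) (x j) = of_real (norm (f i)) * of_real (norm (x j)) * b i j"
      by (cases "norm (f i) * norm (x j) = 0") (auto simp: b_def)
  qed
  also have "cmod \<dots> = ((\<Prod>i<n. norm (f i)) * (\<Prod>i<n. norm (x i))) * cmod (sdet {..<n} b)"
    unfolding sdet_scale norm_mult prod_norm[symmetric] by simp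
  also have "\<dots> \<le> ((\<Prod>i<n. norm (f i)) * (\<Prod>i<n. norm (x i))) * hadamard_const (1 / 2) n"
  proof (intro mult_left_mono det_entries_bound)
    fix i j
    show "cmod (b i j) \<le> 1"
      using norm_cdual_apply[of "f i" "x j"] by (auto simp: b_def norm_divide norm_mult divide_le_eq_1 zero_less_mult_iff)
  qed (auto intro!: mult_nonneg_nonneg prod_nonneg)
  finally show "cmod (sdet {..<n} (\<lambda>i j. cdual_apply (f i) (x j))) \<le>
      hadamard_const (1 / 2) n * ((\<Prod>i<n. norm (f i)) * (\<Prod>i<n. norm (x i)))" by (simp add: mult.commute)
qed

section \<open>Both kinds of subquotients, the endpoint exponents and the conclusion\<close>

lemma det_bounded_space_subquotient_Lp:
  fixes M :: "'m measure"
  assumes p: "1 \<le> p"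
    and Y: "is_subspace_of_quotient_Lp TYPE('y::complex_banach) M p \<or> is_quotient_of_subspace_Lp TYPE('y) M p"
  shows "det_bounded_space \<bar>1 / 2 - enn2real (1 / p)\<bar> TYPE('y)"
proof (cases "p = \<infinity> \<or> p = 1")
  case True
  \<comment> \<open>Both endpoints give the exponent 1/2, with the reciprocal of infinity equal to
    0.\<close>
  then have "\<bar>1 / 2 - enn2real (1 / p)\<bar> = 1 / 2" by auto
  then show ?thesis by (simp only: det_bounded_space_half)
next
  case False
  define P where "P = enn2real p"
  have pP: "p = ennreal P" using False by (simp add: P_def less_top)
  have "1 < p" using p False by (simp add: order_less_le)
  then have "1 < P" unfolding pP by (simp add: ennreal_less_iff flip: ennreal_1)
  interpret Lp_space M p P by unfold_locales (use False \<open>1 < P\<close> in \<open>auto simp: P_def\<close>)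
  have inv: "enn2real (1 / p) = 1 / P"
    unfolding pP using \<open>1 < P\<close> by (simp add: divide_ennreal flip: ennreal_1)
  \<comment> \<open>A common form of the two alternatives, cosets of \<open>N\<close> inside some
    \<open>Z\<close>: in the first \<open>Z\<close> is all of L_p, in the second it is the given
    subspace.\<close>
  obtain Z N and J :: "'y \<Rightarrow> ('m \<Rightarrow> complex) set" where
    Z: "Z \<subseteq> Lp_functions M p" "\<And>g h. g \<in> Z \<Longrightarrow> h \<in> N \<Longrightarrow> (\<lambda>x. g x + h x) \<in> Z" and N: "(\<lambda>x. 0) \<in> N"
    and J: "range J \<subseteq> Lp_cosets Z N" and iso: "linear_isometry_to_cosets M p J"
  proof -
    from Y show thesis
    proof
      assume "is_subspace_of_quotient_Lp TYPE('y) M p"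
      then obtain N and J :: "'y \<Rightarrow> ('m \<Rightarrow> complex) set" where
        "Lp_closed_subspace M p N" "range J \<subseteq> Lp_cosets (Lp_functions M p) N" "linear_isometry_to_cosets M p J"
        unfolding is_subspace_of_quotient_Lp_def by blast
      note * = this
      have "(\<lambda>x. g x + h x) \<in> Lp_functions M p" if "g \<in> Lp_functions M p" "h \<in> N" for g h
        using Lp_add(1)[OF that(1)] that(2) *(1) unfolding Lp_closed_subspace_def by blast
      moreover have "(\<lambda>x. 0) \<in> N" using *(1) unfolding Lp_closed_subspace_def by blast
      ultimately show thesis using that[of "Lp_functions M p" N J] *(2,3) by blast
    next
      assume "is_quotient_of_subspace_Lp TYPE('y) M p"
      then obtain Z N and J :: "'y \<Rightarrow> ('m \<Rightarrow> complex) set" where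
        "Lp_closed_subspace M p Z" "Lp_closed_subspace M p N" "N \<subseteq> Z" "range J = Lp_cosets Z N" "linear_isometry_to_cosets M p J"
        unfolding is_quotient_of_subspace_Lp_def by blast
      note * = this
      have "(\<lambda>x. g x + h x) \<in> Z" if "g \<in> Z" "h \<in> N" for g h
        using that *(1,3) unfolding Lp_closed_subspace_def by blast
      moreover have "(\<lambda>x. 0) \<in> N" "Z \<subseteq> Lp_functions M p" using *(1,2) unfolding Lp_closed_subspace_def by blast+
      ultimately show thesis using that[of Z N J] *(4,5) by blast
    qed
  qed
  have coset: "\<exists>g. g \<in> Z \<and> J y = {\<lambda>x. g x + h x | h. h \<in> N}" for y
  proof -
    have "J y \<in> Lp_cosets Z N" using J by blast
    then show ?thesis unfolding Lp_cosets_def by blast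
  qed
  have "J y \<noteq> {} \<and> J y \<subseteq> Lp_functions M p" for y
  proof -
    obtain g where g: "g \<in> Z" "J y = {\<lambda>x. g x + h x | h. h \<in> N}" using coset[of y] by (elim exE conjE)
    have "(\<lambda>x. g x + 0) \<in> J y" unfolding g(2) by (intro CollectI exI[of _ "\<lambda>x. 0"] conjI HOL.refl N)
    moreover have "k \<in> Lp_functions M p" if "k \<in> J y" for k
    proof -
      obtain h where "k = (\<lambda>x. g x + h x)" "h \<in> N" using \<open>k \<in> J y\<close> unfolding g(2) by (elim CollectE exE conjE)
      then show ?thesis using Z(2)[OF g(1)] Z(1) by auto
    qed
    ultimately show ?thesis by auto
  qed
  then show ?thesis unfolding inv by (intro det_bounded_subquotient[OF iso]) auto
qed

theorem theorem1:
  fixes p :: ennreal and s :: real and M :: "'m measure"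
    and u :: "('y::complex_banach cdual, 'y) ptensor"
  assumes "1 \<le> p"
    and "is_subspace_of_quotient_Lp TYPE('y) M p \<or> is_quotient_of_subspace_Lp TYPE('y) M p"
    and "1 / s = 1 + \<bar>1 / 2 - enn2real (1 / p)\<bar>"
    and "u \<in> s_tensors s"
  shows "central_symmetric_spectrum (ptensor_op u) \<longleftrightarrow>
    (\<forall>n\<ge>1. ptrace (ptensor_power u (2 * n - 1)) = 0)"
proof -
  define a where "a = \<bar>1 / 2 - enn2real (1 / p)\<bar>"
  \<comment> \<open>Taking reciprocals twice turns the equation for 1/s into s = 1 / (1 + a), the
    exponent in \<open>nuclear_rep\<close>.\<close>
  have "s = 1 / (1 / s)" by simp
  then have s: "s = 1 / (1 + a)" unfolding assms(3) a_def .
  obtain f x where fx: "(\<lambda>k. ptensor_elem (f k) (x k)) sums u" "summable (\<lambda>k. norm (f k) powr s * norm (x k) powr s)"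
    using assms(4) unfolding s_tensors_def by blast
  interpret nuclear_rep a f x u
  proof
    show "det_bounded_space a TYPE('y)"
      unfolding a_def by (rule det_bounded_space_subquotient_Lp[OF assms(1,2)])
    show "summable (\<lambda>k. (norm (f k) * norm (x k)) powr (1 / (1 + a)))"
      using fx(2) unfolding s by (simp add: powr_mult)
  qed (use fx in \<open>auto simp: a_def\<close>)
  show ?thesis by (rule central_symmetric_iff)
qed

end
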